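(* Let $m\in\mathbb{R}$, $d/2<t_0\le s_0$ and $\sigma\in\Gamma^m_{s_0}$. Then for all $u\in\mathcal{S}(\mathbb{R}^d)$ the following estimates hold: $$\forall\, -t_0<s<t_0,\qquad |\mathrm{Op}(\sigma)u|_{H^s}\lesssim \big(n_{0,t_0}(\sigma)+N^m_{2[d/2]+2,\,t_0}(\sigma)\big)\,|u|_{H^{s+m}},$$ and $$\forall\, t_0\le s\le s_0,\qquad |\mathrm{Op}(\sigma)u|_{H^s}\lesssim \big(n_{0,s}(\sigma)+N^m_{2[d/2]+2,\,s}(\sigma)\big)\,|u|_{H^{m+t_0}}+M^m_d(\sigma)\,|u|_{H^{s+m}}.$$
   Context: Here $\langle\xi\rangle=(1+|\xi|^2)^{1/2}$, $[a]$ is the integer part of $a$, $|\cdot|_{H^s}$ is the norm of the $L^2$-based Sobolev space $H^s(\mathbb{R}^d)$. $\mathrm{Op}(\sigma)u(x)=(2\pi)^{-d}\int_{\mathbb{R}^d}e^{ix\cdot\xi}\sigma(x,\xi)\widehat u(\xi)\,d\xi$. The notation $A\lesssim B$ means $A\le CB$ with a constant $C$ independent of $u$ and $\sigma$ (it may depend on $d,m,s,t_0,s_0$). Symbol class. For $m\in\mathbb{R}$ and $s_0>d/2$, a symbol $\sigma(x,\xi)$ on $\mathbb{R}^d\times\mathbb{R}^d$ belongs to $\Gamma^m_{s_0}$ iff (a) $\sigma|_{\mathbb{R}^d\times\{|\xi|\le1\}}\in L^\infty(\{|\xi|\le 1\};H^{s_0}(\mathbb{R}^d))$, and (b) for all $\beta\in\mathbb{N}^d$,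 $\sup_{|\xi|\ge1/4}\langle\xi\rangle^{|\beta|-m}|\partial_\xi^\beta\sigma(\cdot,\xi)|_{H^{s_0}}<\infty$. Seminorms. $N^m_{k,s}(\sigma)=\sup_{|\beta|\le k}\sup_{|\xi|\ge1/4}\langle\xi\rangle^{|\beta|-m}|\partial_\xi^\beta\sigma(\cdot,\xi)|_{H^s}$; $M^m_{k}(\sigma)=\sup_{|\beta|\le k}\sup_{|\xi|\ge1/4}\langle\xi\rangle^{|\beta|-m}|\partial_\xi^\beta\sigma(\cdot,\xi)|_{L^\infty}$; $n_{k,s}(\sigma)=\sup_{|\beta|\le k,\,|\xi|\le1}|\partial_\xi^\beta\sigma(\cdot,\xi)|_{H^s}$. *)

theory Defs
  imports "HOL-Analysis.Analysis" "HOL-Probability.Essential_Supremum"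
begin

text \<open>
  Derivatives are taken within a region S, so that they also make sense (as one-sided derivatives)
  at the boundary points of \<open>{\<xi>. 1/4 \<le> norm \<xi>}\<close> and of the closed unit ball. In both regions,
  as in the whole space, the derivative within S is unique.
\<close>

definition partial_within ::
    "(real^'n) set \<Rightarrow> 'n \<Rightarrow> (real^'n \<Rightarrow> complex) \<Rightarrow> real^'n \<Rightarrow> complex" where
  "partial_within S i f \<xi> = frechet_derivative f (at \<xi> within S) (axis i 1)"

fun partials ::
    "(real^'n) set \<Rightarrow> 'n list \<Rightarrow> (real^'n \<Rightarrow> complex) \<Rightarrow> real^'n \<Rightarrow> complex" where
  "partials S [] f = f"
| "partials S (i # is) f = partial_within S i (partials S is f)"

definition smooth_on :: "(real^'n) set \<Rightarrow> (real^'n \<Rightarrow> complex) \<Rightarrow> bool" where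
  "smooth_on S f \<longleftrightarrow> (\<forall>is. partials S is f differentiable_on S)"

definition mi_order :: "('n::finite \<Rightarrow> nat) \<Rightarrow> nat" where
  "mi_order \<beta> = (\<Sum>i\<in>UNIV. \<beta> i)"

text \<open>
  For a multi-index \<open>\<beta>\<close>, one differentiates \<open>\<beta> i\<close> times in the direction i. The order in which this
  is done is left open; it is irrelevant for functions that are smooth on the regions
  mentioned above.
\<close>

definition multi_deriv ::
    "(real^'n) set \<Rightarrow> ('n \<Rightarrow> nat) \<Rightarrow> (real^'n \<Rightarrow> complex) \<Rightarrow> real^'n \<Rightarrow> complex" where
  "multi_deriv S \<beta> f = partials S (SOME is. \<forall>i. count_list is i = \<beta> i) f"

definition schwartz :: "(real^'n \<Rightarrow> complex) set" where
  "schwartz = {u. smooth_on UNIV u \<and>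
     (\<forall>k \<beta>. \<exists>C. \<forall>x. norm x ^ k * norm (multi_deriv UNIV \<beta> u x) \<le> C)}"

definition fourier :: "(real^'n \<Rightarrow> complex) \<Rightarrow> real^'n \<Rightarrow> complex" where
  "fourier u \<xi> = (LINT x|lebesgue. exp (- (\<i> * of_real (x \<bullet> \<xi>))) * u x)"

text \<open>
  f is a function defining a tempered distribution, and the Fourier transform of this
  distribution is the function g.
\<close>

definition has_fourier :: "(real^'n \<Rightarrow> complex) \<Rightarrow> (real^'n \<Rightarrow> complex) \<Rightarrow> bool" where
  "has_fourier f g \<longleftrightarrow>
     f \<in> borel_measurable lebesgue \<and> g \<in> borel_measurable lebesgue \<and>
     (\<forall>\<phi>\<in>schwartz.
        integrable lebesgue (\<lambda>x. f x * fourier \<phi> x) \<and>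
        integrable lebesgue (\<lambda>\<xi>. g \<xi> * \<phi> \<xi>) \<and>
        (LINT x|lebesgue. f x * fourier \<phi> x) = (LINT \<xi>|lebesgue. g \<xi> * \<phi> \<xi>))"

definition japanese :: "real^'n \<Rightarrow> real" where
  "japanese \<xi> = sqrt (1 + (norm \<xi>)\<^sup>2)"

definition l2_norm :: "(real^'n \<Rightarrow> complex) \<Rightarrow> ennreal" where
  "l2_norm f = (let I = (\<integral>\<^sup>+ \<xi>. ennreal ((norm (f \<xi>))\<^sup>2) \<partial>lebesgue)
                in if I = \<infinity> then \<infinity> else ennreal (sqrt (enn2real I)))"

text \<open>
  The Sobolev norm of order s is \<open>(2\<pi>)\<^bsup>-d/2\<^esup>\<close> times the L2 norm of \<open>\<langle>\<xi>\<rangle>\<^bsup>s\<^esup> g(\<xi>)\<close>, where g is the Fourier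
  transform of f. As g is unique almost everywhere if it exists, the infimum below is taken
  over at most one value; it is \<open>\<infinity>\<close> if there is no such g. So the norm is finite
  iff f belongs to the Sobolev space. Negative s is allowed.
\<close>

definition sobolev_norm :: "real \<Rightarrow> (real^'n \<Rightarrow> complex) \<Rightarrow> ennreal" where
  "sobolev_norm s f =
     (INF g\<in>{g. has_fourier f g}.
        ennreal ((2 * pi) powr (- real CARD('n) / 2)) *
        l2_norm (\<lambda>\<xi>. of_real (japanese \<xi> powr s) * g \<xi>))"

definition linf_norm :: "(real^'n \<Rightarrow> complex) \<Rightarrow> ennreal" where
  "linf_norm f = esssup lebesgue (\<lambda>x. ennreal (norm (f x)))"

text \<open>A symbol is written \<open>\<sigma> x \<xi>\<close>.\<close>

definition high_freq :: "(real^'n) set" where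
  "high_freq = {\<xi>. 1/4 \<le> norm \<xi>}"

abbreviation low_freq :: "(real^'n) set" where
  "low_freq \<equiv> cball 0 1"

definition N_seminorm ::
    "real \<Rightarrow> nat \<Rightarrow> real \<Rightarrow> (real^'n \<Rightarrow> real^'n \<Rightarrow> complex) \<Rightarrow> ennreal" where
  "N_seminorm m k s \<sigma> =
     (SUP \<beta>\<in>{\<beta>. mi_order \<beta> \<le> k}. SUP \<xi>\<in>high_freq.
        ennreal (japanese \<xi> powr (real (mi_order \<beta>) - m)) *
        sobolev_norm s (\<lambda>x. multi_deriv high_freq \<beta> (\<sigma> x) \<xi>))"

definition M_seminorm ::
    "real \<Rightarrow> nat \<Rightarrow> (real^'n \<Rightarrow> real^'n \<Rightarrow> complex) \<Rightarrow> ennreal" where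
  "M_seminorm m k \<sigma> =
     (SUP \<beta>\<in>{\<beta>. mi_order \<beta> \<le> k}. SUP \<xi>\<in>high_freq.
        ennreal (japanese \<xi> powr (real (mi_order \<beta>) - m)) *
        linf_norm (\<lambda>x. multi_deriv high_freq \<beta> (\<sigma> x) \<xi>))"

text \<open>
  At low frequencies symbols are only essentially bounded functions of \<open>\<xi>\<close> with values in a Sobolev
  space, so the supremum over \<open>\<xi>\<close> is an essential one.
\<close>

definition n_seminorm ::
    "nat \<Rightarrow> real \<Rightarrow> (real^'n \<Rightarrow> real^'n \<Rightarrow> complex) \<Rightarrow> ennreal" where
  "n_seminorm k s \<sigma> =
     (SUP \<beta>\<in>{\<beta>. mi_order \<beta> \<le> k}.
        esssup (lebesgue_on low_freq)
          (\<lambda>\<xi>. sobolev_norm s (\<lambda>x. multi_deriv low_freq \<beta> (\<sigma> x) \<xi>)))"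

text \<open>
  The first two conditions say that \<open>\<xi> \<mapsto> \<sigma>(\<cdot>, \<xi>)\<close> is an essentially bounded function on the closed unit
  ball with values in the Sobolev space of order s0: since this space is separable, strong
  measurability amounts to joint measurability of a representative.
\<close>

definition symbol_class ::
    "real \<Rightarrow> real \<Rightarrow> (real^'n \<Rightarrow> real^'n \<Rightarrow> complex) set" where
  "symbol_class m s0 = {\<sigma>.
     (\<lambda>(x, \<xi>). \<sigma> x \<xi>) \<in> borel_measurable (lebesgue_on (UNIV \<times> low_freq)) \<and>
     esssup (lebesgue_on low_freq) (\<lambda>\<xi>. sobolev_norm s0 (\<lambda>x. \<sigma> x \<xi>)) < \<infinity> \<and>
     (\<forall>x. smooth_on high_freq (\<sigma> x)) \<and>
     (\<forall>\<beta>. (SUP \<xi>\<in>high_freq.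
        ennreal (japanese \<xi> powr (real (mi_order \<beta>) - m)) *
        sobolev_norm s0 (\<lambda>x. multi_deriv high_freq \<beta> (\<sigma> x) \<xi>)) < \<infinity>)}"

definition Op ::
    "(real^'n \<Rightarrow> real^'n \<Rightarrow> complex) \<Rightarrow> (real^'n \<Rightarrow> complex) \<Rightarrow> real^'n \<Rightarrow> complex" where
  "Op \<sigma> u x = of_real ((2 * pi) powr (- real CARD('n))) *
     (LINT \<xi>|lebesgue. exp (\<i> * of_real (x \<bullet> \<xi>)) * \<sigma> x \<xi> * fourier u \<xi>)"

end

theory Submission
  imports Defs "HOL-Probability.Probability" "HOL-Real_Asymp.Real_Asymp"
begin

text \<open>
  The Fourier transform of \<open>Op \<sigma> u\<close> at \<open>\<zeta>\<close> is, up to a constant, the integral over \<open>\<xi>\<close> of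
  \<open>G (\<zeta> - \<xi>) \<xi>\<close> times the Fourier transform of u, where G is the Fourier transform of the symbol in the
  space variable. So everything is estimated on the Fourier side. For \<open>norm \<xi> \<ge> 1\<close> the frequencies are
  split into dyadic shells. If \<open>\<zeta>\<close> is large compared with \<open>\<xi>\<close> (or \<open>\<xi>\<close> is small), the weight
  \<open>\<langle>\<zeta>\<rangle>\<^sup>s\<close> is absorbed by the Sobolev weight of the symbol; the same works for \<open>\<zeta>\<close> small compared with \<open>\<xi>\<close> if
  s is the order of that weight, and otherwise a geometric series over the shells helps. If \<open>\<zeta>\<close> and \<open>\<xi>\<close> are comparable, only boundedly
  many shells contribute at a given \<open>\<zeta>\<close>, and each one is an operator bounded on L2: on a cube of the size of the
  shell, the symbol is a superposition, over frozen frequencies y, of its mixed derivatives at y, each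
  of which acts as a multiplication operator by a bounded function of x.
\<close>

section \<open>Integration preliminaries\<close>

text \<open>Comparable frequencies are the obstacle: there the Sobolev weight of the symbol yields
  no gain, and absolute values on the Fourier side would destroy the L2 bound of a multiplication
  operator. So each term of the superposition stays a convolution, and absolute values are taken
  only in the parameter y. Freezing by the fundamental theorem of calculus costs at most one
  derivative per coordinate; this is where the order d of \<open>M_seminorm\<close> comes from, and
  d \<le> 2 * (d div 2) + 2 lets the same derivatives be read off \<open>N_seminorm\<close>. The
  cube has the side of the shell, so that the volume of the parameters balances the decay of the
  derivatives, and it points away from the origin, so that frozen frequencies keep norm at least 1.
  In the estimate for |s| < t0 the supremum bounds follow from the Sobolev bounds, because t0 > d/2.
  The second obstacle is measurability: for each \<xi> the transform in x is determined only almost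
  everywhere, while Fubini needs a jointly measurable function. Gaussians serve as explicit test
  functions for uniqueness, inversion, Plancherel and this joint choice.\<close>

lemma Fubini_complex:
  fixes f :: "'a \<Rightarrow> 'b \<Rightarrow> complex"
  assumes "sigma_finite_measure M" "sigma_finite_measure N"
    and f [measurable]: "(\<lambda>(x, y). f x y) \<in> borel_measurable (M \<Otimes>\<^sub>M N)"
    and fin: "(\<integral>\<^sup>+x. \<integral>\<^sup>+y. ennreal (norm (f x y)) \<partial>N \<partial>M) < \<infinity>"
  shows Fubini_complex_integrable: "integrable (M \<Otimes>\<^sub>M N) (\<lambda>(x, y). f x y)"
    and Fubini_complex_eq: "(\<integral>x. (\<integral>y. f x y \<partial>N) \<partial>M) = (\<integral>y. (\<integral>x. f x y \<partial>M) \<partial>N)"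
    and Fubini_complex_AE1: "AE x in M. integrable N (f x)"
    and Fubini_complex_AE2: "AE y in N. integrable M (\<lambda>x. f x y)"
    and Fubini_complex_int1: "integrable M (\<lambda>x. \<integral>y. f x y \<partial>N)"
    and Fubini_complex_int2: "integrable N (\<lambda>y. \<integral>x. f x y \<partial>M)"
proof -
  interpret M: sigma_finite_measure M by fact
  interpret N: sigma_finite_measure N by fact
  interpret pair_sigma_finite M N ..
  have "(\<integral>\<^sup>+z. ennreal (norm (case z of (x, y) \<Rightarrow> f x y)) \<partial>(M \<Otimes>\<^sub>M N)) < \<infinity>"
    using fin by (subst N.nn_integral_fst[symmetric]) auto
  then show I: "integrable (M \<Otimes>\<^sub>M N) (\<lambda>(x, y). f x y)"
    by (intro integrableI_bounded) auto
  show "(\<integral>x. (\<integral>y. f x y \<partial>N) \<partial>M) = (\<integral>y. (\<integral>x. f x y \<partial>M) \<partial>N)"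
    using Fubini_integral[OF I] by simp
  show "AE x in M. integrable N (f x)" "integrable M (\<lambda>x. \<integral>y. f x y \<partial>N)"
    using AE_integrable_fst[OF I] integrable_fst[OF I] by auto
  show "AE y in N. integrable M (\<lambda>x. f x y)" "integrable N (\<lambda>y. \<integral>x. f x y \<partial>M)"
    using AE_integrable_snd[OF I] integrable_snd[OF I] by auto
qed

lemma ennreal_norm_le_add:
  fixes a b c :: "'a::real_normed_vector"
  assumes "norm c \<le> norm a + norm b"
  shows "ennreal (norm c) \<le> ennreal (norm a) + ennreal (norm b)"
  using ennreal_leI[OF assms] by (simp add: ennreal_plus)

lemma ennreal_tendsto_0_le:
  fixes f g :: "nat \<Rightarrow> ennreal"
  assumes "g \<longlonglongrightarrow> 0" "\<And>n. f n \<le> g n"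
  shows "f \<longlonglongrightarrow> 0"
  by (rule tendsto_sandwich[OF always_eventually always_eventually tendsto_const assms(1)])
     (simp_all add: assms(2))

lemma integrable_complex_of_real_iff:
  "integrable M (\<lambda>x. complex_of_real (f x)) \<longleftrightarrow> integrable M f"
  using integrable_Re[of M "\<lambda>x. complex_of_real (f x)"] by auto

lemma ennreal_norm_integral_le:
  fixes f :: "'a \<Rightarrow> complex"
  shows "ennreal (norm (integral\<^sup>L M f)) \<le> (\<integral>\<^sup>+x. ennreal (norm (f x)) \<partial>M)"
proof (cases "integrable M f")
  case True
  then show ?thesis by (simp add: integral_norm_bound_ennreal)
qed (simp add: not_integrable_integral_eq)

lemma nn_integral_affine:
  fixes f :: "'a::euclidean_space \<Rightarrow> ennreal"
  assumes [measurable]: "f \<in> borel_measurable borel" and c: "c \<noteq> 0"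
  shows "(\<integral>\<^sup>+x. f x \<partial>lborel) = ennreal (\<bar>c\<bar> ^ DIM('a)) * (\<integral>\<^sup>+x. f (t + c *\<^sub>R x) \<partial>lborel)"
  by (subst lborel_affine[OF c, of t])
     (simp add: nn_integral_density nn_integral_distr nn_integral_cmult)

lemma integrable_affine:
  fixes f :: "'a::euclidean_space \<Rightarrow> complex"
  assumes f: "integrable lborel f" and c: "c \<noteq> 0"
  shows "integrable lborel (\<lambda>x. f (t + c *\<^sub>R x))"
proof -
  have [measurable]: "f \<in> borel_measurable borel" using f by auto
  show ?thesis
    using f c unfolding integrable_iff_bounded
    by (subst (asm) nn_integral_affine[where c=c and t=t]) (auto simp: ennreal_mult_less_top)
qed

lemma integrable_affine_iff:
  fixes f :: "'a::euclidean_space \<Rightarrow> complex"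
  assumes c: "c \<noteq> 0"
  shows "integrable lborel (\<lambda>x. f (t + c *\<^sub>R x)) \<longleftrightarrow> integrable lborel f"
  using integrable_affine[of f c t] integrable_affine[of "\<lambda>x. f (t + c *\<^sub>R x)" "1 / c" "- (1 / c) *\<^sub>R t"] c
  by (auto simp: algebra_simps)

lemma integral_affine:
  fixes f :: "'a::euclidean_space \<Rightarrow> complex"
  assumes c: "c \<noteq> 0"
  shows "(\<integral>x. f x \<partial>lborel) = (\<bar>c\<bar> ^ DIM('a)) *\<^sub>R (\<integral>x. f (t + c *\<^sub>R x) \<partial>lborel)"
proof cases
  assume f: "integrable lborel f"
  then have [measurable]: "f \<in> borel_measurable borel" by auto
  show ?thesis
    using c f integrable_affine[OF f c, of t]
    by (subst lborel_affine[OF c, of t]) (simp add: integral_density integral_distr)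
next
  assume "\<not> integrable lborel f" with c show ?thesis
    by (simp add: integrable_affine_iff not_integrable_integral_eq)
qed

lemma nn_integral_shift:
  fixes f :: "'a::euclidean_space \<Rightarrow> ennreal"
  assumes [measurable]: "f \<in> borel_measurable borel"
  shows "(\<integral>\<^sup>+x. f (x + t) \<partial>lborel) = (\<integral>\<^sup>+x. f x \<partial>lborel)"
  using nn_integral_affine[of f 1 t] by (simp add: add.commute)

lemma nn_integral_shift_minus:
  fixes f :: "'a::euclidean_space \<Rightarrow> ennreal"
  assumes [measurable]: "f \<in> borel_measurable borel"
  shows "(\<integral>\<^sup>+x. f (x - t) \<partial>lborel) = (\<integral>\<^sup>+x. f x \<partial>lborel)"
  using nn_integral_shift[of f "-t"] by simp

lemma nn_integral_reflect:
  fixes f :: "'a::euclidean_space \<Rightarrow> ennreal"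
  assumes [measurable]: "f \<in> borel_measurable borel"
  shows "(\<integral>\<^sup>+x. f (t - x) \<partial>lborel) = (\<integral>\<^sup>+x. f x \<partial>lborel)"
  using nn_integral_affine[of f "-1" t] by simp

lemma integral_shift:
  fixes f :: "'a::euclidean_space \<Rightarrow> complex"
  shows "(\<integral>x. f (x + t) \<partial>lborel) = (\<integral>x. f x \<partial>lborel)"
  using integral_affine[of 1 f t] by (simp add: add.commute)

lemma integrable_shift:
  fixes f :: "'a::euclidean_space \<Rightarrow> complex"
  assumes "integrable lborel f"
  shows "integrable lborel (\<lambda>x. f (x + t))"
  using integrable_affine[OF assms, of 1 t] by (simp add: add.commute)

text \<open>Lebesgue measure on a Euclidean space is the image of the product measure over
  \<open>Basis\<close>, so integrals of products of one-variable functions factorise. The use is for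
  Gaussians.\<close>

lemma integral_prod_Basis:
  fixes f :: "'a::euclidean_space \<Rightarrow> real \<Rightarrow> complex"
  assumes f: "\<And>b. b \<in> Basis \<Longrightarrow> integrable lborel (f b)"
  shows "integrable lborel (\<lambda>x. \<Prod>b\<in>Basis. f b (x \<bullet> b))"
    and "(\<integral>x. (\<Prod>b\<in>Basis. f b (x \<bullet> b)) \<partial>lborel) = (\<Prod>b\<in>Basis. \<integral>t. f b t \<partial>lborel)"
proof -
  interpret product_sigma_finite "\<lambda>_::'a. lborel::real measure" by standard
  have [measurable]: "b \<in> Basis \<Longrightarrow> f b \<in> borel_measurable borel" for b
    using f[of b] by auto
  have *: "(\<Sum>b\<in>Basis. g b *\<^sub>R b) \<bullet> c = g c" if "c \<in> Basis" for g and c :: 'a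
    using that by (simp add: inner_sum_left inner_Basis if_distrib cong: if_cong)
  have eq: "(\<Prod>b\<in>Basis. f b ((\<Sum>b\<in>Basis. g b *\<^sub>R b) \<bullet> b)) = (\<Prod>b\<in>Basis. f b (g b))" for g
    by (intro prod.cong refl) (simp add: *)
  show "integrable lborel (\<lambda>x. \<Prod>b\<in>Basis. f b (x \<bullet> b))"
    unfolding lborel_eq[where 'a='a]
    by (subst integrable_distr_eq) (auto simp: eq intro!: product_integrable_prod f)
  show "(\<integral>x. (\<Prod>b\<in>Basis. f b (x \<bullet> b)) \<partial>lborel) = (\<Prod>b\<in>Basis. \<integral>t. f b t \<partial>lborel)"
    unfolding lborel_eq[where 'a='a]
    by (subst integral_distr) (auto simp: eq lborel_eq[symmetric] intro!: product_integral_prod f)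
qed

section \<open>Gaussian mollification\<close>

definition gauss :: "'a::euclidean_space \<Rightarrow> real" where
  "gauss x = exp (- (norm x)\<^sup>2 / 2) / sqrt (2 * pi) ^ DIM('a)"

lemma gauss_pos: "0 < gauss x"
  by (simp add: gauss_def)

lemma gauss_nonneg [simp]: "0 \<le> gauss x"
  using gauss_pos[of x] by simp

lemma gauss_measurable [measurable]: "gauss \<in> borel_measurable borel"
  unfolding gauss_def[abs_def] by measurable

lemma gauss_prod: "gauss x = (\<Prod>b\<in>Basis. std_normal_density (x \<bullet> b))"
  for x :: "'a::euclidean_space"
proof -
  have "(norm x)\<^sup>2 = (\<Sum>b\<in>Basis. (x \<bullet> b)\<^sup>2)"
    by (subst power2_norm_eq_inner, subst euclidean_inner) (simp add: power2_eq_square)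
  then show ?thesis
    by (simp add: gauss_def std_normal_density_def prod_dividef exp_sum[symmetric] sum_negf
        sum_divide_distrib)
qed

text \<open>Density and character both factorise over the coordinates, which leaves the
  characteristic function of the one-dimensional standard normal distribution.\<close>

lemma integral_gauss_char:
  fixes x :: "'a::euclidean_space"
  shows "integrable lborel (\<lambda>t. of_real (gauss t) * exp (\<i> * of_real (x \<bullet> t)))"
    and "(\<integral>t. of_real (gauss t) * exp (\<i> * of_real (x \<bullet> t)) \<partial>lborel) = of_real (exp (- (norm x)\<^sup>2 / 2))"
proof -
  let ?f = "\<lambda>b t. complex_of_real (std_normal_density t) * exp (\<i> * of_real ((x \<bullet> b) * t))"
  have int: "integrable lborel (?f b)" for b
    by (rule Bochner_Integration.integrable_bound[OF integrable_normal_density[where \<mu>=0 and \<sigma>=1]])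
       (auto simp: norm_mult)
  have val: "(\<integral>t. ?f b t \<partial>lborel) = of_real (exp (- (x \<bullet> b)\<^sup>2 / 2))" for b
  proof -
    have "char std_normal_distribution (x \<bullet> b) = (\<integral>t. ?f b t \<partial>lborel)"
      unfolding char_def by (subst integral_density) (auto simp: scaleR_conv_of_real mult.commute)
    then show ?thesis by (simp add: char_std_normal_distribution)
  qed
  have prod: "(\<Prod>b\<in>Basis. ?f b (t \<bullet> b)) = of_real (gauss t) * exp (\<i> * of_real (x \<bullet> t))" for t
    by (simp add: prod.distrib gauss_prod euclidean_inner[of x t] sum_distrib_left exp_sum)
  show "integrable lborel (\<lambda>t. of_real (gauss t) * exp (\<i> * of_real (x \<bullet> t)))"
    using integral_prod_Basis(1)[of ?f, OF int] unfolding prod .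
  have n: "(norm x)\<^sup>2 = (\<Sum>b\<in>Basis. (x \<bullet> b)\<^sup>2)"
    by (subst power2_norm_eq_inner, subst euclidean_inner) (simp add: power2_eq_square)
  show "(\<integral>t. of_real (gauss t) * exp (\<i> * of_real (x \<bullet> t)) \<partial>lborel) = of_real (exp (- (norm x)\<^sup>2 / 2))"
    using integral_prod_Basis(2)[of ?f, OF int] unfolding prod val
    by (simp add: n sum_divide_distrib exp_sum flip: sum_negf)
qed

lemma integrable_gauss: "integrable lborel (gauss :: 'a::euclidean_space \<Rightarrow> real)"
  using integral_gauss_char(1)[of "0::'a"] by (simp add: integrable_complex_of_real_iff)

lemma integral_gauss: "integral\<^sup>L lborel (gauss :: 'a::euclidean_space \<Rightarrow> real) = 1"
proof -
  have "complex_of_real (integral\<^sup>L lborel (gauss :: 'a \<Rightarrow> real)) = 1"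
    using integral_gauss_char(2)[of "0::'a"] by simp
  then show ?thesis
    by (simp only: of_real_eq_1_iff)
qed

lemma nn_integral_gauss: "(\<integral>\<^sup>+t. ennreal (gauss (t::'a::euclidean_space)) \<partial>lborel) = 1"
  by (subst nn_integral_eq_integral[OF integrable_gauss]) (auto simp: integral_gauss)

lemma ennreal_ex_pos_less:
  assumes "(0::ennreal) < a"
  shows "\<exists>e::real. 0 < e \<and> ennreal e < a"
proof -
  obtain b where b: "0 < b" "b < a" using dense[OF assms] by blast
  then have "b < top" by (meson less_le_trans top_greatest)
  then show ?thesis using b by (cases b) (auto simp: ennreal_less_zero_iff)
qed

text \<open>Continuity of translations in L1, by the induction principle for integrable functions.
  For the indicator of an open set dominated convergence applies, because a point of the set stays
  in it under small shifts. Outer regularity passes to Borel sets, and a three-epsilon argument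
  passes to limits.\<close>

lemma translate_L1_tendsto_0:
  fixes f :: "'a::euclidean_space \<Rightarrow> complex"
  assumes f: "integrable lborel f" and h: "h \<longlonglongrightarrow> (0::'a)"
  shows "(\<lambda>n. \<integral>\<^sup>+x. ennreal (norm (f (x + h n) - f x)) \<partial>lborel) \<longlonglongrightarrow> 0"
  using f
proof (induction rule: integrable_induct)
  case (base A c)
  have A [measurable]: "A \<in> sets borel" and finA: "emeasure lborel A < \<infinity>" using base by auto
  let ?L = "\<lambda>B n. \<integral>\<^sup>+x. ennreal \<bar>indicator B (x + h n) - indicator B x :: real\<bar> \<partial>lborel"
  have U: "?L U \<longlonglongrightarrow> 0" if "open U" "emeasure lborel U < \<infinity>" for U :: "'a set"
  proof -
    have [measurable]: "U \<in> sets borel" using that by auto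
    have iU: "integrable lborel (indicator U :: 'a \<Rightarrow> real)"
      using that by (simp add: less_top[symmetric])
    have iU': "integrable lborel (\<lambda>x. indicator U (x + h n) :: real)" for n
      using integrable_shift[of "\<lambda>x. complex_of_real (indicator U x)" "h n"] iU
      by (simp only: integrable_complex_of_real_iff)
    have eU': "(\<integral>x. indicator U (x + h n) \<partial>lborel) = (\<integral>x. indicator U x \<partial>lborel :: real)" for n
      using integral_shift[of "\<lambda>x. complex_of_real (indicator U x)" "h n"] by simp
    have iUU: "integrable lborel (\<lambda>x. indicator U (x + h n) * indicator U x :: real)" for n
      by (rule Bochner_Integration.integrable_bound[OF iU]) (auto split: split_indicator)
    have conv: "(\<lambda>n. \<integral>x. indicator U (x + h n) * indicator U x \<partial>lborel :: real) \<longlonglongrightarrow> (\<integral>x. indicator U x \<partial>lborel)"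
    proof (rule integral_dominated_convergence[where w="indicator U"])
      show "integrable lborel (indicator U :: 'a \<Rightarrow> real)" by (rule iU)
      show "(\<lambda>x. indicator U x :: real) \<in> borel_measurable lborel" by simp
      show "(\<lambda>x. indicator U (x + h i) * indicator U x :: real) \<in> borel_measurable lborel" for i
        by measurable
      show "AE x in lborel. norm (indicator U (x + h i) * indicator U x :: real) \<le> indicator U x" for i
        by (rule AE_I2) (simp add: indicator_def)
      show "AE x in lborel. (\<lambda>n. indicator U (x + h n) * indicator U x :: real) \<longlonglongrightarrow> indicator U x"
      proof (rule AE_I2)
        fix x :: 'a
        show "(\<lambda>n. indicator U (x + h n) * indicator U x :: real) \<longlonglongrightarrow> indicator U x"
        proof (cases "x \<in> U")
          case True
          have "(\<lambda>n. x + h n) \<longlonglongrightarrow> x" using tendsto_add[OF tendsto_const h, of x] by simp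
          then have "eventually (\<lambda>n. x + h n \<in> U) sequentially"
            using topological_tendstoD[OF _ \<open>open U\<close> True] by blast
          then have "eventually (\<lambda>n. indicator U (x + h n) * indicator U x = (indicator U x :: real)) sequentially"
            by eventually_elim (use True in auto)
          then show ?thesis by (rule tendsto_eventually)
        next
          case False
          then show ?thesis by (simp add: indicator_def)
        qed
      qed
    qed
    \<comment> \<open>For values p, q in {0, 1} one has |p - q| = p + q - 2 p q, so the L1 distance
      reduces to the overlap integral, whose limit is \<open>conv\<close>.\<close>
    have i2: "integrable lborel (\<lambda>x. 2 * (indicator U (x + h n) * indicator U x) :: real)" for n
      by (rule integrable_mult_right) (rule iUU)
    note i1 = Bochner_Integration.integrable_add[OF iU' iU]
    note i3 = Bochner_Integration.integrable_diff[OF i1 i2]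
    have "?L U n = ennreal (2 * (\<integral>x. indicator U x \<partial>lborel) - 2 * (\<integral>x. indicator U (x + h n) * indicator U x \<partial>lborel))" for n
    proof -
      have "?L U n = (\<integral>\<^sup>+x. ennreal (indicator U (x + h n) + indicator U x - 2 * (indicator U (x + h n) * indicator U x)) \<partial>lborel)"
        by (rule nn_integral_cong) (simp add: indicator_def)
      also have "\<dots> = ennreal (\<integral>x. indicator U (x + h n) + indicator U x - 2 * (indicator U (x + h n) * indicator U x) \<partial>lborel)"
        by (rule nn_integral_eq_integral[OF i3]) (rule AE_I2, simp add: indicator_def)
      also have "(\<integral>x. indicator U (x + h n) + indicator U x - 2 * (indicator U (x + h n) * indicator U x) \<partial>lborel)
        = (\<integral>x. indicator U (x + h n) \<partial>lborel) + (\<integral>x. indicator U x \<partial>lborel) - 2 * (\<integral>x. indicator U (x + h n) * indicator U x \<partial>lborel :: real)"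
        unfolding Bochner_Integration.integral_diff[OF i1 i2] Bochner_Integration.integral_add[OF iU' iU] integral_mult_right_zero ..
      finally show ?thesis unfolding eU' by simp
    qed
    moreover have "(\<lambda>n. ennreal (2 * (\<integral>x. indicator U x \<partial>lborel) - 2 * (\<integral>x. indicator U (x + h n) * indicator U x \<partial>lborel)))
      \<longlonglongrightarrow> ennreal (2 * (\<integral>x. indicator U x \<partial>lborel) - 2 * (\<integral>x. indicator U x \<partial>lborel))"
      by (intro tendsto_ennrealI tendsto_intros conv)
    ultimately show ?thesis by simp
  qed
  have "?L A \<longlonglongrightarrow> 0"
  proof (rule order_tendstoI)
    fix a :: ennreal assume "0 < a"
    then obtain e :: real where e: "0 < e" "ennreal e < a"
      using ennreal_ex_pos_less by blast
    obtain V where V: "open V" "A \<subseteq> V" "emeasure lborel (V - A) < e/3"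
      using outer_regular_lborel[OF A, of "e/3"] e(1) by auto
    have [measurable]: "V \<in> sets borel" using V by auto
    have "emeasure lborel V = emeasure lborel A + emeasure lborel (V - A)"
      using V by (subst plus_emeasure) (auto simp: Un_absorb1)
    then have finV: "emeasure lborel V < \<infinity>"
      using finA V(3) by (auto simp: less_top[symmetric])
    have "eventually (\<lambda>n. ?L V n < ennreal (e/3)) sequentially"
      using U[OF V(1) finV] e(1) by (auto simp: order_tendsto_iff)
    then show "eventually (\<lambda>n. ?L A n < a) sequentially"
    proof eventually_elim
      case (elim n)
      \<comment> \<open>Replacing A by the open set V costs the measure of V - A twice, once at the
        shifted point and once at x.\<close>
      have "?L A n \<le> (\<integral>\<^sup>+x. indicator (V - A) (x + h n) + (ennreal \<bar>indicator V (x + h n) - indicator V x :: real\<bar> + indicator (V - A) x) \<partial>lborel)"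
      proof (intro nn_integral_mono)
        fix x
        have "ennreal \<bar>indicator A y - indicator A z :: real\<bar> \<le> indicator (V - A) y + (ennreal \<bar>indicator V y - indicator V z :: real\<bar> + indicator (V - A) z)" for y z
          using V(2) by (auto simp: indicator_def)
        then show "ennreal \<bar>indicator A (x + h n) - indicator A x :: real\<bar> \<le> indicator (V - A) (x + h n) + (ennreal \<bar>indicator V (x + h n) - indicator V x :: real\<bar> + indicator (V - A) x)"
          by blast
      qed
      also have "\<dots> = (\<integral>\<^sup>+x. indicator (V - A) (x + h n) \<partial>lborel) + (?L V n + (\<integral>\<^sup>+x. indicator (V - A) x \<partial>lborel))"
        by (subst nn_integral_add; (subst nn_integral_add)?; measurable)
      also have "(\<integral>\<^sup>+x. indicator (V - A) (x + h n) \<partial>lborel) = emeasure lborel (V - A)"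
        by (subst nn_integral_shift) auto
      also have "(\<integral>\<^sup>+x. indicator (V - A) x \<partial>lborel) = emeasure lborel (V - A)"
        by auto
      also have "emeasure lborel (V - A) + (?L V n + emeasure lborel (V - A)) \<le> ennreal (e/3) + (ennreal (e/3) + ennreal (e/3))"
        using V(3) elim by (intro add_mono) auto
      also have "\<dots> = ennreal e" using e(1) by (simp add: ennreal_plus[symmetric] del: ennreal_plus)
      also have "\<dots> < a" by fact
      finally show ?case .
    qed
  qed simp
  then have "(\<lambda>n. ennreal (norm c) * ?L A n) \<longlonglongrightarrow> ennreal (norm c) * 0"
    by (intro ennreal_tendsto_cmult) auto
  moreover have "(\<integral>\<^sup>+x. ennreal (norm (indicat_real A (x + h n) *\<^sub>R c - indicat_real A x *\<^sub>R c)) \<partial>lborel) = ennreal (norm c) * ?L A n" for n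
    by (subst nn_integral_cmult[symmetric])
       (auto intro!: nn_integral_cong simp: scaleR_diff_left[symmetric] ennreal_mult' mult.commute simp del: ennreal_indicator)
  ultimately show ?case by simp
next
  case (add f g)
  have [measurable]: "f \<in> borel_measurable borel" "g \<in> borel_measurable borel" using add by auto
  have "(\<integral>\<^sup>+x. ennreal (norm ((f (x + h n) + g (x + h n)) - (f x + g x))) \<partial>lborel) \<le>
    (\<integral>\<^sup>+x. ennreal (norm (f (x + h n) - f x)) \<partial>lborel) + (\<integral>\<^sup>+x. ennreal (norm (g (x + h n) - g x)) \<partial>lborel)" for n
    by (subst nn_integral_add[symmetric])
       (measurable, intro nn_integral_mono ennreal_norm_le_add norm_diff_triangle_ineq)
  moreover have "(\<lambda>n. (\<integral>\<^sup>+x. ennreal (norm (f (x + h n) - f x)) \<partial>lborel) + (\<integral>\<^sup>+x. ennreal (norm (g (x + h n) - g x)) \<partial>lborel)) \<longlonglongrightarrow> 0"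
    using tendsto_add[OF add(3,4)] by simp
  ultimately show ?case
    by (rule ennreal_tendsto_0_le[rotated])
next
  case (lim f s)
  have [measurable]: "f \<in> borel_measurable borel" "\<And>i. s i \<in> borel_measurable borel"
    using lim by auto
  have "(\<lambda>i. \<integral>\<^sup>+x. ennreal (norm (s i x - f x)) \<partial>lborel) \<longlonglongrightarrow> integral\<^sup>N lborel (\<lambda>x::'a. 0)"
  proof (rule nn_integral_dominated_convergence[where w="\<lambda>x. ennreal (3 * norm (f x))"])
    show "(\<integral>\<^sup>+x. ennreal (3 * norm (f x)) \<partial>lborel) < \<infinity>"
      using lim(4) by (simp add: integrable_iff_bounded ennreal_mult nn_integral_cmult ennreal_mult_less_top)
    show "AE x in lborel. ennreal (norm (s j x - f x)) \<le> ennreal (3 * norm (f x))" for j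
    proof (intro AE_I2 ennreal_leI)
      fix x
      have "norm (s j x) \<le> 2 * norm (f x)" using lim(3)[of x j] by simp
      then show "norm (s j x - f x) \<le> 3 * norm (f x)"
        using norm_triangle_ineq4[of "s j x" "f x"] by linarith
    qed
    show "AE x in lborel. (\<lambda>i. ennreal (norm (s i x - f x))) \<longlonglongrightarrow> 0"
    proof (intro AE_I2)
      fix x
      have "(\<lambda>i. norm (s i x - f x)) \<longlonglongrightarrow> norm (f x - f x)"
        using lim(2)[of x] by (intro tendsto_intros) auto
      then show "(\<lambda>i. ennreal (norm (s i x - f x))) \<longlonglongrightarrow> 0"
        by (simp add: tendsto_ennrealI[of _ 0, simplified])
    qed
  qed auto
  then have S: "(\<lambda>i. \<integral>\<^sup>+x. ennreal (norm (s i x - f x)) \<partial>lborel) \<longlonglongrightarrow> 0" by simp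
  show ?case
  proof (rule order_tendstoI)
    fix a :: ennreal assume "0 < a"
    then obtain e :: real where e: "0 < e" "ennreal e < a"
      using ennreal_ex_pos_less by blast
    have "eventually (\<lambda>i. (\<integral>\<^sup>+x. ennreal (norm (s i x - f x)) \<partial>lborel) < ennreal (e/3)) sequentially"
      using S e(1) by (auto simp: order_tendsto_iff)
    then obtain i where i: "(\<integral>\<^sup>+x. ennreal (norm (s i x - f x)) \<partial>lborel) < ennreal (e/3)"
      by (auto dest: eventually_happens)
    have "eventually (\<lambda>n. (\<integral>\<^sup>+x. ennreal (norm (s i (x + h n) - s i x)) \<partial>lborel) < ennreal (e/3)) sequentially"
      using lim(5)[of i] e(1) by (auto simp: order_tendsto_iff)
    then show "eventually (\<lambda>n. (\<integral>\<^sup>+x. ennreal (norm (f (x + h n) - f x)) \<partial>lborel) < a) sequentially"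
    proof eventually_elim
      case (elim n)
      have "(\<integral>\<^sup>+x. ennreal (norm (f (x + h n) - f x)) \<partial>lborel) \<le>
        (\<integral>\<^sup>+x. ennreal (norm (s i (x + h n) - f (x + h n))) + (ennreal (norm (s i (x + h n) - s i x)) + ennreal (norm (s i x - f x))) \<partial>lborel)"
      proof (intro nn_integral_mono)
        fix x
        have "norm (f (x + h n) - f x) \<le> norm (s i (x + h n) - f (x + h n)) + (norm (s i (x + h n) - s i x) + norm (s i x - f x))"
          by norm
        then show "ennreal (norm (f (x + h n) - f x)) \<le> ennreal (norm (s i (x + h n) - f (x + h n))) + (ennreal (norm (s i (x + h n) - s i x)) + ennreal (norm (s i x - f x)))"
          by (simp add: ennreal_plus[symmetric] del: ennreal_plus)
      qed
      also have "\<dots> = (\<integral>\<^sup>+x. ennreal (norm (s i (x + h n) - f (x + h n))) \<partial>lborel) + ((\<integral>\<^sup>+x. ennreal (norm (s i (x + h n) - s i x)) \<partial>lborel) + (\<integral>\<^sup>+x. ennreal (norm (s i x - f x)) \<partial>lborel))"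
        by (subst nn_integral_add; (subst nn_integral_add)?; measurable)
      also have "(\<integral>\<^sup>+x. ennreal (norm (s i (x + h n) - f (x + h n))) \<partial>lborel) = (\<integral>\<^sup>+x. ennreal (norm (s i x - f x)) \<partial>lborel)"
        by (subst nn_integral_shift[of "\<lambda>x. ennreal (norm (s i x - f x))"]) auto
      also have "(\<integral>\<^sup>+x. ennreal (norm (s i x - f x)) \<partial>lborel) + ((\<integral>\<^sup>+x. ennreal (norm (s i (x + h n) - s i x)) \<partial>lborel) + (\<integral>\<^sup>+x. ennreal (norm (s i x - f x)) \<partial>lborel))
        \<le> ennreal (e/3) + (ennreal (e/3) + ennreal (e/3))"
        using i elim by (intro add_mono) auto
      also have "\<dots> = ennreal e" using e(1) by (simp add: ennreal_plus[symmetric] del: ennreal_plus)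
      also have "\<dots> < a" by fact
      finally show ?case .
    qed
  qed simp
qed

text \<open>Convolution with the Gaussian of width t, after scaling: the weight no longer depends on
  t, and t tending to 0 becomes a statement about translations of g.\<close>

definition mollify :: "real \<Rightarrow> ('a::euclidean_space \<Rightarrow> complex) \<Rightarrow> 'a \<Rightarrow> complex" where
  "mollify t g \<eta> = (\<integral>\<theta>. of_real (gauss \<theta>) * g (\<eta> + t *\<^sub>R \<theta>) \<partial>lborel)"

lemma mollify_measurable [measurable]:
  fixes g :: "'a::euclidean_space \<Rightarrow> complex"
  assumes [measurable]: "g \<in> borel_measurable borel"
  shows "mollify t g \<in> borel_measurable borel"
  unfolding mollify_def[abs_def] by measurable

text \<open>The L1 error is at most the Gaussian average over \<theta> of the L1 distances between g
  and its translates by t \<theta>. Each of these tends to 0 and all are at most twice the norm of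
  g, so dominated convergence in \<theta> applies.\<close>

lemma mollify_tendsto_L1:
  fixes g :: "'a::euclidean_space \<Rightarrow> complex"
  assumes g: "integrable lborel g" and t: "t \<longlonglongrightarrow> 0"
  shows "(\<lambda>n. \<integral>\<^sup>+\<eta>. ennreal (norm (mollify (t n) g \<eta> - g \<eta>)) \<partial>lborel) \<longlonglongrightarrow> 0"
proof -
  have [measurable]: "g \<in> borel_measurable borel" using g by auto
  let ?I = "\<lambda>n \<theta>. \<integral>\<^sup>+\<eta>. ennreal (norm (g (\<eta> + t n *\<^sub>R \<theta>) - g \<eta>)) \<partial>lborel"
  let ?G = "\<integral>\<^sup>+\<eta>. ennreal (norm (g \<eta>)) \<partial>lborel"
  have G: "?G < \<infinity>" using g by (auto simp: integrable_iff_bounded)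
  have "(\<lambda>n. \<integral>\<^sup>+\<theta>. ennreal (gauss \<theta>) * ?I n \<theta> \<partial>lborel) \<longlonglongrightarrow> integral\<^sup>N lborel (\<lambda>\<theta>::'a. 0)"
  proof (rule nn_integral_dominated_convergence[where w="\<lambda>\<theta>. ennreal (gauss \<theta>) * (?G + ?G)"])
    show "AE \<theta> in lborel. ennreal (gauss \<theta>) * ?I j \<theta> \<le> ennreal (gauss \<theta>) * (?G + ?G)" for j
    proof (intro AE_I2 mult_left_mono)
      fix \<theta> :: 'a
      have "?I j \<theta> \<le> (\<integral>\<^sup>+\<eta>. ennreal (norm (g (\<eta> + t j *\<^sub>R \<theta>))) + ennreal (norm (g \<eta>)) \<partial>lborel)"
        by (intro nn_integral_mono ennreal_norm_le_add norm_triangle_ineq4)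
      also have "\<dots> = ?G + ?G"
        by (subst nn_integral_add) (auto simp: nn_integral_shift[of "\<lambda>x. ennreal (norm (g x))"])
      finally show "?I j \<theta> \<le> ?G + ?G" .
    qed simp
    show "(\<integral>\<^sup>+\<theta>. ennreal (gauss (\<theta>::'a)) * (?G + ?G) \<partial>lborel) < \<infinity>"
      using G by (simp add: nn_integral_multc nn_integral_gauss)
    show "AE \<theta> in lborel. (\<lambda>i. ennreal (gauss \<theta>) * ?I i \<theta>) \<longlonglongrightarrow> 0"
    proof (intro AE_I2)
      fix \<theta> :: 'a
      have "(\<lambda>n. t n *\<^sub>R \<theta>) \<longlonglongrightarrow> 0" using tendsto_scaleR[OF t tendsto_const[of \<theta>]] by simp
      from translate_L1_tendsto_0[OF g this]
      have "(\<lambda>n. ennreal (gauss \<theta>) * ?I n \<theta>) \<longlonglongrightarrow> ennreal (gauss \<theta>) * 0"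
        by (intro ennreal_tendsto_cmult) auto
      then show "(\<lambda>i. ennreal (gauss \<theta>) * ?I i \<theta>) \<longlonglongrightarrow> 0" by simp
    qed
  qed measurable
  then have lim: "(\<lambda>n. \<integral>\<^sup>+\<theta>. ennreal (gauss \<theta>) * ?I n \<theta> \<partial>lborel) \<longlonglongrightarrow> 0" by simp
  have "(\<integral>\<^sup>+\<eta>. ennreal (norm (mollify (t n) g \<eta> - g \<eta>)) \<partial>lborel) \<le> (\<integral>\<^sup>+\<theta>. ennreal (gauss \<theta>) * ?I n \<theta> \<partial>lborel)" for n
  proof -
    have fin: "(\<integral>\<^sup>+\<theta>. \<integral>\<^sup>+\<eta>. ennreal (norm (of_real (gauss \<theta>) * g (\<eta> + t n *\<^sub>R \<theta>))) \<partial>lborel \<partial>lborel) < \<infinity>"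
      using G
      by (simp add: norm_mult ennreal_mult nn_integral_cmult nn_integral_multc nn_integral_gauss
           nn_integral_shift[of "\<lambda>x. ennreal (norm (g x))"])
    have AE: "AE \<eta> in lborel. integrable lborel (\<lambda>\<theta>. of_real (gauss \<theta>) * g (\<eta> + t n *\<^sub>R \<theta>))"
      by (rule Fubini_complex_AE2[OF _ _ _ fin]) (auto simp: sigma_finite_lborel)
    have "(\<integral>\<^sup>+\<eta>. ennreal (norm (mollify (t n) g \<eta> - g \<eta>)) \<partial>lborel) \<le>
      (\<integral>\<^sup>+\<eta>. \<integral>\<^sup>+\<theta>. ennreal (gauss \<theta>) * ennreal (norm (g (\<eta> + t n *\<^sub>R \<theta>) - g \<eta>)) \<partial>lborel \<partial>lborel)"
    proof (intro nn_integral_mono_AE, use AE in eventually_elim)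
      case (elim \<eta>)
      have "mollify (t n) g \<eta> - g \<eta> = mollify (t n) g \<eta> - (\<integral>\<theta>. of_real (gauss (\<theta>::'a)) * g \<eta> \<partial>lborel)"
        by (simp add: integral_gauss)
      also have "\<dots> = (\<integral>\<theta>. of_real (gauss \<theta>) * (g (\<eta> + t n *\<^sub>R \<theta>) - g \<eta>) \<partial>lborel)"
        unfolding mollify_def right_diff_distrib using elim
        by (intro Bochner_Integration.integral_diff[symmetric]) (auto intro!: integrable_gauss)
      finally have "ennreal (norm (mollify (t n) g \<eta> - g \<eta>)) \<le>
         (\<integral>\<^sup>+\<theta>. ennreal (norm (of_real (gauss \<theta>) * (g (\<eta> + t n *\<^sub>R \<theta>) - g \<eta>))) \<partial>lborel)"
        using ennreal_norm_integral_le by metis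
      then show ?case by (simp add: norm_mult ennreal_mult)
    qed
    also have "\<dots> = (\<integral>\<^sup>+\<theta>. \<integral>\<^sup>+\<eta>. ennreal (gauss \<theta>) * ennreal (norm (g (\<eta> + t n *\<^sub>R \<theta>) - g \<eta>)) \<partial>lborel \<partial>lborel)"
      by (rule lborel_pair.Fubini') measurable
    finally show ?thesis by (simp add: nn_integral_cmult)
  qed
  then show ?thesis
    by (rule ennreal_tendsto_0_le[OF lim])
qed

section \<open>Borel representatives and the Fourier transform\<close>

lemma AE_lebesgue_iff: "(AE x in lebesgue. P x) \<longleftrightarrow> (AE x in lborel. P x)"
  by (rule AE_completion_iff)

text \<open>The notions of the theorem refer to the completed measure, but completion does not
  commute with products. The Fubini arguments are therefore carried out with Borel representatives
  and \<open>lborel\<close>.\<close>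

lemma ex_borel_representative:
  fixes f :: "'a::euclidean_space \<Rightarrow> complex"
  assumes "f \<in> borel_measurable lebesgue"
  shows "\<exists>g\<in>borel_measurable borel. AE x in lborel. f x = g x"
proof -
  have "(\<lambda>x. Re (f x)) \<in> borel_measurable (completion lborel)"
       "(\<lambda>x. Im (f x)) \<in> borel_measurable (completion lborel)"
    using assms by measurable
  then obtain a b where [measurable]: "a \<in> borel_measurable lborel" "b \<in> borel_measurable lborel"
    and ae: "AE x in lborel. Re (f x) = a x" "AE x in lborel. Im (f x) = b x"
    using completion_ex_borel_measurable_real[of "\<lambda>x. Re (f x)" lborel] completion_ex_borel_measurable_real[of "\<lambda>x. Im (f x)" lborel]
    by blast
  have "(\<lambda>x. Complex (a x) (b x)) \<in> borel_measurable borel"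
    unfolding Complex_eq by measurable
  moreover have "AE x in lborel. f x = Complex (a x) (b x)"
    using ae by eventually_elim (simp add: complex_eq_iff)
  ultimately show ?thesis by (intro bexI[of _ "\<lambda>x. Complex (a x) (b x)"])
qed

lemma borel_imp_lebesgue:
  fixes f :: "'a::euclidean_space \<Rightarrow> 'b::topological_space"
  assumes "f \<in> borel_measurable borel"
  shows "f \<in> borel_measurable lebesgue"
  using assms by (auto intro!: measurable_completion)

lemma integral_lebesgue_borel:
  fixes f :: "'a::euclidean_space \<Rightarrow> complex"
  assumes "f \<in> borel_measurable borel"
  shows "integral\<^sup>L lebesgue f = integral\<^sup>L lborel f"
    and "integrable lebesgue f \<longleftrightarrow> integrable lborel f"
  using assms by (auto simp: integral_completion integrable_completion)

lemma fourier_borel: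
  fixes u :: "real^'n \<Rightarrow> complex"
  assumes [measurable]: "u \<in> borel_measurable borel"
  shows "fourier u \<xi> = (\<integral>x. exp (- (\<i> * of_real (x \<bullet> \<xi>))) * u x \<partial>lborel)"
  unfolding fourier_def by (rule integral_lebesgue_borel) measurable

lemma fourier_measurable [measurable]:
  fixes u :: "real^'n \<Rightarrow> complex"
  assumes [measurable]: "u \<in> borel_measurable borel"
  shows "fourier u \<in> borel_measurable borel"
  unfolding fourier_borel[OF assms, abs_def] by measurable

lemma norm_exp_ii [simp]:
  "norm (exp (\<i> * complex_of_real t)) = 1" "norm (exp (- (\<i> * complex_of_real t))) = 1"
  by simp_all

lemma fourier_norm_le:
  fixes u :: "real^'n \<Rightarrow> complex"
  assumes [measurable]: "u \<in> borel_measurable borel"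
  shows "ennreal (norm (fourier u \<xi>)) \<le> (\<integral>\<^sup>+x. ennreal (norm (u x)) \<partial>lborel)"
  unfolding fourier_borel[OF assms]
  by (rule order.trans[OF ennreal_norm_integral_le]) (simp add: norm_mult)

lemma schwartz_borel [measurable_dest]:
  assumes "\<phi> \<in> schwartz"
  shows "\<phi> \<in> borel_measurable borel"
proof -
  have "partials UNIV [] \<phi> differentiable_on UNIV"
    using assms unfolding schwartz_def smooth_on_def by blast
  then show ?thesis
    by (intro borel_measurable_continuous_onI differentiable_imp_continuous_on) simp
qed

lemma has_fourier_borel_iff:
  assumes [measurable]: "f \<in> borel_measurable borel" "g \<in> borel_measurable borel"
  shows "has_fourier f g \<longleftrightarrow> (\<forall>\<phi>\<in>schwartz.
     integrable lborel (\<lambda>x. f x * fourier \<phi> x) \<and> integrable lborel (\<lambda>\<xi>. g \<xi> * \<phi> \<xi>) \<and>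
     (\<integral>x. f x * fourier \<phi> x \<partial>lborel) = (\<integral>\<xi>. g \<xi> * \<phi> \<xi> \<partial>lborel))"
proof -
  have [measurable]: "\<phi> \<in> schwartz \<Longrightarrow> \<phi> \<in> borel_measurable borel" for \<phi> :: "real^'a \<Rightarrow> complex"
    by (rule schwartz_borel)
  show ?thesis
    unfolding has_fourier_def using assms
    by (auto simp: borel_imp_lebesgue integral_lebesgue_borel cong: conj_cong)
qed

lemma has_fourier_cong_AE:
  assumes h: "has_fourier f g" and f': "f' \<in> borel_measurable lebesgue" and g': "g' \<in> borel_measurable lebesgue"
    and ae: "AE x in lborel. f x = f' x" "AE x in lborel. g x = g' x"
  shows "has_fourier f' g'"
  unfolding has_fourier_def
proof (intro conjI ballI f' g')
  fix \<phi> :: "real^'a \<Rightarrow> complex" assume \<phi>: "\<phi> \<in> schwartz"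
  note [measurable] = schwartz_borel[OF \<phi>] f' g'
  have [measurable]: "f \<in> borel_measurable lebesgue" "g \<in> borel_measurable lebesgue"
    using h by (auto simp: has_fourier_def)
  have [measurable]: "fourier \<phi> \<in> borel_measurable lebesgue" "\<phi> \<in> borel_measurable lebesgue"
    by (auto intro!: borel_imp_lebesgue)
  have ae': "AE x in lebesgue. f x * fourier \<phi> x = f' x * fourier \<phi> x"
       "AE x in lebesgue. g x * \<phi> x = g' x * \<phi> x"
    unfolding AE_lebesgue_iff using ae by (auto elim: eventually_mono)
  have "integrable lebesgue (\<lambda>x. f x * fourier \<phi> x)" "integrable lebesgue (\<lambda>x. g x * \<phi> x)"
    "(LINT x|lebesgue. f x * fourier \<phi> x) = (LINT \<xi>|lebesgue. g \<xi> * \<phi> \<xi>)"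
    using h \<phi> by (auto simp: has_fourier_def)
  then show "integrable lebesgue (\<lambda>x. f' x * fourier \<phi> x)" "integrable lebesgue (\<lambda>x. g' x * \<phi> x)"
    "(LINT x|lebesgue. f' x * fourier \<phi> x) = (LINT \<xi>|lebesgue. g' \<xi> * \<phi> \<xi>)"
    using integrable_cong_AE[OF _ _ ae'(1)] integrable_cong_AE[OF _ _ ae'(2)]
      integral_cong_AE[OF _ _ ae'(1)] integral_cong_AE[OF _ _ ae'(2)] by auto
qed

section \<open>Gaussians are Schwartz functions\<close>

text \<open>A Gaussian with linear and oscillating terms in the exponent: b moves the centre, c
  modulates. The family contains the bumps, the products of a bump with \<open>gauss\<close>, and
  the modulated Gaussians, up to constant factors.\<close>

definition gexp :: "real \<Rightarrow> real^'n \<Rightarrow> real^'n \<Rightarrow> real^'n \<Rightarrow> complex" where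
  "gexp a b c x = exp (of_real (- (a / 2) * (x \<bullet> x) + b \<bullet> x) + \<i> * of_real (c \<bullet> x))"

text \<open>Polynomials times a fixed \<open>gexp\<close>, described by generators: closure under
  partial derivatives then gives smoothness and decay of all derivatives by induction, without
  formulas for them.\<close>

inductive_set gexp_class :: "real \<Rightarrow> real^'n \<Rightarrow> real^'n \<Rightarrow> (real^'n \<Rightarrow> complex) set"
  for a b c where
  base: "gexp a b c \<in> gexp_class a b c"
| coord: "f \<in> gexp_class a b c \<Longrightarrow> (\<lambda>x. of_real (x $ i) * f x) \<in> gexp_class a b c"
| scale: "f \<in> gexp_class a b c \<Longrightarrow> (\<lambda>x. k * f x) \<in> gexp_class a b c"
| add: "f \<in> gexp_class a b c \<Longrightarrow> g \<in> gexp_class a b c \<Longrightarrow> (\<lambda>x. f x + g x) \<in> gexp_class a b c"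

lemma gexp_class_derivative:
  assumes "f \<in> gexp_class a b c"
  shows "\<exists>D. (\<forall>i. D i \<in> gexp_class a b c) \<and>
    (\<forall>x. (f has_derivative (\<lambda>h. \<Sum>i\<in>UNIV. of_real (h $ i) * D i x)) (at x))"
  using assms
proof induction
  case base
  let ?D = "\<lambda>i x. (of_real (- a) * (of_real (x $ i) * gexp a b c x)) + (of_real (b $ i) + \<i> * of_real (c $ i)) * gexp a b c x"
  have "?D i \<in> gexp_class a b c" for i
    by (intro gexp_class.intros)
  moreover have "(gexp a b c has_derivative (\<lambda>h. \<Sum>i\<in>UNIV. of_real (h $ i) * ?D i x)) (at x)" for x
  proof -
    have "(gexp a b c has_derivative (\<lambda>h. gexp a b c x * (of_real (- (a / 2) * (x \<bullet> h + h \<bullet> x) + b \<bullet> h) + \<i> * of_real (c \<bullet> h)))) (at x)"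
    proof -
      have "((\<lambda>x. complex_of_real (- (a / 2) * (x \<bullet> x) + b \<bullet> x) + \<i> * of_real (c \<bullet> x)) has_derivative
         (\<lambda>h. of_real (- (a / 2) * (x \<bullet> h + h \<bullet> x) + b \<bullet> h) + \<i> * of_real (c \<bullet> h))) (at x)"
        by (rule has_derivative_eq_rhs, (rule derivative_intros)+) (simp add: fun_eq_iff)
      from has_derivative_compose[OF this DERIV_exp[unfolded has_field_derivative_def]] show ?thesis
        unfolding gexp_def[abs_def] .
    qed
    moreover have "gexp a b c x * (of_real (- (a / 2) * (x \<bullet> h + h \<bullet> x) + b \<bullet> h) + \<i> * of_real (c \<bullet> h))
       = (\<Sum>i\<in>UNIV. of_real (h $ i) * ?D i x)" for h
    proof -
      have "(\<Sum>i\<in>UNIV. of_real (h $ i) * ?D i x) = gexp a b c x *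
         (- of_real a * (\<Sum>i\<in>UNIV. of_real (x $ i * h $ i)) + (\<Sum>i\<in>UNIV. of_real (b $ i * h $ i)) + \<i> * (\<Sum>i\<in>UNIV. of_real (c $ i * h $ i)))"
        by (simp add: sum_distrib_left sum.distrib[symmetric] algebra_simps del: of_real_sum)
      moreover have "(\<Sum>i\<in>UNIV. complex_of_real (p $ i * q $ i)) = of_real (p \<bullet> q)" for p q :: "real^'a"
        by (simp add: inner_vec_def)
      ultimately show ?thesis
        by (simp only:) (simp add: inner_commute[of h x] field_simps)
    qed
    ultimately show ?thesis by simp
  qed
  ultimately show ?case by (intro exI[of _ ?D]) blast
next
  case (coord f j)
  then obtain D where D: "\<And>i. D i \<in> gexp_class a b c"
    "\<And>x. (f has_derivative (\<lambda>h. \<Sum>i\<in>UNIV. of_real (h $ i) * D i x)) (at x)" by blast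
  let ?D = "\<lambda>i x. (if i = j then 1 else 0) * f x + of_real (x $ j) * D i x"
  have 1: "?D i \<in> gexp_class a b c" for i
    by (intro gexp_class.intros coord D)
  have "((\<lambda>x. of_real (x $ j) * f x) has_derivative (\<lambda>h. of_real (x $ j) * (\<Sum>i\<in>UNIV. of_real (h $ i) * D i x) + of_real (h $ j) * f x)) (at x)" for x
  proof -
    have "((\<lambda>x. complex_of_real (x $ j)) has_derivative (\<lambda>h. of_real (h $ j))) (at x)"
      by (intro bounded_linear_imp_has_derivative bounded_linear_compose[OF bounded_linear_of_real] bounded_linear_vec_nth)
    from has_derivative_mult[OF this D(2)[of x]] show ?thesis by simp
  qed
  moreover have "of_real (x $ j) * (\<Sum>i\<in>UNIV. of_real (h $ i) * D i x) + of_real (h $ j) * f x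
     = (\<Sum>i\<in>UNIV. of_real (h $ i) * ?D i x)" for h x
    by (simp add: distrib_left sum.distrib sum_distrib_left if_distrib[of "\<lambda>t. _ * t"] if_distrib[of "\<lambda>t. t * _"]
         mult.left_commute cong: if_cong)
  ultimately show ?case using 1 by (intro exI[of _ ?D]) simp
next
  case (scale f k)
  then obtain D where D: "\<And>i. D i \<in> gexp_class a b c"
    "\<And>x. (f has_derivative (\<lambda>h. \<Sum>i\<in>UNIV. of_real (h $ i) * D i x)) (at x)" by blast
  show ?case
  proof (intro exI[of _ "\<lambda>i x. k * D i x"] conjI allI)
    show "(\<lambda>x. k * D i x) \<in> gexp_class a b c" for i by (intro gexp_class.intros D)
    show "((\<lambda>x. k * f x) has_derivative (\<lambda>h. \<Sum>i\<in>UNIV. of_real (h $ i) * (k * D i x))) (at x)" for x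
      using has_derivative_mult_right[OF D(2)[of x], of k]
      by (simp add: sum_distrib_left mult.left_commute)
  qed
next
  case (add f g)
  from add.IH(1) obtain D where D: "\<And>i. D i \<in> gexp_class a b c"
    "\<And>x. (f has_derivative (\<lambda>h. \<Sum>i\<in>UNIV. of_real (h $ i) * D i x)) (at x)" by blast
  from add.IH(2) obtain D' where D': "\<And>i. D' i \<in> gexp_class a b c"
    "\<And>x. (g has_derivative (\<lambda>h. \<Sum>i\<in>UNIV. of_real (h $ i) * D' i x)) (at x)" by blast
  show ?case
  proof (intro exI[of _ "\<lambda>i x. D i x + D' i x"] conjI allI)
    show "(\<lambda>x. D i x + D' i x) \<in> gexp_class a b c" for i by (intro gexp_class.intros D D')
    show "((\<lambda>x. f x + g x) has_derivative (\<lambda>h. \<Sum>i\<in>UNIV. of_real (h $ i) * (D i x + D' i x))) (at x)" for x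
      using has_derivative_add[OF D(2)[of x] D'(2)[of x]]
      by (simp add: sum.distrib distrib_left)
  qed
qed

lemma partial_within_UNIV_eq:
  assumes "(f has_derivative (\<lambda>h. \<Sum>i\<in>UNIV. complex_of_real (h $ i) * D i x)) (at x)"
  shows "partial_within UNIV j f x = D j x"
proof -
  have "frechet_derivative f (at x) = (\<lambda>h. \<Sum>i\<in>UNIV. of_real (h $ i) * D i x)"
    using frechet_derivative_at[OF assms] by simp
  then show ?thesis
    by (simp add: partial_within_def axis_def if_distrib[of "\<lambda>t. t * _"] if_distrib[of of_real] cong: if_cong)
qed

lemma gexp_class_partials:
  assumes "f \<in> gexp_class a b c"
  shows "partials UNIV is f \<in> gexp_class a b c"
proof (induction "is")
  case (Cons i "is")
  obtain D where D: "\<And>i. D i \<in> gexp_class a b c"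
    "\<And>x. (partials UNIV is f has_derivative (\<lambda>h. \<Sum>i\<in>UNIV. of_real (h $ i) * D i x)) (at x)"
    using gexp_class_derivative[OF Cons] by blast
  have "partials UNIV (i # is) f = D i"
    using partial_within_UNIV_eq[where D=D, OF D(2)] by (simp add: fun_eq_iff)
  then show ?case using D(1) by simp
qed (use assms in simp)

text \<open>The power k is arbitrary in the induction, because a coordinate factor is paid for with
  one more power of \<open>norm x\<close>.\<close>

lemma gexp_class_decay:
  assumes "f \<in> gexp_class a b c" "0 < a"
  shows "\<exists>C. \<forall>x. norm x ^ k * norm (f x) \<le> C"
  using assms(1)
proof (induction arbitrary: k)
  case base
  \<comment> \<open>The factorial comes from comparing the power with the exponential series. The
    remaining exponent is a quadratic in \<open>norm x\<close> with leading coefficient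
    \<open>- (a/2)\<close> and linear coefficient \<open>norm b + 1\<close>; its maximum is
    \<open>(norm b + 1)\<^sup>2 / (2 * a)\<close>.\<close>
  have "norm x ^ k * norm (gexp a b c x) \<le> fact k * exp ((norm b + 1)\<^sup>2 / (2 * a))" for x
  proof -
    have "norm x ^ k / fact k \<le> exp (norm x)"
      using sum_le_suminf[of "\<lambda>n. norm x ^ n /\<^sub>R fact n" "{k}"] summable_exp_generic[of "norm x"]
      by (simp add: exp_def divide_inverse mult.commute)
    then have "norm x ^ k \<le> fact k * exp (norm x)"
      by (simp add: field_simps)
    moreover have "norm (gexp a b c x) \<le> exp (- (a/2) * (norm x)\<^sup>2 + norm b * norm x)"
      unfolding gexp_def norm_exp_eq_Re using norm_cauchy_schwarz[of b x]
      by (simp add: power2_norm_eq_inner)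
    ultimately have "norm x ^ k * norm (gexp a b c x) \<le> (fact k * exp (norm x)) * exp (- (a/2) * (norm x)\<^sup>2 + norm b * norm x)"
      by (intro mult_mono) auto
    also have "\<dots> = fact k * exp (norm x + (- (a/2) * (norm x)\<^sup>2 + norm b * norm x))"
      by (simp add: exp_add)
    also have "norm x + (- (a/2) * (norm x)\<^sup>2 + norm b * norm x) \<le> (norm b + 1)\<^sup>2 / (2 * a)"
    proof -
      have "0 \<le> (a * norm x - (norm b + 1))\<^sup>2" by simp
      then show ?thesis using assms(2) by (simp add: field_simps power2_eq_square)
    qed
    finally show ?thesis by simp
  qed
  then show ?case by blast
next
  case (coord f i)
  obtain C where C: "\<And>x. norm x ^ Suc k * norm (f x) \<le> C" using coord.IH by blast
  have "norm x ^ k * norm (of_real (x $ i) * f x) \<le> C" for x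
  proof -
    have "norm x ^ k * norm (of_real (x $ i) * f x) \<le> norm x ^ k * (norm x * norm (f x))"
      using component_le_norm_cart[of x i] by (intro mult_left_mono) (auto simp: norm_mult intro!: mult_right_mono)
    also have "\<dots> \<le> C" using C[of x] by (simp add: algebra_simps)
    finally show ?thesis .
  qed
  then show ?case by blast
next
  case (scale f l)
  obtain C where C: "\<And>x. norm x ^ k * norm (f x) \<le> C" using scale.IH by blast
  have "norm x ^ k * norm (l * f x) \<le> norm l * C" for x
    using mult_left_mono[OF C[of x], of "norm l"] by (simp add: norm_mult algebra_simps)
  then show ?case by blast
next
  case (add f g)
  from add.IH(1) obtain C where C: "\<And>x. norm x ^ k * norm (f x) \<le> C" by blast
  from add.IH(2) obtain C' where C': "\<And>x. norm x ^ k * norm (g x) \<le> C'" by blast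
  have "norm x ^ k * norm (f x + g x) \<le> C + C'" for x
  proof -
    have "norm x ^ k * norm (f x + g x) \<le> norm x ^ k * (norm (f x) + norm (g x))"
      by (intro mult_left_mono norm_triangle_ineq) auto
    also have "\<dots> \<le> C + C'" using C[of x] C'[of x] by (simp add: algebra_simps)
    finally show ?thesis .
  qed
  then show ?case by blast
qed

lemma gexp_class_schwartz:
  assumes "f \<in> gexp_class a b c" "0 < a"
  shows "f \<in> schwartz"
  unfolding schwartz_def smooth_on_def multi_deriv_def
proof (intro CollectI conjI allI)
  fix "is" :: "'a list"
  show "partials UNIV is f differentiable_on UNIV"
    unfolding differentiable_on_def differentiable_def
    using gexp_class_derivative[OF gexp_class_partials[OF assms(1)], of "is"] by auto
qed (use gexp_class_decay[OF gexp_class_partials[OF assms(1)] assms(2)] in blast)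

lemma gexp_schwartz: "0 < a \<Longrightarrow> (\<lambda>x. k * gexp a b c x) \<in> schwartz"
  by (rule gexp_class_schwartz) (auto intro: gexp_class.intros)

text \<open>The Gaussian of width t centred at \<open>\<eta>\<close>, written with \<open>gexp\<close> so that it is recognised as a
  Schwartz function.\<close>

definition bump :: "real \<Rightarrow> real^'n \<Rightarrow> real^'n \<Rightarrow> complex" where
  "bump t \<eta> y = of_real (gauss ((1 / t) *\<^sub>R (y - \<eta>)) / t ^ CARD('n))"

lemma bump_measurable [measurable]: "bump t \<eta> \<in> borel_measurable borel"
  unfolding bump_def[abs_def] by measurable

lemma bump_eq_gexp:
  assumes "t \<noteq> 0"
  shows "\<exists>k. bump t \<eta> = (\<lambda>y. k * gexp (1 / t\<^sup>2) ((1 / t\<^sup>2) *\<^sub>R \<eta>) 0 y)"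
proof (intro exI[of _ "of_real (exp (- (\<eta> \<bullet> \<eta>) / (2 * t\<^sup>2)) / (sqrt (2 * pi) ^ CARD('a) * t ^ CARD('a)))"] ext)
  fix y :: "real^'a"
  have "- (norm ((1 / t) *\<^sub>R (y - \<eta>)))\<^sup>2 / 2 = - (\<eta> \<bullet> \<eta>) / (2 * t\<^sup>2) + (- ((1 / t\<^sup>2) / 2) * (y \<bullet> y) + ((1 / t\<^sup>2) *\<^sub>R \<eta>) \<bullet> y)"
    using assms unfolding power2_norm_eq_inner
    by (simp add: inner_simps inner_commute power2_eq_square field_simps)
  then have "exp (- (norm ((1 / t) *\<^sub>R (y - \<eta>)))\<^sup>2 / 2) = exp (- (\<eta> \<bullet> \<eta>) / (2 * t\<^sup>2)) * exp (- ((1 / t\<^sup>2) / 2) * (y \<bullet> y) + ((1 / t\<^sup>2) *\<^sub>R \<eta>) \<bullet> y)"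
    by (simp only: exp_add)
  then show "bump t \<eta> y = of_real (exp (- (\<eta> \<bullet> \<eta>) / (2 * t\<^sup>2)) / (sqrt (2 * pi) ^ CARD('a) * t ^ CARD('a))) * gexp (1 / t\<^sup>2) ((1 / t\<^sup>2) *\<^sub>R \<eta>) 0 y"
    unfolding bump_def gauss_def gexp_def by (simp add: exp_of_real[symmetric])
qed

lemma bump_schwartz: "t \<noteq> 0 \<Longrightarrow> bump t \<eta> \<in> schwartz"
  using bump_eq_gexp[of t \<eta>] gexp_schwartz[of "1 / t\<^sup>2"] by auto

text \<open>The substitution y = \<eta> + t \<theta>. Through it, pairings with Schwartz functions
  become values of mollifications, which is the form in which the duality in
  \<open>has_fourier\<close> is exploited.\<close>

lemma integral_bump:
  fixes g :: "real^'n \<Rightarrow> complex"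
  assumes "0 < t"
  shows "(\<integral>y. g y * bump t \<eta> y \<partial>lborel) = mollify t g \<eta>"
proof -
  have "(\<integral>y. g y * bump t \<eta> y \<partial>lborel) = (\<bar>t\<bar> ^ DIM(real^'n)) *\<^sub>R (\<integral>\<theta>. g (\<eta> + t *\<^sub>R \<theta>) * bump t \<eta> (\<eta> + t *\<^sub>R \<theta>) \<partial>lborel)"
    using assms by (intro integral_affine) auto
  also have "\<dots> = (\<integral>\<theta>. (\<bar>t\<bar> ^ DIM(real^'n)) *\<^sub>R (g (\<eta> + t *\<^sub>R \<theta>) * bump t \<eta> (\<eta> + t *\<^sub>R \<theta>)) \<partial>lborel)"
    by (simp only: integral_scaleR_right)
  also have "\<dots> = mollify t g \<eta>"
    unfolding mollify_def
  proof (rule Bochner_Integration.integral_cong[OF refl])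
    fix \<theta> :: "real^'n"
    have "bump t \<eta> (\<eta> + t *\<^sub>R \<theta>) = of_real (gauss \<theta> / t ^ CARD('n))"
      using assms by (simp add: bump_def)
    then show "(\<bar>t\<bar> ^ DIM(real^'n)) *\<^sub>R (g (\<eta> + t *\<^sub>R \<theta>) * bump t \<eta> (\<eta> + t *\<^sub>R \<theta>)) = of_real (gauss \<theta>) * g (\<eta> + t *\<^sub>R \<theta>)"
      using assms by (simp add: scaleR_conv_of_real[where 'a=complex])
  qed
  finally show ?thesis .
qed

lemma fourier_bump:
  fixes \<eta> :: "real^'n"
  assumes "0 < t"
  shows "fourier (bump t \<eta>) x = exp (- (\<i> * of_real (x \<bullet> \<eta>))) * of_real (exp (- (norm (t *\<^sub>R x))\<^sup>2 / 2))"
proof -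
  have "fourier (bump t \<eta>) x = mollify t (\<lambda>y. exp (- (\<i> * of_real (y \<bullet> x)))) \<eta>"
    using integral_bump[OF assms, of "\<lambda>y. exp (- (\<i> * of_real (y \<bullet> x)))" \<eta>]
    by (subst fourier_borel) auto
  also have "\<dots> = (\<integral>\<theta>. exp (- (\<i> * of_real (x \<bullet> \<eta>))) * (of_real (gauss \<theta>) * exp (\<i> * of_real ((- t *\<^sub>R x) \<bullet> \<theta>))) \<partial>lborel)"
    unfolding mollify_def
    by (intro Bochner_Integration.integral_cong refl)
       (simp add: inner_add_left inner_commute exp_add[symmetric] algebra_simps)
  also have "\<dots> = exp (- (\<i> * of_real (x \<bullet> \<eta>))) * of_real (exp (- (norm (- t *\<^sub>R x))\<^sup>2 / 2))"
    by (simp only: integral_mult_right_zero integral_gauss_char(2))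
  finally show ?thesis by simp
qed

section \<open>Uniqueness and inversion\<close>

text \<open>Mollifications with widths tending to 0 converge to H in L1.\<close>

lemma AE_zero_if_mollify_zero:
  fixes H :: "'a::euclidean_space \<Rightarrow> complex"
  assumes H: "integrable lborel H" and z: "\<And>t \<eta>. 0 < t \<Longrightarrow> mollify t H \<eta> = 0"
  shows "AE x in lborel. H x = 0"
proof -
  have [measurable]: "H \<in> borel_measurable borel" using H by auto
  have "(\<lambda>n. \<integral>\<^sup>+\<eta>. ennreal (norm (mollify (1 / real (Suc n)) H \<eta> - H \<eta>)) \<partial>lborel) \<longlonglongrightarrow> 0"
    by (rule mollify_tendsto_L1[OF H]) (rule LIMSEQ_Suc[OF lim_1_over_n])
  then have "(\<lambda>n::nat. \<integral>\<^sup>+\<eta>. ennreal (norm (H \<eta>)) \<partial>lborel) \<longlonglongrightarrow> 0"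
    by (simp add: z)
  then have "(\<integral>\<^sup>+\<eta>. ennreal (norm (H \<eta>)) \<partial>lborel) = 0"
    by (simp add: LIMSEQ_const_iff)
  then show ?thesis by (subst (asm) nn_integral_0_iff_AE) auto
qed

text \<open>A function known only through its pairings with Schwartz functions need not be
  integrable. It becomes so after multiplication by \<open>gauss\<close>, and the product can still
  be tested against bumps, because the product of two Gaussians is again a Gaussian.\<close>

lemma gauss_bump_eq_gexp:
  assumes "t \<noteq> 0"
  shows "\<exists>k. \<forall>y. of_real (gauss y) * bump t \<eta> y = k * gexp (1 + 1 / t\<^sup>2) ((1 / t\<^sup>2) *\<^sub>R \<eta>) 0 y"
proof -
  obtain k where k: "bump t \<eta> = (\<lambda>y. k * gexp (1 / t\<^sup>2) ((1 / t\<^sup>2) *\<^sub>R \<eta>) 0 y)"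
    using bump_eq_gexp[OF assms] by blast
  have "of_real (gauss y) * bump t \<eta> y = (k / of_real (sqrt (2 * pi) ^ CARD('a))) * gexp (1 + 1 / t\<^sup>2) ((1 / t\<^sup>2) *\<^sub>R \<eta>) 0 y" for y
  proof -
    have "gexp (1 + 1 / t\<^sup>2) ((1 / t\<^sup>2) *\<^sub>R \<eta>) 0 y = of_real (exp (- (norm y)\<^sup>2 / 2)) * gexp (1 / t\<^sup>2) ((1 / t\<^sup>2) *\<^sub>R \<eta>) 0 y"
      unfolding gexp_def power2_norm_eq_inner exp_of_real[symmetric] exp_add[symmetric]
      by (intro arg_cong[where f=exp]) (simp add: algebra_simps add_divide_distrib)
    then show ?thesis unfolding k gauss_def by simp
  qed
  then show ?thesis by blast
qed

lemma AE_zero_if_schwartz_integrals_zero: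
  fixes h :: "real^'n \<Rightarrow> complex"
  assumes [measurable]: "h \<in> borel_measurable borel"
    and i: "\<And>\<phi>. \<phi> \<in> schwartz \<Longrightarrow> integrable lborel (\<lambda>x. h x * \<phi> x)"
    and z: "\<And>\<phi>. \<phi> \<in> schwartz \<Longrightarrow> (\<integral>x. h x * \<phi> x \<partial>lborel) = 0"
  shows "AE x in lborel. h x = 0"
proof -
  let ?H = "\<lambda>x. h x * of_real (gauss x)"
  have "(\<lambda>x. complex_of_real (gauss x)) = bump 1 (0::real^'n)"
    by (simp add: bump_def fun_eq_iff)
  then have "integrable lborel ?H"
    using i[OF bump_schwartz[of 1 0]] by (simp add: fun_eq_iff)
  moreover have "mollify t ?H \<eta> = 0" if "0 < t" for t \<eta>
  proof -
    have "\<exists>k. \<forall>y. of_real (gauss y) * bump t \<eta> y = k * gexp (1 + 1 / t\<^sup>2) ((1 / t\<^sup>2) *\<^sub>R \<eta>) 0 y"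
      using that by (intro gauss_bump_eq_gexp) auto
    then obtain k where k: "\<And>y. of_real (gauss y) * bump t \<eta> y = k * gexp (1 + 1 / t\<^sup>2) ((1 / t\<^sup>2) *\<^sub>R \<eta>) 0 y"
      by blast
    have "0 < 1 + 1 / t\<^sup>2" by (simp add: add_pos_nonneg)
    from z[OF gexp_schwartz[OF this]]
    have "(\<integral>y. ?H y * bump t \<eta> y \<partial>lborel) = 0" by (simp add: k mult.assoc)
    then show ?thesis using integral_bump[OF that, of ?H \<eta>] by simp
  qed
  ultimately have "AE x in lborel. ?H x = 0" by (rule AE_zero_if_mollify_zero)
  then show ?thesis
  proof eventually_elim
    case (elim x)
    then show ?case using gauss_pos[of x] by simp
  qed
qed

lemma has_fourier_unique:
  assumes h: "has_fourier f g" "has_fourier f g'"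
  shows "AE x in lborel. g x = g' x"
proof -
  have "f \<in> borel_measurable lebesgue" "g \<in> borel_measurable lebesgue" "g' \<in> borel_measurable lebesgue"
    using h by (auto simp: has_fourier_def)
  then obtain f0 g0 g0' where b [measurable]: "f0 \<in> borel_measurable borel" "g0 \<in> borel_measurable borel" "g0' \<in> borel_measurable borel"
    and ae: "AE x in lborel. f x = f0 x" "AE x in lborel. g x = g0 x" "AE x in lborel. g' x = g0' x"
    using ex_borel_representative[of f] ex_borel_representative[of g] ex_borel_representative[of g'] by blast
  have h': "has_fourier f0 g0" "has_fourier f0 g0'"
    using has_fourier_cong_AE[OF h(1) _ _ ae(1,2)] has_fourier_cong_AE[OF h(2) _ _ ae(1,3)]
    by (auto intro: borel_imp_lebesgue b)
  have "AE x in lborel. g0 x - g0' x = 0"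
  proof (rule AE_zero_if_schwartz_integrals_zero)
    fix \<phi> :: "real^'a \<Rightarrow> complex" assume \<phi>: "\<phi> \<in> schwartz"
    have I: "integrable lborel (\<lambda>x. g0 x * \<phi> x)" "integrable lborel (\<lambda>x. g0' x * \<phi> x)"
      and E: "(\<integral>x. g0 x * \<phi> x \<partial>lborel) = (\<integral>x. g0' x * \<phi> x \<partial>lborel)"
      using h' \<phi> by (auto simp: has_fourier_borel_iff)
    show "integrable lborel (\<lambda>x. (g0 x - g0' x) * \<phi> x)"
      unfolding left_diff_distrib by (rule Bochner_Integration.integrable_diff[OF I])
    show "(\<integral>x. (g0 x - g0' x) * \<phi> x \<partial>lborel) = 0"
      unfolding left_diff_distrib Bochner_Integration.integral_diff[OF I] E by simp
  qed measurable
  with ae(2,3) show ?thesis by eventually_elim simp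
qed

lemma l2_norm_cong_AE:
  assumes "AE x in lborel. norm (f x) = norm (g x)"
  shows "l2_norm f = l2_norm g"
proof -
  have "(\<integral>\<^sup>+x. ennreal ((norm (f x))\<^sup>2) \<partial>lebesgue) = (\<integral>\<^sup>+x. ennreal ((norm (g x))\<^sup>2) \<partial>lebesgue)"
    by (rule nn_integral_cong_AE) (use assms in \<open>auto simp: AE_lebesgue_iff elim: eventually_mono\<close>)
  then show ?thesis by (simp add: l2_norm_def)
qed

text \<open>By uniqueness all candidates have the same weighted L2 norm, so the infimum runs over a
  singleton.\<close>

lemma sobolev_norm_eq:
  fixes f :: "real^'n \<Rightarrow> complex"
  assumes "has_fourier f g"
  shows "sobolev_norm s f = ennreal ((2 * pi) powr (- real CARD('n) / 2)) *
        l2_norm (\<lambda>\<xi>. of_real (japanese \<xi> powr s) * g \<xi>)"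
proof -
  have *: "l2_norm (\<lambda>\<xi>. of_real (japanese \<xi> powr s) * g' \<xi>) = l2_norm (\<lambda>\<xi>. of_real (japanese \<xi> powr s) * g \<xi>)"
    if "has_fourier f g'" for g'
    by (rule l2_norm_cong_AE) (use has_fourier_unique[OF assms that] in \<open>auto elim: eventually_mono\<close>)
  then have "(\<lambda>g'. ennreal ((2 * pi) powr (- real CARD('n) / 2)) * l2_norm (\<lambda>\<xi>. of_real (japanese \<xi> powr s) * g' \<xi>)) ` {g. has_fourier f g}
     = (\<lambda>g'. ennreal ((2 * pi) powr (- real CARD('n) / 2)) * l2_norm (\<lambda>\<xi>. of_real (japanese \<xi> powr s) * g \<xi>)) ` {g. has_fourier f g}"
    by (intro image_cong refl arg_cong2[where f="(*)"]) simp
  moreover have "{g. has_fourier f g} \<noteq> {}" using assms by blast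
  ultimately show ?thesis unfolding sobolev_norm_def by simp
qed

text \<open>The inverse Fourier integral without its normalising factor; the power of
  \<open>2 * pi\<close> appears in the inversion and Plancherel formulas instead.\<close>

definition ift :: "(real^'n \<Rightarrow> complex) \<Rightarrow> real^'n \<Rightarrow> complex" where
  "ift g x = (\<integral>\<eta>. exp (\<i> * of_real (x \<bullet> \<eta>)) * g \<eta> \<partial>lborel)"

lemma ift_measurable [measurable]:
  assumes [measurable]: "g \<in> borel_measurable borel"
  shows "ift g \<in> borel_measurable borel"
  unfolding ift_def[abs_def] by measurable

lemma ift_norm_le: "ennreal (norm (ift g x)) \<le> (\<integral>\<^sup>+\<eta>. ennreal (norm (g \<eta>)) \<partial>lborel)"
  unfolding ift_def by (rule order.trans[OF ennreal_norm_integral_le]) (simp add: norm_mult)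

lemma integral_gaussian_char:
  fixes b \<kappa> :: "real^'n"
  assumes "0 < a"
  shows "(\<integral>x. of_real (exp (- (norm (a *\<^sub>R (x - b)))\<^sup>2 / 2)) * exp (\<i> * of_real (\<kappa> \<bullet> x)) \<partial>lborel)
    = of_real ((sqrt (2 * pi) / a) ^ CARD('n)) * exp (\<i> * of_real (\<kappa> \<bullet> b)) * of_real (exp (- (norm ((1 / a) *\<^sub>R \<kappa>))\<^sup>2 / 2))"
proof -
  have "(\<integral>x. of_real (exp (- (norm (a *\<^sub>R (x - b)))\<^sup>2 / 2)) * exp (\<i> * of_real (\<kappa> \<bullet> x)) \<partial>lborel)
    = (\<bar>1 / a\<bar> ^ DIM(real^'n)) *\<^sub>R (\<integral>\<theta>. of_real (exp (- (norm (a *\<^sub>R ((b + (1 / a) *\<^sub>R \<theta>) - b)))\<^sup>2 / 2)) * exp (\<i> * of_real (\<kappa> \<bullet> (b + (1 / a) *\<^sub>R \<theta>))) \<partial>lborel)"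
    using assms by (intro integral_affine) auto
  also have "(\<integral>\<theta>. complex_of_real (exp (- (norm (a *\<^sub>R ((b + (1 / a) *\<^sub>R \<theta>) - b)))\<^sup>2 / 2)) * exp (\<i> * of_real (\<kappa> \<bullet> (b + (1 / a) *\<^sub>R \<theta>))) \<partial>lborel)
    = (\<integral>\<theta>. (of_real (sqrt (2 * pi) ^ CARD('n)) * exp (\<i> * of_real (\<kappa> \<bullet> b))) * (of_real (gauss \<theta>) * exp (\<i> * of_real (((1 / a) *\<^sub>R \<kappa>) \<bullet> \<theta>))) \<partial>lborel)"
  proof (rule Bochner_Integration.integral_cong[OF refl])
    fix \<theta> :: "real^'n"
    have "exp (\<i> * of_real (\<kappa> \<bullet> (b + (1 / a) *\<^sub>R \<theta>))) = exp (\<i> * of_real (\<kappa> \<bullet> b)) * exp (\<i> * of_real (((1 / a) *\<^sub>R \<kappa>) \<bullet> \<theta>))"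
      unfolding exp_add[symmetric] by (simp add: inner_add_right algebra_simps)
    moreover have "exp (- (norm (a *\<^sub>R ((b + (1 / a) *\<^sub>R \<theta>) - b)))\<^sup>2 / 2) = sqrt (2 * pi) ^ CARD('n) * gauss \<theta>"
      using assms by (simp add: gauss_def)
    ultimately show "complex_of_real (exp (- (norm (a *\<^sub>R ((b + (1 / a) *\<^sub>R \<theta>) - b)))\<^sup>2 / 2)) * exp (\<i> * of_real (\<kappa> \<bullet> (b + (1 / a) *\<^sub>R \<theta>)))
      = (of_real (sqrt (2 * pi) ^ CARD('n)) * exp (\<i> * of_real (\<kappa> \<bullet> b))) * (of_real (gauss \<theta>) * exp (\<i> * of_real (((1 / a) *\<^sub>R \<kappa>) \<bullet> \<theta>)))"
      by (simp only: of_real_mult mult_ac)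
  qed
  also have "\<dots> = (of_real (sqrt (2 * pi) ^ CARD('n)) * exp (\<i> * of_real (\<kappa> \<bullet> b))) * of_real (exp (- (norm ((1 / a) *\<^sub>R \<kappa>))\<^sup>2 / 2))"
    by (simp only: integral_mult_right_zero integral_gauss_char(2))
  finally show ?thesis
    using assms by (simp add: scaleR_conv_of_real[where 'a=complex] power_divide field_simps)
qed

lemma integrable_gaussian:
  fixes b :: "real^'n"
  assumes "0 < a"
  shows "integrable lborel (\<lambda>x. exp (- (norm (a *\<^sub>R (x - b)))\<^sup>2 / 2))"
proof -
  have "integrable lborel (\<lambda>x. complex_of_real (gauss (- (a *\<^sub>R b) + a *\<^sub>R x)))"
    using assms integrable_affine[of "\<lambda>x. complex_of_real (gauss x)" a "- (a *\<^sub>R b)"]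
    by (simp add: integrable_complex_of_real_iff integrable_gauss)
  then have "integrable lborel (\<lambda>x. gauss (a *\<^sub>R (x - b)))"
    by (simp add: integrable_complex_of_real_iff algebra_simps)
  from integrable_mult_right[OF this, of "sqrt (2 * pi) ^ CARD('n)"]
  show ?thesis by (simp add: gauss_def)
qed

text \<open>The difference between f and the normalised \<open>ift g\<close> integrates to zero
  against every Gaussian, on the side of f by duality with a modulated Gaussian, on the side of
  \<open>ift g\<close> by Fubini. A product of \<open>gauss\<close> with a bump is a multiple of
  such a Gaussian, so the difference times \<open>gauss\<close> has vanishing
  mollifications.\<close>

lemma fourier_inversion_AE:
  fixes f g :: "real^'n \<Rightarrow> complex"
  assumes h: "has_fourier f g" and [measurable]: "f \<in> borel_measurable borel" and g: "integrable lborel g"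
  shows "AE x in lborel. of_real ((2 * pi) ^ CARD('n)) * f x = ift g x"
proof -
  have [measurable]: "g \<in> borel_measurable borel" using g by auto
  define N where "N = (2 * pi) ^ CARD('n)"
  have N: "0 < N" by (simp add: N_def)
  define f' where "f' x = ift g x / of_real N" for x
  have [measurable]: "f' \<in> borel_measurable borel" unfolding f'_def[abs_def] by measurable
  let ?G = "\<integral>\<^sup>+\<eta>. ennreal (norm (g \<eta>)) \<partial>lborel"
  have G: "?G < \<infinity>" using g by (simp add: integrable_iff_bounded)
  have key: "integrable lborel (\<lambda>x. (f x - f' x) * of_real (exp (- (norm (a *\<^sub>R (x - b)))\<^sup>2 / 2))) \<and>
     (\<integral>x. (f x - f' x) * of_real (exp (- (norm (a *\<^sub>R (x - b)))\<^sup>2 / 2)) \<partial>lborel) = 0"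
    if a: "0 < a" for a and b :: "real^'n"
  proof -
    let ?e = "\<lambda>x. complex_of_real (exp (- (norm (a *\<^sub>R (x - b)))\<^sup>2 / 2))"
    \<comment> \<open>Modulation by b on the test side becomes translation to b after the transform,
      so \<open>fourier \<phi>\<close> is a multiple of the Gaussian of \<open>key\<close>.\<close>
    define \<phi> where "\<phi> = gexp (1 / a\<^sup>2) 0 b"
    define c where "c = (sqrt (2 * pi) * a) ^ CARD('n)"
    have c: "0 < c" using a by (simp add: c_def)
    have \<phi>: "\<phi> \<in> schwartz" using gexp_schwartz[of "1 / a\<^sup>2" 1 0 b] a by (simp add: \<phi>_def)
    have [measurable]: "\<phi> \<in> borel_measurable borel" by (rule schwartz_borel[OF \<phi>])
    have \<phi>_eq: "\<phi> \<eta> = of_real (exp (- (norm ((1 / a) *\<^sub>R \<eta>))\<^sup>2 / 2)) * exp (\<i> * of_real (b \<bullet> \<eta>))" for \<eta>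
      unfolding \<phi>_def gexp_def exp_add exp_of_real[symmetric] power2_norm_eq_inner using a
      by (simp add: power2_eq_square)
    have F: "fourier \<phi> x = of_real c * ?e x" for x
    proof -
      have "fourier \<phi> x = (\<integral>\<xi>. of_real (exp (- (norm ((1 / a) *\<^sub>R (\<xi> - 0)))\<^sup>2 / 2)) * exp (\<i> * of_real ((b - x) \<bullet> \<xi>)) \<partial>lborel)"
        unfolding fourier_borel[OF schwartz_borel[OF \<phi>]]
      proof (rule Bochner_Integration.integral_cong[OF refl])
        fix \<xi> :: "real^'n"
        have "exp (\<i> * of_real ((b - x) \<bullet> \<xi>)) = exp (- (\<i> * of_real (\<xi> \<bullet> x))) * exp (\<i> * of_real (b \<bullet> \<xi>))"
          unfolding exp_add[symmetric] by (simp add: inner_diff_left inner_commute algebra_simps)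
        then show "exp (- (\<i> * of_real (\<xi> \<bullet> x))) * \<phi> \<xi> = of_real (exp (- (norm ((1 / a) *\<^sub>R (\<xi> - 0)))\<^sup>2 / 2)) * exp (\<i> * of_real ((b - x) \<bullet> \<xi>))"
          unfolding \<phi>_eq by (simp only: diff_zero mult_ac)
      qed
      also have "\<dots> = of_real ((sqrt (2 * pi) / (1 / a)) ^ CARD('n)) * exp (\<i> * of_real ((b - x) \<bullet> 0)) * of_real (exp (- (norm ((1 / (1 / a)) *\<^sub>R (b - x)))\<^sup>2 / 2))"
        by (rule integral_gaussian_char) (use a in simp)
      also have "\<dots> = of_real c * ?e x"
        by (simp add: c_def norm_minus_commute)
      finally show ?thesis .
    qed
    have fin: "(\<integral>\<^sup>+x. \<integral>\<^sup>+\<eta>. ennreal (norm (exp (\<i> * of_real (x \<bullet> \<eta>)) * g \<eta> * ?e x)) \<partial>lborel \<partial>lborel) < \<infinity>"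
    proof -
      have "(\<integral>\<^sup>+x. \<integral>\<^sup>+\<eta>. ennreal (norm (exp (\<i> * of_real (x \<bullet> \<eta>)) * g \<eta> * ?e x)) \<partial>lborel \<partial>lborel)
         = (\<integral>\<^sup>+x. ?G * ennreal (exp (- (norm (a *\<^sub>R (x - b)))\<^sup>2 / 2)) \<partial>lborel)"
        by (intro nn_integral_cong, subst nn_integral_multc[symmetric])
           (auto intro!: nn_integral_cong simp: norm_mult ennreal_mult)
      also have "\<dots> = ?G * ennreal (\<integral>x. exp (- (norm (a *\<^sub>R (x - b)))\<^sup>2 / 2) \<partial>lborel)"
        by (subst nn_integral_cmult, measurable, subst nn_integral_eq_integral[OF integrable_gaussian[OF a]]) simp_all
      also have "\<dots> < \<infinity>" using G by (simp add: ennreal_mult_less_top)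
      finally show ?thesis .
    qed
    have meas: "(\<lambda>(x, \<eta>). exp (\<i> * of_real (x \<bullet> \<eta>)) * g \<eta> * ?e x) \<in> borel_measurable (lborel \<Otimes>\<^sub>M lborel)"
      by measurable
    have I': "integrable lborel (\<lambda>x. ift g x * ?e x)"
      using Fubini_complex_int1[OF sigma_finite_lborel sigma_finite_lborel meas fin]
      by (simp add: ift_def)
    have "(\<integral>x. ift g x * ?e x \<partial>lborel) = (\<integral>x. (\<integral>\<eta>. exp (\<i> * of_real (x \<bullet> \<eta>)) * g \<eta> * ?e x \<partial>lborel) \<partial>lborel)"
      by (simp add: ift_def)
    also have "\<dots> = (\<integral>\<eta>. (\<integral>x. exp (\<i> * of_real (x \<bullet> \<eta>)) * g \<eta> * ?e x \<partial>lborel) \<partial>lborel)"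
      by (rule Fubini_complex_eq[OF sigma_finite_lborel sigma_finite_lborel meas fin])
    also have "\<dots> = (\<integral>\<eta>. of_real (N / c) * (g \<eta> * \<phi> \<eta>) \<partial>lborel)"
    proof (rule Bochner_Integration.integral_cong[OF refl])
      fix \<eta> :: "real^'n"
      have "(\<integral>x. exp (\<i> * of_real (x \<bullet> \<eta>)) * g \<eta> * ?e x \<partial>lborel) = g \<eta> * (\<integral>x. ?e x * exp (\<i> * of_real (\<eta> \<bullet> x)) \<partial>lborel)"
        unfolding integral_mult_right_zero[symmetric]
        by (intro Bochner_Integration.integral_cong refl) (simp add: inner_commute mult_ac)
      also have "\<dots> = g \<eta> * (of_real ((sqrt (2 * pi) / a) ^ CARD('n)) * exp (\<i> * of_real (\<eta> \<bullet> b)) * of_real (exp (- (norm ((1 / a) *\<^sub>R \<eta>))\<^sup>2 / 2)))"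
        unfolding integral_gaussian_char[OF a] ..
      also have "(sqrt (2 * pi) / a) ^ CARD('n) = N / c"
      proof -
        have "(sqrt (2 * pi) / a) ^ CARD('n) * c = ((sqrt (2 * pi) / a) * (sqrt (2 * pi) * a)) ^ CARD('n)"
          unfolding c_def power_mult_distrib ..
        also have "(sqrt (2 * pi) / a) * (sqrt (2 * pi) * a) = 2 * pi" using a by simp
        finally show ?thesis using c by (simp add: N_def field_simps)
      qed
      finally show "(\<integral>x. exp (\<i> * of_real (x \<bullet> \<eta>)) * g \<eta> * ?e x \<partial>lborel) = of_real (N / c) * (g \<eta> * \<phi> \<eta>)"
        unfolding \<phi>_eq by (simp only: inner_commute mult_ac)
    qed
    finally have E': "(\<integral>x. ift g x * ?e x \<partial>lborel) = of_real (N / c) * (\<integral>\<eta>. g \<eta> * \<phi> \<eta> \<partial>lborel)"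
      by simp
    have If: "integrable lborel (\<lambda>x. f x * fourier \<phi> x)"
      and Ef: "(\<integral>x. f x * fourier \<phi> x \<partial>lborel) = (\<integral>\<eta>. g \<eta> * \<phi> \<eta> \<partial>lborel)"
      using h \<phi> by (auto simp: has_fourier_borel_iff)
    have If1: "integrable lborel (\<lambda>x. f x * ?e x)"
      using integrable_mult_right[OF If, of "1 / of_real c"] c by (simp add: F)
    have "of_real c * (\<integral>x. f x * ?e x \<partial>lborel) = (\<integral>\<eta>. g \<eta> * \<phi> \<eta> \<partial>lborel)"
      unfolding Ef[symmetric] F integral_mult_right_zero[symmetric]
      by (intro Bochner_Integration.integral_cong refl) (simp add: mult_ac)
    then have Ef1: "(\<integral>x. f x * ?e x \<partial>lborel) = (\<integral>\<eta>. g \<eta> * \<phi> \<eta> \<partial>lborel) / of_real c"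
      using c by (simp add: field_simps)
    have I'1: "integrable lborel (\<lambda>x. f' x * ?e x)"
      using integrable_mult_right[OF I', of "1 / of_real N"] by (simp add: f'_def)
    have "(\<integral>x. f' x * ?e x \<partial>lborel) = (\<integral>x. ift g x * ?e x \<partial>lborel) / of_real N"
      unfolding f'_def by (simp flip: integral_divide_zero)
    also have "\<dots> = (\<integral>\<eta>. g \<eta> * \<phi> \<eta> \<partial>lborel) / of_real c"
      unfolding E' using N by simp
    finally have "(\<integral>x. f x * ?e x \<partial>lborel) - (\<integral>x. f' x * ?e x \<partial>lborel) = 0"
      unfolding Ef1 by simp
    then show ?thesis
      unfolding left_diff_distrib Bochner_Integration.integral_diff[OF If1 I'1]
      by (intro conjI Bochner_Integration.integrable_diff[OF If1 I'1])
  qed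
  let ?H = "\<lambda>x. (f x - f' x) * of_real (gauss x)"
  have "integrable lborel ?H"
  proof -
    have "integrable lborel (\<lambda>x. ((f x - f' x) * of_real (exp (- (norm (1 *\<^sub>R (x - 0)))\<^sup>2 / 2))) * of_real (1 / sqrt (2 * pi) ^ CARD('n)))"
      using key[of 1 0] by (intro integrable_mult_left) auto
    then show ?thesis by (simp add: gauss_def)
  qed
  moreover have "mollify t ?H \<eta> = 0" if "0 < t" for t \<eta>
  proof -
    have "\<exists>k. \<forall>y. of_real (gauss y) * bump t \<eta> y = k * gexp (1 + 1 / t\<^sup>2) ((1 / t\<^sup>2) *\<^sub>R \<eta>) 0 y"
      using that by (intro gauss_bump_eq_gexp) auto
    then obtain k where k: "\<And>y. of_real (gauss y) * bump t \<eta> y = k * gexp (1 + 1 / t\<^sup>2) ((1 / t\<^sup>2) *\<^sub>R \<eta>) 0 y"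
      by blast
    \<comment> \<open>Completing the square: \<open>gexp A q 0\<close> is a multiple of the Gaussian
      with scale \<open>sqrt A\<close> and centre q / A, the form covered by
      \<open>key\<close>.\<close>
    define A where "A = 1 + 1 / t\<^sup>2"
    define q where "q = (1 / t\<^sup>2) *\<^sub>R \<eta>"
    have A: "0 < A" by (simp add: A_def add_pos_nonneg)
    have gx: "gexp A q 0 y = of_real (exp (q \<bullet> q / (2 * A))) * of_real (exp (- (norm (sqrt A *\<^sub>R (y - (1 / A) *\<^sub>R q)))\<^sup>2 / 2))" for y
    proof -
      have "- (norm (sqrt A *\<^sub>R (y - (1 / A) *\<^sub>R q)))\<^sup>2 / 2 = - (A * (norm (y - (1 / A) *\<^sub>R q))\<^sup>2) / 2"
        using A by (simp add: power_mult_distrib)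
      also have "\<dots> = - (A / 2) * (y \<bullet> y) + q \<bullet> y - q \<bullet> q / (2 * A)"
        unfolding power2_norm_eq_inner using A
        by (simp add: inner_diff_left inner_diff_right inner_commute[of y q] field_simps)
      finally have "q \<bullet> q / (2 * A) + - (norm (sqrt A *\<^sub>R (y - (1 / A) *\<^sub>R q)))\<^sup>2 / 2 = - (A / 2) * (y \<bullet> y) + q \<bullet> y"
        by simp
      moreover have "gexp A q 0 y = of_real (exp (- (A / 2) * (y \<bullet> y) + q \<bullet> y))"
        unfolding gexp_def exp_of_real[symmetric] by simp
      ultimately show ?thesis
        unfolding of_real_mult[symmetric] exp_add[symmetric] by simp
    qed
    have "(\<integral>y. ?H y * bump t \<eta> y \<partial>lborel) = (\<integral>y. (k * of_real (exp (q \<bullet> q / (2 * A)))) * ((f y - f' y) * of_real (exp (- (norm (sqrt A *\<^sub>R (y - (1 / A) *\<^sub>R q)))\<^sup>2 / 2))) \<partial>lborel)"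
    proof (rule Bochner_Integration.integral_cong[OF refl])
      fix y :: "real^'n"
      have "?H y * bump t \<eta> y = (f y - f' y) * (k * gexp A q 0 y)"
        unfolding A_def q_def k[symmetric] by simp
      then show "?H y * bump t \<eta> y = (k * of_real (exp (q \<bullet> q / (2 * A)))) * ((f y - f' y) * of_real (exp (- (norm (sqrt A *\<^sub>R (y - (1 / A) *\<^sub>R q)))\<^sup>2 / 2)))"
        unfolding gx by (simp only: mult_ac)
    qed
    also have "\<dots> = 0"
      unfolding integral_mult_right_zero using key[of "sqrt A" "(1 / A) *\<^sub>R q"] A by simp
    finally show ?thesis using integral_bump[OF that, of ?H \<eta>] by simp
  qed
  ultimately have "AE x in lborel. ?H x = 0" by (rule AE_zero_if_mollify_zero)
  then show ?thesis
  proof eventually_elim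
    case (elim x)
    then have "f x = f' x" using gauss_pos[of x] by simp
    then show ?case unfolding N_def[symmetric] using N by (simp add: f'_def)
  qed
qed

section \<open>Plancherel estimates\<close>

lemma borel_measurable_cnj [measurable (raw)]:
  "f \<in> borel_measurable M \<Longrightarrow> (\<lambda>x. cnj (f x)) \<in> borel_measurable M"
  by (rule measurable_compose[OF _ borel_measurable_continuous_onI]) (auto intro: continuous_intros)

lemma integrable_norm_le_K:
  assumes "integrable lborel \<psi>"
  shows "norm (ift \<psi> x) \<le> (\<integral>\<eta>. norm (\<psi> \<eta>) \<partial>lborel)"
  unfolding ift_def
  by (rule order.trans[OF integral_norm_bound]) (simp add: norm_mult)

text \<open>A Gaussian damping makes Fubini applicable; the damped integral equals, up to the
  constant, the pairing of \<psi> with its mollified conjugate. As the width tends to 0, the damped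
  integrals increase to the left-hand side, while the boundedness of \<psi> turns L1 convergence of
  the mollifications into convergence of the pairing.\<close>

lemma plancherel_L1_bounded:
  fixes \<psi> :: "real^'n \<Rightarrow> complex"
  assumes \<psi>: "integrable lborel \<psi>" and bd: "\<And>x. norm (\<psi> x) \<le> K"
  shows "(\<integral>\<^sup>+x. ennreal ((norm (ift \<psi> x))\<^sup>2) \<partial>lborel)
    = ennreal ((2 * pi) ^ CARD('n)) * (\<integral>\<^sup>+x. ennreal ((norm (\<psi> x))\<^sup>2) \<partial>lborel)"
proof -
  have [measurable]: "\<psi> \<in> borel_measurable borel" using \<psi> by auto
  define N where "N = (2 * pi) ^ CARD('n)"
  have N: "0 < N" by (simp add: N_def)
  define F where "F = ift \<psi>"
  have [measurable]: "F \<in> borel_measurable borel" unfolding F_def by measurable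
  define L where "L = (\<integral>\<eta>. norm (\<psi> \<eta>) \<partial>lborel)"
  have L: "norm (F x) \<le> L" for x unfolding F_def L_def by (rule integrable_norm_le_K[OF \<psi>])
  have L0: "0 \<le> L" unfolding L_def by simp
  have K0: "0 \<le> K" using bd[of 0] norm_ge_zero order.trans by blast
  have P: "(\<integral>\<^sup>+\<eta>. ennreal (norm (\<psi> \<eta>)) \<partial>lborel) = ennreal L"
    unfolding L_def using \<psi> by (intro nn_integral_eq_integral) auto
  define c\<psi> where "c\<psi> = (\<lambda>x. cnj (\<psi> x))"
  have c\<psi>: "integrable lborel c\<psi>" unfolding c\<psi>_def using \<psi> by simp
  have [measurable]: "c\<psi> \<in> borel_measurable borel" using c\<psi> by auto
  define e where "e t x = exp (- (norm (t *\<^sub>R (x - 0 :: real^'n)))\<^sup>2 / 2)" for t x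
  have [measurable]: "e t \<in> borel_measurable borel" for t unfolding e_def[abs_def] by measurable
  have e0: "0 \<le> e t x" for t x by (simp add: e_def)
  have ie: "integrable lborel (e t)" if "0 < t" for t
    unfolding e_def[abs_def] by (rule integrable_gaussian[OF that])
  have fe: "(\<integral>\<^sup>+x. ennreal (e t x) \<partial>lborel) < \<infinity>" if "0 < t" for t
    using ie[OF that] e0 by (simp add: nn_integral_eq_integral)
  have cF: "cnj (F x) = (\<integral>\<xi>. exp (- (\<i> * of_real (x \<bullet> \<xi>))) * c\<psi> \<xi> \<partial>lborel)" for x
    unfolding F_def ift_def c\<psi>_def by (simp add: Bochner_Integration.integral_cnj[symmetric] exp_cnj)
  \<comment> \<open>Expanding both transforms and integrating over x first leaves the transform of a
    Gaussian at \<xi> - \<xi>', which is N times a bump centred at \<xi>.\<close>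
  have It: "(\<integral>x. F x * cnj (F x) * of_real (e t x) \<partial>lborel) = of_real N * (\<integral>\<xi>. \<psi> \<xi> * mollify t c\<psi> \<xi> \<partial>lborel)"
    if t: "0 < t" for t
  proof -
    have m1: "(\<lambda>(x, \<xi>). exp (\<i> * of_real (x \<bullet> \<xi>)) * \<psi> \<xi> * (cnj (F x) * of_real (e t x))) \<in> borel_measurable (lborel \<Otimes>\<^sub>M lborel)"
      unfolding e_def by measurable
    have "(\<integral>\<^sup>+x. \<integral>\<^sup>+\<xi>. ennreal (norm (exp (\<i> * of_real (x \<bullet> \<xi>)) * \<psi> \<xi> * (cnj (F x) * of_real (e t x)))) \<partial>lborel \<partial>lborel)
      \<le> (\<integral>\<^sup>+x. \<integral>\<^sup>+\<xi>. ennreal (norm (\<psi> \<xi>)) * (ennreal L * ennreal (e t x)) \<partial>lborel \<partial>lborel)"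
    proof (intro nn_integral_mono)
      fix x \<xi> :: "real^'n"
      have "norm (exp (\<i> * of_real (x \<bullet> \<xi>)) * \<psi> \<xi> * (cnj (F x) * of_real (e t x))) \<le> norm (\<psi> \<xi>) * (L * e t x)"
        using L[of x] e0[of t x] by (simp add: norm_mult mult_left_mono mult_right_mono)
      then show "ennreal (norm (exp (\<i> * of_real (x \<bullet> \<xi>)) * \<psi> \<xi> * (cnj (F x) * of_real (e t x)))) \<le> ennreal (norm (\<psi> \<xi>)) * (ennreal L * ennreal (e t x))"
        using L0 e0[of t x] by (simp add: ennreal_mult[symmetric] ennreal_leI)
    qed
    also have "\<dots> = ennreal L * (ennreal L * (\<integral>\<^sup>+x. ennreal (e t x) \<partial>lborel))"
      by (simp add: nn_integral_multc nn_integral_cmult P)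
    also have "\<dots> < \<infinity>" using fe[OF t] by (simp add: ennreal_mult_less_top)
    finally have f1: "(\<integral>\<^sup>+x. \<integral>\<^sup>+\<xi>. ennreal (norm (exp (\<i> * of_real (x \<bullet> \<xi>)) * \<psi> \<xi> * (cnj (F x) * of_real (e t x)))) \<partial>lborel \<partial>lborel) < \<infinity>" .
    have "(\<integral>x. F x * cnj (F x) * of_real (e t x) \<partial>lborel)
      = (\<integral>x. (\<integral>\<xi>. exp (\<i> * of_real (x \<bullet> \<xi>)) * \<psi> \<xi> * (cnj (F x) * of_real (e t x)) \<partial>lborel) \<partial>lborel)"
      by (rule Bochner_Integration.integral_cong[OF refl], unfold integral_mult_left_zero)
         (simp only: F_def ift_def mult.assoc)
    also have "\<dots> = (\<integral>\<xi>. (\<integral>x. exp (\<i> * of_real (x \<bullet> \<xi>)) * \<psi> \<xi> * (cnj (F x) * of_real (e t x)) \<partial>lborel) \<partial>lborel)"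
      by (rule Fubini_complex_eq[OF sigma_finite_lborel sigma_finite_lborel m1 f1])
    also have "\<dots> = (\<integral>\<xi>. of_real N * (\<psi> \<xi> * mollify t c\<psi> \<xi>) \<partial>lborel)"
    proof (rule Bochner_Integration.integral_cong[OF refl])
      fix \<xi> :: "real^'n"
      have m2: "(\<lambda>(x, \<xi>'). exp (\<i> * of_real (x \<bullet> (\<xi> - \<xi>'))) * c\<psi> \<xi>' * of_real (e t x)) \<in> borel_measurable (lborel \<Otimes>\<^sub>M lborel)"
        unfolding e_def by measurable
      have "(\<integral>\<^sup>+x. \<integral>\<^sup>+\<xi>'. ennreal (norm (exp (\<i> * of_real (x \<bullet> (\<xi> - \<xi>'))) * c\<psi> \<xi>' * of_real (e t x))) \<partial>lborel \<partial>lborel)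
        = (\<integral>\<^sup>+x. \<integral>\<^sup>+\<xi>'. ennreal (norm (\<psi> \<xi>')) * ennreal (e t x) \<partial>lborel \<partial>lborel)"
        by (intro nn_integral_cong) (simp add: norm_mult c\<psi>_def ennreal_mult e0)
      also have "\<dots> = ennreal L * (\<integral>\<^sup>+x. ennreal (e t x) \<partial>lborel)"
        by (simp add: nn_integral_multc nn_integral_cmult P)
      also have "\<dots> < \<infinity>" using fe[OF t] by (simp add: ennreal_mult_less_top)
      finally have f2: "(\<integral>\<^sup>+x. \<integral>\<^sup>+\<xi>'. ennreal (norm (exp (\<i> * of_real (x \<bullet> (\<xi> - \<xi>'))) * c\<psi> \<xi>' * of_real (e t x))) \<partial>lborel \<partial>lborel) < \<infinity>" .
      have "(\<integral>x. exp (\<i> * of_real (x \<bullet> \<xi>)) * \<psi> \<xi> * (cnj (F x) * of_real (e t x)) \<partial>lborel)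
        = (\<integral>x. \<psi> \<xi> * (\<integral>\<xi>'. exp (\<i> * of_real (x \<bullet> (\<xi> - \<xi>'))) * c\<psi> \<xi>' * of_real (e t x) \<partial>lborel) \<partial>lborel)"
      proof (rule Bochner_Integration.integral_cong[OF refl])
        fix x :: "real^'n"
        have "exp (\<i> * of_real (x \<bullet> (\<xi> - \<xi>'))) = exp (\<i> * of_real (x \<bullet> \<xi>)) * exp (- (\<i> * of_real (x \<bullet> \<xi>')))" for \<xi>'
          unfolding exp_add[symmetric] by (simp add: inner_diff_right algebra_simps)
        then have "(\<integral>\<xi>'. exp (\<i> * of_real (x \<bullet> (\<xi> - \<xi>'))) * c\<psi> \<xi>' * of_real (e t x) \<partial>lborel)
           = (\<integral>\<xi>'. exp (\<i> * of_real (x \<bullet> \<xi>)) * ((exp (- (\<i> * of_real (x \<bullet> \<xi>'))) * c\<psi> \<xi>') * of_real (e t x)) \<partial>lborel)"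
          by (simp only: mult.assoc)
        also have "\<dots> = exp (\<i> * of_real (x \<bullet> \<xi>)) * (cnj (F x) * of_real (e t x))"
          unfolding integral_mult_right_zero integral_mult_left_zero cF ..
        finally show "exp (\<i> * of_real (x \<bullet> \<xi>)) * \<psi> \<xi> * (cnj (F x) * of_real (e t x))
           = \<psi> \<xi> * (\<integral>\<xi>'. exp (\<i> * of_real (x \<bullet> (\<xi> - \<xi>'))) * c\<psi> \<xi>' * of_real (e t x) \<partial>lborel)"
          by (simp only: mult_ac)
      qed
      also have "\<dots> = \<psi> \<xi> * (\<integral>\<xi>'. (\<integral>x. exp (\<i> * of_real (x \<bullet> (\<xi> - \<xi>'))) * c\<psi> \<xi>' * of_real (e t x) \<partial>lborel) \<partial>lborel)"
        unfolding integral_mult_right_zero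
          Fubini_complex_eq[OF sigma_finite_lborel sigma_finite_lborel m2 f2] ..
      also have "(\<integral>\<xi>'. (\<integral>x. exp (\<i> * of_real (x \<bullet> (\<xi> - \<xi>'))) * c\<psi> \<xi>' * of_real (e t x) \<partial>lborel) \<partial>lborel)
         = (\<integral>\<xi>'. of_real N * (c\<psi> \<xi>' * bump t \<xi> \<xi>') \<partial>lborel)"
      proof (rule Bochner_Integration.integral_cong[OF refl])
        fix \<xi>' :: "real^'n"
        have "(\<integral>x. exp (\<i> * of_real (x \<bullet> (\<xi> - \<xi>'))) * c\<psi> \<xi>' * of_real (e t x) \<partial>lborel)
          = (\<integral>x. c\<psi> \<xi>' * (of_real (e t x) * exp (\<i> * of_real ((\<xi> - \<xi>') \<bullet> x))) \<partial>lborel)"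
          by (intro Bochner_Integration.integral_cong refl) (simp only: inner_commute mult_ac)
        also have "\<dots> = c\<psi> \<xi>' * (of_real ((sqrt (2 * pi) / t) ^ CARD('n)) * exp (\<i> * of_real ((\<xi> - \<xi>') \<bullet> 0)) * of_real (exp (- (norm ((1 / t) *\<^sub>R (\<xi> - \<xi>')))\<^sup>2 / 2)))"
          unfolding integral_mult_right_zero e_def integral_gaussian_char[OF t] ..
        also have "of_real ((sqrt (2 * pi) / t) ^ CARD('n)) * exp (\<i> * of_real ((\<xi> - \<xi>') \<bullet> 0)) * of_real (exp (- (norm ((1 / t) *\<^sub>R (\<xi> - \<xi>')))\<^sup>2 / 2))
            = of_real N * bump t \<xi> \<xi>'"
        proof -
          have "(sqrt (2 * pi)) ^ CARD('n) * sqrt (2 * pi) ^ CARD('n) = N"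
            unfolding N_def power_mult_distrib[symmetric] by simp
          then have "(sqrt (2 * pi) / t) ^ CARD('n) = N / (sqrt (2 * pi) ^ CARD('n) * t ^ CARD('n))"
            using t by (simp add: power_divide field_simps)
          moreover have "norm ((1 / t) *\<^sub>R (\<xi> - \<xi>')) = norm ((1 / t) *\<^sub>R (\<xi>' - \<xi>))"
            by (simp add: norm_minus_commute)
          ultimately show ?thesis
            unfolding bump_def gauss_def by (simp add: mult_ac)
        qed
        finally show "(\<integral>x. exp (\<i> * of_real (x \<bullet> (\<xi> - \<xi>'))) * c\<psi> \<xi>' * of_real (e t x) \<partial>lborel) = of_real N * (c\<psi> \<xi>' * bump t \<xi> \<xi>')"
          by (simp only: mult_ac)
      qed
      also have "\<dots> = of_real N * mollify t c\<psi> \<xi>"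
        unfolding integral_mult_right_zero integral_bump[OF t] ..
      finally show "(\<integral>x. exp (\<i> * of_real (x \<bullet> \<xi>)) * \<psi> \<xi> * (cnj (F x) * of_real (e t x)) \<partial>lborel) = of_real N * (\<psi> \<xi> * mollify t c\<psi> \<xi>)"
        by (simp only: mult_ac)
    qed
    finally show ?thesis by (simp only: integral_mult_right_zero)
  qed
  define t where "t n = 1 / real (Suc n)" for n
  have t: "0 < t n" for n by (simp add: t_def)
  have t0: "t \<longlonglongrightarrow> 0" unfolding t_def by (rule LIMSEQ_Suc[OF lim_1_over_n])
  have moll: "(\<lambda>n. \<integral>\<^sup>+\<eta>. ennreal (norm (mollify (t n) c\<psi> \<eta> - c\<psi> \<eta>)) \<partial>lborel) \<longlonglongrightarrow> 0"
    by (rule mollify_tendsto_L1[OF c\<psi> t0])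
  define J where "J = (\<integral>\<xi>. (norm (\<psi> \<xi>))\<^sup>2 \<partial>lborel)"
  have i2: "integrable lborel (\<lambda>\<xi>. (norm (\<psi> \<xi>))\<^sup>2)"
  proof (rule Bochner_Integration.integrable_bound)
    show "integrable lborel (\<lambda>\<xi>. K * norm (\<psi> \<xi>))" using \<psi> by auto
    show "AE x in lborel. norm ((norm (\<psi> x))\<^sup>2) \<le> norm (K * norm (\<psi> x))"
      using bd K0 by (intro AE_I2) (simp add: power2_eq_square mult_right_mono)
  qed measurable
  have J: "(\<integral>\<^sup>+\<xi>. ennreal ((norm (\<psi> \<xi>))\<^sup>2) \<partial>lborel) = ennreal J"
    unfolding J_def by (rule nn_integral_eq_integral[OF i2]) simp
  have iF: "integrable lborel (\<lambda>x. (norm (F x))\<^sup>2 * e (t n) x)" for n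
  proof (rule Bochner_Integration.integrable_bound)
    show "integrable lborel (\<lambda>x. L\<^sup>2 * e (t n) x)" using ie[OF t] by auto
    show "AE x in lborel. norm ((norm (F x))\<^sup>2 * e (t n) x) \<le> norm (L\<^sup>2 * e (t n) x)"
      using L e0 by (intro AE_I2) (simp add: mult_right_mono power_mono)
  qed measurable
  define I where "I n = (\<integral>x. (norm (F x))\<^sup>2 * e (t n) x \<partial>lborel)" for n
  have dist: "ennreal \<bar>I n - N * J\<bar> \<le> ennreal (N * K) * (\<integral>\<^sup>+\<eta>. ennreal (norm (mollify (t n) c\<psi> \<eta> - c\<psi> \<eta>)) \<partial>lborel)" for n
  proof (cases "(\<integral>\<^sup>+\<eta>. ennreal (norm (mollify (t n) c\<psi> \<eta> - c\<psi> \<eta>)) \<partial>lborel) < \<infinity>")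
    case True
    have im: "integrable lborel (\<lambda>\<xi>. \<psi> \<xi> * (mollify (t n) c\<psi> \<xi> - c\<psi> \<xi>))"
    proof (rule Bochner_Integration.integrable_bound)
      have "integrable lborel (\<lambda>\<xi>. mollify (t n) c\<psi> \<xi> - c\<psi> \<xi>)"
        using True by (intro integrableI_bounded) auto
      then show "integrable lborel (\<lambda>\<xi>. K * norm (mollify (t n) c\<psi> \<xi> - c\<psi> \<xi>))" by auto
      show "AE x in lborel. norm (\<psi> x * (mollify (t n) c\<psi> x - c\<psi> x)) \<le> norm (K * norm (mollify (t n) c\<psi> x - c\<psi> x))"
        using bd K0 by (intro AE_I2) (simp add: norm_mult mult_right_mono)
    qed measurable
    have i3: "integrable lborel (\<lambda>\<xi>. \<psi> \<xi> * c\<psi> \<xi>)"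
      using i2 unfolding c\<psi>_def complex_norm_square[symmetric] by (simp add: integrable_complex_of_real_iff flip: of_real_power)
    have "complex_of_real (I n) = (\<integral>x. F x * cnj (F x) * of_real (e (t n) x) \<partial>lborel)"
      unfolding I_def complex_norm_square[symmetric] integral_complex_of_real[symmetric] by simp
    also have "\<dots> = of_real N * (\<integral>\<xi>. \<psi> \<xi> * mollify (t n) c\<psi> \<xi> \<partial>lborel)" by (rule It[OF t])
    also have "(\<integral>\<xi>. \<psi> \<xi> * mollify (t n) c\<psi> \<xi> \<partial>lborel) = (\<integral>\<xi>. \<psi> \<xi> * (mollify (t n) c\<psi> \<xi> - c\<psi> \<xi>) + \<psi> \<xi> * c\<psi> \<xi> \<partial>lborel)"
      by (intro Bochner_Integration.integral_cong refl) (simp add: algebra_simps)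
    also have "\<dots> = (\<integral>\<xi>. \<psi> \<xi> * (mollify (t n) c\<psi> \<xi> - c\<psi> \<xi>) \<partial>lborel) + (\<integral>\<xi>. \<psi> \<xi> * c\<psi> \<xi> \<partial>lborel)"
      by (rule Bochner_Integration.integral_add[OF im i3])
    also have "(\<integral>\<xi>. \<psi> \<xi> * c\<psi> \<xi> \<partial>lborel) = of_real J"
      unfolding J_def c\<psi>_def complex_norm_square[symmetric] integral_complex_of_real[symmetric] by simp
    finally have "complex_of_real (I n - N * J) = of_real N * (\<integral>\<xi>. \<psi> \<xi> * (mollify (t n) c\<psi> \<xi> - c\<psi> \<xi>) \<partial>lborel)"
      by (simp add: algebra_simps)
    then have "norm (complex_of_real (I n - N * J)) = N * norm (\<integral>\<xi>. \<psi> \<xi> * (mollify (t n) c\<psi> \<xi> - c\<psi> \<xi>) \<partial>lborel)"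
      using N by (simp only: norm_mult norm_of_real abs_of_pos)
    then have "ennreal \<bar>I n - N * J\<bar> = ennreal N * ennreal (norm (\<integral>\<xi>. \<psi> \<xi> * (mollify (t n) c\<psi> \<xi> - c\<psi> \<xi>) \<partial>lborel))"
      using N by (simp only: norm_of_real ennreal_mult')
    also have "\<dots> \<le> ennreal N * (\<integral>\<^sup>+\<xi>. ennreal (norm (\<psi> \<xi> * (mollify (t n) c\<psi> \<xi> - c\<psi> \<xi>))) \<partial>lborel)"
      by (intro mult_left_mono ennreal_norm_integral_le) simp
    also have "\<dots> \<le> ennreal N * (\<integral>\<^sup>+\<xi>. ennreal K * ennreal (norm (mollify (t n) c\<psi> \<xi> - c\<psi> \<xi>)) \<partial>lborel)"
      using bd K0 by (intro mult_left_mono nn_integral_mono) (auto simp: norm_mult ennreal_mult[symmetric] mult_right_mono intro!: ennreal_leI)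
    also have "\<dots> = ennreal (N * K) * (\<integral>\<^sup>+\<eta>. ennreal (norm (mollify (t n) c\<psi> \<eta> - c\<psi> \<eta>)) \<partial>lborel)"
      using N K0 by (simp add: nn_integral_cmult ennreal_mult mult.assoc)
    finally show ?thesis .
  next
    case False
    then have F: "(\<integral>\<^sup>+\<eta>. ennreal (norm (mollify (t n) c\<psi> \<eta> - c\<psi> \<eta>)) \<partial>lborel) = \<infinity>" by (simp add: less_top[symmetric])
    \<comment> \<open>An infinite L1 distance makes the right-hand side infinite, except for K = 0,
      where \<psi> vanishes identically.\<close>
    show ?thesis
    proof (cases "K = 0")
      case True
      then have "\<psi> x = 0" for x using bd[of x] by simp
      then have "F x = 0" "c\<psi> x = 0" for x by (simp_all add: F_def ift_def c\<psi>_def)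
      then show ?thesis by (simp add: I_def J_def \<open>\<And>x. \<psi> x = 0\<close>)
    next
      case False
      then show ?thesis using F N K0 by (simp add: ennreal_mult_top)
    qed
  qed
  have "(\<lambda>n. ennreal \<bar>I n - N * J\<bar>) \<longlonglongrightarrow> 0"
  proof (rule ennreal_tendsto_0_le[OF _ dist])
    show "(\<lambda>n. ennreal (N * K) * (\<integral>\<^sup>+\<eta>. ennreal (norm (mollify (t n) c\<psi> \<eta> - c\<psi> \<eta>)) \<partial>lborel)) \<longlonglongrightarrow> 0"
      using ennreal_tendsto_cmult[OF _ moll, of "ennreal (N * K)"] by simp
  qed
  then have "(\<lambda>n. \<bar>I n - N * J\<bar>) \<longlonglongrightarrow> 0"
    using tendsto_ennreal_iff[of "\<lambda>n. \<bar>I n - N * J\<bar>" sequentially 0] by simp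
  then have "I \<longlonglongrightarrow> N * J"
    using tendsto_rabs_zero_iff LIM_zero_cancel by blast
  then have A: "(\<lambda>n. ennreal (I n)) \<longlonglongrightarrow> ennreal (N * J)" by (rule tendsto_ennrealI)
  have I_nn: "ennreal (I n) = (\<integral>\<^sup>+x. ennreal ((norm (F x))\<^sup>2 * e (t n) x) \<partial>lborel)" for n
    unfolding I_def using e0 by (intro nn_integral_eq_integral[symmetric] iF) auto
  \<comment> \<open>The damping factors increase pointwise to 1, so monotone convergence
    applies.\<close>
  have B: "(\<lambda>n. ennreal (I n)) \<longlonglongrightarrow> (\<integral>\<^sup>+x. ennreal ((norm (F x))\<^sup>2) \<partial>lborel)"
    unfolding I_nn
  proof (rule nn_integral_LIMSEQ)
    show "incseq (\<lambda>n x. ennreal ((norm (F x))\<^sup>2 * e (t n) x))"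
    proof (intro incseq_SucI le_funI ennreal_leI mult_left_mono)
      fix n and x :: "real^'n"
      have "t (Suc n) \<le> t n" by (simp add: t_def frac_le)
      then have "norm (t (Suc n) *\<^sub>R (x - 0)) \<le> norm (t n *\<^sub>R (x - 0))"
        using t[of n] t[of "Suc n"] by (simp add: mult_right_mono)
      then show "e (t n) x \<le> e (t (Suc n)) x" unfolding e_def by (simp add: power_mono)
    qed simp
    show "(\<lambda>n. ennreal ((norm (F x))\<^sup>2 * e (t n) x)) \<longlonglongrightarrow> ennreal ((norm (F x))\<^sup>2)" for x
    proof (rule tendsto_ennrealI)
      have "(\<lambda>n. (norm (F x))\<^sup>2 * exp (- (norm (t n *\<^sub>R (x - 0)))\<^sup>2 / 2)) \<longlonglongrightarrow> (norm (F x))\<^sup>2 * exp (- (norm (0 *\<^sub>R (x - 0)))\<^sup>2 / 2)"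
        by (intro tendsto_intros t0) simp
      then show "(\<lambda>n. (norm (F x))\<^sup>2 * e (t n) x) \<longlonglongrightarrow> (norm (F x))\<^sup>2" by (simp add: e_def)
    qed
  qed measurable
  have "0 \<le> J" unfolding J_def by simp
  then show ?thesis
    using LIMSEQ_unique[OF A B] N unfolding J N_def[symmetric] F_def[symmetric] by (simp add: ennreal_mult)
qed

definition fconv :: "(real^'n \<Rightarrow> complex) \<Rightarrow> (real^'n \<Rightarrow> complex) \<Rightarrow> real^'n \<Rightarrow> complex" where
  "fconv g w \<zeta> = (\<integral>\<xi>. g (\<zeta> - \<xi>) * w \<xi> \<partial>lborel)"

lemma fconv_measurable [measurable]:
  assumes [measurable]: "g \<in> borel_measurable borel" "w \<in> borel_measurable borel"
  shows "fconv g w \<in> borel_measurable borel"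
  unfolding fconv_def[abs_def] by measurable

text \<open>The inverse transform turns convolution with g into multiplication by
  \<open>ift g\<close>, which by inversion is a constant times the bounded function a. Plancherel
  before and after gives the claim; integrability and boundedness of w carry over to the
  convolution, so that Plancherel applies to both.\<close>

lemma multiplier_L2_bound:
  fixes a g w :: "real^'n \<Rightarrow> complex"
  assumes h: "has_fourier a g" and [measurable]: "a \<in> borel_measurable borel"
    and g: "integrable lborel g" and w: "integrable lborel w"
    and bd: "\<And>x. norm (w x) \<le> K" and B: "AE x in lborel. norm (a x) \<le> B" "0 \<le> B"
  shows "(\<integral>\<^sup>+\<zeta>. ennreal ((norm (fconv g w \<zeta>))\<^sup>2) \<partial>lborel)
     \<le> ennreal (((2 * pi) ^ CARD('n) * B)\<^sup>2) * (\<integral>\<^sup>+\<xi>. ennreal ((norm (w \<xi>))\<^sup>2) \<partial>lborel)"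
proof -
  have [measurable]: "g \<in> borel_measurable borel" "w \<in> borel_measurable borel" using g w by auto
  define N where "N = (2 * pi) ^ CARD('n)"
  have N: "0 < N" by (simp add: N_def)
  let ?V = "fconv g w"
  have fin: "(\<integral>\<^sup>+\<xi>. \<integral>\<^sup>+\<zeta>. ennreal (norm (g (\<zeta> - \<xi>) * w \<xi>)) \<partial>lborel \<partial>lborel) < \<infinity>"
  proof -
    have "(\<integral>\<^sup>+\<xi>. \<integral>\<^sup>+\<zeta>. ennreal (norm (g (\<zeta> - \<xi>) * w \<xi>)) \<partial>lborel \<partial>lborel)
      = (\<integral>\<^sup>+\<zeta>. ennreal (norm (g \<zeta>)) \<partial>lborel) * (\<integral>\<^sup>+\<xi>. ennreal (norm (w \<xi>)) \<partial>lborel)"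
      by (simp add: norm_mult ennreal_mult nn_integral_multc nn_integral_cmult nn_integral_shift_minus[of "\<lambda>x. ennreal (norm (g x))"])
    also have "\<dots> < \<infinity>" using g w by (simp add: integrable_iff_bounded ennreal_mult_less_top)
    finally show ?thesis .
  qed
  have m: "(\<lambda>(\<xi>, \<zeta>). g (\<zeta> - \<xi>) * w \<xi>) \<in> borel_measurable (lborel \<Otimes>\<^sub>M lborel)" by measurable
  have V: "integrable lborel ?V"
    using Fubini_complex_int2[OF sigma_finite_lborel sigma_finite_lborel m fin] by (simp add: fconv_def[abs_def])
  have K0: "0 \<le> K" using bd[of 0] norm_ge_zero order.trans by blast
  have Vbd: "norm (?V \<zeta>) \<le> K * (\<integral>x. norm (g x) \<partial>lborel)" for \<zeta>
  proof -
    have "ennreal (norm (?V \<zeta>)) \<le> (\<integral>\<^sup>+\<xi>. ennreal (norm (g (\<zeta> - \<xi>) * w \<xi>)) \<partial>lborel)"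
      unfolding fconv_def by (rule ennreal_norm_integral_le)
    also have "\<dots> \<le> (\<integral>\<^sup>+\<xi>. ennreal K * ennreal (norm (g (\<zeta> - \<xi>))) \<partial>lborel)"
      using bd K0 by (intro nn_integral_mono) (auto simp: norm_mult ennreal_mult[symmetric] mult.commute mult_right_mono intro!: ennreal_leI)
    also have "\<dots> = ennreal K * (\<integral>\<^sup>+x. ennreal (norm (g x)) \<partial>lborel)"
      by (simp add: nn_integral_cmult nn_integral_reflect[of "\<lambda>x. ennreal (norm (g x))"])
    also have "\<dots> = ennreal (K * (\<integral>x. norm (g x) \<partial>lborel))"
      using g K0 by (subst nn_integral_eq_integral) (auto simp: ennreal_mult)
    finally show ?thesis using K0 by (subst (asm) ennreal_le_iff) auto
  qed
  have conv: "ift ?V x = ift g x * ift w x" for x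
  proof -
    have m': "(\<lambda>(\<xi>, \<zeta>). exp (\<i> * of_real (x \<bullet> \<zeta>)) * (g (\<zeta> - \<xi>) * w \<xi>)) \<in> borel_measurable (lborel \<Otimes>\<^sub>M lborel)" by measurable
    have fin': "(\<integral>\<^sup>+\<xi>. \<integral>\<^sup>+\<zeta>. ennreal (norm (exp (\<i> * of_real (x \<bullet> \<zeta>)) * (g (\<zeta> - \<xi>) * w \<xi>))) \<partial>lborel \<partial>lborel) < \<infinity>"
      using fin by (simp add: norm_mult)
    have "ift ?V x = (\<integral>\<zeta>. (\<integral>\<xi>. exp (\<i> * of_real (x \<bullet> \<zeta>)) * (g (\<zeta> - \<xi>) * w \<xi>) \<partial>lborel) \<partial>lborel)"
      unfolding ift_def fconv_def integral_mult_right_zero ..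
    also have "\<dots> = (\<integral>\<xi>. (\<integral>\<zeta>. exp (\<i> * of_real (x \<bullet> \<zeta>)) * (g (\<zeta> - \<xi>) * w \<xi>) \<partial>lborel) \<partial>lborel)"
      by (rule Fubini_complex_eq[OF sigma_finite_lborel sigma_finite_lborel m' fin', symmetric])
    also have "\<dots> = (\<integral>\<xi>. ift g x * (exp (\<i> * of_real (x \<bullet> \<xi>)) * w \<xi>) \<partial>lborel)"
    proof (rule Bochner_Integration.integral_cong[OF refl])
      fix \<xi> :: "real^'n"
      have "(\<integral>\<zeta>. exp (\<i> * of_real (x \<bullet> \<zeta>)) * (g (\<zeta> - \<xi>) * w \<xi>) \<partial>lborel)
         = (\<integral>\<zeta>. exp (\<i> * of_real (x \<bullet> (\<zeta> + \<xi>))) * (g ((\<zeta> + \<xi>) - \<xi>) * w \<xi>) \<partial>lborel)"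
        by (rule integral_shift[symmetric])
      also have "\<dots> = (\<integral>\<zeta>. (exp (\<i> * of_real (x \<bullet> \<zeta>)) * g \<zeta>) * (exp (\<i> * of_real (x \<bullet> \<xi>)) * w \<xi>) \<partial>lborel)"
        by (intro Bochner_Integration.integral_cong refl) (simp add: inner_add_right distrib_left exp_add)
      finally show "(\<integral>\<zeta>. exp (\<i> * of_real (x \<bullet> \<zeta>)) * (g (\<zeta> - \<xi>) * w \<xi>) \<partial>lborel) = ift g x * (exp (\<i> * of_real (x \<bullet> \<xi>)) * w \<xi>)"
        by (simp only: integral_mult_left_zero ift_def)
    qed
    also have "\<dots> = ift g x * ift w x" by (simp only: integral_mult_right_zero ift_def)
    finally show ?thesis .
  qed
  have "ennreal N * (\<integral>\<^sup>+\<zeta>. ennreal ((norm (?V \<zeta>))\<^sup>2) \<partial>lborel) = (\<integral>\<^sup>+x. ennreal ((norm (ift ?V x))\<^sup>2) \<partial>lborel)"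
    unfolding N_def by (rule plancherel_L1_bounded[OF V Vbd, symmetric])
  also have "\<dots> \<le> (\<integral>\<^sup>+x. ennreal ((N * B)\<^sup>2) * ennreal ((norm (ift w x))\<^sup>2) \<partial>lborel)"
  proof (intro nn_integral_mono_AE)
    show "AE x in lborel. ennreal ((norm (ift ?V x))\<^sup>2) \<le> ennreal ((N * B)\<^sup>2) * ennreal ((norm (ift w x))\<^sup>2)"
      using fourier_inversion_AE[OF h \<open>a \<in> borel_measurable borel\<close> g] B(1)
    proof eventually_elim
      case (elim x)
      have "norm (ift g x) = N * norm (a x)"
        unfolding elim(1)[symmetric] N_def norm_mult norm_of_real by simp
      then have "norm (ift g x) \<le> N * B"
        using elim(2) N by (simp add: mult_left_mono)
      then have "(norm (ift ?V x))\<^sup>2 \<le> (N * B)\<^sup>2 * (norm (ift w x))\<^sup>2"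
        unfolding conv norm_mult power_mult_distrib by (intro mult_right_mono power_mono) (auto simp: power_mono simp flip: power_mult_distrib)
      then show ?case by (simp add: ennreal_mult[symmetric] ennreal_leI)
    qed
  qed
  also have "\<dots> = ennreal ((N * B)\<^sup>2) * (\<integral>\<^sup>+x. ennreal ((norm (ift w x))\<^sup>2) \<partial>lborel)"
    by (rule nn_integral_cmult) measurable
  also have "\<dots> = ennreal ((N * B)\<^sup>2) * (ennreal N * (\<integral>\<^sup>+\<xi>. ennreal ((norm (w \<xi>))\<^sup>2) \<partial>lborel))"
    unfolding plancherel_L1_bounded[OF w bd] N_def ..
  finally have "ennreal N * (\<integral>\<^sup>+\<zeta>. ennreal ((norm (?V \<zeta>))\<^sup>2) \<partial>lborel) \<le> ennreal N * (ennreal ((N * B)\<^sup>2) * (\<integral>\<^sup>+\<xi>. ennreal ((norm (w \<xi>))\<^sup>2) \<partial>lborel))"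
    by (simp only: mult_ac)
  then show ?thesis
    using N unfolding N_def[symmetric] by (subst (asm) ennreal_mult_le_mult_iff) auto
qed

section \<open>Joint measurability of partial Fourier transforms\<close>

text \<open>The mollified transform is computed at each point from f alone. This is how a transform
  that is only known to exist for each value of a parameter can be recovered measurably in the
  parameter.\<close>

lemma has_fourier_mollify:
  fixes f g :: "real^'n \<Rightarrow> complex"
  assumes h: "has_fourier f g" and [measurable]: "f \<in> borel_measurable borel" "g \<in> borel_measurable borel" and t: "0 < t"
  shows "(\<integral>x. f x * (exp (- (\<i> * of_real (x \<bullet> \<eta>))) * of_real (exp (- (norm (t *\<^sub>R x))\<^sup>2 / 2))) \<partial>lborel) = mollify t g \<eta>"
proof -
  have "(\<integral>x. f x * fourier (bump t \<eta>) x \<partial>lborel) = (\<integral>x. g x * bump t \<eta> x \<partial>lborel)"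
    using h bump_schwartz[of t \<eta>] t by (simp add: has_fourier_borel_iff)
  then show ?thesis unfolding fourier_bump[OF t] integral_bump[OF t] .
qed

text \<open>The L1 errors are summable, so the sum of the pointwise errors has a finite integral and
  is finite almost everywhere.\<close>

lemma L1_fast_AE_tendsto:
  fixes g :: "'a \<Rightarrow> complex"
  assumes [measurable]: "\<And>k. h k \<in> borel_measurable M" "g \<in> borel_measurable M"
    and fast: "\<And>k. (\<integral>\<^sup>+x. ennreal (norm (h k x - g x)) \<partial>M) \<le> ennreal ((1/2) ^ k)"
  shows "AE x in M. (\<lambda>k. h k x) \<longlonglongrightarrow> g x"
proof -
  have "(\<integral>\<^sup>+x. (\<Sum>k. ennreal (norm (h k x - g x))) \<partial>M) = (\<Sum>k. \<integral>\<^sup>+x. ennreal (norm (h k x - g x)) \<partial>M)"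
    by (rule nn_integral_suminf) measurable
  also have "\<dots> \<le> (\<Sum>k. ennreal ((1/2) ^ k))"
    by (intro suminf_le fast) auto
  also have "\<dots> = ennreal (\<Sum>k. (1/2) ^ k)"
    by (intro suminf_ennreal2) (auto simp: summable_geometric)
  also have "\<dots> < \<infinity>" by simp
  finally have "(\<integral>\<^sup>+x. (\<Sum>k. ennreal (norm (h k x - g x))) \<partial>M) \<noteq> \<infinity>" by simp
  then have "AE x in M. (\<Sum>k. ennreal (norm (h k x - g x))) \<noteq> \<infinity>"
    by (intro nn_integral_PInf_AE) measurable
  then show ?thesis
  proof eventually_elim
    case (elim x)
    then have "summable (\<lambda>k. norm (h k x - g x))"
      by (intro summable_suminf_not_top) auto
    then have "(\<lambda>k. norm (h k x - g x)) \<longlonglongrightarrow> 0" by (rule summable_LIMSEQ_zero)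
    then show ?case using tendsto_norm_zero_iff LIM_zero_cancel by blast
  qed
qed

text \<open>The Gaussian regularisations are jointly measurable and converge in L1 for each value of the
  parameter y; choosing, measurably in y, a subsequence that converges fast makes them converge
  almost everywhere.\<close>

lemma joint_fourier_transform:
  fixes f :: "real^'n \<Rightarrow> 'b \<Rightarrow> complex"
  assumes f [measurable]: "(\<lambda>(x, y). f x y) \<in> borel_measurable (borel \<Otimes>\<^sub>M N)"
    and ex: "\<And>y. y \<in> space N \<Longrightarrow> \<exists>g. g \<in> borel_measurable borel \<and> integrable lborel g \<and> has_fourier (\<lambda>x. f x y) g"
  obtains G :: "real^'n \<Rightarrow> 'b \<Rightarrow> complex" where
    "(\<lambda>(\<eta>, y). G \<eta> y) \<in> borel_measurable (borel \<Otimes>\<^sub>M N)"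
    "\<And>y. y \<in> space N \<Longrightarrow> integrable lborel (\<lambda>\<eta>. G \<eta> y)"
    "\<And>y. y \<in> space N \<Longrightarrow> has_fourier (\<lambda>x. f x y) (\<lambda>\<eta>. G \<eta> y)"
proof -
  define t where "t n = 1 / real (Suc n)" for n
  have t: "0 < t n" for n by (simp add: t_def)
  have t0: "t \<longlonglongrightarrow> 0" unfolding t_def by (rule LIMSEQ_Suc[OF lim_1_over_n])
  \<comment> \<open>The integral of \<open>has_fourier_mollify\<close> with width
    \<open>t n\<close>: for fixed y it is a mollification of the unknown transform, and its formula
    is visibly measurable in both variables.\<close>
  define G where "G n \<eta> y = (\<integral>x. f x y * (exp (- (\<i> * of_real (x \<bullet> \<eta>))) * of_real (exp (- (norm (t n *\<^sub>R x))\<^sup>2 / 2))) \<partial>lborel)" for n \<eta> y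
  have Gm: "(\<lambda>p. G n (fst p) (snd p)) \<in> borel_measurable (borel \<Otimes>\<^sub>M N)" for n
  proof -
    have 1: "(\<lambda>q. f (snd q) (snd (fst q))) \<in> borel_measurable ((borel \<Otimes>\<^sub>M N) \<Otimes>\<^sub>M lborel)"
      using measurable_compose[OF _ f, of "\<lambda>q. (snd q, snd (fst q))" "(borel \<Otimes>\<^sub>M N) \<Otimes>\<^sub>M lborel"] by simp
    note [measurable] = this
    have "(\<lambda>(p, x). f x (snd p) * (exp (- (\<i> * of_real (x \<bullet> fst p))) * of_real (exp (- (norm (t n *\<^sub>R x))\<^sup>2 / 2)))) \<in> borel_measurable ((borel \<Otimes>\<^sub>M N) \<Otimes>\<^sub>M lborel)"
      unfolding case_prod_beta by measurable
    then show ?thesis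
      unfolding G_def by (rule lborel.borel_measurable_lebesgue_integral)
  qed
  define D where "D n m y = (\<integral>\<^sup>+\<eta>. ennreal (norm (G n \<eta> y - G m \<eta> y)) \<partial>lborel)" for n m y
  have Dm [measurable]: "D n m \<in> borel_measurable N" for n m
  proof -
    have "(\<lambda>q. G n (snd q) (fst q)) \<in> borel_measurable (N \<Otimes>\<^sub>M lborel)" for n
      using measurable_compose[OF _ Gm[of n], of "\<lambda>q. (snd q, fst q)" "N \<Otimes>\<^sub>M lborel"] by simp
    note [measurable] = this
    have "(\<lambda>(y, \<eta>). ennreal (norm (G n \<eta> y - G m \<eta> y))) \<in> borel_measurable (N \<Otimes>\<^sub>M lborel)"
      unfolding case_prod_beta by measurable
    then show ?thesis unfolding D_def[abs_def] by (rule lborel.borel_measurable_nn_integral)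
  qed
  \<comment> \<open>The index is chosen through mutual distances only, because the limit is not yet
    known to depend measurably on y. As a least natural number subject to countably many conditions
    it is measurable.\<close>
  define K where "K k y = (LEAST n. \<forall>m\<in>{n..}. \<forall>l\<in>{n..}. D m l y \<le> ennreal ((1/2) ^ k))" for k y
  have Km [measurable]: "K k \<in> measurable N (count_space UNIV)" for k
    unfolding K_def[abs_def] by measurable
  define H where "H k p = G (K k (snd p)) (fst p) (snd p)" for k p
  have Hm [measurable]: "H k \<in> borel_measurable (borel \<Otimes>\<^sub>M N)" for k
    unfolding H_def[abs_def]
    by (rule measurable_compose_countable[OF Gm]) measurable
  define G' where "G' \<eta> y = lim (\<lambda>k. H k (\<eta>, y))" for \<eta> y
  have G'm: "(\<lambda>(\<eta>, y). G' \<eta> y) \<in> borel_measurable (borel \<Otimes>\<^sub>M N)"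
    unfolding G'_def case_prod_beta prod.collapse by (rule borel_measurable_lim_metric) (rule Hm)
  have main: "\<exists>g. integrable lborel g \<and> has_fourier (\<lambda>x. f x y) g \<and> (AE \<eta> in lborel. g \<eta> = G' \<eta> y)" if y: "y \<in> space N" for y
  proof -
    obtain g where gm [measurable]: "g \<in> borel_measurable borel" and g: "integrable lborel g" and hg: "has_fourier (\<lambda>x. f x y) g"
      using ex[OF y] by blast
    have fy [measurable]: "(\<lambda>x. f x y) \<in> borel_measurable borel"
      using measurable_compose[OF measurable_Pair2'[OF y] f] by simp
    have G: "G n \<eta> y = mollify (t n) g \<eta>" for n \<eta>
      unfolding G_def by (rule has_fourier_mollify[OF hg fy gm t])
    define E where "E n = (\<integral>\<^sup>+\<eta>. ennreal (norm (mollify (t n) g \<eta> - g \<eta>)) \<partial>lborel)" for n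
    have E: "E \<longlonglongrightarrow> 0" unfolding E_def by (rule mollify_tendsto_L1[OF g t0])
    have DE: "D n m y \<le> E n + E m" for n m
    proof -
      have "D n m y \<le> (\<integral>\<^sup>+\<eta>. ennreal (norm (mollify (t n) g \<eta> - g \<eta>)) + ennreal (norm (mollify (t m) g \<eta> - g \<eta>)) \<partial>lborel)"
        unfolding D_def G by (intro nn_integral_mono ennreal_norm_le_add) norm
      also have "\<dots> = E n + E m" unfolding E_def by (rule nn_integral_add) measurable
      finally show ?thesis .
    qed
    have cube_kernel: "\<forall>m\<in>{K k y..}. \<forall>l\<in>{K k y..}. D m l y \<le> ennreal ((1/2) ^ k)" for k
      unfolding K_def
    proof (rule LeastI_ex)
      have "eventually (\<lambda>n. E n < ennreal ((1/2) ^ k / 2)) sequentially"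
        using E by (auto simp: order_tendsto_iff)
      then obtain n where n: "\<And>m. m \<ge> n \<Longrightarrow> E m < ennreal ((1/2) ^ k / 2)"
        by (auto simp: eventually_sequentially)
      show "\<exists>n. \<forall>m\<in>{n..}. \<forall>l\<in>{n..}. D m l y \<le> ennreal ((1/2) ^ k)"
      proof (intro exI ballI)
        fix m l assume "m \<in> {n..}" "l \<in> {n..}"
        then have "D m l y \<le> ennreal ((1/2) ^ k / 2) + ennreal ((1/2) ^ k / 2)"
          using DE[of m l] n[of m] n[of l] by (meson add_mono atLeast_iff less_imp_le order.trans)
        also have "\<dots> = ennreal ((1/2) ^ k)" by (subst ennreal_plus[symmetric]) auto
        finally show "D m l y \<le> ennreal ((1/2) ^ k)" .
      qed
    qed
    \<comment> \<open>The Cauchy bound passes to the distance from the limit when l tends to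
      infinity.\<close>
    have HE: "E (K k y) \<le> ennreal ((1/2) ^ k)" for k
    proof -
      have "E (K k y) \<le> ennreal ((1/2) ^ k) + E l" if "l \<ge> K k y" for l
      proof -
        have "E (K k y) \<le> (\<integral>\<^sup>+\<eta>. ennreal (norm (mollify (t (K k y)) g \<eta> - mollify (t l) g \<eta>)) + ennreal (norm (mollify (t l) g \<eta> - g \<eta>)) \<partial>lborel)"
          unfolding E_def by (intro nn_integral_mono ennreal_norm_le_add) norm
        also have "\<dots> = D (K k y) l y + E l" unfolding E_def D_def G by (rule nn_integral_add) measurable
        also have "\<dots> \<le> ennreal ((1/2) ^ k) + E l" using cube_kernel[of k] that by (intro add_right_mono) auto
        finally show ?thesis .
      qed
      then have "eventually (\<lambda>l. E (K k y) \<le> ennreal ((1/2) ^ k) + E l) sequentially"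
        by (auto simp: eventually_sequentially)
      moreover have "(\<lambda>l. ennreal ((1/2) ^ k) + E l) \<longlonglongrightarrow> ennreal ((1/2) ^ k) + 0"
        by (intro tendsto_add tendsto_const E)
      ultimately show ?thesis
        using tendsto_lowerbound[of "\<lambda>l. ennreal ((1/2) ^ k) + E l" "ennreal ((1/2) ^ k)" sequentially "E (K k y)"] by simp
    qed
    have "AE \<eta> in lborel. (\<lambda>k. H k (\<eta>, y)) \<longlonglongrightarrow> g \<eta>"
    proof (rule L1_fast_AE_tendsto)
      show "(\<lambda>\<eta>. H k (\<eta>, y)) \<in> borel_measurable lborel" for k
        unfolding H_def by (simp add: G)
      show "(\<integral>\<^sup>+x. ennreal (norm (H k (x, y) - g x)) \<partial>lborel) \<le> ennreal ((1/2) ^ k)" for k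
        using HE[of k] by (simp add: H_def G E_def)
    qed simp
    then have "AE \<eta> in lborel. g \<eta> = G' \<eta> y"
      by eventually_elim (simp add: G'_def limI)
    then show ?thesis using g hg by blast
  qed
  have G'y: "(\<lambda>\<eta>. G' \<eta> y) \<in> borel_measurable borel" if "y \<in> space N" for y
    using measurable_compose[OF measurable_Pair2'[OF that] G'm] by simp
  show thesis
  proof (rule that[OF G'm])
    fix y assume y: "y \<in> space N"
    note [measurable] = G'y[OF y]
    obtain g where g: "integrable lborel g" "has_fourier (\<lambda>x. f x y) g" and ae: "AE \<eta> in lborel. g \<eta> = G' \<eta> y"
      using main[OF y] by blast
    have [measurable]: "g \<in> borel_measurable borel" using g by auto
    show "integrable lborel (\<lambda>\<eta>. G' \<eta> y)"
      using g(1) ae by (subst integrable_cong_AE[of _ _ g]) (auto elim: eventually_mono)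
    have "(\<lambda>x. f x y) \<in> borel_measurable lebesgue" using g(2) by (auto simp: has_fourier_def)
    then show "has_fourier (\<lambda>x. f x y) (\<lambda>\<eta>. G' \<eta> y)"
      by (rule has_fourier_cong_AE[OF g(2) _ borel_imp_lebesgue[OF G'y[OF y]] AE_I2[OF refl] ae])
  qed
qed

section \<open>Weights and rapidly decreasing functions\<close>

lemma japanese_ge_1 [simp]: "1 \<le> japanese \<xi>"
  by (simp add: japanese_def)

lemma japanese_pos [simp]: "0 < japanese \<xi>"
  using japanese_ge_1[of \<xi>] by linarith

lemma japanese_nonzero [simp]: "japanese \<xi> \<noteq> 0"
  using japanese_pos[of \<xi>] by (metis less_irrefl)

lemma japanese_nonneg [simp]: "0 \<le> japanese \<xi>"
  using japanese_pos[of \<xi>] by (rule less_imp_le)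

lemma japanese_measurable [measurable]: "japanese \<in> borel_measurable borel"
  unfolding japanese_def[abs_def] by measurable

lemma japanese_sq: "(japanese \<xi>)\<^sup>2 = 1 + (norm \<xi>)\<^sup>2"
  by (simp add: japanese_def)

lemma norm_le_japanese: "norm \<xi> \<le> japanese \<xi>"
  by (rule power2_le_imp_le) (simp_all add: japanese_sq less_imp_le)

lemma japanese_le: "japanese \<xi> \<le> 1 + norm \<xi>"
  by (rule power2_le_imp_le) (simp_all add: japanese_sq power2_sum)

text \<open>On [-1, 1] the integrand is at most 1, outside it is at most |t|^(-2p), whose integral
  is elementary for 2p > 1.\<close>

lemma nn_integral_1d_weight:
  assumes p: "1/2 < p"
  shows "(\<integral>\<^sup>+(t::real). ennreal ((1 + t\<^sup>2) powr (- p)) \<partial>lborel) < \<infinity>"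
proof -
  define T where "T = (\<integral>\<^sup>+(t::real). ennreal (t powr (- (2 * p))) * indicator {1..} t \<partial>lborel)"
  have "T = ennreal (0 - 1 powr (1 - 2 * p) / (1 - 2 * p))"
    unfolding T_def
  proof (rule nn_integral_FTC_atLeast[where F="\<lambda>t. t powr (1 - 2 * p) / (1 - 2 * p)"])
    show "DERIV (\<lambda>t. t powr (1 - 2 * p) / (1 - 2 * p)) x :> x powr (- (2 * p))" if "1 \<le> x" for x
      using that p DERIV_cdivide[OF has_real_derivative_powr[of x "1 - 2 * p"], of "1 - 2 * p"] by simp
    have "((\<lambda>t::real. t powr (1 - 2 * p)) \<longlongrightarrow> 0) at_top"
      by (rule tendsto_neg_powr) (use p in \<open>auto intro: filterlim_ident\<close>)
    from tendsto_divide[OF this tendsto_const[of "1 - 2 * p"]]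
    show "((\<lambda>t. t powr (1 - 2 * p) / (1 - 2 * p)) \<longlongrightarrow> 0) at_top" using p by simp
  qed (auto)
  then have T: "T < \<infinity>" by simp
  have "(\<integral>\<^sup>+(t::real). ennreal ((1 + t\<^sup>2) powr (- p)) \<partial>lborel) \<le>
    (\<integral>\<^sup>+(t::real). indicator {-1..1} t + (ennreal (t powr (- (2 * p))) * indicator {1..} t + ennreal ((0 - t) powr (- (2 * p))) * indicator {1..} (0 - t)) \<partial>lborel)"
  proof (intro nn_integral_mono)
    fix t :: real
    have big: "(1 + t\<^sup>2) powr (- p) \<le> \<bar>t\<bar> powr (- (2 * p))" if "1 \<le> \<bar>t\<bar>"
    proof -
      have sq: "(a\<^sup>2) powr (- p) = a powr (- (2 * p))" if "0 < a" for a :: real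
      proof -
        have "a\<^sup>2 = a powr 2" using that by simp
        then show ?thesis by (simp only: powr_powr) simp
      qed
      have "(1 + t\<^sup>2) powr (- p) \<le> (\<bar>t\<bar>\<^sup>2) powr (- p)"
        using p that by (intro powr_mono2') auto
      then show ?thesis using that by (subst (asm) sq) auto
    qed
    have small: "(1 + t\<^sup>2) powr (- p) \<le> 1"
      using p powr_mono2'[of "-p" 1 "1 + t\<^sup>2"] by simp
    consider "\<bar>t\<bar> \<le> 1" | "1 < t" | "t < -1" by linarith
    then show "ennreal ((1 + t\<^sup>2) powr (- p)) \<le> indicator {-1..1} t + (ennreal (t powr (- (2 * p))) * indicator {1..} t + ennreal ((0 - t) powr (- (2 * p))) * indicator {1..} (0 - t))"
    proof cases
      case 1
      then have "t \<in> {-1..1}" by (simp add: abs_le_iff)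
      then have "indicator {-1..1} t = (1::ennreal)" by (rule indicator_simps(1))
      then show ?thesis using small by (metis add_increasing2 ennreal_leI ennreal_1 zero_le)
    next
      case 2
      then show ?thesis using big by (auto simp: indicator_def intro!: ennreal_leI)
    next
      case 3
      then show ?thesis using big by (auto simp: indicator_def intro!: ennreal_leI)
    qed
  qed
  also have "\<dots> = emeasure lborel {-1..1::real} + (T + (\<integral>\<^sup>+(t::real). ennreal ((0 - t) powr (- (2 * p))) * indicator {1..} (0 - t) \<partial>lborel))"
    unfolding T_def by (subst nn_integral_add; (subst nn_integral_add)?; simp)
  also have "(\<integral>\<^sup>+(t::real). ennreal ((0 - t) powr (- (2 * p))) * indicator {1..} (0 - t) \<partial>lborel) = T"
    unfolding T_def by (rule nn_integral_reflect[of "\<lambda>t. ennreal (t powr (- (2 * p))) * indicator {1..} t"]) measurable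
  finally show ?thesis using T by (auto simp: less_top[symmetric] top_unique)
qed

text \<open>In place of polar coordinates: the product of the d factors 1 + \<xi>_i^2 is at most the
  2d-th power of the weight, so the integrand is dominated by a product of one-variable functions
  with exponent r/d > 1/2.\<close>

lemma nn_integral_japanese_weight:
  assumes r: "real CARD('n) / 2 < r"
  shows "(\<integral>\<^sup>+(\<xi>::real^'n). ennreal (japanese \<xi> powr (- (2 * r))) \<partial>lborel) < \<infinity>"
proof -
  let ?d = "real CARD('n)"
  define p where "p = r / ?d"
  have p: "1/2 < p" using r by (simp add: p_def field_simps)
  have r0: "0 < r" using r by (smt (verit) divide_nonneg_nonneg of_nat_0_le_iff)
  have "(\<integral>\<^sup>+(\<xi>::real^'n). ennreal (japanese \<xi> powr (- (2 * r))) \<partial>lborel)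
     \<le> (\<integral>\<^sup>+(\<xi>::real^'n). (\<Prod>b\<in>Basis. ennreal ((1 + (\<xi> \<bullet> b)\<^sup>2) powr (- p))) \<partial>lborel)"
  proof (intro nn_integral_mono)
    fix \<xi> :: "real^'n"
    have "(\<Prod>b\<in>Basis. 1 + (\<xi> \<bullet> b)\<^sup>2) \<le> (\<Prod>b\<in>(Basis :: (real^'n) set). (japanese \<xi>)\<^sup>2)"
      unfolding japanese_sq
      by (intro prod_mono) (use Basis_le_norm[of _ \<xi>] in \<open>auto intro!: power_mono simp flip: abs_le_square_iff\<close>)
    also have "\<dots> = japanese \<xi> ^ (2 * CARD('n))" by (simp add: power_mult)
    also have "\<dots> = japanese \<xi> powr real (2 * CARD('n))" by (rule powr_realpow[symmetric]) simp
    also have "\<dots> = japanese \<xi> powr (2 * ?d)" by simp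
    finally have le: "(\<Prod>b\<in>Basis. 1 + (\<xi> \<bullet> b)\<^sup>2) \<le> japanese \<xi> powr (2 * ?d)" .
    have pos: "0 < (\<Prod>b\<in>Basis. 1 + (\<xi> \<bullet> b)\<^sup>2)"
      by (intro prod_pos) (auto intro: add_pos_nonneg)
    have "japanese \<xi> powr (- (2 * r)) = (japanese \<xi> powr (2 * ?d)) powr (- p)"
      unfolding powr_powr by (simp add: p_def)
    also have "\<dots> \<le> (\<Prod>b\<in>Basis. 1 + (\<xi> \<bullet> b)\<^sup>2) powr (- p)"
      using p by (intro powr_mono2' le pos) auto
    also have "\<dots> = (\<Prod>b\<in>Basis. (1 + (\<xi> \<bullet> b)\<^sup>2) powr (- p))"
      by (rule prod_powr_distrib)
    finally have "ennreal (japanese \<xi> powr (- (2 * r))) \<le> ennreal (\<Prod>b\<in>Basis. (1 + (\<xi> \<bullet> b)\<^sup>2) powr (- p))"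
      by (rule ennreal_leI)
    then show "ennreal (japanese \<xi> powr (- (2 * r))) \<le> (\<Prod>b\<in>Basis. ennreal ((1 + (\<xi> \<bullet> b)\<^sup>2) powr (- p)))"
      by (subst prod_ennreal) auto
  qed
  also have "\<dots> = (\<Prod>b\<in>(Basis :: (real^'n) set). \<integral>\<^sup>+t. ennreal ((1 + t\<^sup>2) powr (- p)) \<partial>lborel)"
    by (rule nn_integral_lborel_prod) auto
  also have "\<dots> < \<infinity>"
    using nn_integral_1d_weight[OF p] by (simp add: power_less_top_ennreal)
  finally show ?thesis .
qed

text \<open>Decay of the function itself, without its derivatives: besides measurability, this is
  what the estimates use of the Fourier transform of u.\<close>

definition rapid :: "(real^'n \<Rightarrow> complex) \<Rightarrow> bool" where
  "rapid f \<longleftrightarrow> (\<forall>k::nat. \<exists>C. \<forall>x. norm x ^ k * norm (f x) \<le> C)"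

lemma rapid_weight:
  assumes "rapid f"
  shows "\<exists>C>0. \<forall>x. norm (f x) \<le> C * japanese x powr (- p)"
proof -
  define N where "N = nat \<lceil>\<bar>p\<bar>\<rceil>"
  have N: "p \<le> real N" unfolding N_def by linarith
  obtain C0 where C0: "\<And>x. norm x ^ 0 * norm (f x) \<le> C0" using assms unfolding rapid_def by blast
  obtain C1 where C1: "\<And>x. norm x ^ N * norm (f x) \<le> C1" using assms unfolding rapid_def by blast
  define C where "C = 2 ^ N * (\<bar>C0\<bar> + \<bar>C1\<bar>) + 1"
  have "norm (f x) \<le> C * japanese x powr (- p)" for x
  proof -
    have "japanese x powr p * norm (f x) \<le> japanese x ^ N * norm (f x)"
      using N powr_mono[of p "real N" "japanese x"] by (intro mult_right_mono) (auto simp: powr_realpow)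
    also have "\<dots> \<le> (2 ^ N * (1 + norm x ^ N)) * norm (f x)"
    proof (intro mult_right_mono)
      have "japanese x ^ N \<le> (1 + norm x) ^ N" by (intro power_mono japanese_le) (simp add: less_imp_le)
      also have "\<dots> \<le> (2 * max 1 (norm x)) ^ N" by (intro power_mono) auto
      also have "\<dots> = 2 ^ N * (max 1 (norm x)) ^ N" by (rule power_mult_distrib)
      also have "\<dots> \<le> 2 ^ N * (1 + norm x ^ N)" by (intro mult_left_mono) (auto simp: max_def)
      finally show "japanese x ^ N \<le> 2 ^ N * (1 + norm x ^ N)" .
    qed simp
    also have "\<dots> = 2 ^ N * (norm x ^ 0 * norm (f x) + norm x ^ N * norm (f x))" by (simp add: algebra_simps)
    also have "\<dots> \<le> 2 ^ N * (\<bar>C0\<bar> + \<bar>C1\<bar>)"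
      using C0[of x] C1[of x] by (intro mult_left_mono add_mono) auto
    also have "\<dots> \<le> C" by (simp add: C_def)
    finally have *: "japanese x powr p * norm (f x) \<le> C" .
    have "norm (f x) = (japanese x powr p * norm (f x)) * japanese x powr (- p)"
      using japanese_pos[of x] by (simp add: powr_minus)
    also have "\<dots> \<le> C * japanese x powr (- p)" using * by (intro mult_right_mono) auto
    finally show ?thesis .
  qed
  moreover have "0 < C" unfolding C_def by (intro add_nonneg_pos mult_nonneg_nonneg) auto
  ultimately show ?thesis by blast
qed

lemma rapid_integrable_weight:
  fixes f :: "real^'n \<Rightarrow> complex"
  assumes f: "rapid f" and [measurable]: "f \<in> borel_measurable borel"
  shows "(\<integral>\<^sup>+x. ennreal (japanese x powr q * norm (f x)) \<partial>lborel) < \<infinity>"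
proof -
  define r where "r = real CARD('n) / 2 + 1"
  obtain C where C: "0 < C" "\<And>x. norm (f x) \<le> C * japanese x powr (- (q + 2 * r))"
    using rapid_weight[OF f] by blast
  have "(\<integral>\<^sup>+x. ennreal (japanese x powr q * norm (f x)) \<partial>lborel) \<le> (\<integral>\<^sup>+x. ennreal C * ennreal (japanese (x::real^'n) powr (- (2 * r))) \<partial>lborel)"
  proof (intro nn_integral_mono)
    fix x :: "real^'n"
    have "japanese x powr q * norm (f x) \<le> japanese x powr q * (C * japanese x powr (- (q + 2 * r)))"
      by (intro mult_left_mono C) auto
    also have "\<dots> = C * (japanese x powr q * japanese x powr (- (q + 2 * r)))" by simp
    also have "japanese x powr q * japanese x powr (- (q + 2 * r)) = japanese x powr (- (2 * r))"
      by (subst powr_add[symmetric]) simp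
    finally show "ennreal (japanese x powr q * norm (f x)) \<le> ennreal C * ennreal (japanese x powr (- (2 * r)))"
      using C(1) by (simp add: ennreal_mult[symmetric] ennreal_leI)
  qed
  also have "\<dots> = ennreal C * (\<integral>\<^sup>+x. ennreal (japanese (x::real^'n) powr (- (2 * r))) \<partial>lborel)"
    by (rule nn_integral_cmult) measurable
  also have "\<dots> < \<infinity>"
    using nn_integral_japanese_weight[where 'n='n and r=r] by (simp add: ennreal_mult_less_top r_def)
  finally show ?thesis .
qed

lemma rapid_integrable:
  assumes "rapid f" "f \<in> borel_measurable borel"
  shows "integrable lborel f"
  using rapid_integrable_weight[OF assms, of 0] assms(2)
  by (intro integrableI_bounded) auto

section \<open>Schwartz functions\<close>

lemma schwartz_differentiable: "u \<in> schwartz \<Longrightarrow> partials UNIV is u differentiable (at x)"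
  unfolding schwartz_def smooth_on_def by (auto simp: differentiable_on_def)

lemma multi_deriv_zero: "multi_deriv S (\<lambda>_. 0) f = f"
proof -
  have "(SOME is. \<forall>i. count_list is i = 0) = ([] :: 'a list)"
  proof (rule some_equality)
    fix l :: "'a list" assume l: "\<forall>i. count_list l i = 0"
    then have "set l = {}" by (auto simp: count_list_0_iff)
    then show "l = []" by simp
  qed simp
  then show ?thesis by (simp add: multi_deriv_def)
qed

text \<open>For a multi-index supported on one coordinate the list of directions is unique, so the
  choice in \<open>multi_deriv\<close> is determined. Such derivatives are enough for the decay of
  Fourier transforms.\<close>

lemma multi_deriv_pure:
  "multi_deriv S (\<lambda>i. if i = j then N else 0) f = partials S (replicate N j) f"
proof -
  have "(SOME is. \<forall>i. count_list is i = (if i = j then N else 0)) = replicate N j"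
  proof (rule some_equality)
    have "count_list (replicate N j) i = (if i = j then N else 0)" for i by (induction N) auto
    then show "\<forall>i. count_list (replicate N j) i = (if i = j then N else 0)" by blast
    fix l :: "'a list" assume l: "\<forall>i. count_list l i = (if i = j then N else 0)"
    have "set l \<subseteq> {j}"
    proof
      fix i assume "i \<in> set l"
      then have "count_list l i \<noteq> 0" by (simp add: count_list_0_iff)
      then show "i \<in> {j}" using l by (auto split: if_splits)
    qed
    then have "l = replicate (length l) j" by (intro replicate_eqI) auto
    moreover have "count_list (replicate (length l) j) j = length l" for l :: "'a list" by (induction l) auto
    ultimately show "l = replicate N j" using l by metis
  qed
  then show ?thesis by (simp add: multi_deriv_def)
qed

lemma schwartz_rapid_pure: "u \<in> schwartz \<Longrightarrow> rapid (partials UNIV (replicate N j) u)"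
  unfolding schwartz_def rapid_def multi_deriv_pure[symmetric] by blast

lemma schwartz_rapid: "u \<in> schwartz \<Longrightarrow> rapid u"
  using schwartz_rapid_pure[of u 0] by simp

lemma schwartz_integrable: "u \<in> schwartz \<Longrightarrow> integrable lborel u"
  by (intro rapid_integrable schwartz_rapid schwartz_borel)

lemma partials_shift:
  assumes "u \<in> schwartz"
  shows "partials UNIV is (\<lambda>x. u (x + a)) = (\<lambda>x. partials UNIV is u (x + a))
    \<and> (\<forall>x. (\<lambda>x. u (x + a)) \<in> UNIV \<and> (\<lambda>x. partials UNIV is u (x + a)) differentiable (at x))"
proof -
  have d: "((\<lambda>x. partials UNIV is u (x + a)) has_derivative frechet_derivative (partials UNIV is u) (at (x + a))) (at x)" for "is" x
  proof -
    have "(partials UNIV is u has_derivative frechet_derivative (partials UNIV is u) (at (x + a))) (at (x + a))"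
      using schwartz_differentiable[OF assms] frechet_derivative_works by blast
    moreover have "((\<lambda>x. x + a) has_derivative (\<lambda>h. h)) (at x)"
      by (auto intro!: derivative_eq_intros)
    ultimately show ?thesis using has_derivative_compose[of "\<lambda>x. x + a" "\<lambda>h. h" x UNIV] by simp
  qed
  have "partials UNIV is (\<lambda>x. u (x + a)) = (\<lambda>x. partials UNIV is u (x + a))"
  proof (induction "is")
    case (Cons i "is")
    show ?case
      unfolding partials.simps Cons partial_within_def using frechet_derivative_at[OF d] by simp
  qed simp
  then show ?thesis using d by (auto simp: differentiable_def)
qed

lemma schwartz_shift:
  assumes u: "u \<in> schwartz"
  shows "(\<lambda>x. u (x + a)) \<in> schwartz"
proof -
  have "smooth_on UNIV (\<lambda>x. u (x + a))"
    using partials_shift[OF u] by (auto simp: smooth_on_def differentiable_on_def)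
  moreover have "\<exists>C. \<forall>x. norm x ^ k * norm (multi_deriv UNIV \<beta> (\<lambda>x. u (x + a)) x) \<le> C" for k \<beta>
  proof -
    let ?D = "multi_deriv UNIV \<beta> u"
    have D: "multi_deriv UNIV \<beta> (\<lambda>x. u (x + a)) x = ?D (x + a)" for x
      using partials_shift[OF u] by (simp add: multi_deriv_def)
    have "\<exists>C. \<forall>x. norm x ^ k * norm (?D x) \<le> C" "\<exists>C. \<forall>x. norm x ^ 0 * norm (?D x) \<le> C"
      using u unfolding schwartz_def by blast+
    then obtain C C' where C: "\<And>x. norm x ^ k * norm (?D x) \<le> C" and C': "\<And>x. norm (?D x) \<le> C'" by auto
    have "norm x ^ k * norm (?D (x + a)) \<le> 2 ^ k * C + 2 ^ k * norm a ^ k * C'" for x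
    proof -
      have "norm x \<le> norm (x + a) + norm a" by norm
      also have "\<dots> \<le> 2 * max (norm (x + a)) (norm a)" by simp
      finally have "norm x ^ k \<le> (2 * max (norm (x + a)) (norm a)) ^ k" by (rule power_mono) simp
      also have "\<dots> = 2 ^ k * (max (norm (x + a)) (norm a)) ^ k" by (rule power_mult_distrib)
      also have "\<dots> \<le> 2 ^ k * (norm (x + a) ^ k + norm a ^ k)" by (intro mult_left_mono) (auto simp: max_def)
      finally have "norm x ^ k * norm (?D (x + a)) \<le> 2 ^ k * (norm (x + a) ^ k + norm a ^ k) * norm (?D (x + a))"
        by (rule mult_right_mono) simp
      also have "\<dots> = 2 ^ k * (norm (x + a) ^ k * norm (?D (x + a))) + 2 ^ k * norm a ^ k * norm (?D (x + a))"
        by (simp add: algebra_simps)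
      also have "\<dots> \<le> 2 ^ k * C + 2 ^ k * norm a ^ k * C'"
        by (intro add_mono mult_left_mono C C') auto
      finally show ?thesis .
    qed
    then show ?thesis unfolding D by blast
  qed
  ultimately show ?thesis by (simp add: schwartz_def)
qed

text \<open>The fundamental theorem on the segment from x to x + e_j, integrated over x: by Fubini
  and translation invariance one side is the integral of the derivative, the other is a difference
  of two equal integrals.\<close>

lemma integral_partial_zero:
  fixes F :: "real^'n \<Rightarrow> complex"
  assumes d: "\<And>x. (F has_derivative F' x) (at x)"
    and H: "\<And>x. F' x (axis j 1) = H x" and c: "continuous_on UNIV H"
    and iF: "integrable lborel F" and iH: "integrable lborel H"
  shows "(\<integral>x. H x \<partial>lborel) = 0"
proof -
  let ?e = "axis j 1 :: real^'n"
  have [measurable]: "H \<in> borel_measurable borel" using iH by auto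
  have ftc: "(\<integral>\<tau>. indicator {0..1} \<tau> *\<^sub>R H (x + \<tau> *\<^sub>R ?e) \<partial>lborel) = F (x + ?e) - F x" for x
  proof -
    have "(\<integral>\<tau>. indicator {0..1} \<tau> *\<^sub>R H (x + \<tau> *\<^sub>R ?e) \<partial>lborel) = F (x + 1 *\<^sub>R ?e) - F (x + 0 *\<^sub>R ?e)"
    proof (rule integral_FTC_atLeastAtMost)
      show "((\<lambda>\<tau>. F (x + \<tau> *\<^sub>R ?e)) has_vector_derivative H (x + \<tau> *\<^sub>R ?e)) (at \<tau> within {0..1})" for \<tau>
      proof -
        have "((\<lambda>\<tau>. x + \<tau> *\<^sub>R ?e) has_derivative (\<lambda>h. h *\<^sub>R ?e)) (at \<tau> within {0..1})"
          by (auto intro!: derivative_eq_intros)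
        from has_derivative_compose[OF this d]
        have "((\<lambda>\<tau>. F (x + \<tau> *\<^sub>R ?e)) has_derivative (\<lambda>h. F' (x + \<tau> *\<^sub>R ?e) (h *\<^sub>R ?e))) (at \<tau> within {0..1})" .
        moreover have "F' (x + \<tau> *\<^sub>R ?e) (h *\<^sub>R ?e) = h *\<^sub>R H (x + \<tau> *\<^sub>R ?e)" for h
          using d[of "x + \<tau> *\<^sub>R ?e"] H by (simp add: has_derivative_def bounded_linear.linear linear_cmul)
        ultimately show ?thesis by (simp add: has_vector_derivative_def)
      qed
      show "continuous_on {0..1} (\<lambda>\<tau>. H (x + \<tau> *\<^sub>R ?e))"
        by (intro continuous_on_compose2[OF c] continuous_intros) auto
    qed simp
    then show ?thesis by simp
  qed
  have m: "(\<lambda>(x, \<tau>). indicator {0..1} \<tau> *\<^sub>R H (x + \<tau> *\<^sub>R ?e)) \<in> borel_measurable (lborel \<Otimes>\<^sub>M lborel)"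
    by measurable
  have fin: "(\<integral>\<^sup>+x. \<integral>\<^sup>+\<tau>. ennreal (norm (indicator {0..1} \<tau> *\<^sub>R H (x + \<tau> *\<^sub>R ?e))) \<partial>lborel \<partial>lborel) < \<infinity>"
  proof -
    have "(\<integral>\<^sup>+x. \<integral>\<^sup>+\<tau>. ennreal (norm (indicator {0..1} \<tau> *\<^sub>R H (x + \<tau> *\<^sub>R ?e))) \<partial>lborel \<partial>lborel)
       = (\<integral>\<^sup>+\<tau>. \<integral>\<^sup>+x. ennreal (norm (indicator {0..1} \<tau> *\<^sub>R H (x + \<tau> *\<^sub>R ?e))) \<partial>lborel \<partial>lborel)"
      by (rule lborel_pair.Fubini'[symmetric]) measurable
    also have "\<dots> = (\<integral>\<^sup>+\<tau>. indicator {0..1::real} \<tau> * (\<integral>\<^sup>+x. ennreal (norm (H x)) \<partial>lborel) \<partial>lborel)"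
    proof (rule nn_integral_cong)
      fix \<tau> :: real
      have "(\<integral>\<^sup>+x. ennreal (norm (indicator {0..1} \<tau> *\<^sub>R H (x + \<tau> *\<^sub>R ?e))) \<partial>lborel) = (\<integral>\<^sup>+x. indicator {0..1::real} \<tau> * ennreal (norm (H (x + \<tau> *\<^sub>R ?e))) \<partial>lborel)"
        by (intro nn_integral_cong) (auto simp: indicator_def)
      also have "\<dots> = indicator {0..1::real} \<tau> * (\<integral>\<^sup>+x. ennreal (norm (H (x + \<tau> *\<^sub>R ?e))) \<partial>lborel)"
        by (rule nn_integral_cmult) measurable
      finally show "(\<integral>\<^sup>+x. ennreal (norm (indicator {0..1} \<tau> *\<^sub>R H (x + \<tau> *\<^sub>R ?e))) \<partial>lborel) = indicator {0..1::real} \<tau> * (\<integral>\<^sup>+x. ennreal (norm (H x)) \<partial>lborel)"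
        by (subst (asm) nn_integral_shift[of "\<lambda>x. ennreal (norm (H x))"]) auto
    qed
    also have "\<dots> = (\<integral>\<^sup>+x. ennreal (norm (H x)) \<partial>lborel)"
      by (subst nn_integral_multc) auto
    also have "\<dots> < \<infinity>" using iH by (simp add: integrable_iff_bounded)
    finally show ?thesis .
  qed
  have "(\<integral>x. (\<integral>\<tau>. indicator {0..1} \<tau> *\<^sub>R H (x + \<tau> *\<^sub>R ?e) \<partial>lborel) \<partial>lborel)
     = (\<integral>\<tau>. (\<integral>x. indicator {0..1} \<tau> *\<^sub>R H (x + \<tau> *\<^sub>R ?e) \<partial>lborel) \<partial>lborel)"
    by (rule Fubini_complex_eq[OF sigma_finite_lborel sigma_finite_lborel m fin])
  also have "\<dots> = (\<integral>\<tau>. indicator {0..1::real} \<tau> *\<^sub>R (\<integral>x. H x \<partial>lborel) \<partial>lborel)"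
    by (simp only: integral_scaleR_right integral_shift)
  also have "\<dots> = (\<integral>x. H x \<partial>lborel)" by simp
  finally have "(\<integral>x. H x \<partial>lborel) = (\<integral>x. F (x + ?e) - F x \<partial>lborel)" unfolding ftc by simp
  also have "\<dots> = (\<integral>x. F (x + ?e) \<partial>lborel) - (\<integral>x. F x \<partial>lborel)"
    by (rule Bochner_Integration.integral_diff[OF integrable_shift[OF iF] iF])
  also have "\<dots> = 0" by (simp add: integral_shift)
  finally show ?thesis .
qed

text \<open>Integration by parts, in the form that the j-th derivative of the product of f with the
  exponential has integral zero.\<close>

lemma fourier_partial:
  fixes f :: "real^'n \<Rightarrow> complex"
  assumes d: "\<And>x. f differentiable (at x)" and d': "\<And>x. partial_within UNIV j f differentiable (at x)"
    and r: "rapid f" "rapid (partial_within UNIV j f)"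
  shows "fourier (partial_within UNIV j f) \<xi> = \<i> * of_real (\<xi> $ j) * fourier f \<xi>"
proof -
  let ?D = "partial_within UNIV j f"
  let ?E = "\<lambda>x. exp (- (\<i> * of_real (x \<bullet> \<xi>)))"
  have cf: "continuous_on UNIV f" "continuous_on UNIV ?D"
    using d d' by (auto intro!: differentiable_imp_continuous_on simp: differentiable_on_def)
  then have [measurable]: "f \<in> borel_measurable borel" "?D \<in> borel_measurable borel"
    by (auto intro: borel_measurable_continuous_onI)
  have if': "integrable lborel f" "integrable lborel ?D" using r by (auto intro: rapid_integrable)
  have i1: "integrable lborel (\<lambda>x. ?E x * f x)" and i2: "integrable lborel (\<lambda>x. ?E x * ?D x)"
    by (rule Bochner_Integration.integrable_bound[OF if'(1)]; simp add: norm_mult)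
       (rule Bochner_Integration.integrable_bound[OF if'(2)]; simp add: norm_mult)
  define H where "H x = ?E x * ?D x + (- (\<i> * of_real (\<xi> $ j))) * (?E x * f x)" for x
  have "(\<integral>x. H x \<partial>lborel) = 0"
  proof (rule integral_partial_zero)
    fix x
    have f': "(f has_derivative frechet_derivative f (at x)) (at x)"
      using d frechet_derivative_works by blast
    have "((\<lambda>x. - (\<i> * complex_of_real (x \<bullet> \<xi>))) has_derivative (\<lambda>h. - (\<i> * of_real (h \<bullet> \<xi>)))) (at x)"
      by (auto intro!: derivative_eq_intros)
    from has_derivative_compose[OF this DERIV_exp[unfolded has_field_derivative_def]]
    have E': "(?E has_derivative (\<lambda>h. ?E x * - (\<i> * of_real (h \<bullet> \<xi>)))) (at x)" .
    show "((\<lambda>x. ?E x * f x) has_derivative (\<lambda>h. ?E x * frechet_derivative f (at x) h + ?E x * - (\<i> * of_real (h \<bullet> \<xi>)) * f x)) (at x)"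
      by (rule has_derivative_mult[OF E' f'])
    show "?E x * frechet_derivative f (at x) (axis j 1) + ?E x * - (\<i> * of_real (axis j 1 \<bullet> \<xi>)) * f x = H x"
      by (simp add: H_def partial_within_def inner_axis' mult_ac)
  next
    show "continuous_on UNIV H" unfolding H_def by (intro continuous_intros cf)
    show "integrable lborel H" unfolding H_def by (intro Bochner_Integration.integrable_add integrable_mult_right i1 i2)
  qed (rule i1)
  moreover have "(\<integral>x. H x \<partial>lborel) = (\<integral>x. ?E x * ?D x \<partial>lborel) + (- (\<i> * of_real (\<xi> $ j))) * (\<integral>x. ?E x * f x \<partial>lborel)"
    unfolding H_def by (subst Bochner_Integration.integral_add) (auto intro: i1 i2)
  ultimately show ?thesis by (simp add: fourier_borel)
qed

text \<open>Repeated derivatives in a single direction j bound |\<xi>_j|^N times the transform, and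
  the norm of \<xi> is at most d times its largest coordinate.\<close>

lemma fourier_schwartz_rapid:
  fixes u :: "real^'n \<Rightarrow> complex"
  assumes u: "u \<in> schwartz"
  shows "rapid (fourier u)"
  unfolding rapid_def
proof
  fix N :: nat
  have ind: "fourier (partials UNIV (replicate k j) u) \<xi> = (\<i> * of_real (\<xi> $ j)) ^ k * fourier u \<xi>" for k j \<xi>
  proof (induction k)
    case (Suc k)
    have "fourier (partial_within UNIV j (partials UNIV (replicate k j) u)) \<xi> = \<i> * of_real (\<xi> $ j) * fourier (partials UNIV (replicate k j) u) \<xi>"
    proof (rule fourier_partial)
      show "partial_within UNIV j (partials UNIV (replicate k j) u) differentiable at x" for x
        using schwartz_differentiable[OF u, of "j # replicate k j"] by simp
      show "rapid (partial_within UNIV j (partials UNIV (replicate k j) u))"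
        using schwartz_rapid_pure[OF u, of "Suc k" j] by simp
    qed (use schwartz_differentiable[OF u] schwartz_rapid_pure[OF u] in auto)
    then show ?case by (simp add: Suc mult_ac)
  qed simp
  have "\<exists>C. \<forall>\<xi>. \<bar>\<xi> $ j\<bar> ^ N * norm (fourier u \<xi>) \<le> C" for j
  proof -
    let ?D = "partials UNIV (replicate N j) u"
    have b: "?D \<in> borel_measurable borel"
      using schwartz_differentiable[OF u, of "replicate N j"]
      by (intro borel_measurable_continuous_onI differentiable_imp_continuous_on) (auto simp: differentiable_on_def)
    have i: "integrable lborel ?D" by (rule rapid_integrable[OF schwartz_rapid_pure[OF u] b])
    have "\<bar>\<xi> $ j\<bar> ^ N * norm (fourier u \<xi>) \<le> (\<integral>x. norm (?D x) \<partial>lborel)" for \<xi>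
    proof -
      have "\<bar>\<xi> $ j\<bar> ^ N * norm (fourier u \<xi>) = norm (fourier ?D \<xi>)"
        unfolding ind by (simp add: norm_mult norm_power)
      moreover have "ennreal (norm (fourier ?D \<xi>)) \<le> ennreal (\<integral>x. norm (?D x) \<partial>lborel)"
        using fourier_norm_le[OF b, of \<xi>] i by (simp add: nn_integral_eq_integral)
      ultimately show ?thesis by (simp add: ennreal_le_iff)
    qed
    then show ?thesis by blast
  qed
  then obtain C where C: "\<And>j \<xi>. \<bar>\<xi> $ j\<bar> ^ N * norm (fourier u \<xi>) \<le> C j" by metis
  have C0: "0 \<le> C j" for j using C[of 0 j] by (rule order.trans[rotated]) simp
  have "norm \<xi> ^ N * norm (fourier u \<xi>) \<le> real CARD('n) ^ N * (\<Sum>j\<in>UNIV. C j)" for \<xi>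
  proof -
    have "\<exists>j. norm \<xi> \<le> real CARD('n) * \<bar>\<xi> $ j\<bar>"
    proof -
      obtain j where j: "\<And>i. \<bar>\<xi> $ i\<bar> \<le> \<bar>\<xi> $ j\<bar>"
        using Max_ge[of "range (\<lambda>i. \<bar>\<xi> $ i\<bar>)"] Max_in[of "range (\<lambda>i. \<bar>\<xi> $ i\<bar>)"] by fastforce
      have "norm \<xi> \<le> (\<Sum>i\<in>UNIV. \<bar>\<xi> $ i\<bar>)" by (rule norm_le_l1_cart)
      also have "\<dots> \<le> real CARD('n) * \<bar>\<xi> $ j\<bar>" using j by (intro sum_bounded_above) auto
      finally show ?thesis by blast
    qed
    then obtain j where j: "norm \<xi> \<le> real CARD('n) * \<bar>\<xi> $ j\<bar>" by blast
    have "norm \<xi> ^ N * norm (fourier u \<xi>) \<le> (real CARD('n) * \<bar>\<xi> $ j\<bar>) ^ N * norm (fourier u \<xi>)"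
      by (intro mult_right_mono power_mono j) auto
    also have "\<dots> = real CARD('n) ^ N * (\<bar>\<xi> $ j\<bar> ^ N * norm (fourier u \<xi>))"
      by (simp add: power_mult_distrib)
    also have "\<dots> \<le> real CARD('n) ^ N * (\<Sum>j\<in>UNIV. C j)"
      using C0 by (intro mult_left_mono order.trans[OF C] member_le_sum) auto
    finally show ?thesis .
  qed
  then show "\<exists>C. \<forall>\<xi>. norm \<xi> ^ N * norm (fourier u \<xi>) \<le> C" by blast
qed

text \<open>The multiplication formula for Fourier integrals, by Fubini.\<close>

lemma has_fourier_schwartz:
  fixes u :: "real^'n \<Rightarrow> complex"
  assumes u: "u \<in> schwartz"
  shows "has_fourier u (fourier u)"
proof -
  note [measurable] = schwartz_borel[OF u]
  show ?thesis
  proof (subst has_fourier_borel_iff; (measurable)?; intro ballI conjI)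
    fix \<phi> :: "real^'n \<Rightarrow> complex" assume \<phi>: "\<phi> \<in> schwartz"
    note [measurable] = schwartz_borel[OF \<phi>]
    let ?f = "\<lambda>x \<xi>. u x * (exp (- (\<i> * of_real (x \<bullet> \<xi>))) * \<phi> \<xi>)"
    have m: "(\<lambda>(x, \<xi>). ?f x \<xi>) \<in> borel_measurable (lborel \<Otimes>\<^sub>M lborel)" by measurable
    have fin: "(\<integral>\<^sup>+x. \<integral>\<^sup>+\<xi>. ennreal (norm (?f x \<xi>)) \<partial>lborel \<partial>lborel) < \<infinity>"
    proof -
      have "(\<integral>\<^sup>+x. \<integral>\<^sup>+\<xi>. ennreal (norm (?f x \<xi>)) \<partial>lborel \<partial>lborel) = (\<integral>\<^sup>+x. ennreal (norm (u x)) \<partial>lborel) * (\<integral>\<^sup>+\<xi>. ennreal (norm (\<phi> \<xi>)) \<partial>lborel)"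
        by (simp add: norm_mult ennreal_mult nn_integral_cmult nn_integral_multc)
      also have "\<dots> < \<infinity>"
        using schwartz_integrable[OF u] schwartz_integrable[OF \<phi>] by (simp add: integrable_iff_bounded ennreal_mult_less_top)
      finally show ?thesis .
    qed
    have 1: "(\<integral>\<xi>. ?f x \<xi> \<partial>lborel) = u x * fourier \<phi> x" for x
      by (simp add: fourier_borel inner_commute)
    have 2: "(\<integral>x. ?f x \<xi> \<partial>lborel) = fourier u \<xi> * \<phi> \<xi>" for \<xi>
      unfolding fourier_borel[OF schwartz_borel[OF u]] integral_mult_left_zero[symmetric] by (simp only: mult_ac)
    show "integrable lborel (\<lambda>x. u x * fourier \<phi> x)"
      using Fubini_complex_int1[OF sigma_finite_lborel sigma_finite_lborel m fin] unfolding 1 .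
    show "integrable lborel (\<lambda>x. fourier u x * \<phi> x)"
      using Fubini_complex_int2[OF sigma_finite_lborel sigma_finite_lborel m fin] unfolding 2 .
    show "(\<integral>x. u x * fourier \<phi> x \<partial>lborel) = (\<integral>\<xi>. fourier u \<xi> * \<phi> \<xi> \<partial>lborel)"
      using Fubini_complex_eq[OF sigma_finite_lborel sigma_finite_lborel m fin] unfolding 1 2 .
  qed
qed

section \<open>Mixed derivatives\<close>

text \<open>The second difference over a square of side h, evaluated by the mean value theorem in
  both orders, is h^2 times either mixed derivative at some interior point. As h tends to 0,
  continuity at the origin identifies the limits.\<close>

lemma clairaut_real:
  fixes \<phi> \<phi>s \<phi>t \<phi>st \<phi>ts :: "real \<Rightarrow> real \<Rightarrow> real"
  assumes r: "0 < r"
    and ds: "\<And>s t. \<bar>s\<bar> < r \<Longrightarrow> \<bar>t\<bar> < r \<Longrightarrow> DERIV (\<lambda>s. \<phi> s t) s :> \<phi>s s t"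
    and dt: "\<And>s t. \<bar>s\<bar> < r \<Longrightarrow> \<bar>t\<bar> < r \<Longrightarrow> DERIV (\<lambda>t. \<phi> s t) t :> \<phi>t s t"
    and dst: "\<And>s t. \<bar>s\<bar> < r \<Longrightarrow> \<bar>t\<bar> < r \<Longrightarrow> DERIV (\<lambda>t. \<phi>s s t) t :> \<phi>st s t"
    and dts: "\<And>s t. \<bar>s\<bar> < r \<Longrightarrow> \<bar>t\<bar> < r \<Longrightarrow> DERIV (\<lambda>s. \<phi>t s t) s :> \<phi>ts s t"
    and cst: "isCont (\<lambda>p. \<phi>st (fst p) (snd p)) (0, 0)"
    and cts: "isCont (\<lambda>p. \<phi>ts (fst p) (snd p)) (0, 0)"
  shows "\<phi>st 0 0 = \<phi>ts 0 0"
proof -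
  have ex: "\<exists>a b c d. 0 < a \<and> a < h \<and> 0 < b \<and> b < h \<and> 0 < c \<and> c < h \<and> 0 < d \<and> d < h \<and> \<phi>st a b = \<phi>ts c d"
    if h: "0 < h" "h < r" for h
  proof -
    have "\<exists>a>0. a < h \<and> (\<phi> h h - \<phi> h 0) - (\<phi> 0 h - \<phi> 0 0) = (h - 0) * (\<phi>s a h - \<phi>s a 0)"
      by (rule MVT2[of 0 h "\<lambda>s. \<phi> s h - \<phi> s 0"]) (use h in \<open>auto intro!: DERIV_diff ds\<close>)
    then obtain a where a: "0 < a" "a < h" "(\<phi> h h - \<phi> h 0) - (\<phi> 0 h - \<phi> 0 0) = h * (\<phi>s a h - \<phi>s a 0)" by auto
    have "\<exists>b>0. b < h \<and> \<phi>s a h - \<phi>s a 0 = (h - 0) * \<phi>st a b"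
      by (rule MVT2) (use h a in \<open>auto intro!: dst\<close>)
    then obtain b where b: "0 < b" "b < h" "\<phi>s a h - \<phi>s a 0 = h * \<phi>st a b" by auto
    have "\<exists>d>0. d < h \<and> (\<phi> h h - \<phi> 0 h) - (\<phi> h 0 - \<phi> 0 0) = (h - 0) * (\<phi>t h d - \<phi>t 0 d)"
      by (rule MVT2[of 0 h "\<lambda>t. \<phi> h t - \<phi> 0 t"]) (use h in \<open>auto intro!: DERIV_diff dt\<close>)
    then obtain d where d: "0 < d" "d < h" "(\<phi> h h - \<phi> 0 h) - (\<phi> h 0 - \<phi> 0 0) = h * (\<phi>t h d - \<phi>t 0 d)" by auto
    have "\<exists>c>0. c < h \<and> \<phi>t h d - \<phi>t 0 d = (h - 0) * \<phi>ts c d"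
      by (rule MVT2[of 0 h "\<lambda>s. \<phi>t s d"]) (use h d in \<open>auto intro!: dts\<close>)
    then obtain c where c: "0 < c" "c < h" "\<phi>t h d - \<phi>t 0 d = h * \<phi>ts c d" by auto
    have "h * (h * \<phi>st a b) = h * (h * \<phi>ts c d)"
      using a(3)[unfolded b(3)] d(3)[unfolded c(3)] by linarith
    then have "\<phi>st a b = \<phi>ts c d" using h by simp
    then show ?thesis using a b c d by blast
  qed
  \<comment> \<open>The shift by 2 makes every side strictly smaller than r.\<close>
  define h where "h n = r / real (n + 2)" for n
  have h: "0 < h n" "h n < r" for n
    using r divide_strict_left_mono[of 1 "real (n + 2)" r] by (simp_all add: h_def)
  have h0: "h \<longlonglongrightarrow> 0" unfolding h_def by real_asymp
  from ex[OF h] obtain a b c d where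
    abcd: "\<And>n. 0 < a n \<and> a n < h n \<and> 0 < b n \<and> b n < h n \<and> 0 < c n \<and> c n < h n \<and> 0 < d n \<and> d n < h n \<and> \<phi>st (a n) (b n) = \<phi>ts (c n) (d n)"
    by metis
  have lim: "x \<longlonglongrightarrow> 0" if "\<And>n. 0 < x n \<and> x n < h n" for x :: "nat \<Rightarrow> real"
    by (rule tendsto_sandwich[OF _ _ tendsto_const h0]) (use that in \<open>auto intro!: always_eventually less_imp_le\<close>)
  have "(\<lambda>n. \<phi>st (a n) (b n)) \<longlonglongrightarrow> \<phi>st 0 0"
    using isCont_tendsto_compose[OF cst, of "\<lambda>n. (a n, b n)" sequentially] abcd
    by (auto intro!: tendsto_Pair lim)
  moreover have "(\<lambda>n. \<phi>ts (c n) (d n)) \<longlonglongrightarrow> \<phi>ts 0 0"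
    using isCont_tendsto_compose[OF cts, of "\<lambda>n. (c n, d n)" sequentially] abcd
    by (auto intro!: tendsto_Pair lim)
  ultimately show ?thesis using abcd LIMSEQ_unique by simp
qed

text \<open>Restriction to the plane through \<xi> spanned by v and w, separately for real and
  imaginary parts, since the mean value theorem is about real functions.\<close>

lemma clairaut:
  fixes g :: "'a::real_normed_vector \<Rightarrow> complex"
  assumes U: "open U" "\<xi> \<in> U"
    and g: "\<And>x. x \<in> U \<Longrightarrow> (g has_derivative g' x) (at x)"
    and gi: "\<And>x. x \<in> U \<Longrightarrow> ((\<lambda>x. g' x v) has_derivative gv x) (at x)"
    and gj: "\<And>x. x \<in> U \<Longrightarrow> ((\<lambda>x. g' x w) has_derivative gw x) (at x)"
    and c: "continuous_on U (\<lambda>x. gv x w)" "continuous_on U (\<lambda>x. gw x v)"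
  shows "gv \<xi> w = gw \<xi> v"
proof -
  define P where "P s t = \<xi> + s *\<^sub>R v + t *\<^sub>R w" for s t
  obtain e where e: "0 < e" "ball \<xi> e \<subseteq> U" using U by (auto simp: open_contains_ball)
  define r where "r = e / (norm v + norm w + 1)"
  have r: "0 < r" using e by (auto simp: r_def intro!: divide_pos_pos add_nonneg_pos)
  have PU: "P s t \<in> U" if "\<bar>s\<bar> < r" "\<bar>t\<bar> < r" for s t
  proof -
    have "P s t - \<xi> = s *\<^sub>R v + t *\<^sub>R w" by (simp add: P_def)
    then have "dist \<xi> (P s t) = norm (s *\<^sub>R v + t *\<^sub>R w)"
      by (metis dist_norm dist_commute)
    also have "\<dots> \<le> \<bar>s\<bar> * norm v + \<bar>t\<bar> * norm w"
      using norm_triangle_ineq[of "s *\<^sub>R v" "t *\<^sub>R w"] by simp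
    also have "\<dots> \<le> r * norm v + r * norm w"
      using that by (intro add_mono mult_right_mono) auto
    also have "\<dots> < r * (norm v + norm w + 1)" using r by (simp add: algebra_simps)
    also have "\<dots> = e" by (simp add: r_def add_nonneg_eq_0_iff)
    finally show ?thesis using e(2) by auto
  qed
  have key: "T (gv \<xi> w) = T (gw \<xi> v)" if T: "bounded_linear T" for T :: "complex \<Rightarrow> real"
  proof -
    have D: "DERIV (\<lambda>s. T (k (p + s *\<^sub>R z))) s :> T (k' z)"
      if "(k has_derivative k') (at (p + s *\<^sub>R z))" for k :: "'a \<Rightarrow> complex" and k' p z s
    proof -
      have "((\<lambda>s. p + s *\<^sub>R z) has_derivative (\<lambda>h. h *\<^sub>R z)) (at s)"
        by (auto intro!: derivative_eq_intros)
      from has_derivative_compose[OF this that]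
      have "((\<lambda>s. k (p + s *\<^sub>R z)) has_derivative (\<lambda>h. k' (h *\<^sub>R z))) (at s)" .
      from bounded_linear.has_derivative[OF T this]
      have "((\<lambda>s. T (k (p + s *\<^sub>R z))) has_derivative (\<lambda>h. T (k' (h *\<^sub>R z)))) (at s)" .
      moreover have "T (k' (h *\<^sub>R z)) = T (k' z) * h" for h
        using that T by (simp add: has_derivative_def bounded_linear.linear linear_cmul)
      ultimately show ?thesis by (simp add: has_field_derivative_def mult_commute_abs)
    qed
    have "(\<lambda>s t. T (gv (P s t) w)) 0 0 = (\<lambda>s t. T (gw (P s t) v)) 0 0"
    proof (rule clairaut_real[OF r, where \<phi>="\<lambda>s t. T (g (P s t))" and \<phi>s="\<lambda>s t. T (g' (P s t) v)"
          and \<phi>t="\<lambda>s t. T (g' (P s t) w)" and \<phi>st="\<lambda>s t. T (gv (P s t) w)" and \<phi>ts="\<lambda>s t. T (gw (P s t) v)"])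
      fix s t :: real assume st: "\<bar>s\<bar> < r" "\<bar>t\<bar> < r"
      have P1: "P s t = (\<xi> + t *\<^sub>R w) + s *\<^sub>R v" for s t by (simp add: P_def)
      have P2: "P s t = (\<xi> + s *\<^sub>R v) + t *\<^sub>R w" for s t by (simp add: P_def)
      show "DERIV (\<lambda>s. T (g (P s t))) s :> T (g' (P s t) v)"
        using D[of g "g' (P s t)" "\<xi> + t *\<^sub>R w" s v] g[OF PU[OF st]] by (simp add: P1)
      show "DERIV (\<lambda>t. T (g (P s t))) t :> T (g' (P s t) w)"
        using D[of g "g' (P s t)" "\<xi> + s *\<^sub>R v" t w] g[OF PU[OF st]] by (simp add: P2)
      show "DERIV (\<lambda>t. T (g' (P s t) v)) t :> T (gv (P s t) w)"
        using D[of "\<lambda>x. g' x v" "gv (P s t)" "\<xi> + s *\<^sub>R v" t w] gi[OF PU[OF st]] by (simp add: P2)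
      show "DERIV (\<lambda>s. T (g' (P s t) w)) s :> T (gw (P s t) v)"
        using D[of "\<lambda>x. g' x w" "gw (P s t)" "\<xi> + t *\<^sub>R w" s v] gj[OF PU[OF st]] by (simp add: P1)
    next
      have cont: "isCont (\<lambda>p. T (k (P (fst p) (snd p)))) (0, 0)" if "continuous_on U k" for k
      proof -
        have "isCont k \<xi>" using that U by (simp add: continuous_on_eq_continuous_at)
        then have "isCont k (P (fst (0, 0)) (snd (0, 0)))" by (simp add: P_def)
        moreover have "isCont (\<lambda>p. P (fst p) (snd p)) (0, 0)" unfolding P_def by (intro continuous_intros)
        ultimately have "isCont (\<lambda>p. k (P (fst p) (snd p))) (0, 0)" by (rule isCont_o2[rotated])
        then show ?thesis by (rule bounded_linear.isCont[OF T])
      qed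
      show "isCont (\<lambda>p. T (gv (P (fst p) (snd p)) w)) (0, 0)" "isCont (\<lambda>p. T (gw (P (fst p) (snd p)) v)) (0, 0)"
        by (rule cont[OF c(1)], rule cont[OF c(2)])
    qed
    then show ?thesis by (simp add: P_def)
  qed
  show ?thesis using key[OF bounded_linear_Re] key[OF bounded_linear_Im] by (simp add: complex_eq_iff)
qed

lemma smooth_on_differentiable_at:
  assumes "smooth_on S f" "x \<in> interior S"
  shows "partials S is f differentiable (at x)"
  using assms interior_subset[of S] at_within_interior[OF assms(2)]
  unfolding smooth_on_def differentiable_on_def by (metis subsetD)

lemma partial_within_interior:
  "x \<in> interior S \<Longrightarrow> partial_within S i g x = frechet_derivative g (at x) (axis i 1)"
  unfolding partial_within_def by (subst at_within_interior) auto

lemma smooth_on_continuous_interior: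
  assumes "smooth_on S f"
  shows "continuous_on (interior S) (partials S is f)"
  using smooth_on_differentiable_at[OF assms]
  by (auto intro!: continuous_at_imp_continuous_on differentiable_imp_continuous_within)

text \<open>Rearranged derivatives agree only on the interior of S, so the next derivative has to be
  seen to depend on the values there alone.\<close>

lemma partial_within_cong_interior:
  assumes eq: "\<And>x. x \<in> interior S \<Longrightarrow> g x = h x" and d: "\<And>x. x \<in> interior S \<Longrightarrow> g differentiable (at x)"
    and x: "x \<in> interior S"
  shows "partial_within S i g x = partial_within S i h x"
proof -
  have g: "(g has_derivative frechet_derivative g (at x)) (at x)"
    using d[OF x] frechet_derivative_works by blast
  have "(h has_derivative frechet_derivative g (at x)) (at x)"
    by (rule has_derivative_transform_within_open[OF g open_interior x eq])
  from frechet_derivative_at[OF this] show ?thesis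
    by (simp add: partial_within_interior[OF x])
qed

lemma partials_swap:
  assumes f: "smooth_on S f" and x: "x \<in> interior S"
  shows "partials S (i # j # is) f x = partials S (j # i # is) f x"
proof -
  let ?g = "partials S is f"
  have D: "(partials S js f has_derivative frechet_derivative (partials S js f) (at x)) (at x)" if "x \<in> interior S" for js x
    using smooth_on_differentiable_at[OF f that] frechet_derivative_works by blast
  have tr: "((\<lambda>x. frechet_derivative ?g (at x) (axis k 1)) has_derivative frechet_derivative (partials S (k # is) f) (at x)) (at x)"
    if "x \<in> interior S" for k x
    by (rule has_derivative_transform_within_open[OF D[OF that, of "k # is"] open_interior that])
       (simp add: partial_within_interior)
  have co: "continuous_on (interior S) (\<lambda>x. frechet_derivative (partials S (k # is) f) (at x) (axis l 1))" for k l
    by (rule continuous_on_eq[OF smooth_on_continuous_interior[OF f, of "l # k # is"]])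
       (simp add: partial_within_interior)
  have "frechet_derivative (partials S (j # is) f) (at x) (axis i 1) = frechet_derivative (partials S (i # is) f) (at x) (axis j 1)"
    by (rule clairaut[OF open_interior x D tr tr co co])
  then show ?thesis by (simp add: partial_within_interior[OF x])
qed

text \<open>\<open>multi_deriv\<close> leaves the order of differentiation to an arbitrary choice.
  On the interior, where derivatives within S are ordinary ones, adjacent swaps show that the order
  is irrelevant.\<close>

lemma partials_perm:
  assumes f: "smooth_on S f" and "mset is = mset js"
  shows "\<forall>x\<in>interior S. partials S is f x = partials S js f x"
  using assms(2)
proof (induction "is" arbitrary: js)
  case (Cons i "is")
  have cong: "\<forall>x\<in>interior S. partials S (k # l) f x = partials S (k # l') f x"
    if "\<forall>x\<in>interior S. partials S l f x = partials S l' f x" for k l l'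
    using partial_within_cong_interior[of S "partials S l f" "partials S l' f"] that smooth_on_differentiable_at[OF f] by simp
  have move: "\<forall>x\<in>interior S. partials S (as @ i # bs) f x = partials S (i # as @ bs) f x" for as bs
  proof (induction as)
    case (Cons a as)
    from cong[OF Cons, of a] show ?case using partials_swap[OF f] by simp
  qed simp
  have "i \<in> set js" using Cons.prems by (metis list.set_intros(1) set_mset_mset)
  then obtain as bs where js: "js = as @ i # bs" by (meson split_list)
  then have "mset is = mset (as @ bs)" using Cons.prems by simp
  from cong[OF Cons.IH[OF this], of i] show ?case using move[of as bs] by (simp add: js)
qed simp

text \<open>Derivatives of order at most one in each variable: these are the ones of the symbol that
  enter the estimates.\<close>

definition mixed :: "(real^'n) set \<Rightarrow> 'n set \<Rightarrow> (real^'n \<Rightarrow> complex) \<Rightarrow> real^'n \<Rightarrow> complex" where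
  "mixed S A f = multi_deriv S (\<lambda>i. if i \<in> A then 1 else 0) f"

text \<open>Literally the choice made inside \<open>multi_deriv\<close>, so that
  \<open>mixed\<close> unfolds to iterated partial derivatives along this list.\<close>

definition mixed_list :: "('n::finite) set \<Rightarrow> 'n list" where
  "mixed_list A = (SOME is. \<forall>i. count_list is i = (if i \<in> A then 1 else 0))"

lemma count_mixed_list: "count_list (mixed_list A) i = (if i \<in> A then 1 else 0)"
proof -
  obtain l where l: "set l = A" "distinct l" using finite_distinct_list[of A] by auto
  have "\<forall>i. count_list l i = (if i \<in> A then 1 else 0)"
    using l unfolding distinct_count_atmost_1 count_mset by simp
  then show ?thesis unfolding mixed_list_def by (rule someI2) blast
qed

lemma mixed_eq: "mixed S A f = partials S (mixed_list A) f"
  by (simp add: mixed_def multi_deriv_def mixed_list_def)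

lemma mixed_empty: "mixed S {} f = f"
  using multi_deriv_zero[of S f] by (simp add: mixed_def)

text \<open>The lists chosen for A and for \<open>insert i A\<close> are unrelated as lists, but
  they agree as multisets once i is added to the first.\<close>

lemma mixed_derivative:
  assumes f: "smooth_on S f" and x: "x \<in> interior S" and i: "i \<notin> A"
  shows "frechet_derivative (mixed S A f) (at x) (axis i 1) = mixed S (insert i A) f x"
proof -
  have "mset (i # mixed_list A) = mset (mixed_list (insert i A))"
    by (rule multiset_eqI) (use i in \<open>auto simp: count_mset count_mixed_list\<close>)
  from partials_perm[OF f this] x show ?thesis
    by (simp add: mixed_eq partial_within_interior)
qed

section \<open>Reproducing kernel on a cube\<close>

definition kint :: "real \<Rightarrow> real \<Rightarrow> real set" where
  "kint l x = (if 0 \<le> x then {x..x + l} else {x - l..x})"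

text \<open>Averaging the fundamental theorem of calculus over an interval of length l that starts at x and
  points away from 0 represents f x as the integral of \<open>kern l False x y\<close> times f y plus \<open>kern l True x y\<close> times
  the derivative of f at y.\<close>

definition kern :: "real \<Rightarrow> bool \<Rightarrow> real \<Rightarrow> real \<Rightarrow> real" where
  "kern l b x y = indicator (kint l x) y *
     (if b then (if 0 \<le> x then - (1 - (y - x) / l) else 1 - (x - y) / l) else 1 / l)"

lemma kint_measurable [measurable]: "Measurable.pred (borel \<Otimes>\<^sub>M borel) (\<lambda>p. snd p \<in> kint l (fst p))"
proof -
  have "(\<lambda>p. snd p \<in> kint l (fst p)) = (\<lambda>p. 0 \<le> fst p \<and> fst p \<le> snd p \<and> snd p \<le> fst p + l \<or>
      fst p < 0 \<and> fst p - l \<le> snd p \<and> snd p \<le> fst p)"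
    by (auto simp: kint_def fun_eq_iff)
  also have "Measurable.pred (borel \<Otimes>\<^sub>M borel) \<dots>"
    by measurable
  finally show ?thesis .
qed

lemma kern_measurable [measurable]: "(\<lambda>p. kern l b (fst p) (snd p)) \<in> borel_measurable (borel \<Otimes>\<^sub>M borel)"
proof -
  have "(\<lambda>p. kern l b (fst p) (snd p)) = (\<lambda>p. (if snd p \<in> kint l (fst p) then 1 else 0) *
     (if b then (if 0 \<le> fst p then - (1 - (snd p - fst p) / l) else 1 - (fst p - snd p) / l) else 1 / l))"
    by (auto simp: kern_def indicator_def fun_eq_iff)
  also have "\<dots> \<in> borel_measurable (borel \<Otimes>\<^sub>M borel)"
    by measurable
  finally show ?thesis .
qed

lemma kern_bound:
  assumes "0 < l"
  shows "\<bar>kern l b x y\<bar> \<le> indicator (kint l x) y * (if b then 1 else 1 / l)"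
  using assms by (auto simp: kern_def kint_def indicator_def abs_le_iff field_simps)

text \<open>Integration by parts with the affine function q of slope 1/l that vanishes at the end of
  the interval opposite to x. In either orientation the boundary term at x is \<phi> x, since q is
  -1 at a left end and 1 at a right end.\<close>

lemma kern_reproduce:
  fixes \<phi> \<phi>' :: "real \<Rightarrow> complex"
  assumes l: "0 < l"
    and d: "\<And>y. y \<in> kint l x \<Longrightarrow> (\<phi> has_vector_derivative \<phi>' y) (at y within kint l x)"
    and c: "continuous_on (kint l x) \<phi>'"
  shows "(\<integral>y. kern l False x y *\<^sub>R \<phi> y + kern l True x y *\<^sub>R \<phi>' y \<partial>lborel) = \<phi> x"
proof -
  obtain a b where ab: "kint l x = {a..b}" "a \<le> b"
    using l by (cases "0 \<le> x") (auto simp: kint_def)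
  define q where "q y = (if 0 \<le> x then - (1 - (y - x) / l) else 1 - (x - y) / l)" for y
  have q': "(q has_field_derivative 1 / l) (at y within T)" for y T
    unfolding q_def using l by (cases "0 \<le> x") (auto intro!: derivative_eq_intros)
  have cq: "continuous_on T q" for T unfolding q_def using l by (cases "0 \<le> x") (auto intro!: continuous_intros)
  have c\<phi>: "continuous_on {a..b} \<phi>"
    using d unfolding ab by (intro continuous_on_vector_derivative) auto
  have k0: "kern l False x y *\<^sub>R \<phi> y = indicator {a..b} y *\<^sub>R ((1 / l) *\<^sub>R \<phi> y)" for y
    by (simp add: kern_def ab)
  have k1: "kern l True x y *\<^sub>R \<phi>' y = indicator {a..b} y *\<^sub>R (q y *\<^sub>R \<phi>' y)" for y
    by (simp add: kern_def ab q_def)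
  have "(\<integral>y. kern l False x y *\<^sub>R \<phi> y + kern l True x y *\<^sub>R \<phi>' y \<partial>lborel)
    = (\<integral>y. indicator {a..b} y *\<^sub>R (q y *\<^sub>R \<phi>' y + (1 / l) *\<^sub>R \<phi> y) \<partial>lborel)"
    unfolding k0 k1 by (simp add: scaleR_add_right add.commute)
  also have "\<dots> = q b *\<^sub>R \<phi> b - q a *\<^sub>R \<phi> a"
  proof (rule integral_FTC_atLeastAtMost[OF ab(2)])
    show "((\<lambda>y. q y *\<^sub>R \<phi> y) has_vector_derivative q y *\<^sub>R \<phi>' y + (1 / l) *\<^sub>R \<phi> y) (at y within {a..b})" if "a \<le> y" "y \<le> b" for y
      using has_vector_derivative_scaleR[OF q' d[of y]] that by (simp add: ab)
    show "continuous_on {a..b} (\<lambda>y. q y *\<^sub>R \<phi>' y + (1 / l) *\<^sub>R \<phi> y)"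
      using c cq c\<phi> by (auto simp: ab intro!: continuous_intros)
  qed
  also have "\<dots> = \<phi> x"
  proof (cases "0 \<le> x")
    case True
    then have "a = x" "b = x + l" using ab l by (auto simp: kint_def Icc_eq_Icc)
    then show ?thesis using True l by (simp add: q_def)
  next
    case False
    then have "a = x - l" "b = x" using ab l by (auto simp: kint_def Icc_eq_Icc)
    then show ?thesis using False l by (simp add: q_def)
  qed
  finally show ?thesis .
qed

text \<open>The point whose coordinates in I are already integration variables while the others are
  still those of \<xi>; the induction over I leads from \<xi> to a free point.\<close>

definition vecof :: "'n set \<Rightarrow> real^'n \<Rightarrow> ('n \<Rightarrow> real) \<Rightarrow> real^'n" where
  "vecof I \<xi> y = (\<chi> i. if i \<in> I then y i else \<xi> $ i)"

definition cubeset :: "real \<Rightarrow> real^'n \<Rightarrow> (real^'n) set" where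
  "cubeset l \<xi> = {z. \<forall>i. z $ i \<in> kint l (\<xi> $ i)}"

lemma compact_cubeset: "compact (cubeset l \<xi>)"
proof -
  have "cubeset l \<xi> = cbox (\<chi> i. if 0 \<le> \<xi> $ i then \<xi> $ i else \<xi> $ i - l) (\<chi> i. if 0 \<le> \<xi> $ i then \<xi> $ i + l else \<xi> $ i)"
    by (auto simp: cubeset_def kint_def mem_box_cart split: if_splits)
  then show ?thesis by simp
qed

lemma vecof_measurable [measurable]:
  "vecof I \<xi> \<in> borel_measurable (PiM I (\<lambda>_. lborel))"
proof -
  have "vecof I \<xi> = (\<lambda>y. \<Sum>i\<in>UNIV. (if i \<in> I then y i else \<xi> $ i) *\<^sub>R axis i 1)"
    by (auto simp: vecof_def fun_eq_iff vec_eq_iff axis_def if_distrib[of "\<lambda>t. _ * t"] cong: if_cong)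
  moreover have "(\<lambda>y. if i \<in> I then y i else \<xi> $ i) \<in> borel_measurable (PiM I (\<lambda>_. lborel))" for i
    by (cases "i \<in> I") auto
  ultimately show ?thesis by simp
qed

text \<open>Outside the cube some factor of the kernel vanishes, and on the compact cube G is
  bounded; so G can be replaced by a bounded Borel function.\<close>

lemma kern_product_integrable:
  fixes G :: "real^'n \<Rightarrow> complex" and I :: "'n set"
  assumes l: "0 < l" and c: "continuous_on (cubeset l \<xi>) G"
  shows "integrable (PiM I (\<lambda>_. lborel)) (\<lambda>y. (\<Prod>i\<in>I. kern l (i \<in> A) (\<xi> $ i) (y i)) *\<^sub>R G (vecof I \<xi> y))"
proof -
  interpret product_sigma_finite "\<lambda>_::'n. lborel::real measure" by standard
  let ?C = "cubeset l \<xi>"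
  have C [measurable]: "?C \<in> sets borel" by (intro borel_closed compact_imp_closed compact_cubeset)
  have "bounded (G ` ?C)" using compact_continuous_image[OF c compact_cubeset] by (rule compact_imp_bounded)
  then obtain B where B: "\<And>z. z \<in> ?C \<Longrightarrow> norm (G z) \<le> B" "0 < B" unfolding bounded_pos by auto
  have [measurable]: "(\<lambda>z. indicator ?C z *\<^sub>R G z) \<in> borel_measurable borel"
    by (rule borel_measurable_continuous_on_indicator[OF C c])
  have km [measurable]: "(\<lambda>t. kern l b x t) \<in> borel_measurable borel" for b x
  proof -
    have "(\<lambda>t. (x, t)) \<in> borel \<rightarrow>\<^sub>M (borel \<Otimes>\<^sub>M borel)" by measurable
    from measurable_compose[OF this kern_measurable] show ?thesis by simp
  qed
  let ?k = "\<lambda>y. \<Prod>i\<in>I. kern l (i \<in> A) (\<xi> $ i) (y i)"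
  have eq: "?k y *\<^sub>R G (vecof I \<xi> y) = ?k y *\<^sub>R (indicator ?C (vecof I \<xi> y) *\<^sub>R G (vecof I \<xi> y))" for y
  proof (cases "vecof I \<xi> y \<in> ?C")
    case False
    then obtain i where i: "vecof I \<xi> y $ i \<notin> kint l (\<xi> $ i)" by (auto simp: cubeset_def)
    have "i \<in> I" using i l by (auto simp: vecof_def kint_def split: if_splits)
    moreover have "kern l (i \<in> A) (\<xi> $ i) (y i) = 0" using i \<open>i \<in> I\<close> by (simp add: kern_def vecof_def)
    ultimately have "?k y = 0" by (intro prod_zero) auto
    then show ?thesis by simp
  qed simp
  let ?m = "max 1 (1 / l)"
  have int: "integrable lborel (\<lambda>t. indicator (kint l x) t * ?m)" for x
  proof -
    have "integrable lborel (indicator (kint l x) :: real \<Rightarrow> real)"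
      by (rule integrable_real_indicator) (auto simp: kint_def emeasure_lborel_Icc_eq)
    then show ?thesis by (rule integrable_mult_left)
  qed
  show ?thesis
    unfolding eq
  proof (rule Bochner_Integration.integrable_bound)
    show "integrable (PiM I (\<lambda>_. lborel)) (\<lambda>y. B * (\<Prod>i\<in>I. indicator (kint l (\<xi> $ i)) (y i) * ?m))"
      by (intro integrable_mult_right product_integrable_prod int) auto
    show "(\<lambda>y. ?k y *\<^sub>R (indicator ?C (vecof I \<xi> y) *\<^sub>R G (vecof I \<xi> y))) \<in> borel_measurable (PiM I (\<lambda>_. lborel))"
    proof (rule borel_measurable_scaleR)
      show "?k \<in> borel_measurable (PiM I (\<lambda>_. lborel))"
        by (rule borel_measurable_prod) measurable
      show "(\<lambda>y. indicator ?C (vecof I \<xi> y) *\<^sub>R G (vecof I \<xi> y)) \<in> borel_measurable (PiM I (\<lambda>_. lborel))"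
        by (rule measurable_compose[OF vecof_measurable]) measurable
    qed
    show "AE y in PiM I (\<lambda>_. lborel). norm (?k y *\<^sub>R (indicator ?C (vecof I \<xi> y) *\<^sub>R G (vecof I \<xi> y))) \<le> norm (B * (\<Prod>i\<in>I. indicator (kint l (\<xi> $ i)) (y i) * ?m))"
    proof (rule AE_I2)
      fix y
      have "\<bar>?k y\<bar> \<le> (\<Prod>i\<in>I. indicator (kint l (\<xi> $ i)) (y i) * ?m)"
        unfolding abs_prod
      proof (intro prod_mono conjI)
        fix i
        have "\<bar>kern l (i \<in> A) (\<xi> $ i) (y i)\<bar> \<le> indicator (kint l (\<xi> $ i)) (y i) * (if i \<in> A then 1 else 1 / l)"
          by (rule kern_bound[OF l])
        also have "\<dots> \<le> indicator (kint l (\<xi> $ i)) (y i) * ?m"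
          by (intro mult_left_mono) auto
        finally show "\<bar>kern l (i \<in> A) (\<xi> $ i) (y i)\<bar> \<le> indicator (kint l (\<xi> $ i)) (y i) * ?m" .
      qed simp
      moreover have "norm (indicator ?C (vecof I \<xi> y) *\<^sub>R G (vecof I \<xi> y)) \<le> B"
        using B by (auto simp: indicator_def less_imp_le)
      ultimately have "\<bar>?k y\<bar> * norm (indicator ?C (vecof I \<xi> y) *\<^sub>R G (vecof I \<xi> y)) \<le> (\<Prod>i\<in>I. indicator (kint l (\<xi> $ i)) (y i) * ?m) * B"
        by (intro mult_mono) (auto intro: order.trans[OF abs_ge_zero])
      also have "\<dots> \<le> norm (B * (\<Prod>i\<in>I. indicator (kint l (\<xi> $ i)) (y i) * ?m))"
        by (simp only: mult.commute real_norm_def abs_ge_self)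
      finally show "norm (?k y *\<^sub>R (indicator ?C (vecof I \<xi> y) *\<^sub>R G (vecof I \<xi> y))) \<le> norm (B * (\<Prod>i\<in>I. indicator (kint l (\<xi> $ i)) (y i) * ?m))"
        by (simp only: norm_scaleR)
    qed
  qed
qed

text \<open>Induction on the set I of treated coordinates. In a new coordinate j the one-dimensional
  formula replaces \<open>F A\<close> by averages of \<open>F A\<close> and
  \<open>F (insert j A)\<close>, so the subset A records the coordinates in which a derivative was
  taken.\<close>

lemma cube_reproduce_partial:
  fixes F :: "'n::finite set \<Rightarrow> real^'n \<Rightarrow> complex"
  assumes l: "0 < l" and U: "cubeset l \<xi> \<subseteq> U"
    and D: "\<And>A z. z \<in> U \<Longrightarrow> F A differentiable (at z)"
    and F': "\<And>A i z. z \<in> U \<Longrightarrow> i \<notin> A \<Longrightarrow> frechet_derivative (F A) (at z) (axis i 1) = F (insert i A) z"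
  shows "F {} \<xi> = (\<Sum>A\<in>Pow I. \<integral>y. (\<Prod>i\<in>I. kern l (i \<in> A) (\<xi> $ i) (y i)) *\<^sub>R F A (vecof I \<xi> y) \<partial>PiM I (\<lambda>_. lborel))"
  using finite[of I]
proof (induction I rule: finite_induct)
  case empty
  interpret product_sigma_finite "\<lambda>_::'n. lborel::real measure" by standard
  interpret finite_measure "PiM {} (\<lambda>_::'n. lborel::real measure)"
    by rule (simp add: space_PiM)
  have "vecof {} \<xi> y = \<xi>" for y by (simp add: vecof_def)
  then show ?case by (simp add: space_PiM measure_def)
next
  case (insert j I)
  interpret product_sigma_finite "\<lambda>_::'n. lborel::real measure" by standard
  have cont: "continuous_on (cubeset l \<xi>) (F A)" for A
    using D U by (auto intro!: continuous_at_imp_continuous_on differentiable_imp_continuous_within)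
  let ?h = "\<lambda>J A y. (\<Prod>i\<in>J. kern l (i \<in> A) (\<xi> $ i) (y i)) *\<^sub>R F A (vecof J \<xi> y)"
  let ?P = "\<lambda>J. PiM J (\<lambda>_::'n. lborel::real measure)"
  have int: "integrable (?P J) (?h J A)" for J A
    by (rule kern_product_integrable[OF l cont])
  have step: "(\<integral>y. ?h (insert j I) A y \<partial>?P (insert j I)) + (\<integral>y. ?h (insert j I) (insert j A) y \<partial>?P (insert j I))
     = (\<integral>y. ?h I A y \<partial>?P I)" if A: "A \<subseteq> I" for A
  proof -
    have "(\<integral>y. ?h (insert j I) A y \<partial>?P (insert j I)) + (\<integral>y. ?h (insert j I) (insert j A) y \<partial>?P (insert j I))
      = (\<integral>y. ?h (insert j I) A y + ?h (insert j I) (insert j A) y \<partial>?P (insert j I))"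
      by (rule Bochner_Integration.integral_add[symmetric, OF int int])
    also have "\<dots> = (\<integral>y. (\<integral>t. ?h (insert j I) A (y(j := t)) + ?h (insert j I) (insert j A) (y(j := t)) \<partial>lborel) \<partial>?P I)"
      by (rule product_integral_insert[OF insert(1,2) Bochner_Integration.integrable_add[OF int int]])
    also have "\<dots> = (\<integral>y. ?h I A y \<partial>?P I)"
    proof (rule Bochner_Integration.integral_cong[OF refl])
      fix y :: "'n \<Rightarrow> real"
      define z where "z = vecof I \<xi> y"
      define Z where "Z t = z + (t - \<xi> $ j) *\<^sub>R axis j 1" for t
      define p where "p = (\<Prod>i\<in>I. kern l (i \<in> A) (\<xi> $ i) (y i))"
      have zj: "z $ j = \<xi> $ j" using insert(2) by (simp add: z_def vecof_def)
      have Z: "vecof (insert j I) \<xi> (y(j := t)) = Z t" for t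
        using insert(2) by (auto simp: vecof_def Z_def z_def vec_eq_iff axis_def)
      have jA: "j \<notin> A" using A insert(2) by auto
      have p1: "(\<Prod>i\<in>insert j I. kern l (i \<in> A) (\<xi> $ i) ((y(j := t)) i)) = kern l False (\<xi> $ j) t * p" for t
        using insert(1,2) jA by (auto simp: p_def intro!: arg_cong2[where f="(*)"] prod.cong)
      have p2: "(\<Prod>i\<in>insert j I. kern l (i \<in> insert j A) (\<xi> $ i) ((y(j := t)) i)) = kern l True (\<xi> $ j) t * p" for t
        using insert(1,2) A by (auto simp: p_def intro!: arg_cong2[where f="(*)"] prod.cong)
      have "(\<integral>t. ?h (insert j I) A (y(j := t)) + ?h (insert j I) (insert j A) (y(j := t)) \<partial>lborel)
        = (\<integral>t. p *\<^sub>R (kern l False (\<xi> $ j) t *\<^sub>R F A (Z t) + kern l True (\<xi> $ j) t *\<^sub>R F (insert j A) (Z t)) \<partial>lborel)"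
        unfolding p1 p2 Z by (simp add: scaleR_add_right mult.commute)
      also have "\<dots> = p *\<^sub>R (\<integral>t. kern l False (\<xi> $ j) t *\<^sub>R F A (Z t) + kern l True (\<xi> $ j) t *\<^sub>R F (insert j A) (Z t) \<partial>lborel)"
        by (rule integral_scaleR_right)
      \<comment> \<open>For p = 0 both sides vanish. Otherwise every averaged coordinate lies in its
        interval, which keeps the segment in direction j inside the cube.\<close>
      also have "\<dots> = p *\<^sub>R F A z"
      proof (cases "p = 0")
        case False
        have yi: "y i \<in> kint l (\<xi> $ i)" if "i \<in> I" for i
        proof -
          have "kern l (i \<in> A) (\<xi> $ i) (y i) \<noteq> 0" using False that insert(1) by (auto simp: p_def)
          then show ?thesis by (auto simp: kern_def indicator_def split: if_splits)
        qed
        have ZC: "Z t \<in> cubeset l \<xi>" if "t \<in> kint l (\<xi> $ j)" for t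
        proof -
          have "\<xi> $ i \<in> kint l (\<xi> $ i)" for i using l by (simp add: kint_def)
          then show ?thesis using that yi unfolding Z[symmetric] cubeset_def by (auto simp: vecof_def)
        qed
        have "(\<integral>t. kern l False (\<xi> $ j) t *\<^sub>R F A (Z t) + kern l True (\<xi> $ j) t *\<^sub>R F (insert j A) (Z t) \<partial>lborel) = F A (Z (\<xi> $ j))"
        proof (rule kern_reproduce[OF l])
          fix t assume t: "t \<in> kint l (\<xi> $ j)"
          then have ZU: "Z t \<in> U" using ZC U by auto
          have "(Z has_derivative (\<lambda>h. h *\<^sub>R axis j 1)) (at t within kint l (\<xi> $ j))"
            unfolding Z_def by (auto intro!: derivative_eq_intros)
          moreover have d: "(F A has_derivative frechet_derivative (F A) (at (Z t))) (at (Z t))"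
            using D[OF ZU] frechet_derivative_works by blast
          ultimately have "((\<lambda>t. F A (Z t)) has_derivative (\<lambda>h. frechet_derivative (F A) (at (Z t)) (h *\<^sub>R axis j 1))) (at t within kint l (\<xi> $ j))"
            by (rule has_derivative_compose)
          moreover have "frechet_derivative (F A) (at (Z t)) (h *\<^sub>R axis j 1) = h *\<^sub>R F (insert j A) (Z t)" for h
            using d F'[OF ZU jA] by (simp add: has_derivative_def bounded_linear.linear linear_cmul)
          ultimately show "((\<lambda>t. F A (Z t)) has_vector_derivative F (insert j A) (Z t)) (at t within kint l (\<xi> $ j))"
            by (simp add: has_vector_derivative_def)
        next
          show "continuous_on (kint l (\<xi> $ j)) (\<lambda>t. F (insert j A) (Z t))"
            by (rule continuous_on_compose2[OF cont]) (auto simp: Z_def intro!: continuous_intros ZC[unfolded Z_def])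
        qed
        also have "Z (\<xi> $ j) = z" by (simp add: Z_def)
        finally show ?thesis by simp
      qed simp
      finally show "(\<integral>t. ?h (insert j I) A (y(j := t)) + ?h (insert j I) (insert j A) (y(j := t)) \<partial>lborel) = ?h I A y"
        by (simp add: p_def z_def)
    qed
    finally show ?thesis .
  qed
  have inj: "inj_on (insert j) (Pow I)" using insert(2) by (auto simp: inj_on_def)
  have "F {} \<xi> = (\<Sum>A\<in>Pow I. \<integral>y. ?h I A y \<partial>?P I)" by (rule insert.IH)
  also have "\<dots> = (\<Sum>A\<in>Pow I. (\<integral>y. ?h (insert j I) A y \<partial>?P (insert j I)) + (\<integral>y. ?h (insert j I) (insert j A) y \<partial>?P (insert j I)))"
    by (intro sum.cong refl step[symmetric]) auto
  also have "\<dots> = (\<Sum>A\<in>Pow I. (\<integral>y. ?h (insert j I) A y \<partial>?P (insert j I))) + (\<Sum>A\<in>insert j ` Pow I. (\<integral>y. ?h (insert j I) A y \<partial>?P (insert j I)))"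
    unfolding sum.distrib sum.reindex[OF inj] by simp
  also have "\<dots> = (\<Sum>A\<in>Pow I \<union> insert j ` Pow I. (\<integral>y. ?h (insert j I) A y \<partial>?P (insert j I)))"
    using insert(1,2) by (intro sum.union_disjoint[symmetric]) auto
  also have "Pow I \<union> insert j ` Pow I = Pow (insert j I)" by (simp add: Pow_insert)
  finally show ?case .
qed

section \<open>Cube kernels and frozen frequencies for a dyadic shell\<close>

abbreviation parM :: "('n::finite \<Rightarrow> real) measure" where
  "parM \<equiv> PiM UNIV (\<lambda>_. lborel)"

definition cube_kernel :: "real \<Rightarrow> 'n set \<Rightarrow> real^'n \<Rightarrow> ('n \<Rightarrow> real) \<Rightarrow> real" where
  "cube_kernel l A \<xi> y = (\<Prod>i\<in>UNIV. kern l (i \<in> A) (\<xi> $ i) (y i))"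

text \<open>Parameters live in the function space because the cube formula is built coordinate by
  coordinate on \<open>PiM\<close>; the symbol is evaluated at the corresponding vector.\<close>

definition vec_of :: "('n \<Rightarrow> real) \<Rightarrow> real^'n" where
  "vec_of y = (\<chi> i. y i)"

lemma vecof_UNIV: "vecof UNIV \<xi> = vec_of"
  by (auto simp: vecof_def vec_of_def fun_eq_iff)

lemma vec_of_measurable [measurable]: "vec_of \<in> borel_measurable parM"
  using vecof_measurable[of UNIV] by (simp add: vecof_UNIV)

lemma sigma_finite_parM: "sigma_finite_measure (parM :: ('n::finite \<Rightarrow> real) measure)"
proof -
  interpret product_sigma_finite "\<lambda>_::'n. lborel::real measure" by standard
  interpret finite_product_sigma_finite "\<lambda>_::'n. lborel::real measure" UNIV by standard simp
  show ?thesis by (rule sigma_finite_measure_axioms)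
qed

lemma cube_reproduce:
  fixes F :: "'n::finite set \<Rightarrow> real^'n \<Rightarrow> complex"
  assumes "0 < l" "cubeset l \<xi> \<subseteq> U"
    and "\<And>A z. z \<in> U \<Longrightarrow> F A differentiable (at z)"
    and "\<And>A i z. z \<in> U \<Longrightarrow> i \<notin> A \<Longrightarrow> frechet_derivative (F A) (at z) (axis i 1) = F (insert i A) z"
  shows "F {} \<xi> = (\<Sum>A\<in>UNIV. \<integral>y. cube_kernel l A \<xi> y *\<^sub>R F A (vec_of y) \<partial>parM)"
  using cube_reproduce_partial[where I=UNIV, OF assms] by (simp add: cube_kernel_def vecof_UNIV)

lemma cube_kernel_measurable [measurable]:
  "(\<lambda>p. cube_kernel l A (fst p) (snd p)) \<in> borel_measurable (borel \<Otimes>\<^sub>M parM)"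
  unfolding cube_kernel_def
proof (intro borel_measurable_prod)
  fix i :: 'a
  have [measurable]: "(\<lambda>x::real^'a. x $ i) \<in> borel_measurable borel"
    by (intro borel_measurable_continuous_onI continuous_intros)
  have "(\<lambda>p::(real^'a) \<times> ('a \<Rightarrow> real). fst p $ i) \<in> borel_measurable (borel \<Otimes>\<^sub>M parM)"
    by (rule measurable_compose[OF measurable_fst]) measurable
  moreover have "(\<lambda>p::(real^'a) \<times> ('a \<Rightarrow> real). snd p i) \<in> borel_measurable (borel \<Otimes>\<^sub>M parM)"
    using measurable_compose[OF measurable_snd measurable_component_singleton[of i UNIV "\<lambda>_. lborel::real measure"], of "borel :: (real^'a) measure"] by simp
  ultimately have "(\<lambda>p::(real^'a) \<times> ('a \<Rightarrow> real). (fst p $ i, snd p i)) \<in> (borel \<Otimes>\<^sub>M parM) \<rightarrow>\<^sub>M (borel \<Otimes>\<^sub>M borel)"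
    by (rule measurable_Pair)
  then show "(\<lambda>p. kern l (i \<in> A) (fst p $ i) (snd p i)) \<in> borel_measurable (borel \<Otimes>\<^sub>M parM)"
    using measurable_compose[OF _ kern_measurable, of "\<lambda>p. (fst p $ i, snd p i)" "borel \<Otimes>\<^sub>M parM" l "i \<in> A"] by simp
qed

text \<open>A coordinate without derivative contributes the averaging density 1/l, a coordinate with
  a derivative at most 1.\<close>

lemma cube_kernel_abs_le:
  fixes A :: "'n::finite set"
  assumes l: "0 < l"
  shows "\<bar>cube_kernel l A \<xi> y\<bar> \<le> (1 / l) ^ (CARD('n) - card A)"
proof -
  have "\<bar>cube_kernel l A \<xi> y\<bar> \<le> (\<Prod>i\<in>UNIV. if i \<in> A then 1 else 1 / l)"
    unfolding cube_kernel_def abs_prod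
  proof (intro prod_mono conjI)
    fix i
    show "\<bar>kern l (i \<in> A) (\<xi> $ i) (y i)\<bar> \<le> (if i \<in> A then 1 else 1 / l)"
      using kern_bound[OF l, of "i \<in> A" "\<xi> $ i" "y i"] l by (auto simp: indicator_def split: if_splits intro: order.trans)
  qed simp
  also have "\<dots> = (\<Prod>i\<in>UNIV - A. 1 / l)"
    by (rule prod.mono_neutral_cong_right) auto
  also have "\<dots> = (1 / l) ^ (CARD('n) - card A)" by (simp add: card_Diff_subset)
  finally show ?thesis .
qed

lemma cube_kernel_nonzero: "cube_kernel l A \<xi> y \<noteq> 0 \<Longrightarrow> y i \<in> kint l (\<xi> $ i)"
  unfolding cube_kernel_def by (auto simp: kern_def indicator_def)

text \<open>The intervals point away from 0, so no coordinate decreases in absolute value. Hence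
  frozen frequencies stay where the derivatives of the symbol are controlled.\<close>

lemma cubeset_norm_ge:
  assumes "0 < l" "z \<in> cubeset l \<xi>"
  shows "norm \<xi> \<le> norm z"
proof (rule norm_le_componentwise_cart)
  fix i
  show "norm (\<xi> $ i) \<le> norm (z $ i)"
    using assms by (auto simp: cubeset_def kint_def dest!: spec[of _ i] split: if_splits)
qed

definition shell :: "nat \<Rightarrow> (real^'n) set" where
  "shell k = {\<xi>. 2 ^ k \<le> norm \<xi> \<and> norm \<xi> < 2 ^ Suc k}"

text \<open>A range of parameters common to all \<xi> of the shell: coordinates of \<xi> are below 2
  * 2^k in absolute value and an interval has length 2^k, hence the bound 3 * 2^k; the norm does not
  drop below 2^k.\<close>

definition parset :: "nat \<Rightarrow> ('n::finite \<Rightarrow> real) set" where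
  "parset k = {y \<in> space parM. (\<forall>i. \<bar>y i\<bar> \<le> 3 * 2 ^ k) \<and> 2 ^ k \<le> norm (vec_of y)}"

lemma shell_measurable [measurable]: "shell k \<in> sets borel"
  unfolding shell_def by measurable

lemma parset_measurable [measurable]: "parset k \<in> sets parM"
  unfolding parset_def by measurable

lemma cube_kernel_nonzero_parset:
  assumes "\<xi> \<in> shell k" "cube_kernel (2 ^ k) A \<xi> y \<noteq> 0"
  shows "y \<in> parset k"
proof -
  have y: "y i \<in> kint (2 ^ k) (\<xi> $ i)" for i by (rule cube_kernel_nonzero[OF assms(2)])
  then have "vec_of y \<in> cubeset (2 ^ k) \<xi>" by (simp add: cubeset_def vec_of_def)
  from cubeset_norm_ge[OF _ this] have "2 ^ k \<le> norm (vec_of y)"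
    using assms(1) by (simp add: shell_def)
  moreover have "\<bar>y i\<bar> \<le> 3 * 2 ^ k" for i
  proof -
    have "\<bar>\<xi> $ i\<bar> < 2 ^ Suc k" using component_le_norm_cart[of \<xi> i] assms(1) by (simp add: shell_def)
    then show ?thesis using y[of i] by (auto simp: kint_def split: if_splits)
  qed
  ultimately show ?thesis by (simp add: parset_def space_PiM)
qed

lemma emeasure_parset: "emeasure parM (parset k :: ('n::finite \<Rightarrow> real) set) \<le> ennreal ((6 * 2 ^ k) ^ CARD('n))"
proof -
  interpret product_sigma_finite "\<lambda>_::'n. lborel::real measure" by standard
  have "emeasure parM (parset k :: ('n \<Rightarrow> real) set) \<le> emeasure parM (Pi\<^sub>E UNIV (\<lambda>_::'n. {- (3 * 2 ^ k)..3 * 2 ^ k :: real}))"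
  proof (rule emeasure_mono)
    show "parset k \<subseteq> Pi\<^sub>E UNIV (\<lambda>_::'n. {- (3 * 2 ^ k)..3 * 2 ^ k :: real})"
    proof
      fix y :: "'n \<Rightarrow> real" assume "y \<in> parset k"
      then have "\<bar>y i\<bar> \<le> 3 * 2 ^ k" for i by (simp add: parset_def)
      from this[unfolded abs_le_iff] have "y i \<in> {- (3 * 2 ^ k)..3 * 2 ^ k}" for i
        unfolding atLeastAtMost_iff using minus_le_iff by blast
      then show "y \<in> Pi\<^sub>E UNIV (\<lambda>_::'n. {- (3 * 2 ^ k)..3 * 2 ^ k})" by (auto simp: PiE_def)
    qed
  qed (rule sets_PiM_I_finite, auto)
  also have "\<dots> = (\<Prod>i\<in>(UNIV::'n set). emeasure lborel {- (3 * 2 ^ k)..3 * 2 ^ k :: real})"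
    by (rule emeasure_PiM) auto
  also have "\<dots> = ennreal ((6 * 2 ^ k) ^ CARD('n))"
    by (simp add: ennreal_power)
  finally show ?thesis .
qed

lemma parset_norm:
  assumes "y \<in> parset k"
  shows "2 ^ k \<le> japanese (vec_of y :: real^'n)" "japanese (vec_of y :: real^'n) \<le> (1 + 3 * real CARD('n)) * 2 ^ k" "1 \<le> norm (vec_of y :: real^'n)"
proof -
  let ?z = "vec_of y :: real^'n"
  have 1: "2 ^ k \<le> norm ?z" using assms by (simp add: parset_def)
  then show "2 ^ k \<le> japanese ?z" using norm_le_japanese[of ?z] by linarith
  have "norm ?z \<le> (\<Sum>i\<in>UNIV. \<bar>?z $ i\<bar>)" by (rule norm_le_l1_cart)
  also have "\<dots> \<le> (\<Sum>i\<in>(UNIV::'n set). 3 * 2 ^ k)"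
    using assms by (intro sum_mono) (simp add: parset_def vec_of_def)
  finally have "norm ?z \<le> 3 * real CARD('n) * 2 ^ k" by simp
  moreover have "(1::real) \<le> 2 ^ k" by simp
  ultimately show "japanese ?z \<le> (1 + 3 * real CARD('n)) * 2 ^ k"
    using japanese_le[of ?z] unfolding distrib_right by linarith
  show "1 \<le> norm ?z" using 1 \<open>(1::real) \<le> 2 ^ k\<close> by linarith
qed

lemma powr_comparable:
  fixes a b K p :: real
  assumes "0 < b" "b \<le> a" "a \<le> K * b" "1 \<le> K"
  shows "a powr p \<le> K powr \<bar>p\<bar> * b powr p" and "b powr p \<le> K powr \<bar>p\<bar> * a powr p"
proof -
  have a: "0 < a" using assms by linarith
  have K1: "1 \<le> K powr \<bar>p\<bar>" using assms by (simp add: ge_one_powr_ge_zero)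
  have 1: "x powr p \<le> K powr \<bar>p\<bar> * y powr p" if "0 < x" "0 < y" "x \<le> K * y" "y \<le> K * x" for x y
  proof (cases "0 \<le> p")
    case True
    have "x powr p \<le> (K * y) powr p" using that True by (intro powr_mono2) auto
    also have "\<dots> = K powr \<bar>p\<bar> * y powr p" using that assms True by (simp add: powr_mult)
    finally show ?thesis .
  next
    case False
    have "x powr p \<le> (y / K) powr p"
      using that False assms by (intro powr_mono2') (auto simp: field_simps)
    also have "\<dots> = K powr \<bar>p\<bar> * y powr p" using that assms False by (simp add: powr_divide powr_minus field_simps)
    finally show ?thesis .
  qed
  have "b \<le> K * a" using assms a mult_mono[of 1 K b a] by simp
  then show "a powr p \<le> K powr \<bar>p\<bar> * b powr p" "b powr p \<le> K powr \<bar>p\<bar> * a powr p"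
    by - (rule 1[OF a assms(1) assms(3)], assumption, rule 1[OF assms(1) a _ assms(3)], assumption)
qed

abbreviation weighted_sq :: "real \<Rightarrow> (real^'n \<Rightarrow> complex) \<Rightarrow> ennreal" where
  "weighted_sq s f \<equiv> (\<integral>\<^sup>+\<xi>. (ennreal (japanese \<xi> powr s * norm (f \<xi>)))\<^sup>2 \<partial>lborel)"

section \<open>Block estimates on the Fourier side\<close>

lemma nn_integral_weighted_CS:
  fixes P h :: "'a \<Rightarrow> ennreal"
  assumes [measurable]: "P \<in> borel_measurable M" "h \<in> borel_measurable M"
  shows "(\<integral>\<^sup>+x. P x * h x \<partial>M)\<^sup>2 \<le> (\<integral>\<^sup>+x. h x \<partial>M) * (\<integral>\<^sup>+x. (P x)\<^sup>2 * h x \<partial>M)"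
  using Cauchy_Schwarz_nn_integral[of P "density M h" "\<lambda>_. 1"]
  by (simp add: nn_integral_density mult.commute emeasure_density)

text \<open>Minkowski's inequality for integrals in its L2 form: Cauchy-Schwarz with the weight h,
  then Fubini. The bound is demanded only where h does not vanish, so a restriction of the
  parameters can be encoded in h.\<close>

lemma weighted_young:
  fixes P :: "'a \<Rightarrow> 'b \<Rightarrow> ennreal" and h :: "'b \<Rightarrow> ennreal"
  assumes "sigma_finite_measure M" "sigma_finite_measure N"
    and P [measurable]: "(\<lambda>(x, y). P x y) \<in> borel_measurable (M \<Otimes>\<^sub>M N)"
    and h [measurable]: "h \<in> borel_measurable N"
    and B: "\<And>y. y \<in> space N \<Longrightarrow> h y \<noteq> 0 \<Longrightarrow> (\<integral>\<^sup>+x. (P x y)\<^sup>2 \<partial>M) \<le> B"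
  shows "(\<integral>\<^sup>+x. (\<integral>\<^sup>+y. P x y * h y \<partial>N)\<^sup>2 \<partial>M) \<le> B * (\<integral>\<^sup>+y. h y \<partial>N)\<^sup>2"
proof -
  interpret M: sigma_finite_measure M by fact
  interpret N: sigma_finite_measure N by fact
  interpret pair_sigma_finite M N ..
  have "(\<integral>\<^sup>+x. (\<integral>\<^sup>+y. P x y * h y \<partial>N)\<^sup>2 \<partial>M) \<le> (\<integral>\<^sup>+x. (\<integral>\<^sup>+y. h y \<partial>N) * (\<integral>\<^sup>+y. (P x y)\<^sup>2 * h y \<partial>N) \<partial>M)"
    by (intro nn_integral_mono nn_integral_weighted_CS) measurable
  also have "\<dots> = (\<integral>\<^sup>+y. h y \<partial>N) * (\<integral>\<^sup>+x. (\<integral>\<^sup>+y. (P x y)\<^sup>2 * h y \<partial>N) \<partial>M)"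
    by (rule nn_integral_cmult) measurable
  also have "(\<integral>\<^sup>+x. (\<integral>\<^sup>+y. (P x y)\<^sup>2 * h y \<partial>N) \<partial>M) = (\<integral>\<^sup>+y. (\<integral>\<^sup>+x. (P x y)\<^sup>2 * h y \<partial>M) \<partial>N)"
    by (rule Fubini'[symmetric]) measurable
  also have "\<dots> \<le> (\<integral>\<^sup>+y. B * h y \<partial>N)"
  proof (intro nn_integral_mono)
    fix y assume y: "y \<in> space N"
    have [measurable]: "(\<lambda>x. P x y) \<in> borel_measurable M"
      using measurable_compose[OF measurable_Pair2'[OF y] P] by simp
    have "(\<integral>\<^sup>+x. (P x y)\<^sup>2 * h y \<partial>M) = (\<integral>\<^sup>+x. (P x y)\<^sup>2 \<partial>M) * h y"
      by (rule nn_integral_multc) measurable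
    also have "\<dots> \<le> B * h y"
      by (cases "h y = 0") (auto intro!: mult_right_mono B y)
    finally show "(\<integral>\<^sup>+x. (P x y)\<^sup>2 * h y \<partial>M) \<le> B * h y" .
  qed
  also have "\<dots> = B * (\<integral>\<^sup>+y. h y \<partial>N)"
    by (rule nn_integral_cmult) measurable
  finally have "(\<integral>\<^sup>+x. (\<integral>\<^sup>+y. P x y * h y \<partial>N)\<^sup>2 \<partial>M) \<le> (\<integral>\<^sup>+y. h y \<partial>N) * (B * (\<integral>\<^sup>+y. h y \<partial>N))"
    by (simp add: mult_left_mono)
  then show ?thesis by (simp add: power2_eq_square mult_ac)
qed

lemma ennreal_power2_le_imp_le:
  assumes "x\<^sup>2 \<le> (ennreal c)\<^sup>2" "0 \<le> c"
  shows "x \<le> ennreal c"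
proof (cases x)
  case (real r)
  then have "r\<^sup>2 \<le> c\<^sup>2" using assms by (simp add: ennreal_power)
  then show ?thesis using real assms(2) power2_le_imp_le[of r c] by (simp add: ennreal_leI)
next
  case top
  then show ?thesis using assms by (simp add: ennreal_power top_unique)
qed

lemma ennreal_mult_sq:
  assumes "0 \<le> p"
  shows "ennreal p * (ennreal p * ennreal (x\<^sup>2)) = ennreal ((p * x)\<^sup>2)"
  using assms by (simp add: ennreal_mult[symmetric] power2_eq_square mult_ac)

lemma ennreal_sum_sq_le:
  fixes x :: "'a \<Rightarrow> ennreal"
  assumes "finite I"
  shows "(\<Sum>i\<in>I. x i)\<^sup>2 \<le> of_nat (card I) * (\<Sum>i\<in>I. (x i)\<^sup>2)"
  using nn_integral_weighted_CS[of x "count_space I" "\<lambda>_. 1"] assms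
  by (simp add: nn_integral_count_space_finite)

text \<open>What remains of \<open>block_symbol\<close> when each kernel is replaced by its bound:
  it is independent of \<xi> within the shell and still satisfies a weighted L2 bound in \<eta>. It
  serves where absolute values are harmless.\<close>

definition block_majorant :: "('n::finite set \<Rightarrow> real^'n \<Rightarrow> real^'n \<Rightarrow> complex) \<Rightarrow> nat \<Rightarrow> real^'n \<Rightarrow> ennreal" where
  "block_majorant GA k \<eta> = (\<Sum>A\<in>UNIV. ennreal ((1 / 2 ^ k) ^ (CARD('n) - card A)) *
      (\<integral>\<^sup>+y. ennreal (norm (GA A \<eta> (vec_of y))) * indicator (parset k) y \<partial>parM))"

text \<open>The Fourier transform in x of the reproducing formula for the cube of side
  \<open>2 ^ k\<close> at \<xi>.\<close>

definition block_symbol :: "('n::finite set \<Rightarrow> real^'n \<Rightarrow> real^'n \<Rightarrow> complex) \<Rightarrow> nat \<Rightarrow> real^'n \<Rightarrow> real^'n \<Rightarrow> complex" where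
  "block_symbol GA k \<eta> \<xi> = (\<Sum>A\<in>UNIV. \<integral>y. cube_kernel (2 ^ k) A \<xi> y *\<^sub>R GA A \<eta> (vec_of y) \<partial>parM)"

text \<open>\<open>6 ^ CARD('n)\<close> is the volume of the parameter box in units of the shell.
  The other factor compares a power of the weight at y with the same power of 2^k, uniformly in the
  number of derivatives.\<close>

definition blockC :: "real \<Rightarrow> 'n::finite itself \<Rightarrow> real" where
  "blockC m _ = 6 ^ CARD('n) * (1 + 3 * real CARD('n)) powr (\<bar>m\<bar> + real CARD('n))"

lemma blockC_pos: "0 < blockC m TYPE('n::finite)"
  by (simp add: blockC_def add_pos_nonneg)

text \<open>The powers belonging to the shell balance: 2^(-k(d - |A|)) from the kernel, 2^(kd) from
  the volume and 2^(k(m - |A|)) from the derivative multiply to 2^(km) for every A.\<close>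

lemma parset_weight:
  fixes A :: "'n::finite set"
  assumes y: "y \<in> parset k"
  shows "(1 / 2 ^ k) ^ (CARD('n) - card A) * (6 * 2 ^ k) ^ CARD('n) * japanese (vec_of y :: real^'n) powr (m - real (card A))
    \<le> blockC m TYPE('n) * (2 ^ k) powr m"
proof -
  let ?d = "CARD('n)" and ?K = "1 + 3 * real CARD('n)"
  have c: "card A \<le> ?d" by (intro card_mono) auto
  have J: "japanese (vec_of y :: real^'n) powr (m - real (card A)) \<le> ?K powr \<bar>m - real (card A)\<bar> * (2 ^ k) powr (m - real (card A))"
    by (rule powr_comparable(1)) (use parset_norm[OF y] in auto)
  also have "\<dots> \<le> ?K powr (\<bar>m\<bar> + real ?d) * (2 ^ k) powr (m - real (card A))"
    using c by (intro mult_right_mono powr_mono) auto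
  finally have "(1 / 2 ^ k) ^ (?d - card A) * (6 * 2 ^ k) ^ ?d * japanese (vec_of y :: real^'n) powr (m - real (card A))
    \<le> (1 / 2 ^ k) ^ (?d - card A) * (6 * 2 ^ k) ^ ?d * (?K powr (\<bar>m\<bar> + real ?d) * (2 ^ k) powr (m - real (card A)))"
    by (intro mult_left_mono) auto
  also have "\<dots> = blockC m TYPE('n) * (((1 / 2 ^ k) ^ (?d - card A) * (2 ^ k) ^ ?d) * (2 ^ k) powr (m - real (card A)))"
    by (simp add: blockC_def power_mult_distrib)
  also have "(1 / 2 ^ k) ^ (?d - card A) * (2 ^ k) ^ ?d = ((2::real) ^ k) ^ card A"
    using c by (simp add: power_divide power_diff field_simps)
  also have "((2::real) ^ k) ^ card A = (2 ^ k) powr real (card A)" by (simp add: powr_realpow)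
  also have "(2 ^ k) powr real (card A) * (2 ^ k) powr (m - real (card A)) = ((2::real) ^ k) powr m"
    by (simp add: powr_add[symmetric])
  finally show ?thesis .
qed

lemma card_UNIV_sets: "card (UNIV :: 'n::finite set set) = 2 ^ CARD('n)"
  using card_Pow[of "UNIV :: 'n set"] by simp

text \<open>The data: partial Fourier transforms of the low frequency part of the symbol (\<open>GL\<close>) and of
  its mixed derivatives at high frequencies (\<open>GA\<close>). The constant \<open>a\<close> stands for the Sobolev seminorms,
  \<open>b\<close> for the seminorm based on the supremum norm.\<close>

locale fourier_symbol =
  fixes GL :: "real^'n \<Rightarrow> real^'n \<Rightarrow> complex"
    and GA :: "'n::finite set \<Rightarrow> real^'n \<Rightarrow> real^'n \<Rightarrow> complex"
    and m \<tau> a b :: real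
  assumes GL_meas [measurable]: "(\<lambda>p. GL (fst p) (snd p)) \<in> borel_measurable (borel \<Otimes>\<^sub>M borel)"
    and GA_meas [measurable]: "\<And>A. (\<lambda>p. GA A (fst p) (snd p)) \<in> borel_measurable (borel \<Otimes>\<^sub>M borel)"
    and tau: "real CARD('n) / 2 < \<tau>" and a0: "0 \<le> a" and b0: "0 \<le> b"
    and GL_bound: "\<And>\<xi>. (weighted_sq \<tau> (\<lambda>\<eta>. GL \<eta> \<xi>)) \<le> ennreal (a\<^sup>2)"
    and GA_bound: "\<And>A z. 1 \<le> norm z \<Longrightarrow>
      (weighted_sq \<tau> (\<lambda>\<eta>. GA A \<eta> z)) \<le> ennreal ((a * japanese z powr (m - real (card A)))\<^sup>2)"
    and GA_mult: "\<And>A z w K. 1 \<le> norm z \<Longrightarrow> integrable lborel w \<Longrightarrow> (\<And>x. norm (w x) \<le> K) \<Longrightarrow>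
      (\<integral>\<^sup>+\<zeta>. ennreal ((norm (fconv (\<lambda>\<eta>. GA A \<eta> z) w \<zeta>))\<^sup>2) \<partial>lborel)
        \<le> ennreal ((b * japanese z powr (m - real (card A)))\<^sup>2) * (\<integral>\<^sup>+\<xi>. ennreal ((norm (w \<xi>))\<^sup>2) \<partial>lborel)"
begin

lemma GA_vec_meas [measurable]:
  "(\<lambda>p. GA A (fst p) (vec_of (snd p))) \<in> borel_measurable (borel \<Otimes>\<^sub>M parM)"
  using measurable_compose[OF _ GA_meas, of "\<lambda>p. (fst p, vec_of (snd p))" "borel \<Otimes>\<^sub>M parM" A] by simp

lemma block_majorant_measurable [measurable]: "block_majorant GA k \<in> borel_measurable borel"
proof -
  interpret parM: sigma_finite_measure "parM :: ('n \<Rightarrow> real) measure" by (rule sigma_finite_parM)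
  have "(\<lambda>\<eta>. \<integral>\<^sup>+y. ennreal (norm (GA A \<eta> (vec_of y))) * indicator (parset k) y \<partial>parM) \<in> borel_measurable borel" for A
  proof (rule parM.borel_measurable_nn_integral)
    show "(\<lambda>(\<eta>, y). ennreal (norm (GA A \<eta> (vec_of y))) * indicator (parset k) y) \<in> borel_measurable (borel \<Otimes>\<^sub>M parM)"
      unfolding case_prod_beta by measurable
  qed
  then show ?thesis unfolding block_majorant_def[abs_def] by measurable
qed

lemma block_symbol_measurable [measurable]: "(\<lambda>p. block_symbol GA k (fst p) (snd p)) \<in> borel_measurable (borel \<Otimes>\<^sub>M borel)"
proof -
  interpret parM: sigma_finite_measure "parM :: ('n \<Rightarrow> real) measure" by (rule sigma_finite_parM)
  have "(\<lambda>p. \<integral>y. cube_kernel (2 ^ k) A (snd p) y *\<^sub>R GA A (fst p) (vec_of y) \<partial>parM) \<in> borel_measurable (borel \<Otimes>\<^sub>M borel)" for A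
  proof (rule parM.borel_measurable_lebesgue_integral)
    have 1: "(\<lambda>q. cube_kernel (2 ^ k) A (snd (fst q)) (snd q)) \<in> borel_measurable (((borel :: (real^'n) measure) \<Otimes>\<^sub>M borel) \<Otimes>\<^sub>M parM)"
      using measurable_compose[OF _ cube_kernel_measurable, of "\<lambda>q. (snd (fst q), snd q)" "((borel :: (real^'n) measure) \<Otimes>\<^sub>M borel) \<Otimes>\<^sub>M parM"] by simp
    have 2: "(\<lambda>q. GA A (fst (fst q)) (vec_of (snd q))) \<in> borel_measurable ((borel \<Otimes>\<^sub>M (borel :: (real^'n) measure)) \<Otimes>\<^sub>M parM)"
      using measurable_compose[OF _ GA_vec_meas, of "\<lambda>q. (fst (fst q), snd q)" "(borel \<Otimes>\<^sub>M (borel :: (real^'n) measure)) \<Otimes>\<^sub>M parM"] by simp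
    note [measurable] = 1 2
    show "(\<lambda>(p, y). cube_kernel (2 ^ k) A (snd p) y *\<^sub>R GA A (fst p) (vec_of y)) \<in> borel_measurable ((borel \<Otimes>\<^sub>M borel) \<Otimes>\<^sub>M parM)"
      unfolding case_prod_beta by measurable
  qed
  then show ?thesis unfolding block_symbol_def by measurable
qed

lemma norm_cube_kernel_le:
  fixes A :: "'n set"
  assumes "\<xi> \<in> shell k"
  shows "ennreal (norm (cube_kernel (2 ^ k) A \<xi> y *\<^sub>R z)) \<le> ennreal ((1 / 2 ^ k) ^ (CARD('n) - card A)) * (ennreal (norm z) * indicator (parset k) y)"
proof (cases "y \<in> parset k")
  case True
  have "norm (cube_kernel (2 ^ k) A \<xi> y *\<^sub>R z) \<le> (1 / 2 ^ k) ^ (CARD('n) - card A) * norm z"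
    using cube_kernel_abs_le[of "2 ^ k" A \<xi> y] by (simp add: mult_right_mono)
  then have "ennreal (norm (cube_kernel (2 ^ k) A \<xi> y *\<^sub>R z)) \<le> ennreal ((1 / 2 ^ k) ^ (CARD('n) - card A)) * ennreal (norm z)"
    by (subst ennreal_mult[symmetric]) (auto intro: ennreal_leI)
  then show ?thesis using True by simp
next
  case False
  then have "cube_kernel (2 ^ k) A \<xi> y = 0" using cube_kernel_nonzero_parset[OF assms] by blast
  then show ?thesis by simp
qed

lemma block_symbol_le_block_majorant:
  assumes "\<xi> \<in> shell k"
  shows "ennreal (norm (block_symbol GA k \<eta> \<xi>)) \<le> block_majorant GA k \<eta>"
proof -
  have [measurable]: "(\<lambda>y. GA A \<eta> (vec_of y)) \<in> borel_measurable parM" for A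
    using measurable_compose[OF _ GA_vec_meas, of "\<lambda>y. (\<eta>, y)" parM A] by simp
  have "ennreal (norm (block_symbol GA k \<eta> \<xi>)) \<le> (\<Sum>A\<in>UNIV. ennreal (norm (\<integral>y. cube_kernel (2 ^ k) A \<xi> y *\<^sub>R GA A \<eta> (vec_of y) \<partial>parM)))"
    unfolding block_symbol_def by (subst sum_ennreal) (auto intro!: ennreal_leI norm_sum)
  also have "\<dots> \<le> block_majorant GA k \<eta>"
    unfolding block_majorant_def
  proof (intro sum_mono)
    fix A :: "'n set"
    have "ennreal (norm (\<integral>y. cube_kernel (2 ^ k) A \<xi> y *\<^sub>R GA A \<eta> (vec_of y) \<partial>parM)) \<le> (\<integral>\<^sup>+y. ennreal (norm (cube_kernel (2 ^ k) A \<xi> y *\<^sub>R GA A \<eta> (vec_of y))) \<partial>parM)"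
      by (rule ennreal_norm_integral_le)
    also have "\<dots> \<le> (\<integral>\<^sup>+y. ennreal ((1 / 2 ^ k) ^ (CARD('n) - card A)) * (ennreal (norm (GA A \<eta> (vec_of y))) * indicator (parset k) y) \<partial>parM)"
      by (intro nn_integral_mono norm_cube_kernel_le assms)
    also have "\<dots> = ennreal ((1 / 2 ^ k) ^ (CARD('n) - card A)) * (\<integral>\<^sup>+y. ennreal (norm (GA A \<eta> (vec_of y))) * indicator (parset k) y \<partial>parM)"
      by (rule nn_integral_cmult) measurable
    finally show "ennreal (norm (\<integral>y. cube_kernel (2 ^ k) A \<xi> y *\<^sub>R GA A \<eta> (vec_of y) \<partial>parM)) \<le> \<dots>" .
  qed
  finally show ?thesis .
qed

text \<open>Both block estimates sum, over A and over the parameters y, contributions of equal size.\<close>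

lemma parset_young:
  fixes P :: "'n set \<Rightarrow> real^'n \<Rightarrow> ('n \<Rightarrow> real) \<Rightarrow> ennreal"
  assumes P: "\<And>A. (\<lambda>(x, y). P A x y) \<in> borel_measurable (lborel \<Otimes>\<^sub>M parM)"
    and c: "0 \<le> c"
    and bd: "\<And>A y. y \<in> parset k \<Longrightarrow> (\<integral>\<^sup>+x. (P A x y)\<^sup>2 \<partial>lborel) \<le> ennreal ((c * (1 / 2 ^ k) ^ (CARD('n) - card A) * japanese (vec_of y :: real^'n) powr (m - real (card A)))\<^sup>2) * T"
  shows "(\<integral>\<^sup>+x. (\<Sum>A\<in>UNIV. \<integral>\<^sup>+y. P A x y * indicator (parset k) y \<partial>parM)\<^sup>2 \<partial>lborel)
     \<le> ennreal ((2 ^ CARD('n) * blockC m TYPE('n) * c * (2 ^ k) powr m)\<^sup>2) * T"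
proof -
  interpret parM: sigma_finite_measure "parM :: ('n \<Rightarrow> real) measure" by (rule sigma_finite_parM)
  let ?q = "(6 * 2 ^ k) ^ CARD('n) :: real"
  let ?B = "blockC m TYPE('n)"
  let ?I = "\<lambda>A x. \<integral>\<^sup>+y. P A x y * indicator (parset k) y \<partial>parM"
  have Im [measurable]: "?I A \<in> borel_measurable lborel" for A
  proof (rule parM.borel_measurable_nn_integral)
    note [measurable] = P[of A]
    show "(\<lambda>(x, y). P A x y * indicator (parset k) y) \<in> borel_measurable (lborel \<Otimes>\<^sub>M parM)"
      by measurable
  qed
  \<comment> \<open>The density is the indicator of \<open>parset k\<close>, so bounds are needed
    for frozen frequencies only; the square of its integral is at most \<open>?q\<^sup>2\<close>,
    which the division by \<open>?q\<close> compensates.\<close>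
  have one: "(\<integral>\<^sup>+x. (?I A x)\<^sup>2 \<partial>lborel) \<le> ennreal ((?B * c * (2 ^ k) powr m)\<^sup>2) * T" for A
  proof -
    have "(\<integral>\<^sup>+x. (?I A x)\<^sup>2 \<partial>lborel) \<le> (ennreal ((?B * c * (2 ^ k) powr m / ?q)\<^sup>2) * T) * (\<integral>\<^sup>+y. indicator (parset k) y \<partial>(parM :: ('n \<Rightarrow> real) measure))\<^sup>2"
    proof (rule weighted_young[OF sigma_finite_lborel sigma_finite_parM P])
      fix y :: "'n \<Rightarrow> real" assume "indicator (parset k) y \<noteq> (0::ennreal)"
      then have y: "y \<in> parset k" by (auto simp: indicator_def split: if_splits)
      have "(1 / 2 ^ k) ^ (CARD('n) - card A) * ?q * japanese (vec_of y :: real^'n) powr (m - real (card A)) \<le> ?B * (2 ^ k) powr m"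
        by (rule parset_weight[OF y])
      then have "c * ((1 / 2 ^ k) ^ (CARD('n) - card A) * ?q * japanese (vec_of y :: real^'n) powr (m - real (card A))) \<le> c * (?B * (2 ^ k) powr m)"
        using c by (rule mult_left_mono)
      then have "c * (1 / 2 ^ k) ^ (CARD('n) - card A) * japanese (vec_of y :: real^'n) powr (m - real (card A)) \<le> ?B * c * (2 ^ k) powr m / ?q"
        by (simp add: pos_le_divide_eq mult_ac)
      then have "(c * (1 / 2 ^ k) ^ (CARD('n) - card A) * japanese (vec_of y :: real^'n) powr (m - real (card A)))\<^sup>2 \<le> (?B * c * (2 ^ k) powr m / ?q)\<^sup>2"
        using c by (intro power_mono) auto
      then show "(\<integral>\<^sup>+x. (P A x y)\<^sup>2 \<partial>lborel) \<le> ennreal ((?B * c * (2 ^ k) powr m / ?q)\<^sup>2) * T"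
        using bd[OF y, of A] by (elim order.trans) (intro mult_right_mono ennreal_leI, auto)
    qed simp
    also have "(\<integral>\<^sup>+y. indicator (parset k) y \<partial>(parM :: ('n \<Rightarrow> real) measure))\<^sup>2 \<le> (ennreal ?q)\<^sup>2"
      using emeasure_parset[of k, where 'n='n] by (intro power_mono) auto
    also have "(ennreal ((?B * c * (2 ^ k) powr m / ?q)\<^sup>2) * T) * (ennreal ?q)\<^sup>2 = (ennreal ((?B * c * (2 ^ k) powr m / ?q)\<^sup>2) * ennreal (?q\<^sup>2)) * T"
      by (simp add: ennreal_power mult_ac)
    also have "ennreal ((?B * c * (2 ^ k) powr m / ?q)\<^sup>2) * ennreal (?q\<^sup>2) = ennreal ((?B * c * (2 ^ k) powr m)\<^sup>2)"
      by (subst ennreal_mult[symmetric]) (auto simp: power_divide)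
    finally show ?thesis by (simp add: mult_left_mono)
  qed
  \<comment> \<open>The number \<open>2 ^ CARD('n)\<close> of subsets A enters twice, through
    Cauchy-Schwarz and through the sum of equal bounds; together these give its square.\<close>
  have "(\<integral>\<^sup>+x. (\<Sum>A\<in>UNIV. ?I A x)\<^sup>2 \<partial>lborel) \<le> (\<integral>\<^sup>+x. of_nat (2 ^ CARD('n)) * (\<Sum>A\<in>UNIV. (?I A x)\<^sup>2) \<partial>lborel)"
    unfolding card_UNIV_sets[symmetric] by (intro nn_integral_mono ennreal_sum_sq_le) simp
  also have "\<dots> = of_nat (2 ^ CARD('n)) * (\<Sum>A\<in>UNIV. \<integral>\<^sup>+x. (?I A x)\<^sup>2 \<partial>lborel)"
    by (subst nn_integral_cmult, measurable, subst nn_integral_sum) auto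
  also have "\<dots> \<le> of_nat (2 ^ CARD('n)) * (\<Sum>A\<in>(UNIV::'n set set). ennreal ((?B * c * (2 ^ k) powr m)\<^sup>2) * T)"
    by (intro mult_left_mono sum_mono one) auto
  also have "\<dots> = (ennreal (2 ^ CARD('n)) * (ennreal (2 ^ CARD('n)) * ennreal ((?B * c * (2 ^ k) powr m)\<^sup>2))) * T"
    by (simp add: card_UNIV_sets mult_ac flip: ennreal_numeral ennreal_power)
  also have "ennreal (2 ^ CARD('n)) * (ennreal (2 ^ CARD('n)) * ennreal ((?B * c * (2 ^ k) powr m)\<^sup>2)) = ennreal ((2 ^ CARD('n) * ?B * c * (2 ^ k) powr m)\<^sup>2)"
    by (subst ennreal_mult_sq) (simp_all add: mult.assoc)
  finally show ?thesis .
qed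

text \<open>\<open>parset_young\<close> with the Sobolev bound of the symbol at each frozen
  frequency; no input function takes part, so its factor T is 1.\<close>

lemma block_majorant_bound:
  "(\<integral>\<^sup>+\<eta>. (ennreal (japanese \<eta> powr \<tau>) * block_majorant GA k \<eta>)\<^sup>2 \<partial>lborel)
    \<le> ennreal ((2 ^ CARD('n) * blockC m TYPE('n) * a * (2 ^ k) powr m)\<^sup>2)"
proof -
  let ?P = "\<lambda>A \<eta> y. ennreal ((1 / 2 ^ k) ^ (CARD('n) - card A)) * ennreal (japanese \<eta> powr \<tau> * norm (GA A \<eta> (vec_of y)))"
  have Pm: "(\<lambda>(\<eta>, y). ?P A \<eta> y) \<in> borel_measurable (lborel \<Otimes>\<^sub>M parM)" for A
    unfolding case_prod_beta by measurable
  have "(\<integral>\<^sup>+\<eta>. (ennreal (japanese \<eta> powr \<tau>) * block_majorant GA k \<eta>)\<^sup>2 \<partial>lborel) = (\<integral>\<^sup>+\<eta>. (\<Sum>A\<in>UNIV. \<integral>\<^sup>+y. ?P A \<eta> y * indicator (parset k) y \<partial>parM)\<^sup>2 \<partial>lborel)"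
  proof (intro nn_integral_cong arg_cong[where f="\<lambda>t. t\<^sup>2"])
    fix \<eta> :: "real^'n"
    have [measurable]: "(\<lambda>y. GA A \<eta> (vec_of y)) \<in> borel_measurable parM" for A
      using measurable_compose[OF _ GA_vec_meas, of "\<lambda>y. (\<eta>, y)" parM A] by simp
    show "ennreal (japanese \<eta> powr \<tau>) * block_majorant GA k \<eta> = (\<Sum>A\<in>UNIV. \<integral>\<^sup>+y. ?P A \<eta> y * indicator (parset k) y \<partial>parM)"
      unfolding block_majorant_def sum_distrib_left
    proof (intro sum.cong refl)
      fix A :: "'n set"
      have "(\<integral>\<^sup>+y. ?P A \<eta> y * indicator (parset k) y \<partial>parM) = (\<integral>\<^sup>+y. (ennreal (japanese \<eta> powr \<tau>) * ennreal ((1 / 2 ^ k) ^ (CARD('n) - card A))) * (ennreal (norm (GA A \<eta> (vec_of y))) * indicator (parset k) y) \<partial>parM)"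
        by (intro nn_integral_cong) (simp add: ennreal_mult mult_ac)
      also have "\<dots> = (ennreal (japanese \<eta> powr \<tau>) * ennreal ((1 / 2 ^ k) ^ (CARD('n) - card A))) * (\<integral>\<^sup>+y. ennreal (norm (GA A \<eta> (vec_of y))) * indicator (parset k) y \<partial>parM)"
        by (rule nn_integral_cmult) measurable
      finally show "ennreal (japanese \<eta> powr \<tau>) * (ennreal ((1 / 2 ^ k) ^ (CARD('n) - card A)) * (\<integral>\<^sup>+y. ennreal (norm (GA A \<eta> (vec_of y))) * indicator (parset k) y \<partial>parM))
         = (\<integral>\<^sup>+y. ?P A \<eta> y * indicator (parset k) y \<partial>parM)" by (simp only: mult.assoc)
    qed
  qed
  also have "\<dots> \<le> ennreal ((2 ^ CARD('n) * blockC m TYPE('n) * a * (2 ^ k) powr m)\<^sup>2) * 1"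
  proof (rule parset_young[OF Pm a0])
    fix A :: "'n set" and y :: "'n \<Rightarrow> real" assume y: "y \<in> parset k"
    have z: "1 \<le> norm (vec_of y :: real^'n)" by (rule parset_norm(3)[OF y])
    have [measurable]: "(\<lambda>\<eta>. GA A \<eta> (vec_of y)) \<in> borel_measurable borel"
      using measurable_compose[OF _ GA_meas, of "\<lambda>\<eta>. (\<eta>, vec_of y)" borel A] by simp
    have "(\<integral>\<^sup>+\<eta>. (?P A \<eta> y)\<^sup>2 \<partial>lborel) = (ennreal ((1 / 2 ^ k) ^ (CARD('n) - card A)))\<^sup>2 * weighted_sq \<tau> (\<lambda>\<eta>. GA A \<eta> (vec_of y))"
      unfolding power_mult_distrib by (rule nn_integral_cmult) measurable
    also have "\<dots> \<le> (ennreal ((1 / 2 ^ k) ^ (CARD('n) - card A)))\<^sup>2 * ennreal ((a * japanese (vec_of y) powr (m - real (card A)))\<^sup>2)"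
      by (intro mult_left_mono GA_bound z) auto
    also have "\<dots> = ennreal ((a * (1 / 2 ^ k) ^ (CARD('n) - card A) * japanese (vec_of y :: real^'n) powr (m - real (card A)))\<^sup>2) * 1"
      by (simp add: ennreal_power ennreal_mult[symmetric] power_mult_distrib mult_ac)
    finally show "(\<integral>\<^sup>+\<eta>. (?P A \<eta> y)\<^sup>2 \<partial>lborel) \<le> \<dots>" .
  qed
  finally show ?thesis by simp
qed

lemma weight_L1:
  fixes f :: "real^'n \<Rightarrow> ennreal"
  assumes [measurable]: "f \<in> borel_measurable borel"
  shows "(\<integral>\<^sup>+\<eta>. f \<eta> \<partial>lborel)\<^sup>2 \<le> (\<integral>\<^sup>+\<eta>. ennreal (japanese (\<eta>::real^'n) powr (- (2 * \<tau>))) \<partial>lborel) * (\<integral>\<^sup>+\<eta>. (ennreal (japanese \<eta> powr \<tau>) * f \<eta>)\<^sup>2 \<partial>lborel)"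
proof -
  have "f \<eta> = ennreal (japanese \<eta> powr (- \<tau>)) * (ennreal (japanese \<eta> powr \<tau>) * f \<eta>)" for \<eta>
    unfolding mult.assoc[symmetric] by (subst ennreal_mult[symmetric]) (auto simp: powr_add[symmetric])
  then have "(\<integral>\<^sup>+\<eta>. f \<eta> \<partial>lborel)\<^sup>2 = (\<integral>\<^sup>+\<eta>. ennreal (japanese \<eta> powr (- \<tau>)) * (ennreal (japanese \<eta> powr \<tau>) * f \<eta>) \<partial>lborel)\<^sup>2"
    by simp
  also have "\<dots> \<le> (\<integral>\<^sup>+\<eta>. (ennreal (japanese (\<eta>::real^'n) powr (- \<tau>)))\<^sup>2 \<partial>lborel) * (\<integral>\<^sup>+\<eta>. (ennreal (japanese \<eta> powr \<tau>) * f \<eta>)\<^sup>2 \<partial>lborel)"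
    by (rule Cauchy_Schwarz_nn_integral) measurable
  also have "(\<lambda>\<eta>::real^'n. (ennreal (japanese \<eta> powr (- \<tau>)))\<^sup>2) = (\<lambda>\<eta>. ennreal (japanese \<eta> powr (- (2 * \<tau>))))"
    by (simp add: fun_eq_iff power2_eq_square ennreal_mult[symmetric] powr_add[symmetric])
  finally show ?thesis .
qed

text \<open>Qualitative information for Fubini: the constant L does not enter the final
  estimates.\<close>

lemma GA_L1_finite:
  obtains L where "0 \<le> L" "\<And>A z. 1 \<le> norm z \<Longrightarrow> (\<integral>\<^sup>+\<eta>. ennreal (norm (GA A \<eta> z)) \<partial>lborel) \<le> ennreal (L * japanese z powr (m - real (card A)))"
proof -
  define W where "W = enn2real (\<integral>\<^sup>+\<eta>. ennreal (japanese (\<eta>::real^'n) powr (- (2 * \<tau>))) \<partial>lborel)"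
  have W: "(\<integral>\<^sup>+\<eta>. ennreal (japanese (\<eta>::real^'n) powr (- (2 * \<tau>))) \<partial>lborel) = ennreal W" "0 \<le> W"
    using nn_integral_japanese_weight[OF tau] by (auto simp: W_def less_top)
  show thesis
  proof (rule that[of "sqrt W * a"])
    show "0 \<le> sqrt W * a" using W a0 by simp
    fix A :: "'n set" and z :: "real^'n" assume z: "1 \<le> norm z"
    have [measurable]: "(\<lambda>\<eta>. GA A \<eta> z) \<in> borel_measurable borel"
      using measurable_compose[OF _ GA_meas, of "\<lambda>\<eta>. (\<eta>, z)" borel A] by simp
    have "(\<integral>\<^sup>+\<eta>. ennreal (norm (GA A \<eta> z)) \<partial>lborel)\<^sup>2 \<le> ennreal W * ennreal ((a * japanese z powr (m - real (card A)))\<^sup>2)"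
      using weight_L1[of "\<lambda>\<eta>. ennreal (norm (GA A \<eta> z))"] GA_bound[OF z, of A] unfolding W(1)
      by (simp add: ennreal_mult) (meson mult_left_mono order.trans zero_le)
    also have "\<dots> = (ennreal (sqrt W * a * japanese z powr (m - real (card A))))\<^sup>2"
      using W a0 by (subst ennreal_mult[symmetric]) (auto simp: ennreal_power power_mult_distrib)
    finally show "(\<integral>\<^sup>+\<eta>. ennreal (norm (GA A \<eta> z)) \<partial>lborel) \<le> ennreal (sqrt W * a * japanese z powr (m - real (card A)))"
      by (rule ennreal_power2_le_imp_le) (use W a0 in auto)
  qed
qed

text \<open>The part of the output produced by input frequencies in the shell k, before any
  splitting of output frequencies.\<close>

definition block_output :: "(real^'n \<Rightarrow> complex) \<Rightarrow> nat \<Rightarrow> real^'n \<Rightarrow> complex" where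
  "block_output u k \<zeta> = (\<integral>\<xi>. indicator (shell k) \<xi> *\<^sub>R (block_symbol GA k (\<zeta> - \<xi>) \<xi> * u \<xi>) \<partial>lborel)"

lemma block_output_measurable [measurable]:
  assumes [measurable]: "u \<in> borel_measurable borel"
  shows "block_output u k \<in> borel_measurable borel"
proof -
  have [measurable]: "(\<lambda>q. block_symbol GA k (fst q - snd q) (snd q)) \<in> borel_measurable (borel \<Otimes>\<^sub>M borel)"
    using measurable_compose[OF _ block_symbol_measurable, of "\<lambda>q. (fst q - snd q, snd q)" "borel \<Otimes>\<^sub>M borel" k] by simp
  have "(\<lambda>(\<zeta>, \<xi>). indicator (shell k) \<xi> *\<^sub>R (block_symbol GA k (\<zeta> - \<xi>) \<xi> * u \<xi>)) \<in> borel_measurable (borel \<Otimes>\<^sub>M lborel)"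
    unfolding case_prod_beta by measurable
  then show ?thesis unfolding block_output_def[abs_def] by (rule lborel.borel_measurable_lebesgue_integral)
qed

lemma block_output_bound:
  fixes u :: "real^'n \<Rightarrow> complex"
  assumes u: "integrable lborel u" and bd: "\<And>x. norm (u x) \<le> K"
  shows "(\<integral>\<^sup>+\<zeta>. ennreal ((norm (block_output u k \<zeta>))\<^sup>2) \<partial>lborel)
    \<le> ennreal ((2 ^ CARD('n) * blockC m TYPE('n) * b * (2 ^ k) powr m)\<^sup>2) * (\<integral>\<^sup>+\<xi>. ennreal ((norm (u \<xi>))\<^sup>2) * indicator (shell k) \<xi> \<partial>lborel)"
proof -
  interpret parM: sigma_finite_measure "parM :: ('n \<Rightarrow> real) measure" by (rule sigma_finite_parM)
  have um [measurable]: "u \<in> borel_measurable borel" using u by auto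
  \<comment> \<open>The \<xi>-dependence of the kernel is moved into the input, so that the
    remaining factor depends on \<zeta> - \<xi> only and a convolution results.\<close>
  define w where "w A y \<xi> = cube_kernel (2 ^ k) A \<xi> y *\<^sub>R (indicator (shell k) \<xi> *\<^sub>R u \<xi>)" for A y \<xi>
  let ?\<alpha> = "\<lambda>A. (1 / 2 ^ k) ^ (CARD('n) - card A) :: real"
  have wle: "norm (w A y \<xi>) \<le> ?\<alpha> A * (indicator (shell k) \<xi> * norm (u \<xi>))" for A y \<xi>
    using cube_kernel_abs_le[of "2 ^ k" A \<xi> y] by (cases "\<xi> \<in> shell k") (simp_all add: w_def mult_right_mono)
  have KKy [measurable]: "(\<lambda>\<xi>. cube_kernel (2 ^ k) A \<xi> y) \<in> borel_measurable borel" if "y \<in> space parM" for A :: "'n set" and y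
    using measurable_compose[OF measurable_Pair2'[OF that] cube_kernel_measurable] by simp
  have F3: "(\<lambda>q. GA A (fst (fst q) - snd q) (vec_of (snd (fst q))) * w A (snd (fst q)) (snd q)) \<in> borel_measurable (((borel :: (real^'n) measure) \<Otimes>\<^sub>M parM) \<Otimes>\<^sub>M borel)" for A
  proof -
    let ?M = "((borel :: (real^'n) measure) \<Otimes>\<^sub>M parM) \<Otimes>\<^sub>M (borel :: (real^'n) measure)"
    have [measurable]: "(\<lambda>q. GA A (fst (fst q) - snd q) (vec_of (snd (fst q)))) \<in> borel_measurable ?M"
      using measurable_compose[OF _ GA_vec_meas, of "\<lambda>q. (fst (fst q) - snd q, snd (fst q))" ?M A] by simp
    have [measurable]: "(\<lambda>q. cube_kernel (2 ^ k) A (snd q) (snd (fst q))) \<in> borel_measurable ?M"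
      using measurable_compose[OF _ cube_kernel_measurable, of "\<lambda>q. (snd q, snd (fst q))" ?M "2 ^ k" A] by simp
    show ?thesis unfolding w_def by measurable
  qed
  let ?f = "\<lambda>A y \<zeta>. fconv (\<lambda>\<eta>. GA A \<eta> (vec_of y)) (w A y) \<zeta>"
  have fm [measurable]: "(\<lambda>(\<zeta>, y). ?f A y \<zeta>) \<in> borel_measurable (lborel \<Otimes>\<^sub>M parM)" for A
  proof -
    have "(\<lambda>p. \<integral>\<xi>. GA A (fst p - \<xi>) (vec_of (snd p)) * w A (snd p) \<xi> \<partial>lborel) \<in> borel_measurable ((borel :: (real^'n) measure) \<Otimes>\<^sub>M parM)"
      by (rule lborel.borel_measurable_lebesgue_integral) (use F3[of A] in \<open>simp add: case_prod_beta\<close>)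
    then show ?thesis by (simp add: fconv_def case_prod_beta)
  qed
  obtain L where L: "0 \<le> L" "\<And>A z. 1 \<le> norm z \<Longrightarrow> (\<integral>\<^sup>+\<eta>. ennreal (norm (GA A \<eta> z)) \<partial>lborel) \<le> ennreal (L * japanese z powr (m - real (card A)))"
    by (rule GA_L1_finite) blast
  have w0: "w A y \<xi> = 0" if "y \<notin> parset k" for A y \<xi>
    using cube_kernel_nonzero_parset[of \<xi> k A y] that by (cases "\<xi> \<in> shell k") (auto simp: w_def)
  \<comment> \<open>Absolute convergence, from the L1 bound of \<open>GA A\<close>, the kernel bound
    and the finite measure of \<open>parset k\<close>.\<close>
  have fin: "(\<integral>\<^sup>+y. \<integral>\<^sup>+\<zeta>. \<integral>\<^sup>+\<xi>. ennreal (norm (GA A (\<zeta> - \<xi>) (vec_of y) * w A y \<xi>)) \<partial>lborel \<partial>lborel \<partial>parM) < \<infinity>" for A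
  proof -
    define N where "N = (\<integral>x. norm (u x) \<partial>lborel)"
    have N: "(\<integral>\<^sup>+x. ennreal (norm (u x)) \<partial>lborel) = ennreal N" "0 \<le> N"
      unfolding N_def using u by (auto intro!: nn_integral_eq_integral)
    have "(\<integral>\<^sup>+y. \<integral>\<^sup>+\<zeta>. \<integral>\<^sup>+\<xi>. ennreal (norm (GA A (\<zeta> - \<xi>) (vec_of y) * w A y \<xi>)) \<partial>lborel \<partial>lborel \<partial>parM)
      \<le> (\<integral>\<^sup>+y. ennreal (L * (blockC m TYPE('n) * (2 ^ k) powr m) * N) * indicator (parset k) y \<partial>(parM :: ('n \<Rightarrow> real) measure))"
    proof (intro nn_integral_mono)
      fix y :: "'n \<Rightarrow> real" assume yM: "y \<in> space parM"
      show "(\<integral>\<^sup>+\<zeta>. \<integral>\<^sup>+\<xi>. ennreal (norm (GA A (\<zeta> - \<xi>) (vec_of y) * w A y \<xi>)) \<partial>lborel \<partial>lborel) \<le> ennreal (L * (blockC m TYPE('n) * (2 ^ k) powr m) * N) * indicator (parset k) y"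
      proof (cases "y \<in> parset k")
        case True
        let ?z = "vec_of y :: real^'n"
        have [measurable]: "(\<lambda>\<eta>. GA A \<eta> ?z) \<in> borel_measurable borel"
          using measurable_compose[OF _ GA_meas, of "\<lambda>\<eta>. (\<eta>, ?z)" borel A] by simp
        note [measurable] = KKy[OF yM, of A]
        have [measurable]: "w A y \<in> borel_measurable borel" unfolding w_def by measurable
        have "(\<integral>\<^sup>+\<zeta>. \<integral>\<^sup>+\<xi>. ennreal (norm (GA A (\<zeta> - \<xi>) ?z * w A y \<xi>)) \<partial>lborel \<partial>lborel)
          = (\<integral>\<^sup>+\<xi>. \<integral>\<^sup>+\<zeta>. ennreal (norm (GA A (\<zeta> - \<xi>) ?z)) * ennreal (norm (w A y \<xi>)) \<partial>lborel \<partial>lborel)"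
          by (subst lborel_pair.Fubini'[symmetric]) (auto simp: norm_mult ennreal_mult)
        also have "\<dots> = (\<integral>\<^sup>+\<eta>. ennreal (norm (GA A \<eta> ?z)) \<partial>lborel) * (\<integral>\<^sup>+\<xi>. ennreal (norm (w A y \<xi>)) \<partial>lborel)"
          by (simp add: nn_integral_multc nn_integral_cmult nn_integral_shift_minus[of "\<lambda>\<eta>. ennreal (norm (GA A \<eta> ?z))"])
        also have "\<dots> \<le> ennreal (L * japanese ?z powr (m - real (card A))) * (\<integral>\<^sup>+\<xi>. ennreal (?\<alpha> A) * ennreal (norm (u \<xi>)) \<partial>lborel)"
        proof (intro mult_mono L(2) parset_norm(3)[OF True] nn_integral_mono)
          fix \<xi>
          have "norm (w A y \<xi>) \<le> ?\<alpha> A * norm (u \<xi>)"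
            by (rule order.trans[OF wle]) (auto intro!: mult_left_mono simp: indicator_def)
          then show "ennreal (norm (w A y \<xi>)) \<le> ennreal (?\<alpha> A) * ennreal (norm (u \<xi>))"
            by (subst ennreal_mult[symmetric]) (auto intro: ennreal_leI)
        qed auto
        also have "\<dots> = ennreal (L * (?\<alpha> A * japanese ?z powr (m - real (card A))) * N)"
          using L(1) N(2) by (subst nn_integral_cmult, measurable) (simp add: N(1) ennreal_mult mult_ac)
        also have "\<dots> \<le> ennreal (L * (blockC m TYPE('n) * (2 ^ k) powr m) * N)"
        proof (intro ennreal_leI mult_right_mono mult_left_mono)
          have "?\<alpha> A * japanese ?z powr (m - real (card A)) = ?\<alpha> A * 1 * japanese ?z powr (m - real (card A))" by simp
          also have "\<dots> \<le> ?\<alpha> A * (6 * 2 ^ k) ^ CARD('n) * japanese ?z powr (m - real (card A))"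
            using one_le_power[of "2::real" k] by (intro mult_right_mono mult_left_mono one_le_power) (auto simp del: one_le_power)
          also have "\<dots> \<le> blockC m TYPE('n) * (2 ^ k) powr m" by (rule parset_weight[OF True])
          finally show "?\<alpha> A * japanese ?z powr (m - real (card A)) \<le> blockC m TYPE('n) * (2 ^ k) powr m" .
        qed (use L(1) N(2) in auto)
        finally show ?thesis using True by simp
      next
        case False
        then show ?thesis by (simp add: w0)
      qed
    qed
    also have "\<dots> < \<infinity>"
      using emeasure_parset[of k, where 'n='n]
      by (subst nn_integral_cmult) (auto simp: ennreal_mult_less_top intro: le_less_trans)
    finally show ?thesis .
  qed
  have AE1: "AE \<zeta> in lborel. block_output u k \<zeta> = (\<Sum>A\<in>UNIV. \<integral>y. ?f A y \<zeta> \<partial>parM)"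
  proof -
    have "AE \<zeta> in lborel. \<forall>A\<in>UNIV. (\<integral>\<^sup>+y. \<integral>\<^sup>+\<xi>. ennreal (norm (GA A (\<zeta> - \<xi>) (vec_of y) * w A y \<xi>)) \<partial>lborel \<partial>parM) \<noteq> \<infinity>"
    proof (rule AE_finite_allI)
      fix A :: "'n set"
      interpret pair_sigma_finite "parM :: ('n \<Rightarrow> real) measure" "lborel :: (real^'n) measure" ..
      have mm: "(\<lambda>(\<zeta>, y). \<integral>\<^sup>+\<xi>. ennreal (norm (GA A (\<zeta> - \<xi>) (vec_of y) * w A y \<xi>)) \<partial>lborel) \<in> borel_measurable (lborel \<Otimes>\<^sub>M parM)"
      proof -
        note [measurable] = F3[of A]
        have "(\<lambda>p. \<integral>\<^sup>+\<xi>. ennreal (norm (GA A (fst p - \<xi>) (vec_of (snd p)) * w A (snd p) \<xi>)) \<partial>lborel) \<in> borel_measurable ((borel :: (real^'n) measure) \<Otimes>\<^sub>M parM)"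
        proof (rule lborel.borel_measurable_nn_integral)
          have "(\<lambda>q. ennreal (norm (GA A (fst (fst q) - snd q) (vec_of (snd (fst q))) * w A (snd (fst q)) (snd q)))) \<in> borel_measurable (((borel :: (real^'n) measure) \<Otimes>\<^sub>M parM) \<Otimes>\<^sub>M borel)"
            by measurable
          then show "(\<lambda>(p, \<xi>). ennreal (norm (GA A (fst p - \<xi>) (vec_of (snd p)) * w A (snd p) \<xi>))) \<in> borel_measurable (((borel :: (real^'n) measure) \<Otimes>\<^sub>M parM) \<Otimes>\<^sub>M lborel)"
            by (simp add: case_prod_beta)
        qed
        then show ?thesis by (simp add: case_prod_beta)
      qed
      have mm': "(\<lambda>(y, \<zeta>). \<integral>\<^sup>+\<xi>. ennreal (norm (GA A (\<zeta> - \<xi>) (vec_of y) * w A y \<xi>)) \<partial>lborel) \<in> borel_measurable (parM \<Otimes>\<^sub>M lborel)"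
        using measurable_compose[OF measurable_pair_swap' mm] by (simp add: case_prod_beta)
      have "(\<integral>\<^sup>+\<zeta>. \<integral>\<^sup>+y. \<integral>\<^sup>+\<xi>. ennreal (norm (GA A (\<zeta> - \<xi>) (vec_of y) * w A y \<xi>)) \<partial>lborel \<partial>parM \<partial>lborel) < \<infinity>"
        using fin[of A] Fubini'[OF mm'] by simp
      then show "AE \<zeta> in lborel. (\<integral>\<^sup>+y. \<integral>\<^sup>+\<xi>. ennreal (norm (GA A (\<zeta> - \<xi>) (vec_of y) * w A y \<xi>)) \<partial>lborel \<partial>parM) \<noteq> \<infinity>"
        by (intro nn_integral_PInf_AE parM.borel_measurable_nn_integral) (use mm in auto)
    qed simp
    then show ?thesis
    proof eventually_elim
      case (elim \<zeta>)
      have m2: "(\<lambda>(y, \<xi>). GA A (\<zeta> - \<xi>) (vec_of y) * w A y \<xi>) \<in> borel_measurable (parM \<Otimes>\<^sub>M lborel)" for A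
        using measurable_compose[OF _ F3[of A], of "\<lambda>q. ((\<zeta>, fst q), snd q)" "parM \<Otimes>\<^sub>M borel"] by (simp add: case_prod_beta)
      have fin2: "(\<integral>\<^sup>+y. \<integral>\<^sup>+\<xi>. ennreal (norm (GA A (\<zeta> - \<xi>) (vec_of y) * w A y \<xi>)) \<partial>lborel \<partial>parM) < \<infinity>" for A
        using elim by (simp add: less_top)
      have eq: "(\<integral>y. GA A (\<zeta> - \<xi>) (vec_of y) * w A y \<xi> \<partial>parM) = (\<integral>y. cube_kernel (2 ^ k) A \<xi> y *\<^sub>R GA A (\<zeta> - \<xi>) (vec_of y) \<partial>parM) * (indicator (shell k) \<xi> *\<^sub>R u \<xi>)" for A \<xi>
        unfolding w_def integral_mult_left_zero[symmetric] by (intro Bochner_Integration.integral_cong refl) simp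
      have "block_output u k \<zeta> = (\<integral>\<xi>. (\<Sum>A\<in>UNIV. \<integral>y. GA A (\<zeta> - \<xi>) (vec_of y) * w A y \<xi> \<partial>parM) \<partial>lborel)"
        unfolding block_output_def block_symbol_def eq sum_distrib_right[symmetric] by simp
      also have "\<dots> = (\<Sum>A\<in>UNIV. \<integral>\<xi>. (\<integral>y. GA A (\<zeta> - \<xi>) (vec_of y) * w A y \<xi> \<partial>parM) \<partial>lborel)"
        by (rule Bochner_Integration.integral_sum) (rule Fubini_complex_int2[OF sigma_finite_parM sigma_finite_lborel m2 fin2])
      also have "\<dots> = (\<Sum>A\<in>UNIV. \<integral>y. ?f A y \<zeta> \<partial>parM)"
        unfolding fconv_def by (intro sum.cong refl Fubini_complex_eq[OF sigma_finite_parM sigma_finite_lborel m2 fin2, symmetric])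
      finally show ?case .
    qed
  qed
  have "(\<integral>\<^sup>+\<zeta>. ennreal ((norm (block_output u k \<zeta>))\<^sup>2) \<partial>lborel) \<le> (\<integral>\<^sup>+\<zeta>. (\<Sum>A\<in>UNIV. \<integral>\<^sup>+y. ennreal (norm (?f A y \<zeta>)) * indicator (parset k) y \<partial>parM)\<^sup>2 \<partial>lborel)"
  proof (rule nn_integral_mono_AE, use AE1 in eventually_elim)
    case (elim \<zeta>)
    have "ennreal (norm (block_output u k \<zeta>)) \<le> (\<Sum>A\<in>UNIV. ennreal (norm (\<integral>y. ?f A y \<zeta> \<partial>parM)))"
      unfolding elim by (subst sum_ennreal) (auto intro!: ennreal_leI norm_sum)
    also have "\<dots> \<le> (\<Sum>A\<in>UNIV. \<integral>\<^sup>+y. ennreal (norm (?f A y \<zeta>)) * indicator (parset k) y \<partial>parM)"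
    proof (intro sum_mono order.trans[OF ennreal_norm_integral_le] nn_integral_mono)
      fix A y
      show "ennreal (norm (?f A y \<zeta>)) \<le> ennreal (norm (?f A y \<zeta>)) * indicator (parset k) y"
        by (cases "y \<in> parset k") (auto simp: w0 fconv_def)
    qed
    finally have "(ennreal (norm (block_output u k \<zeta>)))\<^sup>2 \<le> (\<Sum>A\<in>UNIV. \<integral>\<^sup>+y. ennreal (norm (?f A y \<zeta>)) * indicator (parset k) y \<partial>parM)\<^sup>2"
      by (intro power_mono) auto
    then show ?case by (simp add: ennreal_power)
  qed
  also have "\<dots> \<le> ennreal ((2 ^ CARD('n) * blockC m TYPE('n) * b * (2 ^ k) powr m)\<^sup>2) * (\<integral>\<^sup>+\<xi>. ennreal ((norm (u \<xi>))\<^sup>2) * indicator (shell k) \<xi> \<partial>lborel)"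
  proof (rule parset_young[OF _ b0])
    show "(\<lambda>(\<zeta>, y). ennreal (norm (?f A y \<zeta>))) \<in> borel_measurable (lborel \<Otimes>\<^sub>M parM)" for A
      using fm[of A] unfolding case_prod_beta by measurable
    fix A :: "'n set" and y :: "'n \<Rightarrow> real" assume y: "y \<in> parset k"
    then have yM: "y \<in> space parM" by (simp add: parset_def)
    note [measurable] = KKy[OF yM, of A]
    have wm [measurable]: "w A y \<in> borel_measurable borel" unfolding w_def by measurable
    have K0: "0 \<le> K" using bd[of 0] norm_ge_zero order.trans by blast
    have wle2: "norm (w A y \<xi>) \<le> ?\<alpha> A * norm (u \<xi>)" for \<xi>
      by (rule order.trans[OF wle]) (auto intro!: mult_left_mono simp: indicator_def)
    have wi: "integrable lborel (w A y)"
      by (rule Bochner_Integration.integrable_bound[OF integrable_mult_right[OF integrable_norm[OF u], of "?\<alpha> A"]]) (use wle2 in auto)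
    have wK: "norm (w A y \<xi>) \<le> ?\<alpha> A * K" for \<xi>
      by (rule order.trans[OF wle2]) (intro mult_left_mono bd, simp)
    have "(\<integral>\<^sup>+\<zeta>. (ennreal (norm (?f A y \<zeta>)))\<^sup>2 \<partial>lborel) \<le> ennreal ((b * japanese (vec_of y) powr (m - real (card A)))\<^sup>2) * (\<integral>\<^sup>+\<xi>. ennreal ((norm (w A y \<xi>))\<^sup>2) \<partial>lborel)"
      using GA_mult[OF parset_norm(3)[OF y] wi wK, of A] by (simp add: ennreal_power)
    also have "\<dots> \<le> ennreal ((b * japanese (vec_of y) powr (m - real (card A)))\<^sup>2) * (\<integral>\<^sup>+\<xi>. ennreal ((?\<alpha> A)\<^sup>2) * (ennreal ((norm (u \<xi>))\<^sup>2) * indicator (shell k) \<xi>) \<partial>lborel)"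
    proof (intro mult_left_mono nn_integral_mono)
      fix \<xi>
      have "(norm (w A y \<xi>))\<^sup>2 \<le> (?\<alpha> A * (indicator (shell k) \<xi> * norm (u \<xi>)))\<^sup>2"
        by (intro power_mono wle) simp
      also have "\<dots> = (?\<alpha> A)\<^sup>2 * ((norm (u \<xi>))\<^sup>2 * indicator (shell k) \<xi>)"
        by (auto simp: power_mult_distrib indicator_def)
      finally show "ennreal ((norm (w A y \<xi>))\<^sup>2) \<le> ennreal ((?\<alpha> A)\<^sup>2) * (ennreal ((norm (u \<xi>))\<^sup>2) * indicator (shell k) \<xi>)"
        by (auto simp: ennreal_mult[symmetric] indicator_def intro: ennreal_leI)
    qed simp
    also have "\<dots> = (ennreal ((b * japanese (vec_of y) powr (m - real (card A)))\<^sup>2) * ennreal ((?\<alpha> A)\<^sup>2)) * (\<integral>\<^sup>+\<xi>. ennreal ((norm (u \<xi>))\<^sup>2) * indicator (shell k) \<xi> \<partial>lborel)"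
      by (subst nn_integral_cmult) (auto simp: mult.assoc)
    also have "ennreal ((b * japanese (vec_of y) powr (m - real (card A)))\<^sup>2) * ennreal ((?\<alpha> A)\<^sup>2) = ennreal ((b * ?\<alpha> A * japanese (vec_of y :: real^'n) powr (m - real (card A)))\<^sup>2)"
      by (subst ennreal_mult[symmetric]) (auto simp: power_mult_distrib mult_ac)
    finally show "(\<integral>\<^sup>+\<zeta>. (ennreal (norm (?f A y \<zeta>)))\<^sup>2 \<partial>lborel) \<le> ennreal ((b * ?\<alpha> A * japanese (vec_of y :: real^'n) powr (m - real (card A)))\<^sup>2) * (\<integral>\<^sup>+\<xi>. ennreal ((norm (u \<xi>))\<^sup>2) * indicator (shell k) \<xi> \<partial>lborel)" .
  qed
  finally show ?thesis .
qed

end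

section \<open>The weighted estimate\<close>

lemma powr_comparable_sym:
  fixes x y K p :: real
  assumes "0 < x" "0 < y" "x \<le> K * y" "y \<le> K * x" "1 \<le> K"
  shows "x powr p \<le> K powr \<bar>p\<bar> * y powr p"
proof (cases "0 \<le> p")
  case True
  have "x powr p \<le> (K * y) powr p" using assms True by (intro powr_mono2) auto
  also have "\<dots> = K powr \<bar>p\<bar> * y powr p" using assms True by (simp add: powr_mult)
  finally show ?thesis .
next
  case False
  have "x powr p \<le> (y / K) powr p"
    using assms False by (intro powr_mono2') (auto simp: field_simps)
  also have "\<dots> = K powr \<bar>p\<bar> * y powr p" using assms False by (simp add: powr_divide powr_minus field_simps)
  finally show ?thesis .
qed

lemma ennreal_add_sq: "(x + y)\<^sup>2 \<le> 2 * x\<^sup>2 + 2 * y\<^sup>2" for x y :: ennreal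
  using ennreal_sum_sq_le[of UNIV "\<lambda>b. if b then x else y"] by (simp add: UNIV_bool distrib_left add.commute)

lemma blockC_ge_1: "1 \<le> blockC m TYPE('n::finite)"
  unfolding blockC_def
proof (rule mult_ge1_I)
  show "1 \<le> (1 + 3 * real CARD('n)) powr (\<bar>m\<bar> + real CARD('n))"
    by (rule ge_one_powr_ge_zero) auto
qed simp

section \<open>Dyadic levels and weights in the regions of output frequencies\<close>

definition level :: "real^'n \<Rightarrow> nat" where
  "level \<xi> = (LEAST k. norm \<xi> < 2 ^ Suc k)"

lemma level_measurable [measurable]: "level \<in> borel \<rightarrow>\<^sub>M count_space UNIV"
  unfolding level_def[abs_def] by measurable

lemma level_ex: "\<exists>k. norm \<xi> < 2 ^ Suc k" for \<xi> :: "real^'n"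
proof -
  obtain k where "norm \<xi> < 2 ^ k" using real_arch_pow[of 2 "norm \<xi>"] by auto
  then have "norm \<xi> < 2 ^ Suc k" by (rule less_le_trans) simp
  then show ?thesis by blast
qed

text \<open>Frequencies of norm below 1 also have level 0, although they lie in no shell; this is
  why \<open>G\<close>, \<open>farp\<close> and \<open>nearp\<close> test the norm
  separately.\<close>

lemma shell_level:
  assumes "1 \<le> norm \<xi>"
  shows "\<xi> \<in> shell (level \<xi>)"
proof -
  have 1: "norm \<xi> < 2 ^ Suc (level \<xi>)" unfolding level_def by (rule LeastI_ex[OF level_ex])
  have "2 ^ level \<xi> \<le> norm \<xi>"
  proof (cases "level \<xi>")
    case 0 then show ?thesis using assms by simp
  next
    case (Suc j)
    have "\<not> norm \<xi> < 2 ^ Suc j"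
      unfolding level_def by (rule not_less_Least[of j "\<lambda>k. norm \<xi> < 2 ^ Suc k", folded level_def]) (simp add: Suc)
    then show ?thesis by (simp add: Suc)
  qed
  with 1 show ?thesis by (simp add: shell_def)
qed

lemma level_shell:
  assumes "\<xi> \<in> shell k"
  shows "level \<xi> = k"
  unfolding level_def
proof (rule Least_equality)
  show "norm \<xi> < 2 ^ Suc k" using assms by (simp add: shell_def)
  fix j assume j: "norm \<xi> < 2 ^ Suc j"
  show "k \<le> j"
  proof (rule ccontr)
    assume "\<not> k \<le> j"
    then have "(2::real) ^ Suc j \<le> 2 ^ k" by (intro power_increasing) auto
    then show False using assms j by (simp add: shell_def)
  qed
qed

lemma shell_norm_ge_1: "\<xi> \<in> shell k \<Longrightarrow> 1 \<le> norm \<xi>"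
  unfolding shell_def by (auto intro: order.trans[OF one_le_power[of "2::real" k]])

lemma shell_disjoint: "disjoint_family shell"
  unfolding disjoint_family_on_def using level_shell by blast

lemma shell_japanese:
  assumes "\<xi> \<in> shell k"
  shows "2 ^ k \<le> japanese \<xi>" "japanese \<xi> \<le> 4 * 2 ^ k"
proof -
  have "(1::real) \<le> 2 ^ k" "2 ^ k \<le> norm \<xi>" "norm \<xi> < 2 * 2 ^ k"
    using assms by (simp_all add: shell_def)
  then show "2 ^ k \<le> japanese \<xi>" "japanese \<xi> \<le> 4 * 2 ^ k"
    using norm_le_japanese[of \<xi>] japanese_le[of \<xi>] by linarith+
qed

lemma japanese_mono: "norm x \<le> K * norm y \<Longrightarrow> 1 \<le> K \<Longrightarrow> japanese x \<le> K * japanese y"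
proof (rule power2_le_imp_le)
  assume "norm x \<le> K * norm y" and K: "1 \<le> K"
  then have "(norm x)\<^sup>2 \<le> (K * norm y)\<^sup>2" by (intro power_mono) auto
  moreover have "1 \<le> K\<^sup>2" using K by simp
  ultimately show "(japanese x)\<^sup>2 \<le> (K * japanese y)\<^sup>2"
    by (simp add: japanese_sq power_mult_distrib distrib_left)
  show "0 \<le> K * japanese y" using K by simp
qed

text \<open>The regions of output frequencies \<open>\<zeta>\<close> far above, far below and comparable to the shell of \<open>\<xi>\<close>. Low
  input frequencies are counted as the first kind.\<close>

definition farp :: "real^'n \<Rightarrow> real^'n \<Rightarrow> bool" where
  "farp \<zeta> \<xi> \<longleftrightarrow> norm \<xi> < 1 \<or> 4 * 2 ^ level \<xi> < norm \<zeta>"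

definition belowp :: "real^'n \<Rightarrow> real^'n \<Rightarrow> bool" where
  "belowp \<zeta> \<xi> \<longleftrightarrow> 1 \<le> norm \<xi> \<and> 2 * norm \<zeta> < 2 ^ level \<xi>"

definition nearp :: "real^'n \<Rightarrow> real^'n \<Rightarrow> bool" where
  "nearp \<zeta> \<xi> \<longleftrightarrow> 1 \<le> norm \<xi> \<and> 2 ^ level \<xi> \<le> 2 * norm \<zeta> \<and> norm \<zeta> \<le> 4 * 2 ^ level \<xi>"

lemma regions_measurable [measurable]:
  "Measurable.pred (borel \<Otimes>\<^sub>M borel) (\<lambda>p. farp (fst p) (snd p))"
  "Measurable.pred (borel \<Otimes>\<^sub>M borel) (\<lambda>p. belowp (fst p) (snd p))"
  "Measurable.pred (borel \<Otimes>\<^sub>M borel) (\<lambda>p. nearp (fst p) (snd p))"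
  unfolding farp_def belowp_def nearp_def by measurable

lemma regions_partition:
  "of_bool (farp \<zeta> \<xi>) + of_bool (belowp \<zeta> \<xi>) + of_bool (nearp \<zeta> \<xi>) = (1 :: 'a::semiring_1)"
proof -
  have "\<not> (4 * 2 ^ level \<xi> < norm \<zeta> \<and> 2 * norm \<zeta> < 2 ^ level \<xi>)"
    using zero_less_power[of "2::real" "level \<xi>"] by linarith
  then show ?thesis by (auto simp: farp_def belowp_def nearp_def)
qed

text \<open>The power of 3 covers the comparison of the weights of \<zeta> and \<zeta> - \<xi>; the
  power of 2 covers the weight of \<xi> inside the unit ball, which lies between 1 and 2.\<close>

definition farC :: "real \<Rightarrow> real \<Rightarrow> real" where
  "farC s \<tau> = 3 powr \<bar>s\<bar> * 2 powr \<bar>s - \<tau>\<bar>"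

lemma farC_pos: "0 < farC s \<tau>" by (simp add: farC_def)

text \<open>Far above the shell, \<zeta> and \<zeta> - \<xi> have comparable weights and that of
  \<xi> is no larger than that of \<zeta> - \<xi>. Since s \<le> \<tau>, the power s - \<tau> may be
  moved from \<zeta> - \<xi> to \<xi>. For \<xi> in the unit ball its weight is comparable to
  1.\<close>

lemma farp_weight:
  assumes far: "farp \<zeta> \<xi>" and st: "s \<le> \<tau>"
  shows "japanese \<zeta> powr s \<le> farC s \<tau> * (japanese (\<zeta> - \<xi>) powr \<tau> * japanese \<xi> powr (s - \<tau>))"
proof (cases "norm \<xi> < 1")
  case True
  have "norm \<zeta> \<le> norm (\<zeta> - \<xi>) + norm \<xi>" "norm (\<zeta> - \<xi>) \<le> norm \<zeta> + norm \<xi>" by norm+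
  then have "japanese \<zeta> \<le> 3 * japanese (\<zeta> - \<xi>)" "japanese (\<zeta> - \<xi>) \<le> 3 * japanese \<zeta>"
    using True japanese_le[of \<zeta>] japanese_le[of "\<zeta> - \<xi>"] norm_le_japanese[of \<zeta>] norm_le_japanese[of "\<zeta> - \<xi>"]
      japanese_ge_1[of \<zeta>] japanese_ge_1[of "\<zeta> - \<xi>"] by linarith+
  then have "japanese \<zeta> powr s \<le> 3 powr \<bar>s\<bar> * japanese (\<zeta> - \<xi>) powr s"
    by (intro powr_comparable_sym) auto
  also have "\<dots> \<le> 3 powr \<bar>s\<bar> * (japanese (\<zeta> - \<xi>) powr \<tau> * 1)"
    using st by (intro mult_left_mono) (auto intro!: powr_mono)
  also have "\<dots> \<le> 3 powr \<bar>s\<bar> * (japanese (\<zeta> - \<xi>) powr \<tau> * (2 powr \<bar>s - \<tau>\<bar> * japanese \<xi> powr (s - \<tau>)))"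
  proof (intro mult_left_mono)
    have "1 powr (s - \<tau>) \<le> 2 powr \<bar>s - \<tau>\<bar> * japanese \<xi> powr (s - \<tau>)"
      by (rule powr_comparable(2)) (use True japanese_le[of \<xi>] in auto)
    then show "1 \<le> 2 powr \<bar>s - \<tau>\<bar> * japanese \<xi> powr (s - \<tau>)" by simp
  qed auto
  finally show ?thesis by (simp add: farC_def mult_ac)
next
  case False
  then have sh: "\<xi> \<in> shell (level \<xi>)" and z: "4 * 2 ^ level \<xi> < norm \<zeta>"
    using far shell_level[of \<xi>] by (auto simp: farp_def)
  have x: "2 * norm \<xi> < norm \<zeta>" using sh z by (simp add: shell_def)
  have n: "norm \<zeta> \<le> norm (\<zeta> - \<xi>) + norm \<xi>" "norm (\<zeta> - \<xi>) \<le> norm \<zeta> + norm \<xi>" by norm+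
  have "japanese \<zeta> \<le> 2 * japanese (\<zeta> - \<xi>)" "japanese (\<zeta> - \<xi>) \<le> 2 * japanese \<zeta>" "japanese \<xi> \<le> 1 * japanese (\<zeta> - \<xi>)"
    using n x by (intro japanese_mono; linarith)+
  then have "japanese \<zeta> powr s \<le> 2 powr \<bar>s\<bar> * japanese (\<zeta> - \<xi>) powr s"
    by (intro powr_comparable_sym) auto
  also have "\<dots> = 2 powr \<bar>s\<bar> * (japanese (\<zeta> - \<xi>) powr \<tau> * japanese (\<zeta> - \<xi>) powr (s - \<tau>))"
    by (simp add: powr_add[symmetric])
  also have "\<dots> \<le> farC s \<tau> * (japanese (\<zeta> - \<xi>) powr \<tau> * japanese \<xi> powr (s - \<tau>))"
  proof (intro mult_mono mult_left_mono)
    have "2 powr \<bar>s\<bar> \<le> 3 powr \<bar>s\<bar>" by (intro powr_mono2) auto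
    also have "3 powr \<bar>s\<bar> \<le> farC s \<tau>"
      unfolding farC_def by (simp add: ge_one_powr_ge_zero)
    finally show "2 powr \<bar>s\<bar> \<le> farC s \<tau>" .
    show "japanese (\<zeta> - \<xi>) powr (s - \<tau>) \<le> japanese \<xi> powr (s - \<tau>)"
      using st \<open>japanese \<xi> \<le> 1 * japanese (\<zeta> - \<xi>)\<close> by (intro powr_mono2') auto
  qed (auto simp: farC_pos less_imp_le)
  finally show ?thesis .
qed

text \<open>Below the shell, \<zeta> - \<xi> is at least as large as \<zeta>, so a nonnegative power
  s is absorbed by a Sobolev weight of order s on the symbol. The trivial exponent s - s matches the
  form asked for by \<open>weighted_region_bound\<close>.\<close>

lemma belowp_weight:
  assumes below: "belowp \<zeta> \<xi>" and s: "0 \<le> s"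
  shows "japanese \<zeta> powr s \<le> farC s s * (japanese (\<zeta> - \<xi>) powr s * japanese \<xi> powr (s - s))"
proof -
  have sh: "\<xi> \<in> shell (level \<xi>)" and z: "2 * norm \<zeta> < 2 ^ level \<xi>"
    using below shell_level[of \<xi>] by (auto simp: belowp_def)
  have "norm \<xi> \<le> norm (\<zeta> - \<xi>) + norm \<zeta>" by norm
  then have "norm \<zeta> \<le> 1 * norm (\<zeta> - \<xi>)" using sh z by (simp add: shell_def)
  then have "japanese \<zeta> \<le> 1 * japanese (\<zeta> - \<xi>)" by (rule japanese_mono) simp
  then have "1 * japanese \<zeta> powr s \<le> farC s s * japanese (\<zeta> - \<xi>) powr s"
    using s by (intro mult_mono powr_mono2) (auto simp: farC_def ge_one_powr_ge_zero)
  then show ?thesis by simp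
qed

lemma weight_CS:
  fixes u :: "real^'n \<Rightarrow> complex"
  assumes [measurable]: "u \<in> borel_measurable borel"
  shows "(\<integral>\<^sup>+\<xi>. ennreal (japanese \<xi> powr p * norm (u \<xi>)) \<partial>lborel)\<^sup>2
    \<le> (\<integral>\<^sup>+\<xi>. ennreal (japanese (\<xi>::real^'n) powr (- (2 * t))) \<partial>lborel) * weighted_sq (p + t) u"
proof -
  have "(\<integral>\<^sup>+\<xi>. ennreal (japanese \<xi> powr p * norm (u \<xi>)) \<partial>lborel) = (\<integral>\<^sup>+\<xi>. ennreal (japanese \<xi> powr (- t)) * ennreal (japanese \<xi> powr (p + t) * norm (u \<xi>)) \<partial>lborel)"
    by (intro nn_integral_cong, subst ennreal_mult[symmetric]) (auto simp: powr_add powr_minus field_simps)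
  also have "\<dots>\<^sup>2 \<le> (\<integral>\<^sup>+\<xi>. (ennreal (japanese (\<xi>::real^'n) powr (- t)))\<^sup>2 \<partial>lborel) * weighted_sq (p + t) u"
    by (rule Cauchy_Schwarz_nn_integral) measurable
  also have "(\<lambda>\<xi>::real^'n. (ennreal (japanese \<xi> powr (- t)))\<^sup>2) = (\<lambda>\<xi>. ennreal (japanese \<xi> powr (- (2 * t))))"
    by (simp add: fun_eq_iff power2_eq_square ennreal_mult[symmetric] powr_add[symmetric])
  finally show ?thesis .
qed

context fourier_symbol
begin

text \<open>The transform in x of the symbol at frequency \<xi>, as one jointly measurable function;
  from norm 1 on, each \<xi> uses the cubes of its own shell.\<close>

definition G :: "real^'n \<Rightarrow> real^'n \<Rightarrow> complex" where
  "G \<eta> \<xi> = (if norm \<xi> < 1 then GL \<eta> \<xi> else block_symbol GA (level \<xi>) \<eta> \<xi>)"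

lemma G_measurable [measurable]: "(\<lambda>p. G (fst p) (snd p)) \<in> borel_measurable (borel \<Otimes>\<^sub>M borel)"
proof -
  have [measurable]: "(\<lambda>p. block_symbol GA (level (snd p)) (fst p) (snd p)) \<in> borel_measurable ((borel :: (real^'n) measure) \<Otimes>\<^sub>M borel)"
    by (rule measurable_compose_countable[where g="\<lambda>p. level (snd p)"]) measurable
  show ?thesis unfolding G_def by measurable
qed

lemma G_shift_measurable [measurable]:
  "(\<lambda>p. G (fst p - snd p) (snd p)) \<in> borel_measurable (borel \<Otimes>\<^sub>M borel)"
  using measurable_compose[OF _ G_measurable, of "\<lambda>p. (fst p - snd p, snd p)" "borel \<Otimes>\<^sub>M borel"] by simp

lemma G_section_measurable [measurable]: "(\<lambda>\<eta>. G \<eta> \<xi>) \<in> borel_measurable borel"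
  using measurable_compose[OF _ G_measurable, of "\<lambda>\<eta>. (\<eta>, \<xi>)" borel] by simp

definition GC :: real where
  "GC = 2 ^ CARD('n) * blockC m TYPE('n) * 4 powr \<bar>m\<bar>"

lemma GC_pos: "0 < GC" unfolding GC_def using blockC_pos[where 'n='n, of m] by simp

text \<open>On the unit ball the power of the weight of \<xi> is comparable to 1, beyond it
  \<open>block_majorant\<close> dominates; one bound results for both regimes.\<close>

lemma G_bound: "weighted_sq \<tau> (\<lambda>\<eta>. G \<eta> \<xi>) \<le> ennreal ((GC * a * japanese \<xi> powr m)\<^sup>2)"
proof (cases "norm \<xi> < 1")
  case True
  have "1 powr m \<le> 2 powr \<bar>m\<bar> * japanese \<xi> powr m"
    by (rule powr_comparable(2)) (use True japanese_le[of \<xi>] in auto)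
  also have "\<dots> \<le> GC * japanese \<xi> powr m"
  proof (intro mult_right_mono)
    have "2 powr \<bar>m\<bar> \<le> 4 powr \<bar>m\<bar>" by (intro powr_mono2) auto
    also have "\<dots> \<le> GC"
    proof -
      have "1 * 1 \<le> 2 ^ CARD('n) * blockC m TYPE('n)"
        by (intro mult_mono blockC_ge_1) auto
      then show ?thesis unfolding GC_def using mult_right_mono[of 1 "2 ^ CARD('n) * blockC m TYPE('n)" "4 powr \<bar>m\<bar>"] by simp
    qed
    finally show "2 powr \<bar>m\<bar> \<le> GC" .
  qed simp
  finally have "1 \<le> GC * japanese \<xi> powr m" by simp
  then have "a * 1 \<le> a * (GC * japanese \<xi> powr m)" using a0 by (rule mult_left_mono)
  then have "a\<^sup>2 \<le> (GC * a * japanese \<xi> powr m)\<^sup>2" using a0 by (intro power_mono) (auto simp: mult_ac)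
  then show ?thesis using GL_bound[of \<xi>] True by (auto simp: G_def intro: order.trans ennreal_leI)
next
  case False
  define k where "k = level \<xi>"
  have sh: "\<xi> \<in> shell k" using False shell_level[of \<xi>] by (simp add: k_def)
  have "weighted_sq \<tau> (\<lambda>\<eta>. G \<eta> \<xi>) \<le> (\<integral>\<^sup>+\<eta>. (ennreal (japanese \<eta> powr \<tau>) * block_majorant GA k \<eta>)\<^sup>2 \<partial>lborel)"
  proof (intro nn_integral_mono power_mono)
    fix \<eta>
    show "ennreal (japanese \<eta> powr \<tau> * norm (G \<eta> \<xi>)) \<le> ennreal (japanese \<eta> powr \<tau>) * block_majorant GA k \<eta>"
      using False block_symbol_le_block_majorant[OF sh, of \<eta>] by (simp add: G_def k_def ennreal_mult mult_left_mono)
  qed simp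
  also have "\<dots> \<le> ennreal ((2 ^ CARD('n) * blockC m TYPE('n) * a * (2 ^ k) powr m)\<^sup>2)" by (rule block_majorant_bound)
  also have "\<dots> \<le> ennreal ((GC * a * japanese \<xi> powr m)\<^sup>2)"
  proof (intro ennreal_leI power_mono)
    have "(2 ^ k) powr m \<le> 4 powr \<bar>m\<bar> * japanese \<xi> powr m"
      by (rule powr_comparable(2)) (use shell_japanese[OF sh] in auto)
    then have "2 ^ CARD('n) * blockC m TYPE('n) * a * (2 ^ k) powr m \<le> 2 ^ CARD('n) * blockC m TYPE('n) * a * (4 powr \<bar>m\<bar> * japanese \<xi> powr m)"
      using blockC_pos[where 'n='n, of m] a0 by (intro mult_left_mono) auto
    then show "2 ^ CARD('n) * blockC m TYPE('n) * a * (2 ^ k) powr m \<le> GC * a * japanese \<xi> powr m"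
      by (simp add: GC_def mult_ac)
  qed (use blockC_pos[where 'n='n, of m] a0 in auto)
  finally show ?thesis .
qed

definition v :: "(real^'n \<Rightarrow> complex) \<Rightarrow> real^'n \<Rightarrow> complex" where
  "v u \<zeta> = (\<integral>\<xi>. G (\<zeta> - \<xi>) \<xi> * u \<xi> \<partial>lborel)"

text \<open>\<open>weighted_young\<close> with the density
  \<open>japanese \<xi> powr (m + s - \<tau>) * norm (u \<xi>)\<close>. After the weight hypothesis
  is inserted, the exponents of the weight of \<xi> add up to -m, which the bound on G
  compensates.\<close>

lemma weighted_region_bound:
  fixes R :: "real^'n \<Rightarrow> real^'n \<Rightarrow> bool" and u :: "real^'n \<Rightarrow> complex"
  assumes R [measurable]: "Measurable.pred (borel \<Otimes>\<^sub>M borel) (\<lambda>p. R (fst p) (snd p))"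
    and w: "\<And>\<zeta> \<xi>. R \<zeta> \<xi> \<Longrightarrow> japanese \<zeta> powr s \<le> farC s \<tau> * (japanese (\<zeta> - \<xi>) powr \<tau> * japanese \<xi> powr (s - \<tau>))"
    and [measurable]: "u \<in> borel_measurable borel"
  shows "(\<integral>\<^sup>+\<zeta>. (ennreal (japanese \<zeta> powr s) * (\<integral>\<^sup>+\<xi>. of_bool (R \<zeta> \<xi>) * ennreal (norm (G (\<zeta> - \<xi>) \<xi> * u \<xi>)) \<partial>lborel))\<^sup>2 \<partial>lborel)
    \<le> ennreal ((farC s \<tau> * GC * a)\<^sup>2) * (\<integral>\<^sup>+\<xi>. ennreal (japanese \<xi> powr (m + s - \<tau>) * norm (u \<xi>)) \<partial>lborel)\<^sup>2"
proof -
  let ?p = "m + s - \<tau>"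
  let ?P = "\<lambda>\<zeta> \<xi>. of_bool (R \<zeta> \<xi>) * ennreal (japanese \<zeta> powr s * japanese \<xi> powr (- ?p) * norm (G (\<zeta> - \<xi>) \<xi>))"
  let ?h = "\<lambda>\<xi>. ennreal (japanese \<xi> powr ?p * norm (u \<xi>))"
  have Rm [measurable]: "(\<lambda>p. of_bool (R (fst p) (snd p)) :: ennreal) \<in> borel_measurable (borel \<Otimes>\<^sub>M borel)"
    unfolding of_bool_def by measurable
  have Rs [measurable]: "(\<lambda>\<xi>. of_bool (R \<zeta> \<xi>) :: ennreal) \<in> borel_measurable borel" for \<zeta>
    using measurable_compose[OF _ Rm, of "\<lambda>\<xi>. (\<zeta>, \<xi>)" borel] by simp
  have Gs [measurable]: "(\<lambda>\<xi>. G (\<zeta> - \<xi>) \<xi>) \<in> borel_measurable borel" for \<zeta>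
    using measurable_compose[OF _ G_shift_measurable, of "\<lambda>\<xi>. (\<zeta>, \<xi>)" borel] by simp
  have Pm: "(\<lambda>(\<zeta>, \<xi>). ?P \<zeta> \<xi>) \<in> borel_measurable (lborel \<Otimes>\<^sub>M lborel)"
    unfolding case_prod_beta by measurable
  have "(\<integral>\<^sup>+\<zeta>. (ennreal (japanese \<zeta> powr s) * (\<integral>\<^sup>+\<xi>. of_bool (R \<zeta> \<xi>) * ennreal (norm (G (\<zeta> - \<xi>) \<xi> * u \<xi>)) \<partial>lborel))\<^sup>2 \<partial>lborel)
    = (\<integral>\<^sup>+\<zeta>. (\<integral>\<^sup>+\<xi>. ?P \<zeta> \<xi> * ?h \<xi> \<partial>lborel)\<^sup>2 \<partial>lborel)"
  proof (intro nn_integral_cong arg_cong[where f="\<lambda>t. t\<^sup>2"])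
    fix \<zeta> :: "real^'n"
    have "ennreal (japanese \<zeta> powr s) * (\<integral>\<^sup>+\<xi>. of_bool (R \<zeta> \<xi>) * ennreal (norm (G (\<zeta> - \<xi>) \<xi> * u \<xi>)) \<partial>lborel)
      = (\<integral>\<^sup>+\<xi>. ennreal (japanese \<zeta> powr s) * (of_bool (R \<zeta> \<xi>) * ennreal (norm (G (\<zeta> - \<xi>) \<xi> * u \<xi>))) \<partial>lborel)"
      by (rule nn_integral_cmult[symmetric]) measurable
    also have "\<dots> = (\<integral>\<^sup>+\<xi>. ?P \<zeta> \<xi> * ?h \<xi> \<partial>lborel)"
    proof (rule nn_integral_cong)
      fix \<xi> :: "real^'n"
      have e: "japanese \<xi> powr (- ?p) * japanese \<xi> powr ?p = 1" by (simp add: powr_add[symmetric])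
      have "(japanese \<zeta> powr s * japanese \<xi> powr (- ?p) * norm (G (\<zeta> - \<xi>) \<xi>)) * (japanese \<xi> powr ?p * norm (u \<xi>))
         = japanese \<zeta> powr s * (norm (G (\<zeta> - \<xi>) \<xi>) * norm (u \<xi>)) * (japanese \<xi> powr (- ?p) * japanese \<xi> powr ?p)"
        by (simp only: mult_ac)
      then have "japanese \<zeta> powr s * norm (G (\<zeta> - \<xi>) \<xi> * u \<xi>) = (japanese \<zeta> powr s * japanese \<xi> powr (- ?p) * norm (G (\<zeta> - \<xi>) \<xi>)) * (japanese \<xi> powr ?p * norm (u \<xi>))"
        unfolding e norm_mult by simp
      then have "ennreal (japanese \<zeta> powr s) * ennreal (norm (G (\<zeta> - \<xi>) \<xi> * u \<xi>)) = ennreal (japanese \<zeta> powr s * japanese \<xi> powr (- ?p) * norm (G (\<zeta> - \<xi>) \<xi>)) * ?h \<xi>"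
        by (subst (1 2) ennreal_mult[symmetric]) auto
      then show "ennreal (japanese \<zeta> powr s) * (of_bool (R \<zeta> \<xi>) * ennreal (norm (G (\<zeta> - \<xi>) \<xi> * u \<xi>))) = ?P \<zeta> \<xi> * ?h \<xi>"
        by (cases "R \<zeta> \<xi>") auto
    qed
    finally show "ennreal (japanese \<zeta> powr s) * (\<integral>\<^sup>+\<xi>. of_bool (R \<zeta> \<xi>) * ennreal (norm (G (\<zeta> - \<xi>) \<xi> * u \<xi>)) \<partial>lborel) = (\<integral>\<^sup>+\<xi>. ?P \<zeta> \<xi> * ?h \<xi> \<partial>lborel)" .
  qed
  also have "\<dots> \<le> ennreal ((farC s \<tau> * GC * a)\<^sup>2) * (\<integral>\<^sup>+\<xi>. ?h \<xi> \<partial>lborel)\<^sup>2"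
  proof (rule weighted_young[OF sigma_finite_lborel sigma_finite_lborel Pm])
    fix \<xi> :: "real^'n"
    have "(\<integral>\<^sup>+\<zeta>. (?P \<zeta> \<xi>)\<^sup>2 \<partial>lborel) \<le> (\<integral>\<^sup>+\<zeta>. (ennreal (farC s \<tau> * japanese \<xi> powr (- m)))\<^sup>2 * (ennreal (japanese (\<zeta> - \<xi>) powr \<tau> * norm (G (\<zeta> - \<xi>) \<xi>)))\<^sup>2 \<partial>lborel)"
      unfolding power_mult_distrib[symmetric]
    proof (intro nn_integral_mono power_mono)
      fix \<zeta> :: "real^'n"
      show "?P \<zeta> \<xi> \<le> ennreal (farC s \<tau> * japanese \<xi> powr (- m)) * ennreal (japanese (\<zeta> - \<xi>) powr \<tau> * norm (G (\<zeta> - \<xi>) \<xi>))"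
      proof (cases "R \<zeta> \<xi>")
        case True
        have "japanese \<zeta> powr s * japanese \<xi> powr (- ?p) * norm (G (\<zeta> - \<xi>) \<xi>)
          \<le> (farC s \<tau> * (japanese (\<zeta> - \<xi>) powr \<tau> * japanese \<xi> powr (s - \<tau>))) * japanese \<xi> powr (- ?p) * norm (G (\<zeta> - \<xi>) \<xi>)"
          by (intro mult_right_mono w True) auto
        also have "\<dots> = (farC s \<tau> * (japanese \<xi> powr (s - \<tau>) * japanese \<xi> powr (- ?p))) * (japanese (\<zeta> - \<xi>) powr \<tau> * norm (G (\<zeta> - \<xi>) \<xi>))"
          by (simp only: mult_ac)
        also have "japanese \<xi> powr (s - \<tau>) * japanese \<xi> powr (- ?p) = japanese \<xi> powr (- m)"
          by (simp add: powr_add[symmetric])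
        finally show ?thesis
          using True farC_pos[of s \<tau>] by (simp add: ennreal_mult[symmetric] ennreal_leI)
      qed simp
    qed simp
    also have "\<dots> = (ennreal (farC s \<tau> * japanese \<xi> powr (- m)))\<^sup>2 * (\<integral>\<^sup>+\<zeta>. (ennreal (japanese (\<zeta> - \<xi>) powr \<tau> * norm (G (\<zeta> - \<xi>) \<xi>)))\<^sup>2 \<partial>lborel)"
    proof (rule nn_integral_cmult)
      have [measurable]: "(\<lambda>\<zeta>. G (\<zeta> - \<xi>) \<xi>) \<in> borel_measurable borel"
        using measurable_compose[OF _ G_shift_measurable, of "\<lambda>\<zeta>. (\<zeta>, \<xi>)" borel] by simp
      show "(\<lambda>\<zeta>. (ennreal (japanese (\<zeta> - \<xi>) powr \<tau> * norm (G (\<zeta> - \<xi>) \<xi>)))\<^sup>2) \<in> borel_measurable lborel"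
        by measurable
    qed
    also have "(\<integral>\<^sup>+\<zeta>. (ennreal (japanese (\<zeta> - \<xi>) powr \<tau> * norm (G (\<zeta> - \<xi>) \<xi>)))\<^sup>2 \<partial>lborel) = weighted_sq \<tau> (\<lambda>\<eta>. G \<eta> \<xi>)"
      by (rule nn_integral_shift_minus[of "\<lambda>\<eta>. (ennreal (japanese \<eta> powr \<tau> * norm (G \<eta> \<xi>)))\<^sup>2"]) measurable
    finally have "(\<integral>\<^sup>+\<zeta>. (?P \<zeta> \<xi>)\<^sup>2 \<partial>lborel) \<le> (ennreal (farC s \<tau> * japanese \<xi> powr (- m)))\<^sup>2 * ennreal ((GC * a * japanese \<xi> powr m)\<^sup>2)"
      using mult_left_mono[OF G_bound[of \<xi>], of "(ennreal (farC s \<tau> * japanese \<xi> powr (- m)))\<^sup>2"] by (auto intro: order.trans)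
    also have "\<dots> = ennreal ((farC s \<tau> * japanese \<xi> powr (- m))\<^sup>2 * (GC * a * japanese \<xi> powr m)\<^sup>2)"
    proof -
      have "(ennreal (farC s \<tau> * japanese \<xi> powr (- m)))\<^sup>2 = ennreal ((farC s \<tau> * japanese \<xi> powr (- m))\<^sup>2)"
        by (rule ennreal_power) (simp add: farC_pos less_imp_le)
      then show ?thesis by (simp only:) (rule ennreal_mult[symmetric], auto)
    qed
    also have "(farC s \<tau> * japanese \<xi> powr (- m))\<^sup>2 * (GC * a * japanese \<xi> powr m)\<^sup>2 = (farC s \<tau> * GC * a * (japanese \<xi> powr (- m) * japanese \<xi> powr m))\<^sup>2"
      unfolding power_mult_distrib[symmetric] by (simp only: mult_ac)
    also have "japanese \<xi> powr (- m) * japanese \<xi> powr m = 1" by (simp add: powr_add[symmetric])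
    finally show "(\<integral>\<^sup>+\<zeta>. (?P \<zeta> \<xi>)\<^sup>2 \<partial>lborel) \<le> ennreal ((farC s \<tau> * GC * a)\<^sup>2)" by simp
  qed measurable
  finally show ?thesis .
qed

text \<open>The L1 norm of G in its first variable grows at most like the power m of the weight of
  \<xi>, which the rapid decay of u outweighs.\<close>

lemma G_u_finite:
  fixes u :: "real^'n \<Rightarrow> complex"
  assumes u: "rapid u" and [measurable]: "u \<in> borel_measurable borel"
  shows "(\<integral>\<^sup>+\<xi>. \<integral>\<^sup>+\<zeta>. ennreal (norm (G (\<zeta> - \<xi>) \<xi> * u \<xi>)) \<partial>lborel \<partial>lborel) < \<infinity>"
proof -
  define W where "W = enn2real (\<integral>\<^sup>+\<eta>. ennreal (japanese (\<eta>::real^'n) powr (- (2 * \<tau>))) \<partial>lborel)"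
  have W: "(\<integral>\<^sup>+\<eta>. ennreal (japanese (\<eta>::real^'n) powr (- (2 * \<tau>))) \<partial>lborel) = ennreal W" "0 \<le> W"
    using nn_integral_japanese_weight[OF tau] by (auto simp: W_def less_top)
  have L: "(\<integral>\<^sup>+\<eta>. ennreal (norm (G \<eta> \<xi>)) \<partial>lborel) \<le> ennreal (sqrt W * (GC * a * japanese \<xi> powr m))" for \<xi>
  proof (rule ennreal_power2_le_imp_le)
    have "(\<integral>\<^sup>+\<eta>. ennreal (norm (G \<eta> \<xi>)) \<partial>lborel)\<^sup>2 \<le> ennreal W * ennreal ((GC * a * japanese \<xi> powr m)\<^sup>2)"
      using weight_L1[of "\<lambda>\<eta>. ennreal (norm (G \<eta> \<xi>))"] G_bound[of \<xi>] unfolding W(1)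
      by (simp add: ennreal_mult) (meson mult_left_mono order.trans zero_le)
    also have "\<dots> = (ennreal (sqrt W * (GC * a * japanese \<xi> powr m)))\<^sup>2"
      using W a0 GC_pos by (subst ennreal_mult[symmetric]) (auto simp: ennreal_power power_mult_distrib)
    finally show "(\<integral>\<^sup>+\<eta>. ennreal (norm (G \<eta> \<xi>)) \<partial>lborel)\<^sup>2 \<le> (ennreal (sqrt W * (GC * a * japanese \<xi> powr m)))\<^sup>2" .
  qed (use W a0 GC_pos in auto)
  have "(\<integral>\<^sup>+\<xi>. \<integral>\<^sup>+\<zeta>. ennreal (norm (G (\<zeta> - \<xi>) \<xi> * u \<xi>)) \<partial>lborel \<partial>lborel) \<le> (\<integral>\<^sup>+\<xi>. ennreal (sqrt W * GC * a) * ennreal (japanese \<xi> powr m * norm (u \<xi>)) \<partial>lborel)"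
  proof (intro nn_integral_mono)
    fix \<xi> :: "real^'n"
    have [measurable]: "(\<lambda>\<zeta>. G (\<zeta> - \<xi>) \<xi>) \<in> borel_measurable borel"
      using measurable_compose[OF _ G_shift_measurable, of "\<lambda>\<zeta>. (\<zeta>, \<xi>)" borel] by simp
    have "(\<integral>\<^sup>+\<zeta>. ennreal (norm (G (\<zeta> - \<xi>) \<xi> * u \<xi>)) \<partial>lborel) = (\<integral>\<^sup>+\<zeta>. ennreal (norm (G (\<zeta> - \<xi>) \<xi>)) \<partial>lborel) * ennreal (norm (u \<xi>))"
      by (simp add: norm_mult ennreal_mult nn_integral_multc)
    also have "(\<integral>\<^sup>+\<zeta>. ennreal (norm (G (\<zeta> - \<xi>) \<xi>)) \<partial>lborel) = (\<integral>\<^sup>+\<eta>. ennreal (norm (G \<eta> \<xi>)) \<partial>lborel)"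
      by (rule nn_integral_shift_minus[of "\<lambda>\<eta>. ennreal (norm (G \<eta> \<xi>))"]) measurable
    finally have "(\<integral>\<^sup>+\<zeta>. ennreal (norm (G (\<zeta> - \<xi>) \<xi> * u \<xi>)) \<partial>lborel) \<le> ennreal (sqrt W * (GC * a * japanese \<xi> powr m)) * ennreal (norm (u \<xi>))"
      using mult_right_mono[OF L[of \<xi>], of "ennreal (norm (u \<xi>))"] by simp
    also have "\<dots> = ennreal (sqrt W * GC * a) * ennreal (japanese \<xi> powr m * norm (u \<xi>))"
      using W a0 GC_pos by (simp add: ennreal_mult[symmetric] mult_ac)
    finally show "(\<integral>\<^sup>+\<zeta>. ennreal (norm (G (\<zeta> - \<xi>) \<xi> * u \<xi>)) \<partial>lborel) \<le> \<dots>" .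
  qed
  also have "\<dots> = ennreal (sqrt W * GC * a) * (\<integral>\<^sup>+\<xi>. ennreal (japanese \<xi> powr m * norm (u \<xi>)) \<partial>lborel)"
    by (rule nn_integral_cmult) measurable
  also have "\<dots> < \<infinity>"
    using rapid_integrable_weight[OF u, of m] by (simp add: ennreal_mult_less_top)
  finally show ?thesis .
qed

end

text \<open>The midpoint r of max(d/2, -s) and \<tau>, for -\<tau> < s. Above d/2, it makes the
  weight with exponent -r square integrable; above -s, it makes s + r positive; below \<tau>, it
  leaves a geometric series of ratio \<open>2 powr (r - \<tau>)\<close> below 1.\<close>

definition belowr :: "real \<Rightarrow> real \<Rightarrow> 'n::finite itself \<Rightarrow> real" where
  "belowr s \<tau> _ = (max (real CARD('n) / 2) (- s) + \<tau>) / 2"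

text \<open>The squared L2 norm of the weight with exponent -t, the source of the constant in
  Cauchy-Schwarz and Sobolev embedding. It has this meaning for t > d/2, where the integral is
  finite.\<close>

definition weightC :: "real \<Rightarrow> 'n::finite itself \<Rightarrow> real" where
  "weightC t _ = enn2real (\<integral>\<^sup>+\<eta>. ennreal (japanese (\<eta>::real^'n) powr (- (2 * t))) \<partial>lborel)"

lemma weightC:
  assumes "real CARD('n::finite) / 2 < t"
  shows "(\<integral>\<^sup>+\<eta>. ennreal (japanese (\<eta>::real^'n) powr (- (2 * t))) \<partial>lborel) = ennreal (weightC t TYPE('n))"
    and "0 \<le> weightC t TYPE('n)"
  using nn_integral_japanese_weight[OF assms] by (auto simp: weightC_def less_top)

definition belowD :: "real \<Rightarrow> real \<Rightarrow> real \<Rightarrow> 'n::finite itself \<Rightarrow> real" where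
  "belowD m s \<tau> n = 2 powr (s + belowr s \<tau> n) * (2 powr \<tau> * (2 ^ CARD('n) * blockC m n) * 4 powr \<bar>s + m\<bar>)"

definition belowC :: "real \<Rightarrow> real \<Rightarrow> real \<Rightarrow> 'n::finite itself \<Rightarrow> real" where
  "belowC m s \<tau> n = weightC (belowr s \<tau> n) n * ((1 / (1 - 2 powr (belowr s \<tau> n - \<tau>))) * belowD m s \<tau> n)\<^sup>2"

text \<open>The leading 4 is the largest number of shells near one \<zeta>; 5 compares the weight of
  \<zeta> with 2^k, and \<open>4 powr \<bar>s + m\<bar>\<close> compares the weight of \<xi> with
  it.\<close>

definition nearC :: "real \<Rightarrow> real \<Rightarrow> 'n::finite itself \<Rightarrow> real" where
  "nearC m s n = 4 * (5 powr \<bar>s\<bar> * (2 ^ CARD('n) * blockC m n) * 4 powr \<bar>s + m\<bar>)\<^sup>2"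

lemma pow_powr: "((2::real) ^ k) powr p = (2 powr p) ^ k"
proof -
  have "((2::real) ^ k) powr p = 2 powr (real k * p)" by (simp add: powr_realpow[symmetric] powr_powr)
  also have "\<dots> = (2 powr p) powr real k" by (simp add: powr_powr mult.commute)
  also have "\<dots> = (2 powr p) ^ k" by (rule powr_realpow) simp
  finally show ?thesis .
qed

lemma shell_weight:
  assumes "\<xi> \<in> shell k"
  shows "norm z \<le> 4 powr \<bar>p\<bar> * (2 ^ k) powr (- p) * (japanese \<xi> powr p * norm z)"
proof -
  have "(2 ^ k) powr p \<le> 4 powr \<bar>p\<bar> * japanese \<xi> powr p"
    by (rule powr_comparable(2)) (use shell_japanese[OF assms] in auto)
  then have "(2 ^ k) powr (- p) * (2 ^ k) powr p \<le> (2 ^ k) powr (- p) * (4 powr \<bar>p\<bar> * japanese \<xi> powr p)"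
    by (rule mult_left_mono) simp
  moreover have "((2::real) ^ k) powr (- p) * (2 ^ k) powr p = 1" by (simp add: powr_add[symmetric])
  ultimately have "1 * norm z \<le> ((2 ^ k) powr (- p) * (4 powr \<bar>p\<bar> * japanese \<xi> powr p)) * norm z"
    by (intro mult_right_mono) auto
  then show ?thesis by (simp add: mult_ac)
qed

section \<open>Output frequencies below and near the shell\<close>

context fourier_symbol
begin

lemma G_u_integrable_AE:
  fixes u :: "real^'n \<Rightarrow> complex"
  assumes u: "rapid u" and um [measurable]: "u \<in> borel_measurable borel"
  shows "AE \<zeta> in lborel. integrable lborel (\<lambda>\<xi>. G (\<zeta> - \<xi>) \<xi> * u \<xi>)"
proof (rule Fubini_complex_AE2[OF sigma_finite_lborel sigma_finite_lborel _ G_u_finite[OF u um]])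
  have [measurable]: "(\<lambda>p. G (snd p - fst p) (fst p)) \<in> borel_measurable (borel \<Otimes>\<^sub>M borel)"
    using measurable_compose[OF _ G_shift_measurable, of "\<lambda>p. (snd p, fst p)" "borel \<Otimes>\<^sub>M borel"] by simp
  show "(\<lambda>(\<xi>, \<zeta>). G (\<zeta> - \<xi>) \<xi> * u \<xi>) \<in> borel_measurable (lborel \<Otimes>\<^sub>M lborel)"
    unfolding case_prod_beta by measurable
qed

lemma shell_L2_le:
  fixes u :: "real^'n \<Rightarrow> complex"
  assumes [measurable]: "u \<in> borel_measurable borel"
  shows "(\<integral>\<^sup>+\<xi>. ennreal ((norm (u \<xi>))\<^sup>2) * indicator (shell k) \<xi> \<partial>lborel)
    \<le> ennreal ((4 powr \<bar>p\<bar> * (2 ^ k) powr (- p))\<^sup>2) * (\<integral>\<^sup>+\<xi>. (ennreal (japanese \<xi> powr p * norm (u \<xi>)))\<^sup>2 * indicator (shell k) \<xi> \<partial>lborel)"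
proof -
  have "(\<integral>\<^sup>+\<xi>. ennreal ((norm (u \<xi>))\<^sup>2) * indicator (shell k) \<xi> \<partial>lborel)
    \<le> (\<integral>\<^sup>+\<xi>. ennreal ((4 powr \<bar>p\<bar> * (2 ^ k) powr (- p))\<^sup>2) * ((ennreal (japanese \<xi> powr p * norm (u \<xi>)))\<^sup>2 * indicator (shell k) \<xi>) \<partial>lborel)"
  proof (intro nn_integral_mono)
    fix \<xi> :: "real^'n"
    show "ennreal ((norm (u \<xi>))\<^sup>2) * indicator (shell k) \<xi> \<le> ennreal ((4 powr \<bar>p\<bar> * (2 ^ k) powr (- p))\<^sup>2) * ((ennreal (japanese \<xi> powr p * norm (u \<xi>)))\<^sup>2 * indicator (shell k) \<xi>)"
    proof (cases "\<xi> \<in> shell k")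
      case True
      have "(norm (u \<xi>))\<^sup>2 \<le> (4 powr \<bar>p\<bar> * (2 ^ k) powr (- p) * (japanese \<xi> powr p * norm (u \<xi>)))\<^sup>2"
        by (intro power_mono shell_weight True) auto
      then have "ennreal ((norm (u \<xi>))\<^sup>2) \<le> ennreal ((4 powr \<bar>p\<bar> * (2 ^ k) powr (- p))\<^sup>2) * ennreal ((japanese \<xi> powr p * norm (u \<xi>))\<^sup>2)"
        by (subst ennreal_mult[symmetric]) (auto simp: power_mult_distrib intro: ennreal_leI)
      then show ?thesis using True by (simp add: ennreal_power)
    qed simp
  qed
  also have "\<dots> = ennreal ((4 powr \<bar>p\<bar> * (2 ^ k) powr (- p))\<^sup>2) * (\<integral>\<^sup>+\<xi>. (ennreal (japanese \<xi> powr p * norm (u \<xi>)))\<^sup>2 * indicator (shell k) \<xi> \<partial>lborel)"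
    by (rule nn_integral_cmult) measurable
  finally show ?thesis .
qed

text \<open>Pointwise in \<zeta>, Cauchy-Schwarz on the shell k gives a term of size 2^(-k(\<tau> +
  s)), as \<zeta> - \<xi> is of size at least 2^k / 2. The weight of \<zeta> is at most a multiple
  of 2^k, so its power s can be replaced by the square integrable power -r at the price 2^(k(s +
  r)). The factor 2^(k(r - \<tau>)) remains and is summed over the shells.\<close>

lemma below_bound:
  fixes u :: "real^'n \<Rightarrow> complex"
  assumes s: "- \<tau> < s" "s < \<tau>" and um [measurable]: "u \<in> borel_measurable borel"
  shows "(\<integral>\<^sup>+\<zeta>. (ennreal (japanese \<zeta> powr s) * (\<integral>\<^sup>+\<xi>. of_bool (belowp \<zeta> \<xi>) * ennreal (norm (G (\<zeta> - \<xi>) \<xi> * u \<xi>)) \<partial>lborel))\<^sup>2 \<partial>lborel)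
    \<le> ennreal (belowC m s \<tau> TYPE('n) * a\<^sup>2) * weighted_sq (s + m) u"
proof -
  define r where "r = belowr s \<tau> TYPE('n)"
  have r: "real CARD('n) / 2 < r" "- s < r" "r < \<tau>" using s tau by (auto simp: r_def belowr_def)
  have t0: "0 < \<tau>" using tau by (auto intro: le_less_trans[rotated])
  define U2 where "U2 = weighted_sq (s + m) u"
  let ?B = "2 ^ CARD('n) * blockC m TYPE('n)"
  have B0: "0 \<le> ?B" using blockC_pos[where 'n='n, of m] by simp
  define D where "D = 2 powr (s + r) * (2 powr \<tau> * ?B * 4 powr \<bar>s + m\<bar>)"
  have D0: "0 \<le> D" unfolding D_def using B0 by simp
  define q where "q = 2 powr (r - \<tau>)"
  have q: "0 < q" "q < 1" using r(3) powr_less_mono[of "r - \<tau>" 0 "2::real"] by (auto simp: q_def)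
  define T where "T \<zeta> k = (if 2 * norm \<zeta> < 2 ^ k then (\<integral>\<^sup>+\<xi>. block_majorant GA k (\<zeta> - \<xi>) * indicator (shell k) \<xi> * ennreal (norm (u \<xi>)) \<partial>lborel) else 0)" for \<zeta> :: "real^'n" and k
  have T: "(T \<zeta> k)\<^sup>2 \<le> ennreal ((2 powr \<tau> * ?B * 4 powr \<bar>s + m\<bar> * a * (2 ^ k) powr (- \<tau> - s))\<^sup>2) * U2" for \<zeta> k
  proof (cases "2 * norm \<zeta> < 2 ^ k")
    case True
    have cm [measurable]: "(\<lambda>\<xi>. block_majorant GA k (\<zeta> - \<xi>)) \<in> borel_measurable borel"
      by (rule measurable_compose[OF _ block_majorant_measurable]) measurable
    have "(T \<zeta> k)\<^sup>2 = (\<integral>\<^sup>+\<xi>. (block_majorant GA k (\<zeta> - \<xi>) * indicator (shell k) \<xi>) * (ennreal (norm (u \<xi>)) * indicator (shell k) \<xi>) \<partial>lborel)\<^sup>2"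
      using True unfolding T_def by (auto intro!: arg_cong[where f="\<lambda>t. t\<^sup>2"] nn_integral_cong simp: indicator_def)
    also have "\<dots> \<le> (\<integral>\<^sup>+\<xi>. (block_majorant GA k (\<zeta> - \<xi>) * indicator (shell k) \<xi>)\<^sup>2 \<partial>lborel) * (\<integral>\<^sup>+\<xi>. (ennreal (norm (u \<xi>)) * indicator (shell k) \<xi>)\<^sup>2 \<partial>lborel)"
      by (rule Cauchy_Schwarz_nn_integral) measurable
    also have "\<dots> \<le> ennreal ((2 powr \<tau> * (2 ^ k) powr (- \<tau>) * (?B * a * (2 ^ k) powr m))\<^sup>2) * (ennreal ((4 powr \<bar>s + m\<bar> * (2 ^ k) powr (- (s + m)))\<^sup>2) * U2)"
    proof (intro mult_mono)
      have "(\<integral>\<^sup>+\<xi>. (block_majorant GA k (\<zeta> - \<xi>) * indicator (shell k) \<xi>)\<^sup>2 \<partial>lborel)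
        \<le> (\<integral>\<^sup>+\<xi>. ennreal ((2 powr \<tau> * (2 ^ k) powr (- \<tau>))\<^sup>2) * (ennreal (japanese (\<zeta> - \<xi>) powr \<tau>) * block_majorant GA k (\<zeta> - \<xi>))\<^sup>2 \<partial>lborel)"
      proof (intro nn_integral_mono)
        fix \<xi> :: "real^'n"
        show "(block_majorant GA k (\<zeta> - \<xi>) * indicator (shell k) \<xi>)\<^sup>2 \<le> ennreal ((2 powr \<tau> * (2 ^ k) powr (- \<tau>))\<^sup>2) * (ennreal (japanese (\<zeta> - \<xi>) powr \<tau>) * block_majorant GA k (\<zeta> - \<xi>))\<^sup>2"
        proof (cases "\<xi> \<in> shell k")
          case sh: True
          have "norm \<xi> \<le> norm (\<zeta> - \<xi>) + norm \<zeta>" by norm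
          \<comment> \<open>On the shell \<open>2 ^ k \<le> norm \<xi>\<close>, while \<zeta> takes
            away less than half of this.\<close>
          then have "2 ^ k / 2 \<le> norm (\<zeta> - \<xi>)" using sh True by (simp add: shell_def)
          then have "2 ^ k / 2 \<le> japanese (\<zeta> - \<xi>)" using norm_le_japanese[of "\<zeta> - \<xi>"] by linarith
          then have "(2 ^ k / 2) powr \<tau> \<le> japanese (\<zeta> - \<xi>) powr \<tau>" using t0 by (intro powr_mono2) auto
          then have "(2 powr \<tau> * (2 ^ k) powr (- \<tau>)) * (2 ^ k / 2) powr \<tau> \<le> (2 powr \<tau> * (2 ^ k) powr (- \<tau>)) * japanese (\<zeta> - \<xi>) powr \<tau>"
            by (rule mult_left_mono) simp
          moreover have "(2 powr \<tau> * (2 ^ k) powr (- \<tau>)) * (2 ^ k / 2) powr \<tau> = (1::real)"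
            by (simp add: powr_divide powr_minus)
          ultimately have "1 \<le> (2 powr \<tau> * (2 ^ k) powr (- \<tau>)) * japanese (\<zeta> - \<xi>) powr \<tau>" by simp
          then have "1 \<le> ennreal ((2 powr \<tau> * (2 ^ k) powr (- \<tau>)) * japanese (\<zeta> - \<xi>) powr \<tau>)"
            using ennreal_leI[of 1] by simp
          then have "1 * block_majorant GA k (\<zeta> - \<xi>) \<le> ennreal ((2 powr \<tau> * (2 ^ k) powr (- \<tau>)) * japanese (\<zeta> - \<xi>) powr \<tau>) * block_majorant GA k (\<zeta> - \<xi>)"
            by (rule mult_right_mono) simp
          also have "\<dots> = ennreal (2 powr \<tau> * (2 ^ k) powr (- \<tau>)) * (ennreal (japanese (\<zeta> - \<xi>) powr \<tau>) * block_majorant GA k (\<zeta> - \<xi>))"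
            by (simp add: ennreal_mult mult.assoc)
          finally have "(block_majorant GA k (\<zeta> - \<xi>))\<^sup>2 \<le> (ennreal (2 powr \<tau> * (2 ^ k) powr (- \<tau>)) * (ennreal (japanese (\<zeta> - \<xi>) powr \<tau>) * block_majorant GA k (\<zeta> - \<xi>)))\<^sup>2"
            by (intro power_mono) auto
          also have "\<dots> = (ennreal (2 powr \<tau> * (2 ^ k) powr (- \<tau>)))\<^sup>2 * (ennreal (japanese (\<zeta> - \<xi>) powr \<tau>) * block_majorant GA k (\<zeta> - \<xi>))\<^sup>2"
            by (rule power_mult_distrib)
          also have "(ennreal (2 powr \<tau> * (2 ^ k) powr (- \<tau>)))\<^sup>2 = ennreal ((2 powr \<tau> * (2 ^ k) powr (- \<tau>))\<^sup>2)"
            by (rule ennreal_power) simp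
          finally show ?thesis using sh by simp
        qed simp
      qed
      also have "\<dots> = ennreal ((2 powr \<tau> * (2 ^ k) powr (- \<tau>))\<^sup>2) * (\<integral>\<^sup>+\<xi>. (ennreal (japanese (\<zeta> - \<xi>) powr \<tau>) * block_majorant GA k (\<zeta> - \<xi>))\<^sup>2 \<partial>lborel)"
        by (rule nn_integral_cmult) measurable
      also have "(\<integral>\<^sup>+\<xi>. (ennreal (japanese (\<zeta> - \<xi>) powr \<tau>) * block_majorant GA k (\<zeta> - \<xi>))\<^sup>2 \<partial>lborel) = (\<integral>\<^sup>+\<eta>. (ennreal (japanese \<eta> powr \<tau>) * block_majorant GA k \<eta>)\<^sup>2 \<partial>lborel)"
        by (rule nn_integral_reflect[of "\<lambda>\<eta>. (ennreal (japanese \<eta> powr \<tau>) * block_majorant GA k \<eta>)\<^sup>2"]) measurable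
      finally have "(\<integral>\<^sup>+\<xi>. (block_majorant GA k (\<zeta> - \<xi>) * indicator (shell k) \<xi>)\<^sup>2 \<partial>lborel)
        \<le> ennreal ((2 powr \<tau> * (2 ^ k) powr (- \<tau>))\<^sup>2) * ennreal ((?B * a * (2 ^ k) powr m)\<^sup>2)"
        using mult_left_mono[OF block_majorant_bound[of k], of "ennreal ((2 powr \<tau> * (2 ^ k) powr (- \<tau>))\<^sup>2)"] by (auto intro: order.trans)
      also have "\<dots> = ennreal ((2 powr \<tau> * (2 ^ k) powr (- \<tau>) * (?B * a * (2 ^ k) powr m))\<^sup>2)"
        unfolding power_mult_distrib[of "2 powr \<tau> * (2 ^ k) powr (- \<tau>)" "?B * a * (2 ^ k) powr m"] by (rule ennreal_mult[symmetric]) auto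
      finally show "(\<integral>\<^sup>+\<xi>. (block_majorant GA k (\<zeta> - \<xi>) * indicator (shell k) \<xi>)\<^sup>2 \<partial>lborel) \<le> \<dots>" .
      have "(\<integral>\<^sup>+\<xi>. (ennreal (norm (u \<xi>)) * indicator (shell k) \<xi>)\<^sup>2 \<partial>lborel) = (\<integral>\<^sup>+\<xi>. ennreal ((norm (u \<xi>))\<^sup>2) * indicator (shell k) \<xi> \<partial>lborel)"
        by (intro nn_integral_cong) (auto simp: indicator_def ennreal_power)
      also have "\<dots> \<le> ennreal ((4 powr \<bar>s + m\<bar> * (2 ^ k) powr (- (s + m)))\<^sup>2) * (\<integral>\<^sup>+\<xi>. (ennreal (japanese \<xi> powr (s + m) * norm (u \<xi>)))\<^sup>2 * indicator (shell k) \<xi> \<partial>lborel)"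
        by (rule shell_L2_le) measurable
      also have "\<dots> \<le> ennreal ((4 powr \<bar>s + m\<bar> * (2 ^ k) powr (- (s + m)))\<^sup>2) * U2"
        unfolding U2_def by (intro mult_left_mono nn_integral_mono) (auto simp: indicator_def)
      finally show "(\<integral>\<^sup>+\<xi>. (ennreal (norm (u \<xi>)) * indicator (shell k) \<xi>)\<^sup>2 \<partial>lborel) \<le> ennreal ((4 powr \<bar>s + m\<bar> * (2 ^ k) powr (- (s + m)))\<^sup>2) * U2" .
    qed auto
    also have "\<dots> = ennreal ((2 powr \<tau> * (2 ^ k) powr (- \<tau>) * (?B * a * (2 ^ k) powr m))\<^sup>2 * (4 powr \<bar>s + m\<bar> * (2 ^ k) powr (- (s + m)))\<^sup>2) * U2"
      by (subst ennreal_mult) (auto simp: mult.assoc)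
    also have "(2 powr \<tau> * (2 ^ k) powr (- \<tau>) * (?B * a * (2 ^ k) powr m))\<^sup>2 * (4 powr \<bar>s + m\<bar> * (2 ^ k) powr (- (s + m)))\<^sup>2
      = (2 powr \<tau> * ?B * 4 powr \<bar>s + m\<bar> * a * ((2 ^ k) powr (- \<tau>) * (2 ^ k) powr m * (2 ^ k) powr (- (s + m))))\<^sup>2"
      unfolding power_mult_distrib[symmetric] by (simp only: mult_ac)
    also have "(2 ^ k) powr (- \<tau>) * (2 ^ k) powr m * (2 ^ k) powr (- (s + m)) = ((2::real) ^ k) powr (- \<tau> - s)"
      by (simp add: powr_add[symmetric])
    finally show ?thesis .
  next
    case False
    then show ?thesis by (simp add: T_def)
  qed
  have X: "(\<integral>\<^sup>+\<xi>. of_bool (belowp \<zeta> \<xi>) * ennreal (norm (G (\<zeta> - \<xi>) \<xi> * u \<xi>)) \<partial>lborel) \<le> (\<Sum>k. T \<zeta> k)" for \<zeta>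
  proof -
    have cm [measurable]: "(\<lambda>\<xi>. block_majorant GA k (\<zeta> - \<xi>)) \<in> borel_measurable borel" for k
      by (rule measurable_compose[OF _ block_majorant_measurable]) measurable
    let ?g = "\<lambda>k \<xi>. of_bool (2 * norm \<zeta> < 2 ^ k) * (block_majorant GA k (\<zeta> - \<xi>) * indicator (shell k) \<xi> * ennreal (norm (u \<xi>)))"
    have "(\<integral>\<^sup>+\<xi>. of_bool (belowp \<zeta> \<xi>) * ennreal (norm (G (\<zeta> - \<xi>) \<xi> * u \<xi>)) \<partial>lborel) \<le> (\<integral>\<^sup>+\<xi>. (\<Sum>k. ?g k \<xi>) \<partial>lborel)"
    proof (intro nn_integral_mono)
      fix \<xi> :: "real^'n"
      show "of_bool (belowp \<zeta> \<xi>) * ennreal (norm (G (\<zeta> - \<xi>) \<xi> * u \<xi>)) \<le> (\<Sum>k. ?g k \<xi>)"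
      proof (cases "belowp \<zeta> \<xi>")
        case True
        then have sh: "\<xi> \<in> shell (level \<xi>)" and z: "2 * norm \<zeta> < 2 ^ level \<xi>" and n: "\<not> norm \<xi> < 1"
          using shell_level[of \<xi>] by (auto simp: belowp_def)
        have "of_bool (belowp \<zeta> \<xi>) * ennreal (norm (G (\<zeta> - \<xi>) \<xi> * u \<xi>)) = ennreal (norm (block_symbol GA (level \<xi>) (\<zeta> - \<xi>) \<xi>)) * ennreal (norm (u \<xi>))"
          using True n by (simp add: G_def norm_mult ennreal_mult)
        also have "\<dots> \<le> ?g (level \<xi>) \<xi>"
          using sh z block_symbol_le_block_majorant[OF sh, of "\<zeta> - \<xi>"] by (simp add: mult_right_mono)
        also have "\<dots> = (\<Sum>k\<in>{level \<xi>}. ?g k \<xi>)" by simp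
        also have "\<dots> \<le> (\<Sum>k. ?g k \<xi>)" by (rule sum_le_suminf) auto
        finally show ?thesis .
      qed simp
    qed
    also have "\<dots> = (\<Sum>k. \<integral>\<^sup>+\<xi>. ?g k \<xi> \<partial>lborel)"
      by (rule nn_integral_suminf) measurable
    also have "\<dots> = (\<Sum>k. T \<zeta> k)" by (intro arg_cong[where f=suminf] ext) (simp add: T_def)
    finally show ?thesis .
  qed
  \<comment> \<open>Normalised so as to be bounded uniformly in k and \<zeta>; the normalisation
    leaves exactly the geometric factor \<open>q ^ k\<close> in \<open>point\<close>.\<close>
  define P where "P \<zeta> k = ennreal (2 powr (s + r) * (2 ^ k) powr (s + \<tau>)) * T \<zeta> k" for \<zeta> k
  have P: "(P \<zeta> k)\<^sup>2 \<le> ennreal ((D * a)\<^sup>2) * U2" for \<zeta> k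
  proof -
    have "(P \<zeta> k)\<^sup>2 \<le> ennreal ((2 powr (s + r) * (2 ^ k) powr (s + \<tau>))\<^sup>2) * (ennreal ((2 powr \<tau> * ?B * 4 powr \<bar>s + m\<bar> * a * (2 ^ k) powr (- \<tau> - s))\<^sup>2) * U2)"
      unfolding P_def power_mult_distrib[of "ennreal _"] by (subst ennreal_power, simp) (intro mult_left_mono T, simp)
    also have "\<dots> = ennreal ((2 powr (s + r) * (2 ^ k) powr (s + \<tau>))\<^sup>2 * (2 powr \<tau> * ?B * 4 powr \<bar>s + m\<bar> * a * (2 ^ k) powr (- \<tau> - s))\<^sup>2) * U2"
      by (subst ennreal_mult) (auto simp: mult.assoc)
    also have "(2 powr (s + r) * (2 ^ k) powr (s + \<tau>))\<^sup>2 * (2 powr \<tau> * ?B * 4 powr \<bar>s + m\<bar> * a * (2 ^ k) powr (- \<tau> - s))\<^sup>2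
       = (D * a * ((2 ^ k) powr (s + \<tau>) * (2 ^ k) powr (- \<tau> - s)))\<^sup>2"
      unfolding power_mult_distrib[symmetric] D_def by (simp only: mult_ac)
    also have "((2::real) ^ k) powr (s + \<tau>) * (2 ^ k) powr (- \<tau> - s) = 1" by (simp add: powr_add[symmetric])
    finally show ?thesis by simp
  qed
  have point: "ennreal (japanese \<zeta> powr s) * (\<Sum>k. T \<zeta> k) \<le> ennreal (japanese \<zeta> powr (- r)) * (\<Sum>k. P \<zeta> k * ennreal (q ^ k))" for \<zeta>
    unfolding ennreal_suminf_cmult[symmetric]
  proof (intro suminf_le)
    fix k
    show "ennreal (japanese \<zeta> powr s) * T \<zeta> k \<le> ennreal (japanese \<zeta> powr (- r)) * (P \<zeta> k * ennreal (q ^ k))"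
    proof (cases "2 * norm \<zeta> < 2 ^ k")
      case True
      have "japanese \<zeta> \<le> 2 * 2 ^ k"
        using japanese_le[of \<zeta>] True one_le_power[of "2::real" k] by linarith
      then have "japanese \<zeta> powr (s + r) \<le> (2 * 2 ^ k) powr (s + r)"
        using r(2) by (intro powr_mono2) auto
      also have "\<dots> = 2 powr (s + r) * ((2 ^ k) powr (s + \<tau>) * (2 ^ k) powr (r - \<tau>))"
        by (simp add: powr_mult powr_add[symmetric])
      also have "((2::real) ^ k) powr (r - \<tau>) = q ^ k" by (simp add: q_def pow_powr)
      finally have "japanese \<zeta> powr (- r) * japanese \<zeta> powr (s + r) \<le> japanese \<zeta> powr (- r) * (2 powr (s + r) * ((2 ^ k) powr (s + \<tau>) * q ^ k))"
        by (rule mult_left_mono) simp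
      moreover have "japanese \<zeta> powr (- r) * japanese \<zeta> powr (s + r) = japanese \<zeta> powr s" by (simp add: powr_add[symmetric])
      ultimately have "ennreal (japanese \<zeta> powr s) \<le> ennreal (japanese \<zeta> powr (- r) * (2 powr (s + r) * ((2 ^ k) powr (s + \<tau>) * q ^ k)))"
        by (simp add: ennreal_leI)
      then have "ennreal (japanese \<zeta> powr s) * T \<zeta> k \<le> ennreal (japanese \<zeta> powr (- r) * (2 powr (s + r) * ((2 ^ k) powr (s + \<tau>) * q ^ k))) * T \<zeta> k"
        by (rule mult_right_mono) simp
      also have "\<dots> = ennreal (japanese \<zeta> powr (- r)) * (P \<zeta> k * ennreal (q ^ k))"
        using q by (simp add: P_def ennreal_mult mult_ac)
      finally show ?thesis .
    next
      case False
      then show ?thesis by (simp add: T_def)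
    qed
  qed auto
  \<comment> \<open>Cauchy-Schwarz with the geometric weights: the squares of P have one common
    bound, so the geometric series appears as a square.\<close>
  have sq: "(\<Sum>k. P \<zeta> k * ennreal (q ^ k))\<^sup>2 \<le> ennreal ((1 / (1 - q))\<^sup>2) * (ennreal ((D * a)\<^sup>2) * U2)" for \<zeta>
  proof -
    have Q: "(\<Sum>k. ennreal (q ^ k)) = ennreal (1 / (1 - q))"
      using q by (subst suminf_ennreal2) (auto simp: suminf_geometric summable_geometric)
    have "(\<Sum>k. P \<zeta> k * ennreal (q ^ k))\<^sup>2 \<le> (\<Sum>k. ennreal (q ^ k)) * (\<Sum>k. (P \<zeta> k)\<^sup>2 * ennreal (q ^ k))"
      using nn_integral_weighted_CS[of "P \<zeta>" "count_space UNIV" "\<lambda>k. ennreal (q ^ k)"]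
      by (simp add: nn_integral_count_space_nat)
    also have "\<dots> \<le> (\<Sum>k. ennreal (q ^ k)) * (\<Sum>k. (ennreal ((D * a)\<^sup>2) * U2) * ennreal (q ^ k))"
      by (intro mult_left_mono suminf_le mult_right_mono P) auto
    also have "\<dots> = (ennreal (1 / (1 - q)) * ennreal (1 / (1 - q))) * (ennreal ((D * a)\<^sup>2) * U2)"
      unfolding ennreal_suminf_cmult Q by (simp only: mult_ac)
    also have "ennreal (1 / (1 - q)) * ennreal (1 / (1 - q)) = ennreal ((1 / (1 - q))\<^sup>2)"
      using q by (subst ennreal_mult[symmetric]) (auto simp: power2_eq_square)
    finally show ?thesis .
  qed
  have "(\<integral>\<^sup>+\<zeta>. (ennreal (japanese \<zeta> powr s) * (\<integral>\<^sup>+\<xi>. of_bool (belowp \<zeta> \<xi>) * ennreal (norm (G (\<zeta> - \<xi>) \<xi> * u \<xi>)) \<partial>lborel))\<^sup>2 \<partial>lborel)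
    \<le> (\<integral>\<^sup>+\<zeta>. (ennreal ((1 / (1 - q))\<^sup>2) * (ennreal ((D * a)\<^sup>2) * U2)) * ennreal (japanese (\<zeta>::real^'n) powr (- (2 * r))) \<partial>lborel)"
  proof (intro nn_integral_mono)
    fix \<zeta> :: "real^'n"
    have "(ennreal (japanese \<zeta> powr s) * (\<integral>\<^sup>+\<xi>. of_bool (belowp \<zeta> \<xi>) * ennreal (norm (G (\<zeta> - \<xi>) \<xi> * u \<xi>)) \<partial>lborel))\<^sup>2
      \<le> (ennreal (japanese \<zeta> powr (- r)) * (\<Sum>k. P \<zeta> k * ennreal (q ^ k)))\<^sup>2"
      by (intro power_mono order.trans[OF mult_left_mono[OF X] point]) auto
    also have "\<dots> = (ennreal (japanese \<zeta> powr (- r)))\<^sup>2 * (\<Sum>k. P \<zeta> k * ennreal (q ^ k))\<^sup>2" by (rule power_mult_distrib)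
    also have "\<dots> \<le> (ennreal (japanese \<zeta> powr (- r)))\<^sup>2 * (ennreal ((1 / (1 - q))\<^sup>2) * (ennreal ((D * a)\<^sup>2) * U2))"
      by (intro mult_left_mono sq) auto
    also have "(ennreal (japanese \<zeta> powr (- r)))\<^sup>2 = ennreal (japanese \<zeta> powr (- (2 * r)))"
      by (simp add: power2_eq_square ennreal_mult[symmetric] powr_add[symmetric])
    finally show "(ennreal (japanese \<zeta> powr s) * (\<integral>\<^sup>+\<xi>. of_bool (belowp \<zeta> \<xi>) * ennreal (norm (G (\<zeta> - \<xi>) \<xi> * u \<xi>)) \<partial>lborel))\<^sup>2
      \<le> (ennreal ((1 / (1 - q))\<^sup>2) * (ennreal ((D * a)\<^sup>2) * U2)) * ennreal (japanese \<zeta> powr (- (2 * r)))"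
      by (simp only: mult_ac)
  qed
  also have "\<dots> = (ennreal ((1 / (1 - q))\<^sup>2) * (ennreal ((D * a)\<^sup>2) * U2)) * ennreal (weightC r TYPE('n))"
    by (subst nn_integral_cmult, measurable, subst weightC(1)[OF r(1)], rule refl)
  also have "\<dots> = ennreal (weightC r TYPE('n) * ((1 / (1 - q))\<^sup>2 * (D * a)\<^sup>2)) * U2"
    using weightC(2)[OF r(1)] by (simp add: ennreal_mult mult_ac)
  also have "weightC r TYPE('n) * ((1 / (1 - q))\<^sup>2 * (D * a)\<^sup>2) = belowC m s \<tau> TYPE('n) * a\<^sup>2"
    unfolding belowC_def belowD_def D_def q_def r_def power_mult_distrib by (simp only: mult_ac)
  finally show ?thesis by (simp add: U2_def)
qed

text \<open>At a given \<zeta> at most four shells contribute, so summing over shells before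
  squaring costs a constant. Each \<open>block_output\<close> is bounded by the L2 norm of u on its
  shell. All weights there are powers of 2^k that cancel, and the shells are disjoint, so the pieces
  add up to the norm of u.\<close>

lemma near_bound:
  fixes u :: "real^'n \<Rightarrow> complex"
  assumes u: "rapid u" and um [measurable]: "u \<in> borel_measurable borel"
  shows "weighted_sq s (\<lambda>\<zeta>. \<integral>\<xi>. of_bool (nearp \<zeta> \<xi>) * (G (\<zeta> - \<xi>) \<xi> * u \<xi>) \<partial>lborel)
    \<le> ennreal (nearC m s TYPE('n) * b\<^sup>2) * weighted_sq (s + m) u"
proof -
  let ?B = "2 ^ CARD('n) * blockC m TYPE('n)"
  have B0: "0 \<le> ?B" using blockC_pos[where 'n='n, of m] by simp
  define U2 where "U2 = weighted_sq (s + m) u"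
  have ui: "integrable lborel u" by (rule rapid_integrable[OF u um])
  obtain K where "\<And>x. norm x ^ 0 * norm (u x) \<le> K" using u unfolding rapid_def by blast
  then have K: "\<And>x. norm (u x) \<le> K" by simp
  \<comment> \<open>The shells that can be near \<zeta>: here 2^k lies between |\<zeta>|/4 and 2
    |\<zeta>|, which differ by a factor 8, so there are at most four of them.\<close>
  define S where "S \<zeta> = {k. 2 ^ k \<le> 2 * norm \<zeta> \<and> norm \<zeta> \<le> 4 * 2 ^ k}" for \<zeta> :: "real^'n"
  have S: "finite (S \<zeta>) \<and> card (S \<zeta>) \<le> 4" for \<zeta>
  proof (cases "S \<zeta> = {}")
    case False
    define k0 where "k0 = (LEAST k. k \<in> S \<zeta>)"
    have k0: "k0 \<in> S \<zeta>" unfolding k0_def using False by (intro LeastI_ex[of "\<lambda>k. k \<in> S \<zeta>"]) auto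
    have "S \<zeta> \<subseteq> {k0..<k0 + 4}"
    proof
      fix k assume k: "k \<in> S \<zeta>"
      have "k0 \<le> k" unfolding k0_def by (rule Least_le[of "\<lambda>k. k \<in> S \<zeta>", OF k])
      moreover have "(2::real) ^ k \<le> 2 ^ (k0 + 3)"
        using k k0 by (simp add: S_def power_add)
      then have "k \<le> k0 + 3" by (rule power_le_imp_le_exp[rotated]) simp
      ultimately show "k \<in> {k0..<k0 + 4}" by simp
    qed
    then show ?thesis using card_mono[of "{k0..<k0 + 4}" "S \<zeta>"] by (auto intro: finite_subset)
  qed simp
  note AE = G_u_integrable_AE[OF u um]
  have "weighted_sq s (\<lambda>\<zeta>. \<integral>\<xi>. of_bool (nearp \<zeta> \<xi>) * (G (\<zeta> - \<xi>) \<xi> * u \<xi>) \<partial>lborel)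
    \<le> (\<integral>\<^sup>+\<zeta>. (\<Sum>k. 4 * (ennreal ((5 powr \<bar>s\<bar> * (2 ^ k) powr s)\<^sup>2) * ennreal ((norm (block_output u k \<zeta>))\<^sup>2))) \<partial>lborel)"
  proof (rule nn_integral_mono_AE)
    show "AE \<zeta> in lborel. (ennreal (japanese \<zeta> powr s * norm (\<integral>\<xi>. of_bool (nearp \<zeta> \<xi>) * (G (\<zeta> - \<xi>) \<xi> * u \<xi>) \<partial>lborel)))\<^sup>2
      \<le> (\<Sum>k. 4 * (ennreal ((5 powr \<bar>s\<bar> * (2 ^ k) powr s)\<^sup>2) * ennreal ((norm (block_output u k \<zeta>))\<^sup>2)))"
      using AE
    proof eventually_elim
    case (elim \<zeta>)
    \<comment> \<open>At a given \<xi> only the index \<open>level \<xi>\<close> contributes to the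
      sum, and it belongs to \<open>S \<zeta>\<close> exactly when \<xi> is near \<zeta>.\<close>
    have near: "of_bool (nearp \<zeta> \<xi>) * (G (\<zeta> - \<xi>) \<xi> * u \<xi>) = (\<Sum>k\<in>S \<zeta>. indicator (shell k) \<xi> *\<^sub>R (block_symbol GA k (\<zeta> - \<xi>) \<xi> * u \<xi>))" for \<xi>
    proof (cases "1 \<le> norm \<xi>")
      case True
      have ind: "indicator (shell k) \<xi> = (if k = level \<xi> then 1 else 0 :: real)" for k
      proof (cases "k = level \<xi>")
        case True
        then show ?thesis using shell_level[OF \<open>1 \<le> norm \<xi>\<close>] by simp
      next
        case False
        then have "\<xi> \<notin> shell k" using level_shell[of \<xi> k] by blast
        then show ?thesis using False by simp
      qed
      have "(\<Sum>k\<in>S \<zeta>. indicator (shell k) \<xi> *\<^sub>R (block_symbol GA k (\<zeta> - \<xi>) \<xi> * u \<xi>)) = (\<Sum>k\<in>S \<zeta>. if k = level \<xi> then block_symbol GA k (\<zeta> - \<xi>) \<xi> * u \<xi> else 0)"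
        unfolding ind by (intro sum.cong) auto
      also have "\<dots> = (if level \<xi> \<in> S \<zeta> then block_symbol GA (level \<xi>) (\<zeta> - \<xi>) \<xi> * u \<xi> else 0)"
        using S[of \<zeta>] by (simp add: sum.delta)
      finally show ?thesis using True by (simp add: nearp_def S_def G_def)
    next
      case False
      then have "\<xi> \<notin> shell k" for k using shell_norm_ge_1 by blast
      then show ?thesis using False by (simp add: nearp_def)
    qed
    have int: "integrable lborel (\<lambda>\<xi>. indicator (shell k) \<xi> *\<^sub>R (block_symbol GA k (\<zeta> - \<xi>) \<xi> * u \<xi>))" for k
    proof -
      have eq: "indicator (shell k) \<xi> *\<^sub>R (block_symbol GA k (\<zeta> - \<xi>) \<xi> * u \<xi>) = indicator (shell k) \<xi> *\<^sub>R (G (\<zeta> - \<xi>) \<xi> * u \<xi>)" for \<xi>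
        using level_shell[of \<xi> k] shell_norm_ge_1[of \<xi> k] by (cases "\<xi> \<in> shell k") (auto simp: G_def)
      show ?thesis unfolding eq by (rule integrable_mult_indicator[OF _ elim]) simp
    qed
    have "(\<integral>\<xi>. of_bool (nearp \<zeta> \<xi>) * (G (\<zeta> - \<xi>) \<xi> * u \<xi>) \<partial>lborel) = (\<Sum>k\<in>S \<zeta>. block_output u k \<zeta>)"
      unfolding near block_output_def by (rule Bochner_Integration.integral_sum) (rule int)
    then have "(ennreal (japanese \<zeta> powr s * norm (\<integral>\<xi>. of_bool (nearp \<zeta> \<xi>) * (G (\<zeta> - \<xi>) \<xi> * u \<xi>) \<partial>lborel)))\<^sup>2
      \<le> (\<Sum>k\<in>S \<zeta>. ennreal (japanese \<zeta> powr s * norm (block_output u k \<zeta>)))\<^sup>2"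
      by (subst sum_ennreal) (auto simp flip: sum_distrib_left intro!: power_mono ennreal_leI mult_left_mono norm_sum)
    also have "\<dots> \<le> of_nat (card (S \<zeta>)) * (\<Sum>k\<in>S \<zeta>. (ennreal (japanese \<zeta> powr s * norm (block_output u k \<zeta>)))\<^sup>2)"
      by (rule ennreal_sum_sq_le) (use S in blast)
    also have "\<dots> \<le> 4 * (\<Sum>k\<in>S \<zeta>. (ennreal (japanese \<zeta> powr s * norm (block_output u k \<zeta>)))\<^sup>2)"
    proof (intro mult_right_mono)
      have "of_nat (card (S \<zeta>)) \<le> (of_nat 4 :: ennreal)" using S[of \<zeta>] by (intro of_nat_mono) auto
      then show "of_nat (card (S \<zeta>)) \<le> (4 :: ennreal)" by simp
    qed simp
    also have "\<dots> = (\<Sum>k\<in>S \<zeta>. 4 * (ennreal (japanese \<zeta> powr s * norm (block_output u k \<zeta>)))\<^sup>2)" by (rule sum_distrib_left)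
    also have "\<dots> \<le> (\<Sum>k\<in>S \<zeta>. 4 * (ennreal ((5 powr \<bar>s\<bar> * (2 ^ k) powr s)\<^sup>2) * ennreal ((norm (block_output u k \<zeta>))\<^sup>2)))"
    proof (intro sum_mono mult_left_mono)
      fix k assume k: "k \<in> S \<zeta>"
      have k1: "(1::real) \<le> 2 ^ k" by simp
      have "japanese \<zeta> \<le> 5 * 2 ^ k"
        using k k1 japanese_le[of \<zeta>] unfolding S_def mem_Collect_eq by linarith
      moreover have "2 ^ k \<le> 5 * japanese \<zeta>"
        using k norm_le_japanese[of \<zeta>] japanese_pos[of \<zeta>] unfolding S_def mem_Collect_eq by linarith
      ultimately have "japanese \<zeta> powr s \<le> 5 powr \<bar>s\<bar> * (2 ^ k) powr s"
        by (intro powr_comparable_sym) auto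
      then have "(japanese \<zeta> powr s * norm (block_output u k \<zeta>))\<^sup>2 \<le> (5 powr \<bar>s\<bar> * (2 ^ k) powr s * norm (block_output u k \<zeta>))\<^sup>2"
        by (intro power_mono mult_right_mono) auto
      then show "(ennreal (japanese \<zeta> powr s * norm (block_output u k \<zeta>)))\<^sup>2 \<le> ennreal ((5 powr \<bar>s\<bar> * (2 ^ k) powr s)\<^sup>2) * ennreal ((norm (block_output u k \<zeta>))\<^sup>2)"
        by (subst ennreal_power, simp, subst ennreal_mult[symmetric]) (auto simp: power_mult_distrib intro: ennreal_leI)
    qed simp
    \<comment> \<open>Summing over all k removes the dependence of the index set on \<zeta>, so that
      the sum can be interchanged with the integral over \<zeta>.\<close>
    also have "\<dots> \<le> (\<Sum>k. 4 * (ennreal ((5 powr \<bar>s\<bar> * (2 ^ k) powr s)\<^sup>2) * ennreal ((norm (block_output u k \<zeta>))\<^sup>2)))"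
      by (rule sum_le_suminf) (use S in auto)
    finally show ?case .
    qed
  qed
  also have "\<dots> = (\<Sum>k. 4 * (ennreal ((5 powr \<bar>s\<bar> * (2 ^ k) powr s)\<^sup>2) * (\<integral>\<^sup>+\<zeta>. ennreal ((norm (block_output u k \<zeta>))\<^sup>2) \<partial>lborel)))"
    by (subst nn_integral_suminf, measurable, subst nn_integral_cmult, measurable, subst nn_integral_cmult) auto
  also have "\<dots> \<le> (\<Sum>k. ennreal (nearC m s TYPE('n) * b\<^sup>2) * (\<integral>\<^sup>+\<xi>. (ennreal (japanese \<xi> powr (s + m) * norm (u \<xi>)))\<^sup>2 * indicator (shell k) \<xi> \<partial>lborel))"
  proof (intro suminf_le)
    fix k
    let ?I = "\<integral>\<^sup>+\<xi>. (ennreal (japanese \<xi> powr (s + m) * norm (u \<xi>)))\<^sup>2 * indicator (shell k) \<xi> \<partial>lborel"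
    let ?x = "5 powr \<bar>s\<bar> * (2 ^ k) powr s" and ?y = "?B * b * (2 ^ k) powr m" and ?z = "4 powr \<bar>s + m\<bar> * (2 ^ k) powr (- (s + m))"
    have "4 * (ennreal (?x\<^sup>2) * (\<integral>\<^sup>+\<zeta>. ennreal ((norm (block_output u k \<zeta>))\<^sup>2) \<partial>lborel))
      \<le> 4 * (ennreal (?x\<^sup>2) * (ennreal (?y\<^sup>2) * (ennreal (?z\<^sup>2) * ?I)))"
      by (intro mult_left_mono order.trans[OF block_output_bound[OF ui K]] shell_L2_le um) auto
    also have "\<dots> = ennreal (4 * (?x * ?y * ?z)\<^sup>2) * ?I"
      unfolding power_mult_distrib by (simp add: ennreal_mult mult.assoc)
    also have "?x * ?y * ?z = 5 powr \<bar>s\<bar> * ?B * 4 powr \<bar>s + m\<bar> * b * ((2 ^ k) powr s * (2 ^ k) powr m * (2 ^ k) powr (- (s + m)))"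
      by (simp only: mult_ac)
    also have "((2::real) ^ k) powr s * (2 ^ k) powr m * (2 ^ k) powr (- (s + m)) = 1" by (simp add: powr_add[symmetric])
    also have "4 * (5 powr \<bar>s\<bar> * ?B * 4 powr \<bar>s + m\<bar> * b * 1)\<^sup>2 = nearC m s TYPE('n) * b\<^sup>2"
      by (simp add: nearC_def power_mult_distrib)
    finally show "4 * (ennreal (?x\<^sup>2) * (\<integral>\<^sup>+\<zeta>. ennreal ((norm (block_output u k \<zeta>))\<^sup>2) \<partial>lborel)) \<le> ennreal (nearC m s TYPE('n) * b\<^sup>2) * ?I" .
  qed auto
  also have "\<dots> = ennreal (nearC m s TYPE('n) * b\<^sup>2) * (\<Sum>k. \<integral>\<^sup>+\<xi>. (ennreal (japanese \<xi> powr (s + m) * norm (u \<xi>)))\<^sup>2 * indicator (shell k) \<xi> \<partial>lborel)"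
    by (rule ennreal_suminf_cmult)
  also have "(\<Sum>k. \<integral>\<^sup>+\<xi>. (ennreal (japanese \<xi> powr (s + m) * norm (u \<xi>)))\<^sup>2 * indicator (shell k) \<xi> \<partial>lborel)
     = (\<integral>\<^sup>+\<xi>. (\<Sum>k. (ennreal (japanese \<xi> powr (s + m) * norm (u \<xi>)))\<^sup>2 * indicator (shell k) \<xi>) \<partial>lborel)"
    by (rule nn_integral_suminf[symmetric]) measurable
  also have "\<dots> \<le> U2"
    unfolding U2_def
  proof (intro nn_integral_mono)
    fix \<xi> :: "real^'n"
    let ?f = "(ennreal (japanese \<xi> powr (s + m) * norm (u \<xi>)))\<^sup>2"
    show "(\<Sum>k. ?f * indicator (shell k) \<xi>) \<le> ?f"
    proof (cases "\<exists>k. \<xi> \<in> shell k")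
      case True
      then obtain k where "\<xi> \<in> shell k" by blast
      then show ?thesis using suminf_cmult_indicator[OF shell_disjoint, of \<xi> k "\<lambda>_. ?f"] by simp
    next
      case False
      then show ?thesis by simp
    qed
  qed
  finally show ?thesis by (simp add: U2_def mult_left_mono)
qed

end

section \<open>Collecting the three regions\<close>

lemma nn_integral_collect:
  fixes f g h :: "'a \<Rightarrow> ennreal"
  assumes [measurable]: "f \<in> borel_measurable M" "g \<in> borel_measurable M" "h \<in> borel_measurable M"
  shows "(\<integral>\<^sup>+x. 4 * (f x)\<^sup>2 + 4 * (g x)\<^sup>2 + 2 * (h x)\<^sup>2 \<partial>M) = 4 * (\<integral>\<^sup>+x. (f x)\<^sup>2 \<partial>M) + 4 * (\<integral>\<^sup>+x. (g x)\<^sup>2 \<partial>M) + 2 * (\<integral>\<^sup>+x. (h x)\<^sup>2 \<partial>M)"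
  by (simp add: nn_integral_add nn_integral_cmult)

lemma ennreal_collect:
  assumes "0 \<le> x" "0 \<le> y"
  shows "4 * (ennreal x * z) + 4 * (ennreal x * z) + 2 * (ennreal y * w) = ennreal (8 * x) * z + ennreal (2 * y) * w"
proof -
  have "4 * (ennreal x * z) + 4 * (ennreal x * z) = (4 + 4) * (ennreal x * z)" by (rule distrib_right[symmetric])
  then show ?thesis using assms by (simp add: ennreal_mult mult.assoc)
qed

context fourier_symbol
begin

lemma v_measurable [measurable]:
  fixes u :: "real^'n \<Rightarrow> complex"
  assumes [measurable]: "u \<in> borel_measurable borel"
  shows "v u \<in> borel_measurable borel"
proof -
  have "(\<lambda>\<zeta>. \<integral>\<xi>. G (\<zeta> - \<xi>) \<xi> * u \<xi> \<partial>lborel) \<in> borel_measurable borel"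
  proof (rule lborel.borel_measurable_lebesgue_integral)
    show "(\<lambda>(\<zeta>, \<xi>). G (\<zeta> - \<xi>) \<xi> * u \<xi>) \<in> borel_measurable (borel \<Otimes>\<^sub>M lborel)"
      unfolding case_prod_beta using G_shift_measurable by measurable
  qed
  then show ?thesis unfolding v_def[abs_def] .
qed

definition region_part :: "(real^'n \<Rightarrow> real^'n \<Rightarrow> bool) \<Rightarrow> real \<Rightarrow> (real^'n \<Rightarrow> complex) \<Rightarrow> real^'n \<Rightarrow> ennreal" where
  "region_part R s u \<zeta> = ennreal (japanese \<zeta> powr s) * (\<integral>\<^sup>+\<xi>. of_bool (R \<zeta> \<xi>) * ennreal (norm (G (\<zeta> - \<xi>) \<xi> * u \<xi>)) \<partial>lborel)"

text \<open>Unlike in \<open>region_part\<close>, the norm is taken after integration: the L2 bound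
  for comparable frequencies rests on cancellation that absolute values would destroy.\<close>

definition near_part :: "real \<Rightarrow> (real^'n \<Rightarrow> complex) \<Rightarrow> real^'n \<Rightarrow> ennreal" where
  "near_part s u \<zeta> = ennreal (japanese \<zeta> powr s * norm (\<integral>\<xi>. of_bool (nearp \<zeta> \<xi>) * (G (\<zeta> - \<xi>) \<xi> * u \<xi>) \<partial>lborel))"

lemma region_part_measurable:
  fixes u :: "real^'n \<Rightarrow> complex"
  assumes [measurable]: "Measurable.pred (borel \<Otimes>\<^sub>M borel) (\<lambda>p. R (fst p) (snd p))" "u \<in> borel_measurable borel"
  shows "region_part R s u \<in> borel_measurable borel"
proof -
  note [measurable] = G_shift_measurable
  have "(\<lambda>\<zeta>. \<integral>\<^sup>+\<xi>. of_bool (R \<zeta> \<xi>) * ennreal (norm (G (\<zeta> - \<xi>) \<xi> * u \<xi>)) \<partial>lborel) \<in> borel_measurable borel"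
  proof (rule lborel.borel_measurable_nn_integral)
    show "(\<lambda>(\<zeta>, \<xi>). of_bool (R \<zeta> \<xi>) * ennreal (norm (G (\<zeta> - \<xi>) \<xi> * u \<xi>))) \<in> borel_measurable (borel \<Otimes>\<^sub>M lborel)"
      unfolding case_prod_beta by measurable
  qed
  then show ?thesis unfolding region_part_def[abs_def] by measurable
qed

lemma near_part_measurable [measurable]:
  fixes u :: "real^'n \<Rightarrow> complex"
  assumes [measurable]: "u \<in> borel_measurable borel"
  shows "near_part s u \<in> borel_measurable borel"
proof -
  note [measurable] = G_shift_measurable
  have "(\<lambda>\<zeta>. \<integral>\<xi>. of_bool (nearp \<zeta> \<xi>) * (G (\<zeta> - \<xi>) \<xi> * u \<xi>) \<partial>lborel) \<in> borel_measurable borel"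
  proof (rule lborel.borel_measurable_lebesgue_integral)
    show "(\<lambda>(\<zeta>, \<xi>). of_bool (nearp \<zeta> \<xi>) * (G (\<zeta> - \<xi>) \<xi> * u \<xi>)) \<in> borel_measurable (borel \<Otimes>\<^sub>M lborel)"
      unfolding case_prod_beta by measurable
  qed
  then show ?thesis unfolding near_part_def[abs_def] by measurable
qed

text \<open>The constants 4, 4 and 2 come from applying \<open>ennreal_add_sq\<close> twice. The
  splitting is made at those \<zeta> at which the integrand of \<open>v\<close> is integrable, which
  is almost everywhere.\<close>

lemma v_le_regions:
  fixes u :: "real^'n \<Rightarrow> complex"
  assumes u: "rapid u" and um [measurable]: "u \<in> borel_measurable borel"
  shows "weighted_sq s (v u)
    \<le> 4 * (\<integral>\<^sup>+\<zeta>. (region_part farp s u \<zeta>)\<^sup>2 \<partial>lborel) + 4 * (\<integral>\<^sup>+\<zeta>. (region_part belowp s u \<zeta>)\<^sup>2 \<partial>lborel) + 2 * (\<integral>\<^sup>+\<zeta>. (near_part s u \<zeta>)\<^sup>2 \<partial>lborel)"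
proof -
  note [measurable] = region_part_measurable
  have "weighted_sq s (v u)
    \<le> (\<integral>\<^sup>+\<zeta>. 4 * (region_part farp s u \<zeta>)\<^sup>2 + 4 * (region_part belowp s u \<zeta>)\<^sup>2 + 2 * (near_part s u \<zeta>)\<^sup>2 \<partial>lborel)"
  proof (rule nn_integral_mono_AE)
    show "AE \<zeta> in lborel. (ennreal (japanese \<zeta> powr s * norm (v u \<zeta>)))\<^sup>2
      \<le> 4 * (region_part farp s u \<zeta>)\<^sup>2 + 4 * (region_part belowp s u \<zeta>)\<^sup>2 + 2 * (near_part s u \<zeta>)\<^sup>2"
      using G_u_integrable_AE[OF u um]
    proof eventually_elim
      case (elim \<zeta>)
      let ?g = "\<lambda>\<xi>. G (\<zeta> - \<xi>) \<xi> * u \<xi>"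
      have pm [measurable]: "Measurable.pred borel (farp \<zeta>)" "Measurable.pred borel (belowp \<zeta>)" "Measurable.pred borel (nearp \<zeta>)"
        unfolding farp_def[abs_def] belowp_def[abs_def] nearp_def[abs_def] by measurable
      have int: "integrable lborel (\<lambda>\<xi>. of_bool (R \<xi>) * ?g \<xi>)" if [measurable]: "Measurable.pred borel R" for R
      proof -
        have [measurable]: "?g \<in> borel_measurable borel" using borel_measurable_integrable[OF elim] by simp
        show ?thesis using elim by (rule Bochner_Integration.integrable_bound) auto
      qed
      have nle: "ennreal (norm (\<integral>\<xi>. of_bool (R \<zeta> \<xi>) * ?g \<xi> \<partial>lborel)) \<le> (\<integral>\<^sup>+\<xi>. of_bool (R \<zeta> \<xi>) * ennreal (norm (?g \<xi>)) \<partial>lborel)" for R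
      proof -
        have "(\<lambda>\<xi>. of_bool (R \<zeta> \<xi>) * ennreal (norm (?g \<xi>))) = (\<lambda>\<xi>. ennreal (norm (of_bool (R \<zeta> \<xi>) * ?g \<xi>)))"
          by (auto simp: fun_eq_iff)
        then show ?thesis by (simp only: ennreal_norm_integral_le)
      qed
      have "v u \<zeta> = (\<integral>\<xi>. of_bool (farp \<zeta> \<xi>) * ?g \<xi> + of_bool (belowp \<zeta> \<xi>) * ?g \<xi> + of_bool (nearp \<zeta> \<xi>) * ?g \<xi> \<partial>lborel)"
        unfolding v_def distrib_right[symmetric] regions_partition by simp
      also have "\<dots> = (\<integral>\<xi>. of_bool (farp \<zeta> \<xi>) * ?g \<xi> \<partial>lborel) + (\<integral>\<xi>. of_bool (belowp \<zeta> \<xi>) * ?g \<xi> \<partial>lborel) + (\<integral>\<xi>. of_bool (nearp \<zeta> \<xi>) * ?g \<xi> \<partial>lborel)" (is "_ = ?F + ?B + ?N")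
        using int pm by (simp add: Bochner_Integration.integral_add)
      finally have "norm (v u \<zeta>) \<le> norm ?F + norm ?B + norm ?N"
        by (simp add: order.trans[OF norm_triangle_ineq] norm_triangle_mono)
      then have "japanese \<zeta> powr s * norm (v u \<zeta>) \<le> japanese \<zeta> powr s * (norm ?F + norm ?B + norm ?N)"
        by (rule mult_left_mono) simp
      then have "ennreal (japanese \<zeta> powr s * norm (v u \<zeta>)) \<le> ennreal (japanese \<zeta> powr s * (norm ?F + norm ?B + norm ?N))"
        by (rule ennreal_leI)
      also have "\<dots> = ennreal (japanese \<zeta> powr s) * ennreal (norm ?F) + ennreal (japanese \<zeta> powr s) * ennreal (norm ?B) + near_part s u \<zeta>"
        unfolding near_part_def by (simp add: distrib_left ennreal_plus ennreal_mult)
      also have "\<dots> \<le> region_part farp s u \<zeta> + region_part belowp s u \<zeta> + near_part s u \<zeta>"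
        unfolding region_part_def by (intro add_mono mult_left_mono nle) auto
      finally have "(ennreal (japanese \<zeta> powr s * norm (v u \<zeta>)))\<^sup>2 \<le> (region_part farp s u \<zeta> + region_part belowp s u \<zeta> + near_part s u \<zeta>)\<^sup>2"
        by (rule power_mono) simp
      also have "\<dots> \<le> 2 * (region_part farp s u \<zeta> + region_part belowp s u \<zeta>)\<^sup>2 + 2 * (near_part s u \<zeta>)\<^sup>2" by (rule ennreal_add_sq)
      also have "\<dots> \<le> 2 * (2 * (region_part farp s u \<zeta>)\<^sup>2 + 2 * (region_part belowp s u \<zeta>)\<^sup>2) + 2 * (near_part s u \<zeta>)\<^sup>2"
        by (intro add_mono mult_left_mono ennreal_add_sq) auto
      also have "\<dots> = 4 * (region_part farp s u \<zeta>)\<^sup>2 + 4 * (region_part belowp s u \<zeta>)\<^sup>2 + 2 * (near_part s u \<zeta>)\<^sup>2"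
        by (simp add: distrib_left mult.assoc[symmetric])
      finally show ?case .
    qed
  qed
  also have "\<dots> = 4 * (\<integral>\<^sup>+\<zeta>. (region_part farp s u \<zeta>)\<^sup>2 \<partial>lborel) + 4 * (\<integral>\<^sup>+\<zeta>. (region_part belowp s u \<zeta>)\<^sup>2 \<partial>lborel) + 2 * (\<integral>\<^sup>+\<zeta>. (near_part s u \<zeta>)\<^sup>2 \<partial>lborel)"
    by (rule nn_integral_collect) measurable
  finally show ?thesis .
qed

text \<open>Cauchy-Schwarz with the weight of order t > d/2 turns the weighted L1 norm of u into a
  weighted L2 norm. The resulting order is s + m for t = \<tau> and m + t for \<tau> = s; both cases
  are used.\<close>

lemma region_part_weight_bound:
  fixes u :: "real^'n \<Rightarrow> complex"
  assumes R: "Measurable.pred (borel \<Otimes>\<^sub>M borel) (\<lambda>p. R (fst p) (snd p))"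
    and w: "\<And>\<zeta> \<xi>. R \<zeta> \<xi> \<Longrightarrow> japanese \<zeta> powr s \<le> farC s \<tau> * (japanese (\<zeta> - \<xi>) powr \<tau> * japanese \<xi> powr (s - \<tau>))"
    and um: "u \<in> borel_measurable borel" and t: "real CARD('n) / 2 < t"
  shows "(\<integral>\<^sup>+\<zeta>. (region_part R s u \<zeta>)\<^sup>2 \<partial>lborel)
    \<le> ennreal ((farC s \<tau> * GC)\<^sup>2 * weightC t TYPE('n) * a\<^sup>2) * weighted_sq (m + s - \<tau> + t) u"
proof -
  have "(\<integral>\<^sup>+\<zeta>. (region_part R s u \<zeta>)\<^sup>2 \<partial>lborel)
    \<le> ennreal ((farC s \<tau> * GC * a)\<^sup>2) * (\<integral>\<^sup>+\<xi>. ennreal (japanese \<xi> powr (m + s - \<tau>) * norm (u \<xi>)) \<partial>lborel)\<^sup>2"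
    unfolding region_part_def by (rule weighted_region_bound[OF R w um])
  also have "\<dots> \<le> ennreal ((farC s \<tau> * GC * a)\<^sup>2) * (ennreal (weightC t TYPE('n)) * weighted_sq (m + s - \<tau> + t) u)"
    using weight_CS[OF um, of "m + s - \<tau>" t] unfolding weightC(1)[OF t] by (intro mult_left_mono) auto
  also have "\<dots> = ennreal ((farC s \<tau> * GC * a)\<^sup>2 * weightC t TYPE('n)) * weighted_sq (m + s - \<tau> + t) u"
    using weightC(2)[OF t] by (simp add: ennreal_mult mult.assoc)
  also have "(farC s \<tau> * GC * a)\<^sup>2 * weightC t TYPE('n) = (farC s \<tau> * GC)\<^sup>2 * weightC t TYPE('n) * a\<^sup>2"
    by (simp add: power_mult_distrib)
  finally show ?thesis .
qed

lemma v_bound_low: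
  fixes u :: "real^'n \<Rightarrow> complex"
  assumes s: "- \<tau> < s" "s < \<tau>" and u: "rapid u" and um: "u \<in> borel_measurable borel"
  shows "weighted_sq s (v u)
    \<le> ennreal (4 * ((farC s \<tau> * GC)\<^sup>2 * weightC \<tau> TYPE('n)) * a\<^sup>2 + 4 * belowC m s \<tau> TYPE('n) * a\<^sup>2 + 2 * nearC m s TYPE('n) * b\<^sup>2)
      * weighted_sq (s + m) u"
proof -
  let ?U = "\<integral>\<^sup>+\<xi>. (ennreal (japanese \<xi> powr (s + m) * norm (u \<xi>)))\<^sup>2 \<partial>lborel"
  have r: "real CARD('n) / 2 < belowr s \<tau> TYPE('n)" using s tau by (auto simp: belowr_def)
  have c0: "0 \<le> weightC \<tau> TYPE('n)" "0 \<le> belowC m s \<tau> TYPE('n)" "0 \<le> nearC m s TYPE('n)"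
    using weightC(2)[OF tau] weightC(2)[OF r] by (auto simp: belowC_def nearC_def)
  have far: "(\<integral>\<^sup>+\<zeta>. (region_part farp s u \<zeta>)\<^sup>2 \<partial>lborel) \<le> ennreal ((farC s \<tau> * GC)\<^sup>2 * weightC \<tau> TYPE('n) * a\<^sup>2) * ?U"
    using region_part_weight_bound[OF regions_measurable(1) farp_weight[of _ _ s \<tau>] um tau] s by (simp add: add.commute)
  have below: "(\<integral>\<^sup>+\<zeta>. (region_part belowp s u \<zeta>)\<^sup>2 \<partial>lborel) \<le> ennreal (belowC m s \<tau> TYPE('n) * a\<^sup>2) * ?U"
    unfolding region_part_def by (rule below_bound[OF s um])
  have near: "(\<integral>\<^sup>+\<zeta>. (near_part s u \<zeta>)\<^sup>2 \<partial>lborel) \<le> ennreal (nearC m s TYPE('n) * b\<^sup>2) * ?U"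
    unfolding near_part_def by (rule near_bound[OF u um])
  have "weighted_sq s (v u)
    \<le> 4 * (ennreal ((farC s \<tau> * GC)\<^sup>2 * weightC \<tau> TYPE('n) * a\<^sup>2) * ?U) + 4 * (ennreal (belowC m s \<tau> TYPE('n) * a\<^sup>2) * ?U) + 2 * (ennreal (nearC m s TYPE('n) * b\<^sup>2) * ?U)"
    by (rule order.trans[OF v_le_regions[OF u um]]) (intro add_mono mult_left_mono far below near, auto)
  also have "\<dots> = ennreal (4 * ((farC s \<tau> * GC)\<^sup>2 * weightC \<tau> TYPE('n)) * a\<^sup>2 + 4 * belowC m s \<tau> TYPE('n) * a\<^sup>2 + 2 * nearC m s TYPE('n) * b\<^sup>2) * ?U"
    using c0 by (simp add: ennreal_plus ennreal_mult distrib_right mult.assoc)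
  finally show ?thesis .
qed

text \<open>With the output measured at the order \<tau> of the symbol's own Sobolev bound, the far
  and the below region both reduce to a weighted L1 norm of u, hence to order m + t. The full order
  \<tau> + m of u appears only next to the supremum constant b.\<close>

lemma v_bound_high:
  fixes u :: "real^'n \<Rightarrow> complex"
  assumes t: "real CARD('n) / 2 < t" and u: "rapid u" and um: "u \<in> borel_measurable borel"
  shows "weighted_sq \<tau> (v u)
    \<le> ennreal (8 * ((farC \<tau> \<tau> * GC)\<^sup>2 * weightC t TYPE('n) * a\<^sup>2)) * weighted_sq (m + t) u
     + ennreal (2 * (nearC m \<tau> TYPE('n) * b\<^sup>2)) * weighted_sq (\<tau> + m) u"
proof -
  let ?T = "\<integral>\<^sup>+\<xi>. (ennreal (japanese \<xi> powr (m + t) * norm (u \<xi>)))\<^sup>2 \<partial>lborel"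
  let ?U = "\<integral>\<^sup>+\<xi>. (ennreal (japanese \<xi> powr (\<tau> + m) * norm (u \<xi>)))\<^sup>2 \<partial>lborel"
  have c0: "0 \<le> weightC t TYPE('n)" "0 \<le> nearC m \<tau> TYPE('n)" using weightC(2)[OF t] by (auto simp: nearC_def)
  have t0: "0 \<le> \<tau>" using tau by (auto intro: order.trans less_imp_le)
  have far: "(\<integral>\<^sup>+\<zeta>. (region_part farp \<tau> u \<zeta>)\<^sup>2 \<partial>lborel) \<le> ennreal ((farC \<tau> \<tau> * GC)\<^sup>2 * weightC t TYPE('n) * a\<^sup>2) * ?T"
    using region_part_weight_bound[OF regions_measurable(1) farp_weight[of _ _ \<tau> \<tau>] um t] by simp
  have below: "(\<integral>\<^sup>+\<zeta>. (region_part belowp \<tau> u \<zeta>)\<^sup>2 \<partial>lborel) \<le> ennreal ((farC \<tau> \<tau> * GC)\<^sup>2 * weightC t TYPE('n) * a\<^sup>2) * ?T"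
    using region_part_weight_bound[OF regions_measurable(2) belowp_weight[OF _ t0] um t] by simp
  have near: "(\<integral>\<^sup>+\<zeta>. (near_part \<tau> u \<zeta>)\<^sup>2 \<partial>lborel) \<le> ennreal (nearC m \<tau> TYPE('n) * b\<^sup>2) * ?U"
    unfolding near_part_def by (rule near_bound[OF u um])
  have "weighted_sq \<tau> (v u)
    \<le> 4 * (ennreal ((farC \<tau> \<tau> * GC)\<^sup>2 * weightC t TYPE('n) * a\<^sup>2) * ?T) + 4 * (ennreal ((farC \<tau> \<tau> * GC)\<^sup>2 * weightC t TYPE('n) * a\<^sup>2) * ?T) + 2 * (ennreal (nearC m \<tau> TYPE('n) * b\<^sup>2) * ?U)"
    by (rule order.trans[OF v_le_regions[OF u um]]) (intro add_mono mult_left_mono far below near, auto)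
  also have "\<dots> = ennreal (8 * ((farC \<tau> \<tau> * GC)\<^sup>2 * weightC t TYPE('n) * a\<^sup>2)) * ?T + ennreal (2 * (nearC m \<tau> TYPE('n) * b\<^sup>2)) * ?U"
    by (rule ennreal_collect) (use c0 in auto)
  finally show ?thesis .
qed

end

section \<open>The Fourier transform of the operator\<close>

text \<open>Modulating f amounts to translating the test function, and translates of Schwartz
  functions are Schwartz functions.\<close>

lemma has_fourier_modulate:
  fixes f :: "real^'n \<Rightarrow> complex"
  assumes h: "has_fourier f g" and [measurable]: "f \<in> borel_measurable borel" "g \<in> borel_measurable borel"
  shows "has_fourier (\<lambda>x. exp (\<i> * of_real (x \<bullet> \<xi>)) * f x) (\<lambda>\<eta>. g (\<eta> - \<xi>))"
proof (subst has_fourier_borel_iff; (measurable)?; intro ballI)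
  fix \<phi> :: "real^'n \<Rightarrow> complex" assume \<phi>: "\<phi> \<in> schwartz"
  note [measurable] = schwartz_borel[OF \<phi>]
  define \<psi> where "\<psi> x = \<phi> (x + \<xi>)" for x
  have \<psi>: "\<psi> \<in> schwartz" unfolding \<psi>_def[abs_def] by (rule schwartz_shift[OF \<phi>])
  note [measurable] = schwartz_borel[OF \<psi>]
  have F: "fourier \<psi> x = exp (\<i> * of_real (x \<bullet> \<xi>)) * fourier \<phi> x" for x
  proof -
    have "fourier \<psi> x = (\<integral>t. exp (\<i> * of_real (x \<bullet> \<xi>)) * (exp (- (\<i> * of_real ((t + \<xi>) \<bullet> x))) * \<phi> (t + \<xi>)) \<partial>lborel)"
      by (subst fourier_borel, measurable)
        (auto intro!: Bochner_Integration.integral_cong simp: \<psi>_def inner_add_left inner_commute exp_add[symmetric] algebra_simps)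
    also have "\<dots> = exp (\<i> * of_real (x \<bullet> \<xi>)) * (\<integral>t. exp (- (\<i> * of_real ((t + \<xi>) \<bullet> x))) * \<phi> (t + \<xi>) \<partial>lborel)"
      by (rule integral_mult_right_zero)
    also have "(\<integral>t. exp (- (\<i> * of_real ((t + \<xi>) \<bullet> x))) * \<phi> (t + \<xi>) \<partial>lborel) = fourier \<phi> x"
      unfolding fourier_borel[OF schwartz_borel[OF \<phi>]]
      by (rule integral_shift[of "\<lambda>t. exp (- (\<i> * of_real (t \<bullet> x))) * \<phi> t"])
    finally show ?thesis .
  qed
  have 1: "(\<lambda>x. f x * fourier \<psi> x) = (\<lambda>x. exp (\<i> * of_real (x \<bullet> \<xi>)) * f x * fourier \<phi> x)" by (simp add: F fun_eq_iff)
  have 2: "(\<lambda>\<eta>. g (\<eta> - \<xi>) * \<phi> \<eta>) = (\<lambda>\<eta>. (\<lambda>t. g t * \<psi> t) (\<eta> - \<xi>))" by (simp add: \<psi>_def)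
  have I: "integrable lborel (\<lambda>x. f x * fourier \<psi> x)" "integrable lborel (\<lambda>t. g t * \<psi> t)"
    "(\<integral>x. f x * fourier \<psi> x \<partial>lborel) = (\<integral>t. g t * \<psi> t \<partial>lborel)"
    using h \<psi> by (auto simp: has_fourier_borel_iff)
  show "integrable lborel (\<lambda>x. exp (\<i> * of_real (x \<bullet> \<xi>)) * f x * fourier \<phi> x) \<and>
      integrable lborel (\<lambda>\<eta>. g (\<eta> - \<xi>) * \<phi> \<eta>) \<and>
      (\<integral>x. exp (\<i> * of_real (x \<bullet> \<xi>)) * f x * fourier \<phi> x \<partial>lborel) = (\<integral>\<eta>. g (\<eta> - \<xi>) * \<phi> \<eta> \<partial>lborel)"
    using I integrable_shift[OF I(2), of "- \<xi>"] integral_shift[of "\<lambda>t. g t * \<psi> t" "- \<xi>"]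
    unfolding 1 2 by simp
qed

lemma has_fourier_cmult:
  assumes "has_fourier f g"
  shows "has_fourier (\<lambda>x. c * f x) (\<lambda>\<eta>. c * g \<eta>)"
  using assms unfolding has_fourier_def by (auto simp: mult.assoc)

lemma has_fourier_zero: "has_fourier (\<lambda>_. 0) (\<lambda>_. 0)"
  unfolding has_fourier_def by auto

lemma has_fourier_add:
  assumes "has_fourier f g" "has_fourier f' g'"
  shows "has_fourier (\<lambda>x. f x + f' x) (\<lambda>\<eta>. g \<eta> + g' \<eta>)"
  using assms unfolding has_fourier_def by (auto simp: distrib_right)

lemma has_fourier_sum:
  assumes "finite I" "\<And>i. i \<in> I \<Longrightarrow> has_fourier (f i) (g i)"
  shows "has_fourier (\<lambda>x. \<Sum>i\<in>I. f i x) (\<lambda>\<eta>. \<Sum>i\<in>I. g i \<eta>)"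
  using assms by (induction I rule: finite_induct) (auto intro: has_fourier_zero has_fourier_add)

lemma has_fourier_bounded_AE:
  fixes f :: "real^'n \<Rightarrow> complex"
  assumes h: "has_fourier f g" and f: "f \<in> borel_measurable borel" and g: "integrable lborel g"
  shows "AE x in lborel. ennreal ((2 * pi) ^ CARD('n)) * ennreal (norm (f x)) \<le> (\<integral>\<^sup>+\<eta>. ennreal (norm (g \<eta>)) \<partial>lborel)"
  using fourier_inversion_AE[OF h f g]
proof eventually_elim
  case (elim x)
  have "ennreal ((2 * pi) ^ CARD('n)) * ennreal (norm (f x)) = ennreal (norm (complex_of_real ((2 * pi) ^ CARD('n)) * f x))"
    by (subst norm_mult, subst norm_of_real) (simp add: ennreal_mult)
  then show ?case unfolding elim by (simp add: ift_norm_le)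
qed

text \<open>Superposition over a parameter commutes with the Fourier transform once both pairings
  converge absolutely. On the side of f this follows from the L1 bound on g, because f is almost
  everywhere bounded by the L1 norm of its transform. Parameters with c y = 0 are left out, as the
  data need not be a transform pair there.\<close>

lemma has_fourier_mix:
  fixes f g :: "real^'n \<Rightarrow> 'b \<Rightarrow> complex"
  assumes N: "sigma_finite_measure N" and c [measurable]: "c \<in> borel_measurable N"
    and f [measurable]: "(\<lambda>p. f (fst p) (snd p)) \<in> borel_measurable (borel \<Otimes>\<^sub>M N)"
    and g [measurable]: "(\<lambda>p. g (fst p) (snd p)) \<in> borel_measurable (borel \<Otimes>\<^sub>M N)"
    and h: "\<And>y. y \<in> space N \<Longrightarrow> c y \<noteq> 0 \<Longrightarrow> has_fourier (\<lambda>x. f x y) (\<lambda>\<eta>. g \<eta> y)"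
    and fin: "(\<integral>\<^sup>+y. \<integral>\<^sup>+\<eta>. ennreal (norm (c y * g \<eta> y)) \<partial>lborel \<partial>N) < \<infinity>"
  shows "has_fourier (\<lambda>x. \<integral>y. c y * f x y \<partial>N) (\<lambda>\<eta>. \<integral>y. c y * g \<eta> y \<partial>N)"
proof -
  interpret N: sigma_finite_measure N by fact
  have fs [measurable]: "(\<lambda>x. f x y) \<in> borel_measurable borel" "(\<lambda>x. g x y) \<in> borel_measurable borel" if "y \<in> space N" for y
    using measurable_compose[OF measurable_Pair2'[OF that, of borel] f] measurable_compose[OF measurable_Pair2'[OF that, of borel] g] by simp_all
  have fs' [measurable]: "(\<lambda>y. f x y) \<in> borel_measurable N" "(\<lambda>y. g x y) \<in> borel_measurable N" for x
    using measurable_compose[OF measurable_Pair1'[of x borel] f] measurable_compose[OF measurable_Pair1'[of x borel] g] by simp_all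
  have [measurable]: "(\<lambda>x. \<integral>y. c y * f x y \<partial>N) \<in> borel_measurable borel" "(\<lambda>x. \<integral>y. c y * g x y \<partial>N) \<in> borel_measurable borel"
    by (rule N.borel_measurable_lebesgue_integral; unfold case_prod_beta; measurable)+
  have sw: "(\<lambda>p. f (snd p) (fst p)) \<in> borel_measurable (N \<Otimes>\<^sub>M borel)" "(\<lambda>p. g (snd p) (fst p)) \<in> borel_measurable (N \<Otimes>\<^sub>M borel)"
    using measurable_compose[OF _ f, of "\<lambda>p. (snd p, fst p)" "N \<Otimes>\<^sub>M borel"] measurable_compose[OF _ g, of "\<lambda>p. (snd p, fst p)" "N \<Otimes>\<^sub>M borel"] by simp_all
  note [measurable] = sw
  let ?L = "\<lambda>y. \<integral>\<^sup>+\<eta>. ennreal (norm (c y * g \<eta> y)) \<partial>lborel"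
  have Lm [measurable]: "?L \<in> borel_measurable N"
    by (rule lborel.borel_measurable_nn_integral) (unfold case_prod_beta, measurable)
  have gi: "AE y in N. integrable lborel (\<lambda>\<eta>. c y * g \<eta> y)"
    by (rule Fubini_complex_AE1[OF N sigma_finite_lborel _ fin]) (unfold case_prod_beta, measurable)
  show ?thesis
  proof (subst has_fourier_borel_iff; (measurable)?; intro ballI)
    fix \<phi> :: "real^'n \<Rightarrow> complex" assume \<phi>: "\<phi> \<in> schwartz"
    note [measurable] = schwartz_borel[OF \<phi>]
    obtain K where "\<And>x. norm x ^ 0 * norm (\<phi> x) \<le> K" using schwartz_rapid[OF \<phi>] unfolding rapid_def by blast
    then have K: "norm (\<phi> x) \<le> K" for x by simp
    have K0: "0 \<le> K" using order.trans[OF norm_ge_zero K] .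
    have Fi: "integrable lborel (fourier \<phi>)" by (rule rapid_integrable[OF fourier_schwartz_rapid[OF \<phi>]]) measurable
    define I where "I = (\<integral>\<^sup>+x. ennreal (norm (fourier \<phi> x)) \<partial>lborel)"
    have I: "I < \<infinity>" unfolding I_def using Fi by (simp add: integrable_iff_bounded)
    \<comment> \<open>The boundedness of f is combined with the integrability of the transform of
      the test function \<phi>.\<close>
    have b1: "AE y in N. (\<integral>\<^sup>+x. ennreal (norm (c y * f x y * fourier \<phi> x)) \<partial>lborel) \<le> ?L y * I"
      using gi AE_space
    proof eventually_elim
      case (elim y)
      note [measurable] = fs[OF elim(2)]
      show ?case
      proof (cases "c y = 0")
        case False
        have "has_fourier (\<lambda>x. c y * f x y) (\<lambda>\<eta>. c y * g \<eta> y)" by (rule has_fourier_cmult[OF h[OF elim(2) False]])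
        from has_fourier_bounded_AE[OF this _ elim(1)]
        have "AE x in lborel. ennreal ((2 * pi) ^ CARD('n)) * ennreal (norm (c y * f x y)) \<le> ?L y" by simp
        then have "AE x in lborel. ennreal (norm (c y * f x y * fourier \<phi> x)) \<le> ?L y * ennreal (norm (fourier \<phi> x))"
        proof eventually_elim
          case (elim x)
          have "1 \<le> (2 * pi) ^ CARD('n)" using pi_ge_two by (intro one_le_power) auto
          then have "1 * ennreal (norm (c y * f x y)) \<le> ennreal ((2 * pi) ^ CARD('n)) * ennreal (norm (c y * f x y))"
            by (intro mult_right_mono) (auto simp: ennreal_leI simp flip: ennreal_1)
          also note elim
          finally show ?case by (subst norm_mult, subst ennreal_mult) (auto intro: mult_right_mono)
        qed
        then have "(\<integral>\<^sup>+x. ennreal (norm (c y * f x y * fourier \<phi> x)) \<partial>lborel) \<le> (\<integral>\<^sup>+x. ?L y * ennreal (norm (fourier \<phi> x)) \<partial>lborel)"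
          by (rule nn_integral_mono_AE)
        also have "\<dots> = ?L y * I" unfolding I_def by (rule nn_integral_cmult) measurable
        finally show ?thesis .
      qed simp
    qed
    have "(\<integral>\<^sup>+y. \<integral>\<^sup>+x. ennreal (norm (c y * f x y * fourier \<phi> x)) \<partial>lborel \<partial>N) \<le> (\<integral>\<^sup>+y. ?L y * I \<partial>N)"
      by (rule nn_integral_mono_AE[OF b1])
    also have "\<dots> = (\<integral>\<^sup>+y. ?L y \<partial>N) * I" by (rule nn_integral_multc) measurable
    also have "\<dots> < \<infinity>" using fin I by (simp add: ennreal_mult_less_top)
    finally have fin1: "(\<integral>\<^sup>+y. \<integral>\<^sup>+x. ennreal (norm (c y * f x y * fourier \<phi> x)) \<partial>lborel \<partial>N) < \<infinity>" .
    have b2: "(\<integral>\<^sup>+\<eta>. ennreal (norm (c y * g \<eta> y * \<phi> \<eta>)) \<partial>lborel) \<le> ?L y * ennreal K" if "y \<in> space N" for y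
    proof -
      note [measurable] = fs[OF that]
      have "(\<integral>\<^sup>+\<eta>. ennreal (norm (c y * g \<eta> y * \<phi> \<eta>)) \<partial>lborel) \<le> (\<integral>\<^sup>+\<eta>. ennreal (norm (c y * g \<eta> y)) * ennreal K \<partial>lborel)"
        using K K0 by (intro nn_integral_mono, subst norm_mult, subst ennreal_mult) (auto intro!: mult_left_mono ennreal_leI)
      also have "\<dots> = ?L y * ennreal K" by (rule nn_integral_multc) measurable
      finally show ?thesis .
    qed
    have "(\<integral>\<^sup>+y. \<integral>\<^sup>+\<eta>. ennreal (norm (c y * g \<eta> y * \<phi> \<eta>)) \<partial>lborel \<partial>N) \<le> (\<integral>\<^sup>+y. ?L y * ennreal K \<partial>N)"
      by (rule nn_integral_mono[OF b2])
    also have "\<dots> = (\<integral>\<^sup>+y. ?L y \<partial>N) * ennreal K" by (rule nn_integral_multc) measurable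
    also have "\<dots> < \<infinity>" using fin by (simp add: ennreal_mult_less_top)
    finally have fin2: "(\<integral>\<^sup>+y. \<integral>\<^sup>+\<eta>. ennreal (norm (c y * g \<eta> y * \<phi> \<eta>)) \<partial>lborel \<partial>N) < \<infinity>" .
    have m1: "(\<lambda>(y, x). c y * f x y * fourier \<phi> x) \<in> borel_measurable (N \<Otimes>\<^sub>M lborel)"
      and m2: "(\<lambda>(y, \<eta>). c y * g \<eta> y * \<phi> \<eta>) \<in> borel_measurable (N \<Otimes>\<^sub>M lborel)"
      unfolding case_prod_beta by measurable
    have i: "(\<integral>y. c y * f x y * fourier \<phi> x \<partial>N) = (\<integral>y. c y * f x y \<partial>N) * fourier \<phi> x"
      "(\<integral>y. c y * g x y * \<phi> x \<partial>N) = (\<integral>y. c y * g x y \<partial>N) * \<phi> x" for x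
      by (rule integral_mult_left_zero)+
    have "(\<integral>x. (\<integral>y. c y * f x y \<partial>N) * fourier \<phi> x \<partial>lborel) = (\<integral>y. (\<integral>x. c y * f x y * fourier \<phi> x \<partial>lborel) \<partial>N)"
      unfolding i[symmetric] by (rule Fubini_complex_eq[OF N sigma_finite_lborel m1 fin1, symmetric])
    also have "\<dots> = (\<integral>y. (\<integral>\<eta>. c y * g \<eta> y * \<phi> \<eta> \<partial>lborel) \<partial>N)"
    proof (rule Bochner_Integration.integral_cong[OF refl])
      fix y assume y: "y \<in> space N"
      show "(\<integral>x. c y * f x y * fourier \<phi> x \<partial>lborel) = (\<integral>\<eta>. c y * g \<eta> y * \<phi> \<eta> \<partial>lborel)"
        using h[OF y] fs[OF y] \<phi> by (cases "c y = 0") (auto simp: has_fourier_borel_iff mult.assoc)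
    qed
    also have "\<dots> = (\<integral>\<eta>. (\<integral>y. c y * g \<eta> y \<partial>N) * \<phi> \<eta> \<partial>lborel)"
      unfolding i[symmetric] by (rule Fubini_complex_eq[OF N sigma_finite_lborel m2 fin2])
    finally show "integrable lborel (\<lambda>x. (\<integral>y. c y * f x y \<partial>N) * fourier \<phi> x) \<and> integrable lborel (\<lambda>\<eta>. (\<integral>y. c y * g \<eta> y \<partial>N) * \<phi> \<eta>) \<and>
        (\<integral>x. (\<integral>y. c y * f x y \<partial>N) * fourier \<phi> x \<partial>lborel) = (\<integral>\<eta>. (\<integral>y. c y * g \<eta> y \<partial>N) * \<phi> \<eta> \<partial>lborel)"
      using Fubini_complex_int2[OF N sigma_finite_lborel m1 fin1] Fubini_complex_int2[OF N sigma_finite_lborel m2 fin2]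
      unfolding i by blast
  qed
qed

context fourier_symbol
begin

lemma has_fourier_block:
  fixes T :: "'n set \<Rightarrow> real^'n \<Rightarrow> real^'n \<Rightarrow> complex"
  assumes Tm [measurable]: "\<And>A. (\<lambda>p. T A (fst p) (snd p)) \<in> borel_measurable (borel \<Otimes>\<^sub>M borel)"
    and Th: "\<And>A z. 1 \<le> norm z \<Longrightarrow> has_fourier (\<lambda>x. T A x z) (\<lambda>\<eta>. GA A \<eta> z)"
    and sh: "\<xi> \<in> shell k"
  shows "has_fourier (\<lambda>x. \<Sum>A\<in>UNIV. \<integral>y. cube_kernel (2 ^ k) A \<xi> y *\<^sub>R T A x (vec_of y) \<partial>parM) (\<lambda>\<eta>. block_symbol GA k \<eta> \<xi>)"
  unfolding block_symbol_def scaleR_conv_of_real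
proof (rule has_fourier_sum)
  fix A :: "'n set"
  obtain L where L: "0 \<le> L" "\<And>A z. 1 \<le> norm z \<Longrightarrow> (\<integral>\<^sup>+\<eta>. ennreal (norm (GA A \<eta> z)) \<partial>lborel) \<le> ennreal (L * japanese z powr (m - real (card A)))"
    by (rule GA_L1_finite) blast
  let ?B = "blockC m TYPE('n) * (2 ^ k) powr m"
  have B: "0 \<le> ?B" using blockC_pos[where 'n='n, of m] by simp
  have KKm [measurable]: "(\<lambda>y. cube_kernel (2 ^ k) A \<xi> y) \<in> borel_measurable parM"
    using measurable_compose[OF measurable_Pair1'[of \<xi> borel] cube_kernel_measurable] by simp
  show "has_fourier (\<lambda>x. \<integral>y. complex_of_real (cube_kernel (2 ^ k) A \<xi> y) * T A x (vec_of y) \<partial>parM) (\<lambda>\<eta>. \<integral>y. complex_of_real (cube_kernel (2 ^ k) A \<xi> y) * GA A \<eta> (vec_of y) \<partial>parM)"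
  proof (rule has_fourier_mix[OF sigma_finite_parM])
    show "(\<lambda>p. T A (fst p) (vec_of (snd p))) \<in> borel_measurable (borel \<Otimes>\<^sub>M parM)"
      using measurable_compose[OF _ Tm, of "\<lambda>p. (fst p, vec_of (snd p))" "borel \<Otimes>\<^sub>M parM" A] by simp
    show "has_fourier (\<lambda>x. T A x (vec_of y)) (\<lambda>\<eta>. GA A \<eta> (vec_of y))" if "complex_of_real (cube_kernel (2 ^ k) A \<xi> y) \<noteq> 0" for y
      using that by (intro Th parset_norm(3)[of y k] cube_kernel_nonzero_parset[OF sh, of A]) auto
    have "(\<integral>\<^sup>+y. \<integral>\<^sup>+\<eta>. ennreal (norm (complex_of_real (cube_kernel (2 ^ k) A \<xi> y) * GA A \<eta> (vec_of y))) \<partial>lborel \<partial>parM)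
      \<le> (\<integral>\<^sup>+y. ennreal (?B * L) * indicator (parset k) y \<partial>(parM :: ('n \<Rightarrow> real) measure))"
    proof (intro nn_integral_mono)
      fix y :: "'n \<Rightarrow> real"
      show "(\<integral>\<^sup>+\<eta>. ennreal (norm (complex_of_real (cube_kernel (2 ^ k) A \<xi> y) * GA A \<eta> (vec_of y))) \<partial>lborel) \<le> ennreal (?B * L) * indicator (parset k) y"
      proof (cases "cube_kernel (2 ^ k) A \<xi> y = 0")
        case False
        then have y: "y \<in> parset k" using cube_kernel_nonzero_parset[OF sh] by blast
        let ?z = "vec_of y :: real^'n" and ?e = "(1 / 2 ^ k) ^ (CARD('n) - card A) :: real"
        have [measurable]: "(\<lambda>\<eta>. GA A \<eta> ?z) \<in> borel_measurable borel"
          using measurable_compose[OF measurable_Pair2'[of ?z borel borel] GA_meas] by simp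
        have "(\<integral>\<^sup>+\<eta>. ennreal (norm (complex_of_real (cube_kernel (2 ^ k) A \<xi> y) * GA A \<eta> ?z)) \<partial>lborel) = ennreal \<bar>cube_kernel (2 ^ k) A \<xi> y\<bar> * (\<integral>\<^sup>+\<eta>. ennreal (norm (GA A \<eta> ?z)) \<partial>lborel)"
          by (simp add: norm_mult ennreal_mult nn_integral_cmult)
        also have "\<dots> \<le> ennreal ?e * ennreal (L * japanese ?z powr (m - real (card A)))"
          by (intro mult_mono ennreal_leI cube_kernel_abs_le L parset_norm(3)[OF y]) auto
        also have "\<dots> = ennreal (L * (?e * japanese ?z powr (m - real (card A))))"
          using L(1) by (simp add: ennreal_mult[symmetric] mult_ac)
        also have "\<dots> \<le> ennreal (L * ?B)"
        proof (intro ennreal_leI mult_left_mono L(1))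
          have "1 \<le> (6 * 2 ^ k :: real) ^ CARD('n)" by (intro one_le_power) (auto intro: order.trans[OF one_le_power[of "2::real" k]])
          then have "?e * 1 * japanese ?z powr (m - real (card A)) \<le> ?e * (6 * 2 ^ k) ^ CARD('n) * japanese ?z powr (m - real (card A))"
            by (intro mult_right_mono mult_left_mono) auto
          also note parset_weight[OF y, of A m]
          finally show "?e * japanese ?z powr (m - real (card A)) \<le> ?B" by (simp only: mult_1_right)
        qed
        finally show ?thesis using y by (simp add: mult.commute)
      qed simp
    qed
    also have "\<dots> = ennreal (?B * L) * emeasure parM (parset k :: ('n \<Rightarrow> real) set)" by (rule nn_integral_cmult_indicator) measurable
    also have "\<dots> < \<infinity>" using emeasure_parset[where 'n='n, of k] by (auto simp: ennreal_mult_less_top intro: le_less_trans)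
    finally show "(\<integral>\<^sup>+y. \<integral>\<^sup>+\<eta>. ennreal (norm (complex_of_real (cube_kernel (2 ^ k) A \<xi> y) * GA A \<eta> (vec_of y))) \<partial>lborel \<partial>parM) < \<infinity>" .
  qed (auto simp: GA_vec_meas)
qed simp

text \<open>T and R are meant as Borel versions of the mixed derivatives and of the low frequency
  part of the symbol, S as the assembled symbol. The operator is a superposition over \<xi> of the
  modulated functions S(., \<xi>) with coefficients u \<xi>.\<close>

lemma has_fourier_v:
  fixes T :: "'n set \<Rightarrow> real^'n \<Rightarrow> real^'n \<Rightarrow> complex" and R :: "real^'n \<Rightarrow> real^'n \<Rightarrow> complex" and u :: "real^'n \<Rightarrow> complex"
  assumes Tm [measurable]: "\<And>A. (\<lambda>p. T A (fst p) (snd p)) \<in> borel_measurable (borel \<Otimes>\<^sub>M borel)"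
    and Th: "\<And>A z. 1 \<le> norm z \<Longrightarrow> has_fourier (\<lambda>x. T A x z) (\<lambda>\<eta>. GA A \<eta> z)"
    and rep: "\<And>x \<xi> k. \<xi> \<in> shell k \<Longrightarrow> T {} x \<xi> = (\<Sum>A\<in>UNIV. \<integral>y. cube_kernel (2 ^ k) A \<xi> y *\<^sub>R T A x (vec_of y) \<partial>parM)"
    and Rm [measurable]: "(\<lambda>p. R (fst p) (snd p)) \<in> borel_measurable (borel \<Otimes>\<^sub>M borel)"
    and Rh: "\<And>\<xi>. norm \<xi> < 1 \<Longrightarrow> has_fourier (\<lambda>x. R x \<xi>) (\<lambda>\<eta>. GL \<eta> \<xi>)"
    and u: "rapid u" and um [measurable]: "u \<in> borel_measurable borel"
  defines "S x \<xi> \<equiv> if norm \<xi> < 1 then R x \<xi> else T {} x \<xi>"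
  shows "has_fourier (\<lambda>x. \<integral>\<xi>. u \<xi> * (exp (\<i> * of_real (x \<bullet> \<xi>)) * S x \<xi>) \<partial>lborel) (v u)"
    and "(\<lambda>p. S (fst p) (snd p)) \<in> borel_measurable (borel \<Otimes>\<^sub>M borel)"
proof -
  show Sm [measurable]: "(\<lambda>p. S (fst p) (snd p)) \<in> borel_measurable (borel \<Otimes>\<^sub>M borel)"
    unfolding S_def by measurable
  have Sx [measurable]: "(\<lambda>x. S x \<xi>) \<in> borel_measurable borel" for \<xi>
    using measurable_compose[OF measurable_Pair2'[of \<xi> borel borel] Sm] by simp
  have S: "has_fourier (\<lambda>x. S x \<xi>) (\<lambda>\<eta>. G \<eta> \<xi>)" for \<xi>
  proof (cases "norm \<xi> < 1")
    case True
    then show ?thesis using Rh[OF True] by (simp add: S_def G_def)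
  next
    case False
    then have sh: "\<xi> \<in> shell (level \<xi>)" using shell_level[of \<xi>] by simp
    show ?thesis using has_fourier_block[OF Tm Th sh] False by (simp add: S_def G_def rep[OF sh])
  qed
  have "has_fourier (\<lambda>x. \<integral>\<xi>. u \<xi> * (exp (\<i> * of_real (x \<bullet> \<xi>)) * S x \<xi>) \<partial>lborel) (\<lambda>\<zeta>. \<integral>\<xi>. u \<xi> * G (\<zeta> - \<xi>) \<xi> \<partial>lborel)"
  proof (rule has_fourier_mix[OF sigma_finite_lborel])
    show "(\<integral>\<^sup>+\<xi>. \<integral>\<^sup>+\<eta>. ennreal (norm (u \<xi> * G (\<eta> - \<xi>) \<xi>)) \<partial>lborel \<partial>lborel) < \<infinity>"
      using G_u_finite[OF u um] by (simp add: mult.commute)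
    show "has_fourier (\<lambda>x. exp (\<i> * of_real (x \<bullet> \<xi>)) * S x \<xi>) (\<lambda>\<eta>. G (\<eta> - \<xi>) \<xi>)" for \<xi>
      by (rule has_fourier_modulate[OF S]) measurable
    show "(\<lambda>p. G (fst p - snd p) (snd p)) \<in> borel_measurable (borel \<Otimes>\<^sub>M lborel)"
      using G_shift_measurable by measurable
    show "(\<lambda>p. exp (\<i> * of_real (fst p \<bullet> snd p)) * S (fst p) (snd p)) \<in> borel_measurable (borel \<Otimes>\<^sub>M lborel)"
      by measurable
  qed measurable
  then show "has_fourier (\<lambda>x. \<integral>\<xi>. u \<xi> * (exp (\<i> * of_real (x \<bullet> \<xi>)) * S x \<xi>) \<partial>lborel) (v u)"
    unfolding v_def[abs_def] by (simp add: mult.commute)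
qed

end

section \<open>Borel representatives of a symbol\<close>

lemma lebesgue_measurable_cong_AE:
  fixes f g :: "'a::euclidean_space \<Rightarrow> 'b::topological_space"
  assumes g: "g \<in> borel_measurable borel" and ae: "AE x in lborel. f x = g x"
  shows "f \<in> borel_measurable lebesgue"
proof (rule measurableI)
  from ae obtain Z where Z: "\<And>x. x \<in> space lborel - Z \<Longrightarrow> f x = g x" "Z \<in> null_sets lborel" by (rule AE_E3) blast
  fix A :: "'b set" assume A: "A \<in> sets borel"
  have "f -` A \<inter> Z \<in> null_sets lebesgue"
    by (rule null_sets_completion_subset[of _ Z]) (use Z(2) in \<open>auto intro: null_sets_completionI\<close>)
  moreover have "g -` A - Z \<in> sets lebesgue"
    using measurable_sets[OF g A] Z(2) by (auto intro!: sets_completionI_sets)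
  moreover have "f -` A \<inter> space lebesgue = (g -` A - Z) \<union> (f -` A \<inter> Z)" using Z(1) by auto
  ultimately show "f -` A \<inter> space lebesgue \<in> sets lebesgue" by (metis sets.Un null_setsD2)
qed simp

text \<open>By continuity in \<xi> countably many sections determine the function, so one null set
  of x serves all of them. Approximating \<xi> by the first point of a dense sequence within
  distance 1/(n + 1) gives jointly measurable functions that converge.\<close>

lemma measurable_continuous_section:
  fixes F :: "'a::euclidean_space \<Rightarrow> 'b::euclidean_space \<Rightarrow> complex"
  assumes V: "open V" and cont: "\<And>x. continuous_on V (F x)"
    and meas: "\<And>\<xi>. \<xi> \<in> V \<Longrightarrow> (\<lambda>x. F x \<xi>) \<in> borel_measurable lebesgue"
  shows "\<exists>Z\<in>null_sets lborel. (\<lambda>p. if fst p \<notin> Z \<and> snd p \<in> V then F (fst p) (snd p) else 0) \<in> borel_measurable (borel \<Otimes>\<^sub>M borel)"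
proof (cases "V = {}")
  case True
  then show ?thesis by (intro bexI[of _ "{}"]) auto
next
  case False
  obtain D :: "'b set" where D: "countable D" "\<And>X. open X \<Longrightarrow> X \<noteq> {} \<Longrightarrow> \<exists>d\<in>D. d \<in> X"
    using countable_dense_exists[where 'a='b] by blast
  have ne: "D \<inter> V \<noteq> {}" using D(2)[OF V False] by blast
  define q where "q = from_nat_into (D \<inter> V)"
  have rq: "range q = D \<inter> V" unfolding q_def using ne D(1) by (intro range_from_nat_into) auto
  then have qO: "q k \<in> V" for k by blast
  have "\<forall>k. \<exists>g. g \<in> borel_measurable borel \<and> (AE x in lborel. F x (q k) = g x)"
    using ex_borel_representative[OF meas[OF qO]] by blast
  then obtain g where g [measurable]: "\<And>k. g k \<in> borel_measurable borel" and ae: "\<And>k. AE x in lborel. F x (q k) = g k x" by metis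
  from ae have "AE x in lborel. \<forall>k. F x (q k) = g k x" by (simp add: AE_all_countable)
  then obtain Z where Z: "\<And>x. x \<in> space lborel - Z \<Longrightarrow> \<forall>k. F x (q k) = g k x" "Z \<in> null_sets lborel" by (rule AE_E3) blast
  have [measurable]: "Z \<in> sets borel" "V \<in> sets borel" using Z(2) V by auto
  define i where "i n \<xi> = (LEAST k. dist (q k) \<xi> < 1 / real (Suc n))" for n \<xi>
  have im [measurable]: "i n \<in> borel \<rightarrow>\<^sub>M count_space UNIV" for n
    unfolding i_def[abs_def] by measurable
  have i: "dist (q (i n \<xi>)) \<xi> < 1 / real (Suc n)" if "\<xi> \<in> V" for n \<xi>
  proof -
    have "\<exists>d\<in>D. d \<in> V \<inter> ball \<xi> (1 / real (Suc n))"
      using that V by (intro D(2)) auto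
    then obtain d where "d \<in> range q" "dist d \<xi> < 1 / real (Suc n)" unfolding rq by (auto simp: dist_commute)
    then show ?thesis unfolding i_def by (intro LeastI_ex[of "\<lambda>k. dist (q k) \<xi> < 1 / real (Suc n)"]) auto
  qed
  have "(\<lambda>p. if fst p \<notin> Z \<and> snd p \<in> V then F (fst p) (snd p) else 0) \<in> borel_measurable (borel \<Otimes>\<^sub>M borel)"
  proof (rule borel_measurable_LIMSEQ_metric)
    fix n
    have [measurable]: "(\<lambda>p::'a \<times> 'b. g (i n (snd p)) (fst p)) \<in> borel_measurable (borel \<Otimes>\<^sub>M borel)"
      by (rule measurable_compose_countable[where g="\<lambda>p. i n (snd p)"]) measurable
    show "(\<lambda>p. if fst p \<notin> Z \<and> snd p \<in> V then g (i n (snd p)) (fst p) else 0) \<in> borel_measurable (borel \<Otimes>\<^sub>M borel)"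
      by measurable
  next
    fix p :: "'a \<times> 'b"
    show "(\<lambda>n. if fst p \<notin> Z \<and> snd p \<in> V then g (i n (snd p)) (fst p) else 0) \<longlonglongrightarrow> (if fst p \<notin> Z \<and> snd p \<in> V then F (fst p) (snd p) else 0)"
    proof (cases "fst p \<notin> Z \<and> snd p \<in> V")
      case True
      have "(\<lambda>n. q (i n (snd p))) \<longlonglongrightarrow> snd p"
        by (rule metric_tendsto_imp_tendsto[OF LIMSEQ_Suc[OF lim_1_over_n[where 'a=real]]])
          (use i[of "snd p"] True in \<open>auto intro!: always_eventually less_imp_le simp: dist_norm\<close>)
      then have "(\<lambda>n. F (fst p) (q (i n (snd p)))) \<longlonglongrightarrow> F (fst p) (snd p)"
        using True qO by (intro continuous_on_tendsto_compose[OF cont]) auto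
      then show ?thesis using True Z(1) by simp
    next
      case False
      show ?thesis unfolding if_not_P[OF False] by (rule tendsto_const)
    qed
  qed
  then show ?thesis using Z(2) by blast
qed

text \<open>Measurability is given for the completion of the product measure. A Borel representative
  agrees off a null set of the product, and almost all sections of a null set, in either direction,
  are null.\<close>

lemma joint_representative:
  fixes f :: "real^'n \<Rightarrow> real^'n \<Rightarrow> complex"
  assumes f: "(\<lambda>(x, \<xi>). f x \<xi>) \<in> borel_measurable (lebesgue_on (UNIV \<times> S))" and S: "S \<in> sets borel"
  obtains h where "(\<lambda>p. h (fst p) (snd p)) \<in> borel_measurable (borel \<Otimes>\<^sub>M borel)"
    "AE x in lborel. AE \<xi> in lborel. \<xi> \<in> S \<longrightarrow> f x \<xi> = h x \<xi>"
    "AE \<xi> in lborel. AE x in lborel. \<xi> \<in> S \<longrightarrow> f x \<xi> = h x \<xi>"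
proof -
  let ?S = "UNIV \<times> S :: ((real^'n) \<times> (real^'n)) set"
  have "?S \<in> sets borel"
    using pair_measureI[of UNIV "borel :: (real^'n) measure" S "borel :: (real^'n) measure"] S unfolding borel_prod by simp
  then have "?S \<in> sets lebesgue" by (intro sets_completionI_sets) simp
  then have "(\<lambda>p. if p \<in> ?S then (\<lambda>(x, \<xi>). f x \<xi>) p else 0) \<in> borel_measurable lebesgue"
    using f by (subst (asm) measurable_restrict_space_iff) auto
  from ex_borel_representative[OF this] obtain h :: "(real^'n) \<times> (real^'n) \<Rightarrow> complex"
    where h: "h \<in> borel_measurable borel" and ae: "AE p in lborel. (if p \<in> ?S then (\<lambda>(x, \<xi>). f x \<xi>) p else 0) = h p" by blast
  from ae have "AE p in lborel \<Otimes>\<^sub>M lborel. snd p \<in> S \<longrightarrow> f (fst p) (snd p) = h p"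
    unfolding lborel_prod by eventually_elim (auto split: if_splits)
  then obtain N where N: "\<And>p. p \<in> space (lborel \<Otimes>\<^sub>M lborel) - N \<Longrightarrow> snd p \<in> S \<longrightarrow> f (fst p) (snd p) = h p"
    "N \<in> null_sets (lborel \<Otimes>\<^sub>M lborel)" by (rule AE_E3) blast
  have N': "f x \<xi> = h (x, \<xi>)" if "(x, \<xi>) \<notin> N" "\<xi> \<in> S" for x \<xi>
    using N(1)[of "(x, \<xi>)"] that by (simp add: space_pair_measure)
  have "AE p in lborel \<Otimes>\<^sub>M lborel. p \<notin> N" by (rule AE_not_in[OF N(2)])
  from lborel_pair.AE_pair[OF this] have 1: "AE x in lborel. AE \<xi> in lborel. (x, \<xi>) \<notin> N" .
  have "{p \<in> space (lborel \<Otimes>\<^sub>M lborel). (fst p, snd p) \<notin> N} \<in> sets (lborel \<Otimes>\<^sub>M lborel)"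
    using sets.compl_sets[OF null_setsD2[OF N(2)]] by (simp add: set_diff_eq)
  from lborel_pair.AE_commute[OF this] 1 have 2: "AE \<xi> in lborel. AE x in lborel. (x, \<xi>) \<notin> N" by blast
  show thesis
  proof (rule that[of "\<lambda>x \<xi>. h (x, \<xi>)"])
    show "(\<lambda>p. h (fst p, snd p)) \<in> borel_measurable (borel \<Otimes>\<^sub>M borel)" using h by (simp add: borel_prod)
    show "AE x in lborel. AE \<xi> in lborel. \<xi> \<in> S \<longrightarrow> f x \<xi> = h (x, \<xi>)"
      by (rule eventually_mono[OF 1]) (auto elim!: eventually_mono intro: N')
    show "AE \<xi> in lborel. AE x in lborel. \<xi> \<in> S \<longrightarrow> f x \<xi> = h (x, \<xi>)"
      by (rule eventually_mono[OF 2]) (auto elim!: eventually_mono intro: N')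
  qed
qed

section \<open>From the seminorms to bounds on Fourier transforms\<close>

lemma l2_norm_sq:
  assumes "F \<in> borel_measurable borel"
  shows "(l2_norm F)\<^sup>2 = (\<integral>\<^sup>+\<xi>. ennreal ((norm (F \<xi>))\<^sup>2) \<partial>lborel)"
proof -
  have "(\<integral>\<^sup>+\<xi>. ennreal ((norm (F \<xi>))\<^sup>2) \<partial>lebesgue) = (\<integral>\<^sup>+\<xi>. ennreal ((norm (F \<xi>))\<^sup>2) \<partial>lborel)"
    using assms by (simp add: nn_integral_completion)
  moreover have "(ennreal (sqrt (enn2real I)))\<^sup>2 = I" if "I \<noteq> \<infinity>" for I :: ennreal
    using that by (simp add: ennreal_power less_top)
  ultimately show ?thesis by (simp add: l2_norm_def Let_def power2_eq_square ennreal_top_mult)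
qed

lemma l2_norm_weight_sq:
  assumes [measurable]: "g \<in> borel_measurable borel"
  shows "(l2_norm (\<lambda>\<xi>. of_real (japanese \<xi> powr s) * g \<xi>))\<^sup>2 = weighted_sq s g"
  by (subst l2_norm_sq, measurable) (simp add: norm_mult ennreal_power)

lemma sobolev_bound_fourier:
  fixes f :: "real^'n \<Rightarrow> complex"
  assumes le: "sobolev_norm s f \<le> ennreal c" and c: "0 \<le> c" and h: "has_fourier f g" and g: "g \<in> borel_measurable borel"
  shows "weighted_sq s g \<le> ennreal (((2 * pi) powr (real CARD('n) / 2) * c)\<^sup>2)"
proof -
  let ?l = "l2_norm (\<lambda>\<xi>. of_real (japanese \<xi> powr s) * g \<xi>)" and ?p = "(2 * pi) powr (real CARD('n) / 2)"
  have "ennreal ?p * (ennreal ((2 * pi) powr (- real CARD('n) / 2)) * ?l) \<le> ennreal ?p * ennreal c"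
    using le unfolding sobolev_norm_eq[OF h] by (rule mult_left_mono) simp
  also have "ennreal ?p * (ennreal ((2 * pi) powr (- real CARD('n) / 2)) * ?l) = ?l"
    unfolding mult.assoc[symmetric] by (subst ennreal_mult[symmetric]) (auto simp: powr_add[symmetric])
  also have "ennreal ?p * ennreal c = ennreal (?p * c)" using c by (simp add: ennreal_mult)
  finally have "?l\<^sup>2 \<le> (ennreal (?p * c))\<^sup>2" by (rule power_mono) simp
  then show ?thesis unfolding l2_norm_weight_sq[OF g] using c by (simp add: ennreal_power)
qed

text \<open>A finite norm excludes an infimum over the empty set, so a transform exists; the order
  above d/2 makes it integrable by Cauchy-Schwarz.\<close>

lemma sobolev_finite_has_fourier:
  fixes f :: "real^'n \<Rightarrow> complex"
  assumes le: "sobolev_norm s f \<le> ennreal c" and c: "0 \<le> c" and s: "real CARD('n) / 2 < s"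
  shows "\<exists>g. g \<in> borel_measurable borel \<and> integrable lborel g \<and> has_fourier f g"
proof -
  have "{g. has_fourier f g} \<noteq> {}"
  proof
    assume "{g. has_fourier f g} = {}"
    then have "sobolev_norm s f = top" unfolding sobolev_norm_def by (simp only: image_empty Inf_empty)
    then show False using le by (simp add: top_unique)
  qed
  then obtain g0 where g0: "has_fourier f g0" by blast
  then have fm: "f \<in> borel_measurable lebesgue" and "g0 \<in> borel_measurable lebesgue" by (auto simp: has_fourier_def)
  then obtain g where g [measurable]: "g \<in> borel_measurable borel" and ae: "AE x in lborel. g0 x = g x"
    using ex_borel_representative by blast
  have h: "has_fourier f g"
    by (rule has_fourier_cong_AE[OF g0 fm borel_imp_lebesgue[OF g] _ ae]) simp
  have "(\<integral>\<^sup>+\<xi>. ennreal (japanese \<xi> powr 0 * norm (g \<xi>)) \<partial>lborel)\<^sup>2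
    \<le> (\<integral>\<^sup>+\<xi>. ennreal (japanese (\<xi>::real^'n) powr (- (2 * s))) \<partial>lborel) * weighted_sq (0 + s) g"
    by (rule weight_CS[OF g])
  also have "\<dots> < \<infinity>"
    using nn_integral_japanese_weight[OF s] sobolev_bound_fourier[OF le c h g]
    by (auto simp: ennreal_mult_less_top intro: le_less_trans)
  finally have "(\<integral>\<^sup>+\<xi>. ennreal (norm (g \<xi>)) \<partial>lborel) < \<infinity>"
    by (cases "\<integral>\<^sup>+\<xi>. ennreal (norm (g \<xi>)) \<partial>lborel") (auto simp: power2_eq_square ennreal_top_mult)
  then have "integrable lborel g" by (intro integrableI_bounded) auto
  then show ?thesis using h g by blast
qed

lemma sobolev_norm_cong_AE:
  assumes "AE x in lborel. f x = f' x" "f \<in> borel_measurable lebesgue" "f' \<in> borel_measurable lebesgue"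
  shows "sobolev_norm s f = sobolev_norm s f'"
proof -
  have "has_fourier f g \<longleftrightarrow> has_fourier f' g" for g
  proof
    assume h: "has_fourier f g"
    then show "has_fourier f' g" using assms by (intro has_fourier_cong_AE[OF h]) (auto simp: has_fourier_def)
  next
    assume h: "has_fourier f' g"
    have "AE x in lborel. f' x = f x" using assms(1) by eventually_elim simp
    then show "has_fourier f g" using assms h by (intro has_fourier_cong_AE[OF h]) (auto simp: has_fourier_def)
  qed
  then show ?thesis by (simp add: sobolev_norm_def)
qed

lemma l2_norm_zero: "l2_norm (\<lambda>_. 0) = 0"
  by (simp add: l2_norm_def)

lemma sobolev_norm_zero: "sobolev_norm s (\<lambda>_. 0) = 0"
  by (subst sobolev_norm_eq[OF has_fourier_zero]) (simp add: l2_norm_zero)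

lemma mi_order_indicator: "mi_order (\<lambda>i. if i \<in> A then 1 else 0) = card A"
  by (simp add: mi_order_def sum.If_cases)

text \<open>The multi-index is the indicator of A, of order |A| \<le> d \<le> k, so it takes part in
  the supremum.\<close>

lemma N_seminorm_bound:
  fixes \<sigma> :: "real^'n \<Rightarrow> real^'n \<Rightarrow> complex"
  assumes N: "N_seminorm m k \<tau> \<sigma> \<le> ennreal c" and c: "0 \<le> c" and k: "CARD('n) \<le> k" and \<xi>: "\<xi> \<in> high_freq"
  shows "sobolev_norm \<tau> (\<lambda>x. mixed high_freq A (\<sigma> x) \<xi>) \<le> ennreal (c * japanese \<xi> powr (m - real (card A)))"
proof -
  let ?s = "sobolev_norm \<tau> (\<lambda>x. mixed high_freq A (\<sigma> x) \<xi>)"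
  have "card A \<le> k" using k card_mono[of UNIV A] by auto
  then have "ennreal (japanese \<xi> powr (real (card A) - m)) * ?s \<le> N_seminorm m k \<tau> \<sigma>"
    unfolding N_seminorm_def mixed_def mi_order_indicator[symmetric]
    by (intro SUP_upper2[of "\<lambda>i. if i \<in> A then 1 else 0"] SUP_upper \<xi>) simp_all
  then have "ennreal (japanese \<xi> powr (m - real (card A))) * (ennreal (japanese \<xi> powr (real (card A) - m)) * ?s) \<le> ennreal (japanese \<xi> powr (m - real (card A))) * ennreal c"
    by (intro mult_left_mono order.trans[OF _ N]) auto
  moreover have "ennreal (japanese \<xi> powr (m - real (card A))) * (ennreal (japanese \<xi> powr (real (card A) - m)) * ?s) = ?s"
    unfolding mult.assoc[symmetric] by (subst ennreal_mult[symmetric]) (auto simp: powr_add[symmetric])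
  ultimately show ?thesis using c by (simp add: ennreal_mult[symmetric] mult.commute)
qed

lemma M_seminorm_bound:
  fixes \<sigma> :: "real^'n \<Rightarrow> real^'n \<Rightarrow> complex"
  assumes M: "M_seminorm m CARD('n) \<sigma> \<le> ennreal c" and c: "0 \<le> c" and \<xi>: "\<xi> \<in> high_freq"
  shows "AE x in lborel. norm (mixed high_freq A (\<sigma> x) \<xi>) \<le> c * japanese \<xi> powr (m - real (card A))"
proof -
  let ?s = "linf_norm (\<lambda>x. mixed high_freq A (\<sigma> x) \<xi>)"
  have "card A \<le> CARD('n)" using card_mono[of UNIV A] by auto
  then have "ennreal (japanese \<xi> powr (real (card A) - m)) * ?s \<le> M_seminorm m CARD('n) \<sigma>"
    unfolding M_seminorm_def mixed_def mi_order_indicator[symmetric]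
    by (intro SUP_upper2[of "\<lambda>i. if i \<in> A then 1 else 0"] SUP_upper \<xi>) simp_all
  then have "ennreal (japanese \<xi> powr (m - real (card A))) * (ennreal (japanese \<xi> powr (real (card A) - m)) * ?s) \<le> ennreal (japanese \<xi> powr (m - real (card A))) * ennreal c"
    by (intro mult_left_mono order.trans[OF _ M]) auto
  moreover have "ennreal (japanese \<xi> powr (m - real (card A))) * (ennreal (japanese \<xi> powr (real (card A) - m)) * ?s) = ?s"
    unfolding mult.assoc[symmetric] by (subst ennreal_mult[symmetric]) (auto simp: powr_add[symmetric])
  ultimately have s: "?s \<le> ennreal (c * japanese \<xi> powr (m - real (card A)))" using c by (simp add: ennreal_mult[symmetric] mult.commute)
  have "AE x in lborel. ennreal (norm (mixed high_freq A (\<sigma> x) \<xi>)) \<le> ?s"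
    unfolding linf_norm_def AE_lebesgue_iff[symmetric] by (rule esssup_AE)
  then show ?thesis
  proof eventually_elim
    case (elim x)
    from order.trans[OF this s] show ?case using c by (simp add: ennreal_le_iff)
  qed
qed

text \<open>An open region containing all cubes, in which derivatives within
  \<open>high_freq\<close> are ordinary derivatives; 1/2 is an arbitrary value between 1/4 and
  1.\<close>

lemma high_freq_interior: "{\<xi>::real^'n. 1/2 < norm \<xi>} \<subseteq> interior high_freq" "open {\<xi>::real^'n. 1/2 < norm \<xi>}"
proof -
  show o: "open {\<xi>::real^'n. 1/2 < norm \<xi>}" by (intro open_Collect_less continuous_intros)
  show "{\<xi>::real^'n. 1/2 < norm \<xi>} \<subseteq> interior high_freq" by (rule interior_maximal[OF _ o]) (auto simp: high_freq_def)
qed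

text \<open>T is a Borel version of the mixed derivatives that is set to zero for x in a null set
  common to all A and all frequencies. In this way the reproducing formula survives for every x, and
  a transform exists for every frequency.\<close>

lemma symbol_high_representation:
  fixes \<sigma> :: "real^'n \<Rightarrow> real^'n \<Rightarrow> complex"
  assumes sm: "\<And>x. smooth_on high_freq (\<sigma> x)"
    and \<tau>: "real CARD('n) / 2 < \<tau>"
    and N: "N_seminorm m k \<tau> \<sigma> \<le> ennreal c" and c: "0 \<le> c" and k: "CARD('n) \<le> k"
  obtains GA T :: "'n set \<Rightarrow> real^'n \<Rightarrow> real^'n \<Rightarrow> complex" where
    "\<And>A. (\<lambda>p. GA A (fst p) (snd p)) \<in> borel_measurable (borel \<Otimes>\<^sub>M borel)"
    "\<And>A. (\<lambda>p. T A (fst p) (snd p)) \<in> borel_measurable (borel \<Otimes>\<^sub>M borel)"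
    "\<And>A z. has_fourier (\<lambda>x. T A x z) (\<lambda>\<eta>. GA A \<eta> z)"
    "\<And>A z. integrable lborel (\<lambda>\<eta>. GA A \<eta> z)"
    "\<And>A z. 1 \<le> norm z \<Longrightarrow> (weighted_sq \<tau> (\<lambda>\<eta>. GA A \<eta> z))
      \<le> ennreal (((2 * pi) powr (real CARD('n) / 2) * (c * japanese z powr (m - real (card A))))\<^sup>2)"
    "AE x in lborel. \<forall>A z. 1 \<le> norm z \<longrightarrow> T A x z = mixed high_freq A (\<sigma> x) z"
    "\<And>x \<xi> k. \<xi> \<in> shell k \<Longrightarrow> T {} x \<xi> = (\<Sum>A\<in>UNIV. \<integral>y. cube_kernel (2 ^ k) A \<xi> y *\<^sub>R T A x (vec_of y) \<partial>parM)"
proof -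
  let ?F = "\<lambda>A x. mixed high_freq A (\<sigma> x)"
  define V :: "(real^'n) set" where "V = {\<xi>. 1/2 < norm \<xi>}"
  have V: "V \<subseteq> interior high_freq" "open V" unfolding V_def by (rule high_freq_interior)+
  then have Vh: "V \<subseteq> high_freq" using interior_subset by blast
  have cont: "continuous_on V (?F A x)" for A x
    unfolding mixed_eq by (rule continuous_on_subset[OF smooth_on_continuous_interior[OF sm] V(1)])
  have sob: "sobolev_norm \<tau> (\<lambda>x. ?F A x \<xi>) \<le> ennreal (c * japanese \<xi> powr (m - real (card A)))" if "\<xi> \<in> V" for A \<xi>
    by (rule N_seminorm_bound[OF N c k]) (use that Vh in blast)
  have cJ: "0 \<le> c * japanese \<xi> powr (m - real (card A))" for A :: "'n set" and \<xi> :: "real^'n" using c by simp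
  have Fg: "\<exists>g. g \<in> borel_measurable borel \<and> integrable lborel g \<and> has_fourier (\<lambda>x. ?F A x \<xi>) g" if "\<xi> \<in> V" for A \<xi>
    by (rule sobolev_finite_has_fourier[OF sob[OF that] cJ \<tau>])
  then have Fm: "(\<lambda>x. ?F A x \<xi>) \<in> borel_measurable lebesgue" if "\<xi> \<in> V" for A \<xi>
    using that unfolding has_fourier_def by blast
  \<comment> \<open>The null set of x depends on A; the predicate allows one to be selected for each
    A by \<open>SOME\<close>.\<close>
  define J where "J Z A \<longleftrightarrow> Z \<in> null_sets lborel \<and> (\<lambda>p. if fst p \<notin> Z \<and> snd p \<in> V then ?F A (fst p) (snd p) else 0) \<in> borel_measurable (borel \<Otimes>\<^sub>M borel)" for Z A
  have "\<exists>Z. J Z A" for A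
    unfolding J_def Bex_def[symmetric] by (rule measurable_continuous_section[OF V(2) cont Fm])
  then have J: "J (SOME Z. J Z A) A" for A by (rule someI_ex)
  define Z where "Z A = (SOME Z. J Z A)" for A
  have Z: "Z A \<in> null_sets lborel"
    and Zm [measurable]: "(\<lambda>p. if fst p \<notin> Z A \<and> snd p \<in> V then ?F A (fst p) (snd p) else 0) \<in> borel_measurable (borel \<Otimes>\<^sub>M borel)" for A
    using J[of A] unfolding J_def Z_def by (rule conjunct1, rule conjunct2)
  define Y where "Y = (\<Union>A. Z A)"
  have Y: "Y \<in> null_sets lborel" unfolding Y_def by (rule null_sets_UN') (auto simp: Z countable_finite)
  have [measurable]: "Y \<in> sets borel" using Y by auto
  \<comment> \<open>The value zero outside V makes the Sobolev bound hold for every \<xi>, which the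
    construction of a joint transform requires.\<close>
  define T where "T A x \<xi> = (if x \<notin> Y \<and> \<xi> \<in> V then ?F A x \<xi> else 0)" for A x \<xi>
  have Tm [measurable]: "(\<lambda>p. T A (fst p) (snd p)) \<in> borel_measurable (borel \<Otimes>\<^sub>M borel)" for A
  proof -
    have "(\<lambda>p. T A (fst p) (snd p)) = (\<lambda>p. if fst p \<notin> Y then (if fst p \<notin> Z A \<and> snd p \<in> V then ?F A (fst p) (snd p) else 0) else 0)"
      by (auto simp: T_def Y_def fun_eq_iff)
    then show ?thesis by simp
  qed
  have Ts [measurable]: "(\<lambda>x. T A x \<xi>) \<in> borel_measurable borel" for A \<xi>
    using measurable_compose[OF measurable_Pair2'[of \<xi> borel borel] Tm] by simp
  have AEY: "AE x in lborel. x \<notin> Y" by (rule AE_not_in[OF Y])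
  have TF: "AE x in lborel. ?F A x \<xi> = T A x \<xi>" if "\<xi> \<in> V" for A \<xi>
    using AEY by eventually_elim (use that in \<open>simp add: T_def\<close>)
  have Tsob: "sobolev_norm \<tau> (\<lambda>x. T A x \<xi>) \<le> ennreal (c * japanese \<xi> powr (m - real (card A)))" for A \<xi>
  proof (cases "\<xi> \<in> V")
    case True
    show ?thesis using sob[OF True] unfolding sobolev_norm_cong_AE[OF TF[OF True] Fm[OF True] borel_imp_lebesgue[OF Ts]] .
  next
    case False
    then show ?thesis by (simp add: T_def sobolev_norm_zero)
  qed
  have "\<exists>G. (\<lambda>p. G (fst p) (snd p)) \<in> borel_measurable (borel \<Otimes>\<^sub>M borel) \<and> (\<forall>\<xi>. integrable lborel (\<lambda>\<eta>. G \<eta> \<xi>) \<and> has_fourier (\<lambda>x. T A x \<xi>) (\<lambda>\<eta>. G \<eta> \<xi>))" for A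
  proof -
    have m: "(\<lambda>(x, y). T A x y) \<in> borel_measurable (borel \<Otimes>\<^sub>M borel)" using Tm unfolding case_prod_beta .
    obtain G where "(\<lambda>(\<eta>, y). G \<eta> y) \<in> borel_measurable (borel \<Otimes>\<^sub>M borel)"
      "\<And>\<xi>. integrable lborel (\<lambda>\<eta>. G \<eta> \<xi>)" "\<And>\<xi>. has_fourier (\<lambda>x. T A x \<xi>) (\<lambda>\<eta>. G \<eta> \<xi>)"
      by (rule joint_fourier_transform[OF m sobolev_finite_has_fourier[OF Tsob cJ \<tau>]], rule that) simp_all
    then show ?thesis unfolding case_prod_beta by (intro exI[of _ G]) simp
  qed
  then have "\<forall>A. \<exists>G. (\<lambda>p. G (fst p) (snd p)) \<in> borel_measurable (borel \<Otimes>\<^sub>M borel) \<and> (\<forall>\<xi>. integrable lborel (\<lambda>\<eta>. G \<eta> \<xi>) \<and> has_fourier (\<lambda>x. T A x \<xi>) (\<lambda>\<eta>. G \<eta> \<xi>))" ..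
  from choice[OF this] obtain GA where "\<forall>A. (\<lambda>p. GA A (fst p) (snd p)) \<in> borel_measurable (borel \<Otimes>\<^sub>M borel) \<and>
    (\<forall>\<xi>. integrable lborel (\<lambda>\<eta>. GA A \<eta> \<xi>) \<and> has_fourier (\<lambda>x. T A x \<xi>) (\<lambda>\<eta>. GA A \<eta> \<xi>))" ..
  then have GA: "\<And>A. (\<lambda>p. GA A (fst p) (snd p)) \<in> borel_measurable (borel \<Otimes>\<^sub>M borel)"
    "\<And>A \<xi>. integrable lborel (\<lambda>\<eta>. GA A \<eta> \<xi>)" "\<And>A \<xi>. has_fourier (\<lambda>x. T A x \<xi>) (\<lambda>\<eta>. GA A \<eta> \<xi>)"
    by simp_all
  show thesis
  proof (rule that[OF GA(1) Tm GA(3) GA(2)])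
    fix A :: "'n set" and z :: "real^'n"
    show "weighted_sq \<tau> (\<lambda>\<eta>. GA A \<eta> z)
      \<le> ennreal (((2 * pi) powr (real CARD('n) / 2) * (c * japanese z powr (m - real (card A))))\<^sup>2)"
      by (rule sobolev_bound_fourier[OF Tsob cJ GA(3)]) (use GA(2) in auto)
  next
    show "AE x in lborel. \<forall>A z. 1 \<le> norm z \<longrightarrow> T A x z = mixed high_freq A (\<sigma> x) z"
      using AEY by eventually_elim (simp add: T_def V_def)
  next
    fix x \<xi> :: "real^'n" and k :: nat assume sh: "\<xi> \<in> shell k"
    show "T {} x \<xi> = (\<Sum>A\<in>UNIV. \<integral>y. cube_kernel (2 ^ k) A \<xi> y *\<^sub>R T A x (vec_of y) \<partial>parM)"
    proof (cases "x \<in> Y")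
      case True
      then show ?thesis by (simp add: T_def)
    next
      case False
      have n1: "1 \<le> norm \<xi>" by (rule shell_norm_ge_1[OF sh])
      have "?F {} x \<xi> = (\<Sum>A\<in>UNIV. \<integral>y. cube_kernel (2 ^ k) A \<xi> y *\<^sub>R ?F A x (vec_of y) \<partial>parM)"
      proof (rule cube_reproduce[where U=V])
        show "cubeset (2 ^ k) \<xi> \<subseteq> V"
          using cubeset_norm_ge[of "2 ^ k" _ \<xi>] n1 by (fastforce simp: V_def)
        show "?F A x differentiable (at z)" if "z \<in> V" for A z
          unfolding mixed_eq using that V(1) by (intro smooth_on_differentiable_at[OF sm]) auto
        show "frechet_derivative (?F A x) (at z) (axis i 1) = ?F (insert i A) x z" if "z \<in> V" "i \<notin> A" for A i z
          using that V(1) by (intro mixed_derivative[OF sm]) auto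
      qed simp
      moreover have "cube_kernel (2 ^ k) A \<xi> y *\<^sub>R ?F A x (vec_of y) = cube_kernel (2 ^ k) A \<xi> y *\<^sub>R T A x (vec_of y)" for A y
      proof (cases "cube_kernel (2 ^ k) A \<xi> y = 0")
        case False
        from parset_norm(3)[OF cube_kernel_nonzero_parset[OF sh this]] show ?thesis using \<open>x \<notin> Y\<close> by (simp add: T_def V_def)
      qed simp
      ultimately show ?thesis using False n1 by (simp add: T_def V_def)
    qed
  qed
qed

text \<open>At low frequencies the symbol is controlled only up to null sets of \<xi>. R is a Borel
  version that vanishes at the exceptional frequencies, where the Sobolev bound or the agreement
  with \<sigma> may fail; then a transform exists for every \<xi>.\<close>

lemma symbol_low_representation:
  fixes \<sigma> :: "real^'n \<Rightarrow> real^'n \<Rightarrow> complex"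
  assumes m: "(\<lambda>(x, \<xi>). \<sigma> x \<xi>) \<in> borel_measurable (lebesgue_on (UNIV \<times> low_freq))"
    and \<tau>: "real CARD('n) / 2 < \<tau>"
    and n: "n_seminorm 0 \<tau> \<sigma> \<le> ennreal c" and c: "0 \<le> c"
  obtains GL R :: "real^'n \<Rightarrow> real^'n \<Rightarrow> complex" where
    "(\<lambda>p. GL (fst p) (snd p)) \<in> borel_measurable (borel \<Otimes>\<^sub>M borel)"
    "(\<lambda>p. R (fst p) (snd p)) \<in> borel_measurable (borel \<Otimes>\<^sub>M borel)"
    "\<And>\<xi>. has_fourier (\<lambda>x. R x \<xi>) (\<lambda>\<eta>. GL \<eta> \<xi>)"
    "\<And>\<xi>. (weighted_sq \<tau> (\<lambda>\<eta>. GL \<eta> \<xi>)) \<le> ennreal (((2 * pi) powr (real CARD('n) / 2) * c)\<^sup>2)"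
    "AE x in lborel. AE \<xi> in lborel. norm \<xi> < 1 \<longrightarrow> R x \<xi> = \<sigma> x \<xi>"
proof -
  obtain h where h [measurable]: "(\<lambda>p. h (fst p) (snd p)) \<in> borel_measurable (borel \<Otimes>\<^sub>M borel)"
    and h1: "AE x in lborel. AE \<xi> in lborel. \<xi> \<in> low_freq \<longrightarrow> \<sigma> x \<xi> = h x \<xi>"
    and h2: "AE \<xi> in lborel. AE x in lborel. \<xi> \<in> low_freq \<longrightarrow> \<sigma> x \<xi> = h x \<xi>"
    by (rule joint_representative[OF m]) auto
  have hs [measurable]: "(\<lambda>x. h x \<xi>) \<in> borel_measurable borel" for \<xi>
    using measurable_compose[OF measurable_Pair2'[of \<xi> borel borel] h] by simp
  have "esssup (lebesgue_on low_freq) (\<lambda>\<xi>. sobolev_norm \<tau> (\<lambda>x. multi_deriv low_freq (\<lambda>_. 0) (\<sigma> x) \<xi>)) \<le> n_seminorm 0 \<tau> \<sigma>"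
    unfolding n_seminorm_def by (rule SUP_upper) (simp add: mi_order_def)
  then have le: "esssup (lebesgue_on low_freq) (\<lambda>\<xi>. sobolev_norm \<tau> (\<lambda>x. \<sigma> x \<xi>)) \<le> ennreal c"
    unfolding multi_deriv_zero using n by (rule order.trans)
  have "AE \<xi> in lebesgue_on low_freq. sobolev_norm \<tau> (\<lambda>x. \<sigma> x \<xi>) \<le> ennreal c"
    using esssup_AE by eventually_elim (rule order.trans[OF _ le])
  then have "AE \<xi> in lborel. \<xi> \<in> low_freq \<longrightarrow> sobolev_norm \<tau> (\<lambda>x. \<sigma> x \<xi>) \<le> ennreal c"
    by (subst (asm) AE_restrict_space_iff) (auto simp: AE_lebesgue_iff)
  with h2 have "AE \<xi> in lborel. \<xi> \<in> low_freq \<longrightarrow> sobolev_norm \<tau> (\<lambda>x. \<sigma> x \<xi>) \<le> ennreal c \<and> (AE x in lborel. \<sigma> x \<xi> = h x \<xi>)"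
    by eventually_elim simp
  then obtain B where B: "\<And>\<xi>. \<xi> \<in> space lborel - B \<Longrightarrow> \<xi> \<in> low_freq \<longrightarrow> sobolev_norm \<tau> (\<lambda>x. \<sigma> x \<xi>) \<le> ennreal c \<and> (AE x in lborel. \<sigma> x \<xi> = h x \<xi>)"
    "B \<in> null_sets lborel" by (rule AE_E3) blast
  have [measurable]: "B \<in> sets borel" using B(2) by auto
  define R where "R x \<xi> = (if norm \<xi> < 1 \<and> \<xi> \<notin> B then h x \<xi> else 0)" for x \<xi>
  have Rm [measurable]: "(\<lambda>p. R (fst p) (snd p)) \<in> borel_measurable (borel \<Otimes>\<^sub>M borel)" unfolding R_def by measurable
  have Rs: "sobolev_norm \<tau> (\<lambda>x. R x \<xi>) \<le> ennreal c" for \<xi>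
  proof (cases "norm \<xi> < 1 \<and> \<xi> \<notin> B")
    case True
    then have 1: "sobolev_norm \<tau> (\<lambda>x. \<sigma> x \<xi>) \<le> ennreal c" "AE x in lborel. \<sigma> x \<xi> = h x \<xi>" using B(1)[of \<xi>] by auto
    have 2: "(\<lambda>x. \<sigma> x \<xi>) \<in> borel_measurable lebesgue" by (rule lebesgue_measurable_cong_AE[OF hs 1(2)])
    show ?thesis using 1(1) True unfolding sobolev_norm_cong_AE[OF 1(2) 2 borel_imp_lebesgue[OF hs]] by (simp add: R_def)
  next
    case False
    then have "(\<lambda>x. R x \<xi>) = (\<lambda>_. 0)" by (auto simp: R_def)
    then show ?thesis by (simp add: sobolev_norm_zero)
  qed
  have m: "(\<lambda>(x, y). R x y) \<in> borel_measurable (borel \<Otimes>\<^sub>M borel)" using Rm unfolding case_prod_beta .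
  obtain GL where GL: "(\<lambda>(\<eta>, y). GL \<eta> y) \<in> borel_measurable (borel \<Otimes>\<^sub>M borel)"
    "\<And>\<xi>. integrable lborel (\<lambda>\<eta>. GL \<eta> \<xi>)" "\<And>\<xi>. has_fourier (\<lambda>x. R x \<xi>) (\<lambda>\<eta>. GL \<eta> \<xi>)"
    by (rule joint_fourier_transform[OF m sobolev_finite_has_fourier[OF Rs c \<tau>]], rule that) simp_all
  have "AE \<xi> in lborel. \<xi> \<notin> B" by (rule AE_not_in[OF B(2)])
  show thesis
  proof (rule that[OF _ Rm GL(3)])
    show "(\<lambda>p. GL (fst p) (snd p)) \<in> borel_measurable (borel \<Otimes>\<^sub>M borel)" using GL(1) unfolding case_prod_beta .
    show "weighted_sq \<tau> (\<lambda>\<eta>. GL \<eta> \<xi>) \<le> ennreal (((2 * pi) powr (real CARD('n) / 2) * c)\<^sup>2)" for \<xi>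
      by (rule sobolev_bound_fourier[OF Rs c GL(3)]) (use GL(2) in auto)
    show "AE x in lborel. AE \<xi> in lborel. norm \<xi> < 1 \<longrightarrow> R x \<xi> = \<sigma> x \<xi>"
      using h1
    proof eventually_elim
      case (elim x)
      then show ?case using \<open>AE \<xi> in lborel. \<xi> \<notin> B\<close> by eventually_elim (simp add: R_def)
    qed
  qed
qed

section \<open>The estimates\<close>

lemma ennreal_sq_le_imp_le:
  fixes x y :: ennreal
  assumes "x\<^sup>2 \<le> y\<^sup>2"
  shows "x \<le> y"
proof (cases y)
  case (real c)
  then show ?thesis using assms ennreal_power2_le_imp_le[of x c] by simp
qed simp

text \<open>Up to a constant the supremum is bounded by the L1 norm of the transform, and
  Cauchy-Schwarz bounds that by the Sobolev norm because \<tau> > d/2.\<close>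

lemma sobolev_embedding:
  fixes f :: "real^'n \<Rightarrow> complex"
  assumes le: "sobolev_norm \<tau> f \<le> ennreal c" and c: "0 \<le> c" and \<tau>: "real CARD('n) / 2 < \<tau>"
  shows "AE x in lborel. norm (f x) \<le> sqrt (weightC \<tau> TYPE('n)) * c"
proof -
  let ?W = "weightC \<tau> TYPE('n)" and ?p = "(2 * pi) powr (real CARD('n) / 2)"
  obtain g where g [measurable]: "g \<in> borel_measurable borel" and gi: "integrable lborel g" and h: "has_fourier f g"
    using sobolev_finite_has_fourier[OF le c \<tau>] by blast
  have fm: "f \<in> borel_measurable lebesgue" using h by (simp add: has_fourier_def)
  obtain f0 where f0: "f0 \<in> borel_measurable borel" and ae: "AE x in lborel. f x = f0 x"
    using ex_borel_representative[OF fm] by blast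
  have h0: "has_fourier f0 g"
    by (rule has_fourier_cong_AE[OF h borel_imp_lebesgue[OF f0] borel_imp_lebesgue[OF g] ae]) simp
  have "(\<integral>\<^sup>+\<xi>. ennreal (japanese \<xi> powr 0 * norm (g \<xi>)) \<partial>lborel)\<^sup>2
    \<le> (\<integral>\<^sup>+\<xi>. ennreal (japanese (\<xi>::real^'n) powr (- (2 * \<tau>))) \<partial>lborel) * weighted_sq (0 + \<tau>) g"
    by (rule weight_CS[OF g])
  also have "\<dots> \<le> ennreal ?W * ennreal ((?p * c)\<^sup>2)"
    unfolding weightC(1)[OF \<tau>] using sobolev_bound_fourier[OF le c h g] by (intro mult_left_mono) auto
  also have "\<dots> = (ennreal (?p * (sqrt ?W * c)))\<^sup>2"
    using weightC(2)[OF \<tau>] c by (simp add: ennreal_mult[symmetric] ennreal_power power_mult_distrib mult_ac)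
  finally have "(\<integral>\<^sup>+\<xi>. ennreal (japanese \<xi> powr 0 * norm (g \<xi>)) \<partial>lborel) \<le> ennreal (?p * (sqrt ?W * c))"
    by (rule ennreal_sq_le_imp_le)
  moreover have "japanese \<xi> powr 0 = 1" for \<xi> :: "real^'n" by simp
  ultimately have L: "(\<integral>\<^sup>+\<xi>. ennreal (norm (g \<xi>)) \<partial>lborel) \<le> ennreal (?p * (sqrt ?W * c))"
    by (simp only: mult_1_left)
  \<comment> \<open>Inversion carries the factor \<open>?p\<close> twice and the Sobolev norm
    carries it once; the surplus factor is at least 1 and is dropped.\<close>
  have "1 \<le> ?p" using pi_ge_two by (intro ge_one_powr_ge_zero) auto
  have pp: "?p * ?p = (2 * pi) ^ CARD('n)" by (simp add: powr_add[symmetric] powr_realpow)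
  from has_fourier_bounded_AE[OF h0 f0 gi] ae show ?thesis
  proof eventually_elim
    case (elim x)
    have "ennreal (?p * ?p * norm (f x)) \<le> ennreal (?p * (sqrt ?W * c))"
      using order.trans[OF elim(1) L] unfolding pp elim(2) by (simp add: ennreal_mult)
    then have "?p * (?p * norm (f x)) \<le> ?p * (sqrt ?W * c)"
      using weightC(2)[OF \<tau>] c by (subst (asm) ennreal_le_iff) (auto simp: mult.assoc)
    then have "?p * norm (f x) \<le> sqrt ?W * c" using \<open>1 \<le> ?p\<close> by (simp add: mult_le_cancel_left)
    moreover have "1 * norm (f x) \<le> ?p * norm (f x)" using \<open>1 \<le> ?p\<close> by (rule mult_right_mono) simp
    ultimately show ?case by simp
  qed
qed

text \<open>From squared estimates of transforms to norms: x^2 + y^2 \<le> (x + y)^2 separates the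
  two terms, and the factor (2 pi)^(-d) of the operator, being at most 1, is discarded.\<close>

lemma sobolev_transfer:
  fixes u F V :: "real^'n \<Rightarrow> complex"
  assumes h: "has_fourier F (\<lambda>\<zeta>. of_real ((2 * pi) powr (- real CARD('n))) * V \<zeta>)" and V [measurable]: "V \<in> borel_measurable borel"
    and u: "u \<in> schwartz" and A: "0 \<le> A" and B: "0 \<le> B"
    and le: "weighted_sq s V
      \<le> ennreal (A\<^sup>2) * weighted_sq p (fourier u)
       + ennreal (B\<^sup>2) * weighted_sq q (fourier u)"
  shows "sobolev_norm s F \<le> ennreal A * sobolev_norm p u + ennreal B * sobolev_norm q u"
proof -
  note [measurable] = schwartz_borel[OF u]
  let ?r = "(2 * pi) powr (- real CARD('n))" and ?c = "ennreal ((2 * pi) powr (- real CARD('n) / 2))"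
  let ?l = "\<lambda>p g. l2_norm (\<lambda>\<xi>. of_real (japanese \<xi> powr p) * g \<xi>)"
  have r: "?r \<le> 1" using pi_ge_two powr_mono[of "- real CARD('n)" 0 "2 * pi"] by simp
  have "(?l s (\<lambda>\<zeta>. of_real ?r * V \<zeta>))\<^sup>2 = weighted_sq s (\<lambda>\<zeta>. complex_of_real ?r * V \<zeta>)"
    by (rule l2_norm_weight_sq) measurable
  also have "\<dots> \<le> weighted_sq s V"
  proof (intro nn_integral_mono power_mono ennreal_leI mult_left_mono)
    fix \<zeta>
    show "norm (complex_of_real ?r * V \<zeta>) \<le> norm (V \<zeta>)"
      using mult_right_mono[OF r, of "norm (V \<zeta>)"] by (simp add: norm_mult)
  qed auto
  also have "\<dots> \<le> ennreal (A\<^sup>2) * (?l p (fourier u))\<^sup>2 + ennreal (B\<^sup>2) * (?l q (fourier u))\<^sup>2"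
    using le by (subst (1 2) l2_norm_weight_sq) measurable
  also have "\<dots> = (ennreal A * ?l p (fourier u))\<^sup>2 + (ennreal B * ?l q (fourier u))\<^sup>2"
    using A B by (simp add: power_mult_distrib ennreal_power)
  also have "\<dots> \<le> (ennreal A * ?l p (fourier u) + ennreal B * ?l q (fourier u))\<^sup>2"
  proof -
    have "x\<^sup>2 + y\<^sup>2 \<le> (x + y)\<^sup>2" for x y :: ennreal
      unfolding power2_eq_square distrib_left distrib_right by (simp add: add.assoc add_left_mono add_increasing)
    then show ?thesis .
  qed
  finally have X: "?l s (\<lambda>\<zeta>. of_real ?r * V \<zeta>) \<le> ennreal A * ?l p (fourier u) + ennreal B * ?l q (fourier u)"
    by (rule ennreal_sq_le_imp_le)
  have "sobolev_norm s F \<le> ?c * (ennreal A * ?l p (fourier u) + ennreal B * ?l q (fourier u))"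
    unfolding sobolev_norm_eq[OF h] by (rule mult_left_mono[OF X]) simp
  also have "\<dots> = ennreal A * sobolev_norm p u + ennreal B * sobolev_norm q u"
    unfolding sobolev_norm_eq[OF has_fourier_schwartz[OF u]] by (simp only: distrib_left mult_ac)
  finally show ?thesis .
qed

text \<open>In the extended reals infinity times zero is zero, so the final bounds also assert
  something when a seminorm is infinite and a norm of u vanishes. In that case the transform of u
  vanishes almost everywhere.\<close>

lemma sobolev_norm_zero_imp:
  fixes u :: "real^'n \<Rightarrow> complex"
  assumes u: "u \<in> schwartz" and z: "sobolev_norm p u = 0"
  shows "sobolev_norm s (Op \<sigma> u) = 0"
proof -
  note [measurable] = schwartz_borel[OF u]
  have "(2 * pi) powr (- real CARD('n) / 2) \<noteq> 0" by simp
  then have "l2_norm (\<lambda>\<xi>. of_real (japanese \<xi> powr p) * fourier u \<xi>) = 0"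
    using z unfolding sobolev_norm_eq[OF has_fourier_schwartz[OF u]] by (auto simp: ennreal_eq_0_iff)
  then have "(l2_norm (\<lambda>\<xi>. of_real (japanese \<xi> powr p) * fourier u \<xi>))\<^sup>2 = 0" by simp
  then have "weighted_sq p (fourier u) = 0"
    by (subst (asm) l2_norm_weight_sq) measurable
  then have "AE \<xi> in lborel. (ennreal (japanese \<xi> powr p * norm (fourier u \<xi>)))\<^sup>2 = 0"
    by (subst (asm) nn_integral_0_iff_AE) measurable
  then have "AE \<xi> in lebesgue. fourier u \<xi> = 0"
    unfolding AE_lebesgue_iff by eventually_elim (simp add: ennreal_eq_0_iff mult_le_0_iff)
  then have "AE \<xi> in lebesgue. exp (\<i> * of_real (x \<bullet> \<xi>)) * \<sigma> x \<xi> * fourier u \<xi> = 0" for x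
    by eventually_elim simp
  then have "Op \<sigma> u = (\<lambda>_. 0)" unfolding Op_def by (simp add: integral_eq_zero_AE fun_eq_iff)
  then show ?thesis by (simp add: sobolev_norm_zero)
qed

text \<open>Provides the data of the locale and identifies the transform of
  \<open>Op \<sigma> u\<close>. The supremum bound M is a separate hypothesis on the mixed
  derivatives, because one estimate takes it from \<open>M_seminorm\<close> and the other from
  Sobolev embedding.\<close>

lemma Op_fourier_representation:
  fixes \<sigma> :: "real^'n \<Rightarrow> real^'n \<Rightarrow> complex"
  assumes \<sigma>: "\<sigma> \<in> symbol_class m s0" and \<tau>: "real CARD('n) / 2 < \<tau>"
    and n: "n_seminorm 0 \<tau> \<sigma> \<le> ennreal cn" and cn: "0 \<le> cn"
    and N: "N_seminorm m k \<tau> \<sigma> \<le> ennreal cN" and cN: "0 \<le> cN" and k: "CARD('n) \<le> k"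
    and M: "\<And>A z. 1 \<le> norm z \<Longrightarrow> AE x in lborel. norm (mixed high_freq A (\<sigma> x) z) \<le> cM * japanese z powr (m - real (card A))" and cM: "0 \<le> cM"
    and u: "u \<in> schwartz"
  shows "\<exists>GL GA. fourier_symbol GL GA m \<tau> ((2 * pi) powr (real CARD('n) / 2) * (cn + cN)) ((2 * pi) ^ CARD('n) * cM) \<and>
    has_fourier (Op \<sigma> u) (\<lambda>\<zeta>. of_real ((2 * pi) powr (- real CARD('n))) * fourier_symbol.v GL GA (fourier u) \<zeta>)"
proof -
  let ?p = "(2 * pi) powr (real CARD('n) / 2)"
  note um [measurable] = schwartz_borel[OF u]
  have sm: "smooth_on high_freq (\<sigma> x)" for x using \<sigma> by (auto simp: symbol_class_def)
  have lm: "(\<lambda>(x, \<xi>). \<sigma> x \<xi>) \<in> borel_measurable (lebesgue_on (UNIV \<times> low_freq))" using \<sigma> by (auto simp: symbol_class_def)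
  obtain GA T where GA: "\<And>A. (\<lambda>p. GA A (fst p) (snd p)) \<in> borel_measurable (borel \<Otimes>\<^sub>M borel)"
    and T: "\<And>A. (\<lambda>p. T A (fst p) (snd p)) \<in> borel_measurable (borel \<Otimes>\<^sub>M borel)"
    "\<And>A z. has_fourier (\<lambda>x. T A x z) (\<lambda>\<eta>. GA A \<eta> z)"
    and GAi: "\<And>A z. integrable lborel (\<lambda>\<eta>. GA A \<eta> z)"
    and GAb: "\<And>A z. 1 \<le> norm z \<Longrightarrow> (weighted_sq \<tau> (\<lambda>\<eta>. GA A \<eta> z))
      \<le> ennreal ((?p * (cN * japanese z powr (m - real (card A))))\<^sup>2)"
    and TF: "AE x in lborel. \<forall>A z. 1 \<le> norm z \<longrightarrow> T A x z = mixed high_freq A (\<sigma> x) z"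
    and rep: "\<And>x \<xi> k. \<xi> \<in> shell k \<Longrightarrow> T {} x \<xi> = (\<Sum>A\<in>UNIV. \<integral>y. cube_kernel (2 ^ k) A \<xi> y *\<^sub>R T A x (vec_of y) \<partial>parM)"
    by (rule symbol_high_representation[OF sm \<tau> N cN k], rule that)
  obtain GL R where GL: "(\<lambda>p. GL (fst p) (snd p)) \<in> borel_measurable (borel \<Otimes>\<^sub>M borel)"
    and R: "(\<lambda>p. R (fst p) (snd p)) \<in> borel_measurable (borel \<Otimes>\<^sub>M borel)"
    "\<And>\<xi>. has_fourier (\<lambda>x. R x \<xi>) (\<lambda>\<eta>. GL \<eta> \<xi>)"
    and GLb: "\<And>\<xi>. (weighted_sq \<tau> (\<lambda>\<eta>. GL \<eta> \<xi>)) \<le> ennreal ((?p * cn)\<^sup>2)"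
    and RF: "AE x in lborel. AE \<xi> in lborel. norm \<xi> < 1 \<longrightarrow> R x \<xi> = \<sigma> x \<xi>"
    by (rule symbol_low_representation[OF lm \<tau> n cn], rule that)
  \<comment> \<open>The factor \<open>?p\<close> undoes the normalisation of
    \<open>sobolev_norm\<close>; \<open>(2 * pi) ^ CARD('n)\<close> is the constant of
    \<open>multiplier_L2_bound\<close>.\<close>
  interpret fourier_symbol GL GA m \<tau> "?p * (cn + cN)" "(2 * pi) ^ CARD('n) * cM"
  proof
    show "weighted_sq \<tau> (\<lambda>\<eta>. GL \<eta> \<xi>) \<le> ennreal ((?p * (cn + cN))\<^sup>2)" for \<xi>
      using cn cN by (intro order.trans[OF GLb] ennreal_leI power_mono mult_left_mono) auto
    show "weighted_sq \<tau> (\<lambda>\<eta>. GA A \<eta> z) \<le> ennreal ((?p * (cn + cN) * japanese z powr (m - real (card A)))\<^sup>2)"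
      if "1 \<le> norm z" for A z
      unfolding mult.assoc[of ?p] using cn cN by (intro order.trans[OF GAb[OF that]] ennreal_leI power_mono mult_left_mono mult_right_mono) auto
    show "(\<integral>\<^sup>+\<zeta>. ennreal ((norm (fconv (\<lambda>\<eta>. GA A \<eta> z) w \<zeta>))\<^sup>2) \<partial>lborel)
        \<le> ennreal (((2 * pi) ^ CARD('n) * cM * japanese z powr (m - real (card A)))\<^sup>2) * (\<integral>\<^sup>+\<xi>. ennreal ((norm (w \<xi>))\<^sup>2) \<partial>lborel)"
      if z: "1 \<le> norm z" and w: "integrable lborel w" "\<And>x. norm (w x) \<le> K" for A z w K
      unfolding mult.assoc[of "(2 * pi) ^ CARD('n)"]
    proof (rule multiplier_L2_bound[OF T(2) _ GAi w])
      show "(\<lambda>x. T A x z) \<in> borel_measurable borel"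
        using measurable_compose[OF measurable_Pair2'[of z borel borel] T(1)] by simp
      show "AE x in lborel. norm (T A x z) \<le> cM * japanese z powr (m - real (card A))"
        using M[OF z, of A] TF by eventually_elim (simp add: z)
    qed (use cM in auto)
  qed (use GL GA \<tau> cn cN cM in auto)
  define S where "S x \<xi> = (if norm \<xi> < 1 then R x \<xi> else T {} x \<xi>)" for x \<xi>
  define H where "H x = (\<integral>\<xi>. fourier u \<xi> * (exp (\<i> * of_real (x \<bullet> \<xi>)) * S x \<xi>) \<partial>lborel)" for x
  have H: "has_fourier H (v (fourier u))" and Sm: "(\<lambda>p. S (fst p) (snd p)) \<in> borel_measurable (borel \<Otimes>\<^sub>M borel)"
    unfolding H_def[abs_def] S_def
    by (rule has_fourier_v[OF T rep R fourier_schwartz_rapid[OF u] fourier_measurable[OF um]], assumption)+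
  have Sx [measurable]: "(\<lambda>\<xi>. S x \<xi>) \<in> borel_measurable borel" for x
    using measurable_compose[OF measurable_Pair1'[of x borel borel] Sm] by simp
  \<comment> \<open>Agreement holds for almost every x only, and within the integral for almost
    every \<xi>. The integral absorbs the latter, \<open>has_fourier_cong_AE\<close> the
    former.\<close>
  have ae: "AE x in lborel. of_real ((2 * pi) powr (- real CARD('n))) * H x = Op \<sigma> u x"
    using TF RF
  proof eventually_elim
    case (elim x)
    from elim(2) have eq: "AE \<xi> in lborel. exp (\<i> * of_real (x \<bullet> \<xi>)) * \<sigma> x \<xi> * fourier u \<xi> = fourier u \<xi> * (exp (\<i> * of_real (x \<bullet> \<xi>)) * S x \<xi>)"
    proof eventually_elim
      case (elim \<xi>)
      have "T {} x \<xi> = \<sigma> x \<xi>" if "\<not> norm \<xi> < 1"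
        using \<open>\<forall>A z. 1 \<le> norm z \<longrightarrow> T A x z = mixed high_freq A (\<sigma> x) z\<close> that by (simp add: mixed_empty)
      then show ?case using elim by (simp add: S_def)
    qed
    have m: "(\<lambda>\<xi>. fourier u \<xi> * (exp (\<i> * of_real (x \<bullet> \<xi>)) * S x \<xi>)) \<in> borel_measurable borel" by measurable
    have "(LINT \<xi>|lebesgue. exp (\<i> * of_real (x \<bullet> \<xi>)) * \<sigma> x \<xi> * fourier u \<xi>) = (LINT \<xi>|lebesgue. fourier u \<xi> * (exp (\<i> * of_real (x \<bullet> \<xi>)) * S x \<xi>))"
      by (rule integral_cong_AE[OF lebesgue_measurable_cong_AE[OF m eq] borel_imp_lebesgue[OF m]]) (use eq in \<open>simp add: AE_lebesgue_iff\<close>)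
    also have "\<dots> = H x" unfolding H_def by (rule integral_lebesgue_borel[OF m])
    finally show ?case by (simp add: Op_def)
  qed
  have h: "has_fourier (\<lambda>x. of_real ((2 * pi) powr (- real CARD('n))) * H x) (\<lambda>\<zeta>. of_real ((2 * pi) powr (- real CARD('n))) * v (fourier u) \<zeta>)"
    by (rule has_fourier_cmult[OF H])
  from h have "(\<lambda>x. of_real ((2 * pi) powr (- real CARD('n))) * H x) \<in> borel_measurable lebesgue"
    unfolding has_fourier_def by (rule conjunct1)
  from ex_borel_representative[OF this] obtain f0 where f0: "f0 \<in> borel_measurable borel" "AE x in lborel. of_real ((2 * pi) powr (- real CARD('n))) * H x = f0 x"
    unfolding Bex_def by (elim exE conjE) (rule that)
  \<comment> \<open>Measurability of \<open>Op \<sigma> u\<close> is inherited from H, since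
    Lebesgue measure is complete.\<close>
  have om: "Op \<sigma> u \<in> borel_measurable lebesgue"
  proof (rule lebesgue_measurable_cong_AE[OF f0(1)])
    show "AE x in lborel. Op \<sigma> u x = f0 x" using ae f0(2) by eventually_elim simp
  qed
  have "has_fourier (Op \<sigma> u) (\<lambda>\<zeta>. of_real ((2 * pi) powr (- real CARD('n))) * v (fourier u) \<zeta>)"
    by (rule has_fourier_cong_AE[OF h om conjunct1[OF conjunct2[OF h[unfolded has_fourier_def]]] ae]) simp
  with fourier_symbol_axioms show ?thesis by (intro exI conjI)
qed

text \<open>The constant of the regions treated by absolute values, with \<open>GC\<close> unfolded
  so that it can be named outside the locale, independently of the symbol.\<close>

definition farK :: "real \<Rightarrow> real \<Rightarrow> real \<Rightarrow> real \<Rightarrow> 'n::finite itself \<Rightarrow> real" where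
  "farK m s \<tau> t n = (farC s \<tau> * (2 ^ CARD('n) * blockC m n * 4 powr \<bar>m\<bar>))\<^sup>2 * weightC t n"

text \<open>Chosen so that the constant of \<open>v_bound_low\<close> is at most the square of
  \<open>lowC\<close> times (cn + cN), when b is (2 pi)^d sqrt(W) cN with W =
  \<open>weightC \<tau>\<close>, as Sobolev embedding gives it.\<close>

definition lowC :: "real \<Rightarrow> real \<Rightarrow> real \<Rightarrow> 'n::finite itself \<Rightarrow> real" where
  "lowC m s \<tau> n = sqrt ((4 * farK m s \<tau> \<tau> n + 4 * belowC m s \<tau> n) * (2 * pi) ^ CARD('n)
     + 2 * nearC m s n * ((2 * pi) ^ CARD('n))\<^sup>2 * weightC \<tau> n)"

lemma ennreal_const_top: "0 < C \<Longrightarrow> x \<noteq> 0 \<Longrightarrow> ennreal C * (\<infinity> * x) = \<infinity>"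
  by (simp add: ennreal_top_mult ennreal_mult_top ennreal_eq_0_iff)

lemma powr_half_sq: "((2 * pi) powr (real k / 2))\<^sup>2 = (2 * pi) ^ k"
  by (simp add: power2_eq_square powr_add[symmetric] powr_realpow)

text \<open>Sobolev embedding makes the supremum constant b proportional to cN, so all regions are
  bounded by the same seminorms and the same norm of u.\<close>

lemma low_order_estimate:
  fixes \<sigma> :: "real^'n \<Rightarrow> real^'n \<Rightarrow> complex"
  assumes \<sigma>: "\<sigma> \<in> symbol_class m s0" and \<tau>: "real CARD('n) / 2 < \<tau>" and s: "- \<tau> < s" "s < \<tau>"
    and n: "n_seminorm 0 \<tau> \<sigma> \<le> ennreal cn" and cn: "0 \<le> cn"
    and N: "N_seminorm m k \<tau> \<sigma> \<le> ennreal cN" and cN: "0 \<le> cN" and k: "CARD('n) \<le> k"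
    and u: "u \<in> schwartz"
  shows "sobolev_norm s (Op \<sigma> u) \<le> ennreal (lowC m s \<tau> TYPE('n) * (cn + cN)) * sobolev_norm (s + m) u"
proof -
  let ?W = "weightC \<tau> TYPE('n)" and ?K = "farK m s \<tau> \<tau> TYPE('n)" and ?B = "belowC m s \<tau> TYPE('n)" and ?N = "nearC m s TYPE('n)"
  let ?C = "lowC m s \<tau> TYPE('n)"
  have W: "0 \<le> ?W" by (rule weightC(2)[OF \<tau>])
  have "real CARD('n) / 2 < belowr s \<tau> TYPE('n)" using s \<tau> by (auto simp: belowr_def)
  from weightC(2)[OF this] W have nn: "0 \<le> ?K" "0 \<le> ?B" "0 \<le> ?N" by (auto simp: farK_def belowC_def nearC_def)
  have M: "AE x in lborel. norm (mixed high_freq A (\<sigma> x) z) \<le> (sqrt ?W * cN) * japanese z powr (m - real (card A))" if "1 \<le> norm z" for A z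
    unfolding mult.assoc using that cN
    by (intro sobolev_embedding[OF N_seminorm_bound[OF N cN k] _ \<tau>]) (auto simp: high_freq_def)
  obtain GL GA where fs: "fourier_symbol GL GA m \<tau> ((2 * pi) powr (real CARD('n) / 2) * (cn + cN)) ((2 * pi) ^ CARD('n) * (sqrt ?W * cN))"
    and h: "has_fourier (Op \<sigma> u) (\<lambda>\<zeta>. of_real ((2 * pi) powr (- real CARD('n))) * fourier_symbol.v GL GA (fourier u) \<zeta>)"
    using Op_fourier_representation[OF \<sigma> \<tau> n cn N cN k M _ u] W cN by auto
  interpret fourier_symbol GL GA m \<tau> "(2 * pi) powr (real CARD('n) / 2) * (cn + cN)" "(2 * pi) ^ CARD('n) * (sqrt ?W * cN)" by (rule fs)
  have um: "fourier u \<in> borel_measurable borel" by (rule fourier_measurable[OF schwartz_borel[OF u]])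
  have "4 * ?K * ((2 * pi) powr (real CARD('n) / 2) * (cn + cN))\<^sup>2 + 4 * ?B * ((2 * pi) powr (real CARD('n) / 2) * (cn + cN))\<^sup>2 + 2 * ?N * ((2 * pi) ^ CARD('n) * (sqrt ?W * cN))\<^sup>2
    = ((4 * ?K + 4 * ?B) * (2 * pi) ^ CARD('n)) * (cn + cN)\<^sup>2 + (2 * ?N * ((2 * pi) ^ CARD('n))\<^sup>2 * ?W) * cN\<^sup>2"
    using W unfolding power_mult_distrib[of _ "cn + cN"] power_mult_distrib[of "(2 * pi) ^ CARD('n)"] power_mult_distrib[of "sqrt ?W"] powr_half_sq
    by (simp add: distrib_right mult.assoc)
  also have "\<dots> \<le> ((4 * ?K + 4 * ?B) * (2 * pi) ^ CARD('n)) * (cn + cN)\<^sup>2 + (2 * ?N * ((2 * pi) ^ CARD('n))\<^sup>2 * ?W) * (cn + cN)\<^sup>2"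
    using nn W cn cN by (intro add_left_mono mult_left_mono power_mono) auto
  also have "\<dots> = (?C * (cn + cN))\<^sup>2"
    using nn W unfolding lowC_def power_mult_distrib by (subst real_sqrt_pow2) (auto simp: distrib_right)
  finally have le: "4 * ?K * ((2 * pi) powr (real CARD('n) / 2) * (cn + cN))\<^sup>2 + 4 * ?B * ((2 * pi) powr (real CARD('n) / 2) * (cn + cN))\<^sup>2 + 2 * ?N * ((2 * pi) ^ CARD('n) * (sqrt ?W * cN))\<^sup>2 \<le> (?C * (cn + cN))\<^sup>2" .
  have C0: "0 \<le> ?C" unfolding lowC_def using nn W by simp
  have "weighted_sq s (v (fourier u))
    \<le> ennreal ((?C * (cn + cN))\<^sup>2) * weighted_sq (s + m) (fourier u)"
    by (rule order.trans[OF v_bound_low[unfolded GC_def, folded farK_def, OF s fourier_schwartz_rapid[OF u] um] mult_right_mono[OF ennreal_leI[OF le]]]) simp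
  then have "sobolev_norm s (Op \<sigma> u) \<le> ennreal (?C * (cn + cN)) * sobolev_norm (s + m) u + ennreal 0 * sobolev_norm s u"
    using C0 cn cN by (intro sobolev_transfer[OF h v_measurable[OF um] u]) auto
  then show ?thesis by simp
qed

text \<open>The Sobolev order of the symbol is taken equal to the order s of the output; t is any
  number above d/2 and becomes \<open>t0\<close> in the theorem.\<close>

lemma high_order_estimate:
  fixes \<sigma> :: "real^'n \<Rightarrow> real^'n \<Rightarrow> complex"
  assumes \<sigma>: "\<sigma> \<in> symbol_class m s0" and s: "real CARD('n) / 2 < s" and t: "real CARD('n) / 2 < t"
    and n: "n_seminorm 0 s \<sigma> \<le> ennreal cn" and cn: "0 \<le> cn"
    and N: "N_seminorm m k s \<sigma> \<le> ennreal cN" and cN: "0 \<le> cN" and k: "CARD('n) \<le> k"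
    and M: "M_seminorm m CARD('n) \<sigma> \<le> ennreal cM" and cM: "0 \<le> cM"
    and u: "u \<in> schwartz"
  shows "sobolev_norm s (Op \<sigma> u) \<le> ennreal (sqrt (8 * farK m s s t TYPE('n) * (2 * pi) ^ CARD('n)) * (cn + cN)) * sobolev_norm (m + t) u
    + ennreal (sqrt (2 * nearC m s TYPE('n)) * (2 * pi) ^ CARD('n) * cM) * sobolev_norm (s + m) u"
proof -
  let ?K = "farK m s s t TYPE('n)" and ?N = "nearC m s TYPE('n)"
  have nn: "0 \<le> ?K" "0 \<le> ?N" using weightC(2)[OF t] by (auto simp: farK_def nearC_def)
  have M': "AE x in lborel. norm (mixed high_freq A (\<sigma> x) z) \<le> cM * japanese z powr (m - real (card A))" if "1 \<le> norm z" for A z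
    by (rule M_seminorm_bound[OF M cM]) (use that in \<open>simp add: high_freq_def\<close>)
  obtain GL GA where fs: "fourier_symbol GL GA m s ((2 * pi) powr (real CARD('n) / 2) * (cn + cN)) ((2 * pi) ^ CARD('n) * cM)"
    and h: "has_fourier (Op \<sigma> u) (\<lambda>\<zeta>. of_real ((2 * pi) powr (- real CARD('n))) * fourier_symbol.v GL GA (fourier u) \<zeta>)"
    using Op_fourier_representation[OF \<sigma> s n cn N cN k M' cM u] by auto
  interpret fourier_symbol GL GA m s "(2 * pi) powr (real CARD('n) / 2) * (cn + cN)" "(2 * pi) ^ CARD('n) * cM" by (rule fs)
  have um: "fourier u \<in> borel_measurable borel" by (rule fourier_measurable[OF schwartz_borel[OF u]])
  have 1: "8 * (?K * ((2 * pi) powr (real CARD('n) / 2) * (cn + cN))\<^sup>2) = (sqrt (8 * ?K * (2 * pi) ^ CARD('n)) * (cn + cN))\<^sup>2"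
    using nn unfolding power_mult_distrib[of _ "cn + cN"] powr_half_sq by simp
  have 2: "2 * (?N * ((2 * pi) ^ CARD('n) * cM)\<^sup>2) = (sqrt (2 * ?N) * (2 * pi) ^ CARD('n) * cM)\<^sup>2"
    using nn unfolding power_mult_distrib[of _ cM] power_mult_distrib[of "sqrt (2 * ?N)"] by simp
  show ?thesis
    by (rule sobolev_transfer[OF h v_measurable[OF um] u _ _ v_bound_high[unfolded GC_def, folded farK_def, OF t fourier_schwartz_rapid[OF u] um, unfolded 1 2]])
      (use nn cn cN cM in auto)
qed

theorem theorem1:
  fixes m t0 s0 :: real
  assumes "real CARD('n::finite) / 2 < t0" and "t0 \<le> s0"
  shows "(\<forall>s. - t0 < s \<and> s < t0 \<longrightarrow>
           (\<exists>C>0. \<forall>\<sigma> \<in> (symbol_class m s0 :: (real^'n \<Rightarrow> real^'n \<Rightarrow> complex) set). \<forall>u \<in> schwartz.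
              sobolev_norm s (Op \<sigma> u) \<le>
                ennreal C * ((n_seminorm 0 t0 \<sigma> + N_seminorm m (2 * (CARD('n) div 2) + 2) t0 \<sigma>)
                             * sobolev_norm (s + m) u))) \<and>
         (\<forall>s. t0 \<le> s \<and> s \<le> s0 \<longrightarrow>
           (\<exists>C>0. \<forall>\<sigma> \<in> (symbol_class m s0 :: (real^'n \<Rightarrow> real^'n \<Rightarrow> complex) set). \<forall>u \<in> schwartz.
              sobolev_norm s (Op \<sigma> u) \<le>
                ennreal C * ((n_seminorm 0 s \<sigma> + N_seminorm m (2 * (CARD('n) div 2) + 2) s \<sigma>)
                               * sobolev_norm (m + t0) u
                             + M_seminorm m CARD('n) \<sigma> * sobolev_norm (s + m) u)))"
proof (intro conjI allI impI)
  let ?k = "2 * (CARD('n) div 2) + 2"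
  \<comment> \<open>For even and odd d alike, the order 2 * (d div 2) + 2 covers the mixed
    derivatives, which have order at most d.\<close>
  have k: "CARD('n) \<le> ?k" by linarith
  {
    fix s assume s: "- t0 < s \<and> s < t0"
    let ?L = "lowC m s t0 TYPE('n)"
    \<comment> \<open>The absolute value plus 1 is a positive constant whatever the value of
      \<open>?L\<close>.\<close>
    have L: "?L \<le> \<bar>?L\<bar> + 1" by linarith
    show "\<exists>C>0. \<forall>\<sigma> \<in> (symbol_class m s0 :: (real^'n \<Rightarrow> real^'n \<Rightarrow> complex) set). \<forall>u \<in> schwartz.
              sobolev_norm s (Op \<sigma> u) \<le>
                ennreal C * ((n_seminorm 0 t0 \<sigma> + N_seminorm m ?k t0 \<sigma>) * sobolev_norm (s + m) u)"
    proof (intro exI[of _ "\<bar>?L\<bar> + 1"] conjI ballI)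
      fix \<sigma> :: "real^'n \<Rightarrow> real^'n \<Rightarrow> complex" and u :: "real^'n \<Rightarrow> complex"
      assume \<sigma>: "\<sigma> \<in> symbol_class m s0" and u: "u \<in> schwartz"
      let ?S = "n_seminorm 0 t0 \<sigma> + N_seminorm m ?k t0 \<sigma>"
      \<comment> \<open>Three situations: a vanishing norm of u makes the left side zero, an
        infinite seminorm times a nonzero norm makes the right side infinite, and otherwise the
        seminorms are real numbers and the estimate applies.\<close>
      show "sobolev_norm s (Op \<sigma> u) \<le> ennreal (\<bar>?L\<bar> + 1) * (?S * sobolev_norm (s + m) u)"
      proof (cases "sobolev_norm (s + m) u = 0 \<or> ?S = \<infinity>")
        case True
        then consider "sobolev_norm (s + m) u = 0" | "?S = \<infinity>" "sobolev_norm (s + m) u \<noteq> 0" by blast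
        then show ?thesis
        proof cases
          case 1
          show ?thesis by (simp add: sobolev_norm_zero_imp[OF u 1])
        next
          case 2
          have "0 < \<bar>?L\<bar> + 1" by linarith
          from ennreal_const_top[OF this 2(2)] show ?thesis unfolding 2(1) by simp
        qed
      next
        case False
        then obtain cn cN where c: "n_seminorm 0 t0 \<sigma> = ennreal cn" "0 \<le> cn" "N_seminorm m ?k t0 \<sigma> = ennreal cN" "0 \<le> cN"
          by (cases "n_seminorm 0 t0 \<sigma>"; cases "N_seminorm m ?k t0 \<sigma>") auto
        have "sobolev_norm s (Op \<sigma> u) \<le> ennreal (?L * (cn + cN)) * sobolev_norm (s + m) u"
          by (rule low_order_estimate[OF \<sigma> assms(1) _ _ eq_refl[OF c(1)] c(2) eq_refl[OF c(3)] c(4) k u]) (use s in auto)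
        also have "\<dots> \<le> ennreal ((\<bar>?L\<bar> + 1) * (cn + cN)) * sobolev_norm (s + m) u"
          using c L by (intro mult_right_mono ennreal_leI) auto
        finally show ?thesis using c by (simp add: ennreal_mult ennreal_plus mult.assoc)
      qed
    qed linarith
  }
  {
    fix s assume s: "t0 \<le> s \<and> s \<le> s0"
    let ?A = "sqrt (8 * farK m s s t0 TYPE('n) * (2 * pi) ^ CARD('n))" and ?B = "sqrt (2 * nearC m s TYPE('n)) * (2 * pi) ^ CARD('n)"
    let ?C = "\<bar>?A\<bar> + \<bar>?B\<bar> + 1"
    have L: "?A \<le> ?C" "?B \<le> ?C" by linarith+
    show "\<exists>C>0. \<forall>\<sigma> \<in> (symbol_class m s0 :: (real^'n \<Rightarrow> real^'n \<Rightarrow> complex) set). \<forall>u \<in> schwartz.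
              sobolev_norm s (Op \<sigma> u) \<le>
                ennreal C * ((n_seminorm 0 s \<sigma> + N_seminorm m ?k s \<sigma>) * sobolev_norm (m + t0) u
                             + M_seminorm m CARD('n) \<sigma> * sobolev_norm (s + m) u)"
    proof (intro exI[of _ ?C] conjI ballI)
      fix \<sigma> :: "real^'n \<Rightarrow> real^'n \<Rightarrow> complex" and u :: "real^'n \<Rightarrow> complex"
      assume \<sigma>: "\<sigma> \<in> symbol_class m s0" and u: "u \<in> schwartz"
      let ?S = "n_seminorm 0 s \<sigma> + N_seminorm m ?k s \<sigma>" and ?M = "M_seminorm m CARD('n) \<sigma>"
      \<comment> \<open>As before, with two norms of u: the vanishing of either one, at whatever
        order, already forces the transform of u to vanish almost everywhere.\<close>
      show "sobolev_norm s (Op \<sigma> u) \<le> ennreal ?C * (?S * sobolev_norm (m + t0) u + ?M * sobolev_norm (s + m) u)"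
      proof (cases "sobolev_norm (m + t0) u = 0 \<or> sobolev_norm (s + m) u = 0 \<or> ?S = \<infinity> \<or> ?M = \<infinity>")
        case True
        then consider "sobolev_norm (m + t0) u = 0" | "sobolev_norm (s + m) u = 0"
          | "?S = \<infinity>" "sobolev_norm (m + t0) u \<noteq> 0" | "?M = \<infinity>" "sobolev_norm (s + m) u \<noteq> 0" by blast
        then show ?thesis
        proof cases
          case 1
          show ?thesis by (simp add: sobolev_norm_zero_imp[OF u 1])
        next
          case 2
          show ?thesis by (simp add: sobolev_norm_zero_imp[OF u 2])
        next
          case 3
          have "0 < ?C" by linarith
          from ennreal_const_top[OF this 3(2)] show ?thesis unfolding 3(1) distrib_left by simp
        next
          case 4
          have "0 < ?C" by linarith
          from ennreal_const_top[OF this 4(2)] show ?thesis unfolding 4(1) distrib_left by simp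
        qed
      next
        case False
        then obtain cn cN cM where c: "n_seminorm 0 s \<sigma> = ennreal cn" "0 \<le> cn" "N_seminorm m ?k s \<sigma> = ennreal cN" "0 \<le> cN" "?M = ennreal cM" "0 \<le> cM"
          by (cases "n_seminorm 0 s \<sigma>"; cases "N_seminorm m ?k s \<sigma>"; cases ?M) auto
        have "sobolev_norm s (Op \<sigma> u) \<le> ennreal (?A * (cn + cN)) * sobolev_norm (m + t0) u + ennreal (?B * cM) * sobolev_norm (s + m) u"
          by (rule high_order_estimate[OF \<sigma> _ assms(1) eq_refl[OF c(1)] c(2) eq_refl[OF c(3)] c(4) k eq_refl[OF c(5)] c(6) u]) (use s assms(1) in auto)
        also have "\<dots> \<le> ennreal (?C * (cn + cN)) * sobolev_norm (m + t0) u + ennreal (?C * cM) * sobolev_norm (s + m) u"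
          using c L by (intro add_mono mult_right_mono ennreal_leI) auto
        also have "\<dots> = ennreal ?C * (?S * sobolev_norm (m + t0) u + ?M * sobolev_norm (s + m) u)"
        proof -
          have e: "ennreal (?C * (cn + cN)) = ennreal ?C * ?S" "ennreal (?C * cM) = ennreal ?C * ?M"
            unfolding c using c by (simp_all only: ennreal_plus[symmetric]) (intro ennreal_mult; simp)+
          show ?thesis unfolding e mult.assoc[of "ennreal ?C"] by (rule distrib_left[symmetric])
        qed
        finally show ?thesis .
      qed
    qed linarith
  }
qed

end
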